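(* Let $T$ be a finite tree, let $P,Q\in\operatorname{Or}(T)$, and let $R$ be any finite poset. Then the product posets $P\times R$ and $Q\times R$ are universally derived equivalent.
   Context: For a finite tree $T$ with vertex set $V$, an orientation of $T$ is a partial order $P$ on $V$ whose covering relation, viewed as an undirected graph, equals $T$ (equivalently, direct each edge of $T$ and take the reflexive transitive closure). $\operatorname{Or}(T)$ is the set of orientations of $T$. Products of posets carry the componentwise order. For a finite poset $X$ (viewed as a category with a unique morphism $x\to x'$ when $x\leq x'$) and an abelian category $\mathcal{A}$, $\mathcal{A}^X$ is the functor category and $D(\mathcal{A}^X)$ its derived category. Finite posets $X,Y$ are universally derived equivalent if for every abelian category $\mathcal{A}$ there is an equivalence of triangulated categories $D(\mathcal{A}^X)\simeq D(\mathcal{A}^Y)$. *)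

theory Defs
  imports "HOL-Algebra.Group"
begin

section \<open>Trees, orientations and posets\<close>

text \<open>Graphs are simple and undirected: a vertex set with a set of two-element edges.  (The
  \<open>tree\<close> of the AFP entry Graph-Theory excludes directed cycles only and is not the notion
  needed here.)  Posets are a carrier set together with a relation.\<close>

definition cycle_in :: "'v set set \<Rightarrow> 'v list \<Rightarrow> bool" where
  "cycle_in E vs \<longleftrightarrow> 3 \<le> length vs \<and> distinct vs \<and>
     (\<forall>i < length vs. {vs ! i, vs ! (Suc i mod length vs)} \<in> E)"

definition finite_tree :: "'v set \<Rightarrow> 'v set set \<Rightarrow> bool" where
  "finite_tree V E \<longleftrightarrow> finite V \<and> V \<noteq> {} \<and>
     (\<forall>e \<in> E. \<exists>u \<in> V. \<exists>v \<in> V. u \<noteq> v \<and> e = {u, v}) \<and>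
     (\<forall>u \<in> V. \<forall>v \<in> V. (u, v) \<in> {(a, b). {a, b} \<in> E}\<^sup>*) \<and>
     (\<nexists>vs. cycle_in E vs)"

definition covers :: "'v rel \<Rightarrow> 'v \<Rightarrow> 'v \<Rightarrow> bool" where
  "covers r x y \<longleftrightarrow> (x, y) \<in> r \<and> x \<noteq> y \<and>
     (\<nexists>z. (x, z) \<in> r \<and> (z, y) \<in> r \<and> z \<noteq> x \<and> z \<noteq> y)"

definition Or :: "'v set \<Rightarrow> 'v set set \<Rightarrow> 'v rel set" where
  "Or V E = {P. partial_order_on V P \<and> {{x, y} | x y. covers P x y} = E}"

definition prod_order :: "'a rel \<Rightarrow> 'b rel \<Rightarrow> ('a \<times> 'b) rel" where
  "prod_order P R = {((a, b), (a', b')). (a, a') \<in> P \<and> (b, b') \<in> R}"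

section \<open>Categories, functors, natural transformations\<close>

text \<open>Hom-sets are not required to be disjoint.  For that reason functors act on an arrow
  together with its source and target.  \<open>g \<cdot> f\<close> is \<open>g\<close> after \<open>f\<close>.\<close>

record ('o, 'm) precategory =
  Obj :: "'o set"
  Hom :: "'o \<Rightarrow> 'o \<Rightarrow> 'm set"
  Comp :: "'m \<Rightarrow> 'm \<Rightarrow> 'm"  (infixr \<open>\<cdot>\<index>\<close> 75)
  Ident :: "'o \<Rightarrow> 'm"

locale category =
  fixes C :: "('o, 'm, 'z) precategory_scheme" (structure)
  assumes ident_in_Hom: "x \<in> Obj C \<Longrightarrow> Ident C x \<in> Hom C x x"
    and comp_in_Hom: "\<lbrakk>x \<in> Obj C; y \<in> Obj C; z \<in> Obj C; f \<in> Hom C x y; g \<in> Hom C y z\<rbrakk>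
      \<Longrightarrow> g \<cdot> f \<in> Hom C x z"
    and comp_ident_right: "\<lbrakk>x \<in> Obj C; y \<in> Obj C; f \<in> Hom C x y\<rbrakk> \<Longrightarrow> f \<cdot> Ident C x = f"
    and comp_ident_left: "\<lbrakk>x \<in> Obj C; y \<in> Obj C; f \<in> Hom C x y\<rbrakk> \<Longrightarrow> Ident C y \<cdot> f = f"
    and comp_assoc: "\<lbrakk>w \<in> Obj C; x \<in> Obj C; y \<in> Obj C; z \<in> Obj C;
        f \<in> Hom C w x; g \<in> Hom C x y; h \<in> Hom C y z\<rbrakk> \<Longrightarrow> (h \<cdot> g) \<cdot> f = h \<cdot> (g \<cdot> f)"

definition is_iso :: "('o, 'm, 'z) precategory_scheme \<Rightarrow> 'o \<Rightarrow> 'o \<Rightarrow> 'm \<Rightarrow> bool" where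
  "is_iso C x y f \<longleftrightarrow> f \<in> Hom C x y \<and>
     (\<exists>g \<in> Hom C y x. g \<cdot>\<^bsub>C\<^esub> f = Ident C x \<and> f \<cdot>\<^bsub>C\<^esub> g = Ident C y)"

record ('o, 'm, 'p, 'n) func =
  on_obj :: "'o \<Rightarrow> 'p"
  on_arr :: "'o \<Rightarrow> 'o \<Rightarrow> 'm \<Rightarrow> 'n"

definition is_functor :: "('o, 'm, 'y) precategory_scheme \<Rightarrow> ('p, 'n, 'z) precategory_scheme \<Rightarrow>
    ('o, 'm, 'p, 'n) func \<Rightarrow> bool" where
  "is_functor C D F \<longleftrightarrow>
     (\<forall>x \<in> Obj C. on_obj F x \<in> Obj D \<and> on_arr F x x (Ident C x) = Ident D (on_obj F x)) \<and>
     (\<forall>x \<in> Obj C. \<forall>y \<in> Obj C. \<forall>f \<in> Hom C x y. on_arr F x y f \<in> Hom D (on_obj F x) (on_obj F y)) \<and>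
     (\<forall>x \<in> Obj C. \<forall>y \<in> Obj C. \<forall>z \<in> Obj C. \<forall>f \<in> Hom C x y. \<forall>g \<in> Hom C y z.
        on_arr F x z (g \<cdot>\<^bsub>C\<^esub> f) = on_arr F y z g \<cdot>\<^bsub>D\<^esub> on_arr F x y f)"

definition id_functor :: "('o, 'm, 'o, 'm) func" where
  "id_functor = \<lparr>on_obj = (\<lambda>x. x), on_arr = (\<lambda>x y f. f)\<rparr>"

definition comp_functor :: "('p, 'n, 'q, 'k) func \<Rightarrow> ('o, 'm, 'p, 'n) func \<Rightarrow> ('o, 'm, 'q, 'k) func"
  where "comp_functor G F = \<lparr>on_obj = (\<lambda>x. on_obj G (on_obj F x)),
     on_arr = (\<lambda>x y f. on_arr G (on_obj F x) (on_obj F y) (on_arr F x y f))\<rparr>"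

definition nat_trans :: "('o, 'm, 'y) precategory_scheme \<Rightarrow> ('p, 'n, 'z) precategory_scheme \<Rightarrow>
    ('o, 'm, 'p, 'n) func \<Rightarrow> ('o, 'm, 'p, 'n) func \<Rightarrow> ('o \<Rightarrow> 'n) \<Rightarrow> bool" where
  "nat_trans C D F G \<eta> \<longleftrightarrow>
     (\<forall>x \<in> Obj C. \<eta> x \<in> Hom D (on_obj F x) (on_obj G x)) \<and>
     (\<forall>x \<in> Obj C. \<forall>y \<in> Obj C. \<forall>f \<in> Hom C x y.
        \<eta> y \<cdot>\<^bsub>D\<^esub> on_arr F x y f = on_arr G x y f \<cdot>\<^bsub>D\<^esub> \<eta> x)"

definition nat_iso :: "('o, 'm, 'y) precategory_scheme \<Rightarrow> ('p, 'n, 'z) precategory_scheme \<Rightarrow>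
    ('o, 'm, 'p, 'n) func \<Rightarrow> ('o, 'm, 'p, 'n) func \<Rightarrow> ('o \<Rightarrow> 'n) \<Rightarrow> bool" where
  "nat_iso C D F G \<eta> \<longleftrightarrow> nat_trans C D F G \<eta> \<and>
     (\<forall>x \<in> Obj C. is_iso D (on_obj F x) (on_obj G x) (\<eta> x))"

definition poset_category :: "'x set \<Rightarrow> 'x rel \<Rightarrow> ('x, unit) precategory" where
  "poset_category X r = \<lparr>Obj = X, Hom = (\<lambda>x y. if (x, y) \<in> r then {()} else {}),
     Comp = (\<lambda>_ _. ()), Ident = (\<lambda>_. ())\<rparr>"

section \<open>Abelian categories\<close>

record ('o, 'm) preadditive = "('o, 'm) precategory" +
  Plus :: "'m \<Rightarrow> 'm \<Rightarrow> 'm"  (infixl \<open>\<boxplus>\<index>\<close> 65)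
  Zero :: "'o \<Rightarrow> 'o \<Rightarrow> 'm"

definition hom_group :: "('o, 'm, 'z) preadditive_scheme \<Rightarrow> 'o \<Rightarrow> 'o \<Rightarrow> 'm monoid" where
  "hom_group A x y = \<lparr>carrier = Hom A x y, mult = Plus A, one = Zero A x y\<rparr>"

abbreviation Neg :: "('o, 'm, 'z) preadditive_scheme \<Rightarrow> 'o \<Rightarrow> 'o \<Rightarrow> 'm \<Rightarrow> 'm" where
  "Neg A x y f \<equiv> inv\<^bsub>hom_group A x y\<^esub> f"

locale preadditive_category = category A
  for A :: "('o, 'm, 'z) preadditive_scheme" (structure) +
  assumes hom_comm_group: "\<lbrakk>x \<in> Obj A; y \<in> Obj A\<rbrakk> \<Longrightarrow> comm_group (hom_group A x y)"
    and comp_plus_right: "\<lbrakk>x \<in> Obj A; y \<in> Obj A; z \<in> Obj A; f \<in> Hom A x y; f' \<in> Hom A x y;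
        g \<in> Hom A y z\<rbrakk> \<Longrightarrow> g \<cdot> (f \<boxplus> f') = (g \<cdot> f) \<boxplus> (g \<cdot> f')"
    and comp_plus_left: "\<lbrakk>x \<in> Obj A; y \<in> Obj A; z \<in> Obj A; f \<in> Hom A x y; g \<in> Hom A y z;
        g' \<in> Hom A y z\<rbrakk> \<Longrightarrow> (g \<boxplus> g') \<cdot> f = (g \<cdot> f) \<boxplus> (g' \<cdot> f)"

definition is_zero_object :: "('o, 'm, 'z) precategory_scheme \<Rightarrow> 'o \<Rightarrow> bool" where
  "is_zero_object A z \<longleftrightarrow> z \<in> Obj A \<and>
     (\<forall>x \<in> Obj A. (\<exists>!f. f \<in> Hom A z x) \<and> (\<exists>!f. f \<in> Hom A x z))"

definition is_biproduct :: "('o, 'm, 'z) preadditive_scheme \<Rightarrow> 'o \<Rightarrow> 'o \<Rightarrow> 'o \<Rightarrow>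
    'm \<Rightarrow> 'm \<Rightarrow> 'm \<Rightarrow> 'm \<Rightarrow> bool" where
  "is_biproduct A x y b i\<^sub>1 i\<^sub>2 p\<^sub>1 p\<^sub>2 \<longleftrightarrow> b \<in> Obj A \<and>
     i\<^sub>1 \<in> Hom A x b \<and> i\<^sub>2 \<in> Hom A y b \<and> p\<^sub>1 \<in> Hom A b x \<and> p\<^sub>2 \<in> Hom A b y \<and>
     p\<^sub>1 \<cdot>\<^bsub>A\<^esub> i\<^sub>1 = Ident A x \<and> p\<^sub>2 \<cdot>\<^bsub>A\<^esub> i\<^sub>2 = Ident A y \<and>
     p\<^sub>1 \<cdot>\<^bsub>A\<^esub> i\<^sub>2 = Zero A y x \<and> p\<^sub>2 \<cdot>\<^bsub>A\<^esub> i\<^sub>1 = Zero A x y \<and>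
     i\<^sub>1 \<cdot>\<^bsub>A\<^esub> p\<^sub>1 \<boxplus>\<^bsub>A\<^esub> i\<^sub>2 \<cdot>\<^bsub>A\<^esub> p\<^sub>2 = Ident A b"

definition is_kernel :: "('o, 'm, 'z) preadditive_scheme \<Rightarrow> 'o \<Rightarrow> 'o \<Rightarrow> 'm \<Rightarrow> 'o \<Rightarrow> 'm \<Rightarrow> bool" where
  "is_kernel A x y f K k \<longleftrightarrow> K \<in> Obj A \<and> k \<in> Hom A K x \<and> f \<cdot>\<^bsub>A\<^esub> k = Zero A K y \<and>
     (\<forall>z \<in> Obj A. \<forall>g \<in> Hom A z x. f \<cdot>\<^bsub>A\<^esub> g = Zero A z y \<longrightarrow>
        (\<exists>!h. h \<in> Hom A z K \<and> k \<cdot>\<^bsub>A\<^esub> h = g))"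

definition is_cokernel :: "('o, 'm, 'z) preadditive_scheme \<Rightarrow> 'o \<Rightarrow> 'o \<Rightarrow> 'm \<Rightarrow> 'o \<Rightarrow> 'm \<Rightarrow> bool" where
  "is_cokernel A x y f Q q \<longleftrightarrow> Q \<in> Obj A \<and> q \<in> Hom A y Q \<and> q \<cdot>\<^bsub>A\<^esub> f = Zero A x Q \<and>
     (\<forall>z \<in> Obj A. \<forall>g \<in> Hom A y z. g \<cdot>\<^bsub>A\<^esub> f = Zero A x z \<longrightarrow>
        (\<exists>!h. h \<in> Hom A Q z \<and> h \<cdot>\<^bsub>A\<^esub> q = g))"

definition is_mono :: "('o, 'm, 'z) precategory_scheme \<Rightarrow> 'o \<Rightarrow> 'o \<Rightarrow> 'm \<Rightarrow> bool" where
  "is_mono C x y f \<longleftrightarrow> f \<in> Hom C x y \<and>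
     (\<forall>z \<in> Obj C. \<forall>g \<in> Hom C z x. \<forall>h \<in> Hom C z x. f \<cdot>\<^bsub>C\<^esub> g = f \<cdot>\<^bsub>C\<^esub> h \<longrightarrow> g = h)"

definition is_epi :: "('o, 'm, 'z) precategory_scheme \<Rightarrow> 'o \<Rightarrow> 'o \<Rightarrow> 'm \<Rightarrow> bool" where
  "is_epi C x y f \<longleftrightarrow> f \<in> Hom C x y \<and>
     (\<forall>z \<in> Obj C. \<forall>g \<in> Hom C y z. \<forall>h \<in> Hom C y z. g \<cdot>\<^bsub>C\<^esub> f = h \<cdot>\<^bsub>C\<^esub> f \<longrightarrow> g = h)"

locale abelian_category = preadditive_category A
  for A :: "('o, 'm, 'z) preadditive_scheme" (structure) +
  assumes zero_object: "\<exists>z. is_zero_object A z"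
    and biproducts: "\<lbrakk>x \<in> Obj A; y \<in> Obj A\<rbrakk> \<Longrightarrow> \<exists>b i\<^sub>1 i\<^sub>2 p\<^sub>1 p\<^sub>2. is_biproduct A x y b i\<^sub>1 i\<^sub>2 p\<^sub>1 p\<^sub>2"
    and kernels: "\<lbrakk>x \<in> Obj A; y \<in> Obj A; f \<in> Hom A x y\<rbrakk> \<Longrightarrow> \<exists>K k. is_kernel A x y f K k"
    and cokernels: "\<lbrakk>x \<in> Obj A; y \<in> Obj A; f \<in> Hom A x y\<rbrakk> \<Longrightarrow> \<exists>Q q. is_cokernel A x y f Q q"
    and mono_normal: "\<lbrakk>x \<in> Obj A; y \<in> Obj A; is_mono A x y f\<rbrakk>
      \<Longrightarrow> \<exists>z \<in> Obj A. \<exists>g \<in> Hom A y z. is_kernel A y z g x f"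
    and epi_normal: "\<lbrakk>x \<in> Obj A; y \<in> Obj A; is_epi A x y f\<rbrakk>
      \<Longrightarrow> \<exists>z \<in> Obj A. \<exists>g \<in> Hom A z x. is_cokernel A z x g y f"

text \<open>Functors and natural transformations are taken extensional, so that two of them are equal
  as soon as they agree on the source category.\<close>

definition functor_category :: "('c, 'k, 'y) precategory_scheme \<Rightarrow> ('o, 'm, 'z) preadditive_scheme \<Rightarrow>
    (('c, 'k, 'o, 'm) func, 'c \<Rightarrow> 'm) preadditive" where
  "functor_category C A = \<lparr>
     Obj = {F. is_functor C A F \<and> on_obj F \<in> extensional (Obj C) \<and>
       (\<forall>x y f. \<not> (x \<in> Obj C \<and> y \<in> Obj C \<and> f \<in> Hom C x y) \<longrightarrow> on_arr F x y f = undefined)},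
     Hom = (\<lambda>F G. {\<eta> \<in> extensional (Obj C). nat_trans C A F G \<eta>}),
     Comp = (\<lambda>\<theta> \<eta>. \<lambda>x \<in> Obj C. \<theta> x \<cdot>\<^bsub>A\<^esub> \<eta> x),
     Ident = (\<lambda>F. \<lambda>x \<in> Obj C. Ident A (on_obj F x)),
     Plus = (\<lambda>\<theta> \<eta>. \<lambda>x \<in> Obj C. \<theta> x \<boxplus>\<^bsub>A\<^esub> \<eta> x),
     Zero = (\<lambda>F G. \<lambda>x \<in> Obj C. Zero A (on_obj F x) (on_obj G x))\<rparr>"

section \<open>Cochain complexes and quasi-isomorphisms\<close>

record ('o, 'm) cochain =
  deg :: "int \<Rightarrow> 'o"
  diff :: "int \<Rightarrow> 'm"

definition complex_category ::
    "('o, 'm, 'z) preadditive_scheme \<Rightarrow> (('o, 'm) cochain, int \<Rightarrow> 'm) precategory" where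
  "complex_category A = \<lparr>
     Obj = {X. \<forall>n. deg X n \<in> Obj A \<and> diff X n \<in> Hom A (deg X n) (deg X (n + 1)) \<and>
       diff X (n + 1) \<cdot>\<^bsub>A\<^esub> diff X n = Zero A (deg X n) (deg X (n + 1 + 1))},
     Hom = (\<lambda>X Y. {f. \<forall>n. f n \<in> Hom A (deg X n) (deg Y n) \<and>
       diff Y n \<cdot>\<^bsub>A\<^esub> f n = f (n + 1) \<cdot>\<^bsub>A\<^esub> diff X n}),
     Comp = (\<lambda>g f n. g n \<cdot>\<^bsub>A\<^esub> f n),
     Ident = (\<lambda>X n. Ident A (deg X n))\<rparr>"

text \<open>\<open>H\<close> is the \<open>n\<close>-th cohomology object of \<open>X\<close>: \<open>k : K \<rightarrow> X\<^sup>n\<close> is the kernel of \<open>d\<^sup>n\<close>, and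
  \<open>c : K \<rightarrow> H\<close> is the cokernel of the map \<open>X\<^sup>n\<^sup>-\<^sup>1 \<rightarrow> K\<close> induced by the incoming differential.\<close>

definition is_cohomology :: "('o, 'm, 'z) preadditive_scheme \<Rightarrow> ('o, 'm) cochain \<Rightarrow> int \<Rightarrow>
    'o \<Rightarrow> 'm \<Rightarrow> 'o \<Rightarrow> 'm \<Rightarrow> bool" where
  "is_cohomology A X n K k H c \<longleftrightarrow>
     is_kernel A (deg X n) (deg X (n + 1)) (diff X n) K k \<and>
     (\<exists>j \<in> Hom A (deg X (n - 1)) K. k \<cdot>\<^bsub>A\<^esub> j = diff X (n - 1) \<and>
        is_cokernel A (deg X (n - 1)) K j H c)"

text \<open>In an abelian category the cohomology data and the induced maps \<open>g\<close> and \<open>h\<close> exist and are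
  unique up to isomorphism, so the choice made by the existential quantifier is immaterial.\<close>

definition quasi_iso ::
    "('o, 'm, 'z) preadditive_scheme \<Rightarrow> ('o, 'm) cochain \<Rightarrow> ('o, 'm) cochain \<Rightarrow> (int \<Rightarrow> 'm) set" where
  "quasi_iso A X Y = {f \<in> Hom (complex_category A) X Y.
     \<forall>n. \<exists>K k H c K' k' H' c'. is_cohomology A X n K k H c \<and> is_cohomology A Y n K' k' H' c' \<and>
       (\<exists>g \<in> Hom A K K'. k' \<cdot>\<^bsub>A\<^esub> g = f n \<cdot>\<^bsub>A\<^esub> k \<and>
         (\<exists>h. is_iso A H H' h \<and> h \<cdot>\<^bsub>A\<^esub> c = c' \<cdot>\<^bsub>A\<^esub> g))}"

definition shift_complex :: "('o, 'm, 'z) preadditive_scheme \<Rightarrow> ('o, 'm) cochain \<Rightarrow> ('o, 'm) cochain"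
  where "shift_complex A X = \<lparr>deg = (\<lambda>n. deg X (n + 1)),
     diff = (\<lambda>n. Neg A (deg X (n + 1)) (deg X (n + 1 + 1)) (diff X (n + 1)))\<rparr>"

definition shift_map :: "(int \<Rightarrow> 'm) \<Rightarrow> int \<Rightarrow> 'm" where
  "shift_map f = (\<lambda>n. f (n + 1))"

text \<open>Cones are described up to a choice of biproducts: \<open>Z\<close> is a mapping cone of \<open>f : X \<rightarrow> Y\<close>, with \<open>Z\<^sup>n\<close> the biproduct of \<open>X\<^sup>n\<^sup>+\<^sup>1\<close> and \<open>Y\<^sup>n\<close> and
  \<open>d (a, b) = (- d a, f a + d b)\<close>; \<open>i : Y \<rightarrow> Z\<close> and \<open>p : Z \<rightarrow> X[1]\<close> are the canonical maps.\<close>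

definition is_mapping_cone :: "('o, 'm, 'z) preadditive_scheme \<Rightarrow> ('o, 'm) cochain \<Rightarrow>
    ('o, 'm) cochain \<Rightarrow> (int \<Rightarrow> 'm) \<Rightarrow> ('o, 'm) cochain \<Rightarrow> (int \<Rightarrow> 'm) \<Rightarrow> (int \<Rightarrow> 'm) \<Rightarrow> bool" where
  "is_mapping_cone A X Y f Z i p \<longleftrightarrow> (\<exists>j q. \<forall>n.
     is_biproduct A (deg X (n + 1)) (deg Y n) (deg Z n) (j n) (i n) (p n) (q n) \<and>
     diff Z n =
       j (n + 1) \<cdot>\<^bsub>A\<^esub> Neg A (deg X (n + 1)) (deg X (n + 1 + 1)) (diff X (n + 1)) \<cdot>\<^bsub>A\<^esub> p n
       \<boxplus>\<^bsub>A\<^esub> i (n + 1) \<cdot>\<^bsub>A\<^esub> f (n + 1) \<cdot>\<^bsub>A\<^esub> p n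
       \<boxplus>\<^bsub>A\<^esub> i (n + 1) \<cdot>\<^bsub>A\<^esub> diff Y n \<cdot>\<^bsub>A\<^esub> q n)"

section \<open>Localization of a category\<close>

text \<open>The localization of \<open>C\<close> at a class \<open>W\<close> of arrows: formal composites of arrows of \<open>C\<close>
  (\<open>Arr x f y\<close>) and of formal inverses \<open>Inv x w y : y \<rightarrow> x\<close> of arrows \<open>w : x \<rightarrow> y\<close> in \<open>W\<close>, modulo
  the congruence generated by the category axioms, functoriality of \<open>Arr\<close>, and the
  requirement that \<open>Inv\<close> be inverse to \<open>Arr\<close>.\<close>

datatype ('o, 'm) zigzag =
  Arr 'o 'm 'o
| Inv 'o 'm 'o
| Cat "('o, 'm) zigzag" "('o, 'm) zigzag"

inductive zigzag_hom :: "('o, 'm, 'z) precategory_scheme \<Rightarrow> ('o \<Rightarrow> 'o \<Rightarrow> 'm set) \<Rightarrow>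
    ('o, 'm) zigzag \<Rightarrow> 'o \<Rightarrow> 'o \<Rightarrow> bool"
  for C W where
  Arr: "\<lbrakk>x \<in> Obj C; y \<in> Obj C; f \<in> Hom C x y\<rbrakk> \<Longrightarrow> zigzag_hom C W (Arr x f y) x y"
| Inv: "\<lbrakk>x \<in> Obj C; y \<in> Obj C; f \<in> W x y\<rbrakk> \<Longrightarrow> zigzag_hom C W (Inv x f y) y x"
| Cat: "\<lbrakk>zigzag_hom C W p x y; zigzag_hom C W q y z\<rbrakk> \<Longrightarrow> zigzag_hom C W (Cat q p) x z"

inductive zigzag_eq :: "('o, 'm, 'z) precategory_scheme \<Rightarrow> ('o \<Rightarrow> 'o \<Rightarrow> 'm set) \<Rightarrow>
    ('o, 'm) zigzag \<Rightarrow> ('o, 'm) zigzag \<Rightarrow> bool"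
  for C W where
  refl: "zigzag_hom C W p x y \<Longrightarrow> zigzag_eq C W p p"
| sym: "zigzag_eq C W p q \<Longrightarrow> zigzag_eq C W q p"
| trans: "\<lbrakk>zigzag_eq C W p q; zigzag_eq C W q r\<rbrakk> \<Longrightarrow> zigzag_eq C W p r"
| cong: "\<lbrakk>zigzag_hom C W p x y; zigzag_hom C W q y z; zigzag_eq C W p p'; zigzag_eq C W q q'\<rbrakk>
    \<Longrightarrow> zigzag_eq C W (Cat q p) (Cat q' p')"
| assoc: "\<lbrakk>zigzag_hom C W p w x; zigzag_hom C W q x y; zigzag_hom C W r y z\<rbrakk>
    \<Longrightarrow> zigzag_eq C W (Cat (Cat r q) p) (Cat r (Cat q p))"
| ident_right: "zigzag_hom C W p x y \<Longrightarrow> zigzag_eq C W (Cat p (Arr x (Ident C x) x)) p"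
| ident_left: "zigzag_hom C W p x y \<Longrightarrow> zigzag_eq C W (Cat (Arr y (Ident C y) y) p) p"
| comp: "\<lbrakk>x \<in> Obj C; y \<in> Obj C; z \<in> Obj C; f \<in> Hom C x y; g \<in> Hom C y z\<rbrakk>
    \<Longrightarrow> zigzag_eq C W (Cat (Arr y g z) (Arr x f y)) (Arr x (g \<cdot>\<^bsub>C\<^esub> f) z)"
| inv_left: "\<lbrakk>x \<in> Obj C; y \<in> Obj C; f \<in> W x y\<rbrakk>
    \<Longrightarrow> zigzag_eq C W (Cat (Inv x f y) (Arr x f y)) (Arr x (Ident C x) x)"
| inv_right: "\<lbrakk>x \<in> Obj C; y \<in> Obj C; f \<in> W x y\<rbrakk>
    \<Longrightarrow> zigzag_eq C W (Cat (Arr x f y) (Inv x f y)) (Arr y (Ident C y) y)"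

definition zigzag_class :: "('o, 'm, 'z) precategory_scheme \<Rightarrow> ('o \<Rightarrow> 'o \<Rightarrow> 'm set) \<Rightarrow>
    ('o, 'm) zigzag \<Rightarrow> ('o, 'm) zigzag set" where
  "zigzag_class C W p = {q. zigzag_eq C W p q}"

definition localization :: "('o, 'm, 'z) precategory_scheme \<Rightarrow> ('o \<Rightarrow> 'o \<Rightarrow> 'm set) \<Rightarrow>
    ('o, ('o, 'm) zigzag set) precategory" where
  "localization C W = \<lparr>
     Obj = Obj C,
     Hom = (\<lambda>x y. {zigzag_class C W p | p. zigzag_hom C W p x y}),
     Comp = (\<lambda>\<psi> \<phi>. \<Union>q \<in> \<psi>. \<Union>p \<in> \<phi>. zigzag_class C W (Cat q p)),
     Ident = (\<lambda>x. zigzag_class C W (Arr x (Ident C x) x))\<rparr>"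

section \<open>The derived category and triangulated equivalences\<close>

text \<open>A triangle \<open>x \<rightarrow> y \<rightarrow> z \<rightarrow> x[1]\<close> with arrows \<open>u\<close>, \<open>v\<close>, \<open>w\<close> is the tuple
  \<open>(x, y, z, u, v, w)\<close>.\<close>

record ('o, 'm) triangulated = "('o, 'm) precategory" +
  Shift :: "('o, 'm, 'o, 'm) func"
  Triangles :: "('o \<times> 'o \<times> 'o \<times> 'm \<times> 'm \<times> 'm) set"

type_synonym ('o, 'm) derived_arr = "(('o, 'm) cochain, int \<Rightarrow> 'm) zigzag set"

definition derived_localization :: "('o, 'm, 'z) preadditive_scheme \<Rightarrow>
    (('o, 'm) cochain, ('o, 'm) derived_arr) precategory" where
  "derived_localization A = localization (complex_category A) (quasi_iso A)"

definition derived_arrow :: "('o, 'm, 'z) preadditive_scheme \<Rightarrow> ('o, 'm) cochain \<Rightarrow>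
    ('o, 'm) cochain \<Rightarrow> (int \<Rightarrow> 'm) \<Rightarrow> ('o, 'm) derived_arr" where
  "derived_arrow A X Y f = zigzag_class (complex_category A) (quasi_iso A) (Arr X f Y)"

definition derived_shift :: "('o, 'm, 'z) preadditive_scheme \<Rightarrow>
    (('o, 'm) cochain, ('o, 'm) derived_arr,
     ('o, 'm) cochain, ('o, 'm) derived_arr) func" where
  "derived_shift A = \<lparr>
     on_obj = shift_complex A,
     on_arr = (\<lambda>X Y \<phi>. \<Union>p \<in> \<phi>. zigzag_class (complex_category A) (quasi_iso A)
       (map_zigzag (shift_complex A) shift_map p))\<rparr>"

definition derived_triangles :: "('o, 'm, 'z) preadditive_scheme \<Rightarrow>
    (('o, 'm) cochain \<times> ('o, 'm) cochain \<times> ('o, 'm) cochain \<times>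
     ('o, 'm) derived_arr \<times> ('o, 'm) derived_arr \<times> ('o, 'm) derived_arr) set" where
  "derived_triangles A = (let D = derived_localization A; T = derived_shift A in
     {(X, Y, Z, u, v, w). X \<in> Obj D \<and> Y \<in> Obj D \<and> Z \<in> Obj D \<and>
        u \<in> Hom D X Y \<and> v \<in> Hom D Y Z \<and> w \<in> Hom D Z (on_obj T X) \<and>
        (\<exists>X' Y' Z' f i p a b c.
           X' \<in> Obj D \<and> Y' \<in> Obj D \<and> Z' \<in> Obj D \<and>
           f \<in> Hom (complex_category A) X' Y' \<and> is_mapping_cone A X' Y' f Z' i p \<and>
           is_iso D X' X a \<and> is_iso D Y' Y b \<and> is_iso D Z' Z c \<and>
           b \<cdot>\<^bsub>D\<^esub> derived_arrow A X' Y' f = u \<cdot>\<^bsub>D\<^esub> a \<and>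
           c \<cdot>\<^bsub>D\<^esub> derived_arrow A Y' Z' i = v \<cdot>\<^bsub>D\<^esub> b \<and>
           on_arr T X' X a \<cdot>\<^bsub>D\<^esub> derived_arrow A Z' (shift_complex A X') p = w \<cdot>\<^bsub>D\<^esub> c)})"

definition derived_category :: "('o, 'm, 'z) preadditive_scheme \<Rightarrow>
    (('o, 'm) cochain, ('o, 'm) derived_arr) triangulated" where
  "derived_category A = (let D = derived_localization A in
     \<lparr>Obj = Obj D, Hom = Hom D, Comp = Comp D, Ident = Ident D,
      Shift = derived_shift A, Triangles = derived_triangles A\<rparr>)"

text \<open>Additivity is not listed separately: the functors below are applied as equivalences, which
  preserve biproducts and hence the addition of arrows of an additive category.\<close>

definition triangulated_functor :: "('o, 'm, 'y) triangulated_scheme \<Rightarrow>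
    ('p, 'n, 'z) triangulated_scheme \<Rightarrow> ('o, 'm, 'p, 'n) func \<Rightarrow> ('o \<Rightarrow> 'n) \<Rightarrow> bool" where
  "triangulated_functor C D F \<theta> \<longleftrightarrow> is_functor C D F \<and>
     nat_iso C D (comp_functor F (Shift C)) (comp_functor (Shift D) F) \<theta> \<and>
     (\<forall>(x, y, z, u, v, w) \<in> Triangles C.
        (on_obj F x, on_obj F y, on_obj F z, on_arr F x y u, on_arr F y z v,
         \<theta> x \<cdot>\<^bsub>D\<^esub> on_arr F z (on_obj (Shift C) x) w) \<in> Triangles D)"

definition triangulated_equivalent ::
    "('o, 'm, 'y) triangulated_scheme \<Rightarrow> ('p, 'n, 'z) triangulated_scheme \<Rightarrow> bool" where
  "triangulated_equivalent C D \<longleftrightarrow> (\<exists>F \<theta> G \<eta> \<epsilon>.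
     triangulated_functor C D F \<theta> \<and> is_functor D C G \<and>
     nat_iso C C id_functor (comp_functor G F) \<eta> \<and>
     nat_iso D D (comp_functor F G) id_functor \<epsilon>)"

text \<open>A definition cannot quantify over types, so the types of objects and arrows of the abelian
  categories are parameters; a theorem stated for type variables \<open>'o\<close> and \<open>'m\<close> covers all abelian
  categories.\<close>

definition universally_derived_equivalent :: "'o itself \<Rightarrow> 'm itself \<Rightarrow>
    'x set \<Rightarrow> 'x rel \<Rightarrow> 'y set \<Rightarrow> 'y rel \<Rightarrow> bool" where
  "universally_derived_equivalent _ _ X r Y s \<longleftrightarrow>
     (\<forall>A :: ('o, 'm) preadditive. abelian_category A \<longrightarrow>
        triangulated_equivalent
          (derived_category (functor_category (poset_category X r) A))
          (derived_category (functor_category (poset_category Y s) A)))"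

end

theory Submission
 imports Defs
begin

text \<open>The proof moves between orientations by flips at one vertex and realises each flip by a
reflection functor on complexes.

Since a tree has no cycles, an orientation is given by a height function: adjacent
vertices have heights that differ by one and each edge points upwards (\<open>orientation_heights\<close>). Heights
of two orientations can be shifted until they agree modulo two and one lies strictly below the other.
The lower one then reaches the upper one by raising a local minimum by two, again and again
(\<open>raise_minimum\<close>, \<open>heights_equivalence\<close>). Raising the height of \<open>v\<close> turns \<open>v\<close> from a source into a
sink and does nothing else. As triangulated equivalences compose (\<open>derived_equivalent_trans\<close>), one
such flip \<open>P \<leadsto> P'\<close> has to be treated.

For a single flip, let \<open>s\<close> run over the neighbours of \<open>v\<close>. By the absence of cycles every element strictly above \<open>v\<close> in
\<open>P\<close> is above exactly one \<open>s\<close>, and every element strictly below \<open>v\<close> in \<open>P'\<close> is below exactly one \<open>s\<close>. A complex \<open>M\<close> of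
diagrams over \<open>P \<times> R\<close> is sent to the complex \<open>F M\<close> over \<open>P' \<times> R\<close> with the same entries away from \<open>v\<close> and
with the cone of \<open>M(v,w) \<rightarrow> \<Oplus>\<^sub>s M(s,w)\<close> at \<open>(v,w)\<close>. Conversely \<open>G N\<close> has the fibre of \<open>\<Oplus>\<^sub>s N(s,w) \<rightarrow> N(v,w)\<close>
at \<open>(v,w)\<close>. Both are honest functors on complexes. The comparison maps \<open>M \<rightarrow> G F M\<close>, \<open>F G N \<rightarrow> N\<close> and
\<open>F(M[1]) \<rightarrow> (F M)[1]\<close> are explicit matrices, commute strictly with everything in sight, and are
quasi-isomorphisms at each point (\<open>flip_equivalence\<close>). No resolutions or derived functors enter, which
is why the argument works over every abelian category.

Functors of complexes that preserve quasi-isomorphisms and mapping cones descend to triangulated functors between the localizations, and natural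
quasi-isomorphisms become natural isomorphisms (\<open>derived_equivalentI\<close>). Quasi-isomorphisms of
complexes of diagrams are detected at the points of the poset (\<open>quasi_iso_pointwise\<close>), and over the
abelian category itself by a diagram chase with generalised elements (\<open>quasi_iso_iff_qi\<close>). Together
these reduce the theorem to matrix identities (\<open>diag_equivalence\<close>).\<close>

section \<open>Functors, natural isomorphisms and triangulated equivalences\<close>

lemma functor_obj: "is_functor C D F ==> x \<in> Obj C ==> on_obj F x \<in> Obj D"
 by (simp add: is_functor_def)

lemma functor_ident: "is_functor C D F ==> x \<in> Obj C ==>
  on_arr F x x (Ident C x) = Ident D (on_obj F x)"
 by (simp add: is_functor_def)

lemma functor_arr: "is_functor C D F ==> f \<in> Hom C x y ==> x \<in> Obj C ==> y \<in> Obj C ==>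
  on_arr F x y f \<in> Hom D (on_obj F x) (on_obj F y)"
 by (simp add: is_functor_def)

lemma functor_comp: "is_functor C D F ==> f \<in> Hom C x y ==> g \<in> Hom C y z ==>
  x \<in> Obj C ==> y \<in> Obj C ==> z \<in> Obj C ==>
  on_arr F x z (g \<cdot>\<^bsub>C\<^esub> f) = on_arr F y z g \<cdot>\<^bsub>D\<^esub> on_arr F x y f"
 by (simp add: is_functor_def)

lemma comp_functor_sel [simp]:
 "on_obj (comp_functor G F) x = on_obj G (on_obj F x)"
 "on_arr (comp_functor G F) x y f = on_arr G (on_obj F x) (on_obj F y) (on_arr F x y f)"
 by (simp_all add: comp_functor_def)

lemma id_functor_sel [simp]: "on_obj id_functor x = x" "on_arr id_functor x y f = f"
 by (simp_all add: id_functor_def)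

lemma comp_functor_assoc: "comp_functor (comp_functor H G) F = comp_functor H (comp_functor G F)"
 by (simp add: comp_functor_def)

lemma comp_functor_id [simp]: "comp_functor F id_functor = F" "comp_functor id_functor F = F"
 by (simp_all add: comp_functor_def id_functor_def)

lemma is_functor_comp:
 assumes "is_functor C D F" "is_functor D E G"
 shows "is_functor C E (comp_functor G F)"
 using assms unfolding is_functor_def by simp

lemma functor_iso:
 assumes "is_functor C D F" "x \<in> Obj C" "y \<in> Obj C" "is_iso C x y f"
 shows "is_iso D (on_obj F x) (on_obj F y) (on_arr F x y f)"
proof -
 obtain g where g: "f \<in> Hom C x y" "g \<in> Hom C y x" "g \<cdot>\<^bsub>C\<^esub> f = Ident C x" "f \<cdot>\<^bsub>C\<^esub> g = Ident C y"
  using assms(4) by (auto simp: is_iso_def)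
 then show ?thesis unfolding is_iso_def
  using functor_comp[OF assms(1) g(1,2)] functor_comp[OF assms(1) g(2,1)]
   functor_ident[OF assms(1)] functor_arr[OF assms(1)] assms(2,3)
  by (metis (no_types, lifting))
qed

lemma (in category) is_iso_comp:
 assumes o: "x \<in> Obj C" "y \<in> Obj C" "z \<in> Obj C" and f: "is_iso C x y f" and g: "is_iso C y z g"
 shows "is_iso C x z (g \<cdot> f)"
proof -
 obtain f' where f': "f \<in> Hom C x y" "f' \<in> Hom C y x" "f' \<cdot> f = Ident C x" "f \<cdot> f' = Ident C y"
  using f by (auto simp: is_iso_def)
 obtain g' where g': "g \<in> Hom C y z" "g' \<in> Hom C z y" "g' \<cdot> g = Ident C y" "g \<cdot> g' = Ident C z"
  using g by (auto simp: is_iso_def)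
 have "(f' \<cdot> g') \<cdot> (g \<cdot> f) = f' \<cdot> (g' \<cdot> (g \<cdot> f))"
  using o f'(1,2) g'(1,2) comp_in_Hom by (intro comp_assoc[of x z y x]) auto
 also have "g' \<cdot> (g \<cdot> f) = f"
  using comp_assoc[of x y z y f g g'] o f' g' comp_ident_left by simp
 finally have 1: "(f' \<cdot> g') \<cdot> (g \<cdot> f) = Ident C x" using f' by simp
 have "(g \<cdot> f) \<cdot> (f' \<cdot> g') = g \<cdot> (f \<cdot> (f' \<cdot> g'))"
  using o f'(1,2) g'(1,2) comp_in_Hom by (intro comp_assoc[of z x y z]) auto
 also have "f \<cdot> (f' \<cdot> g') = g'"
  using comp_assoc[of z y x y g' f' f] o f' g' comp_ident_left by simp
 finally have 2: "(g \<cdot> f) \<cdot> (f' \<cdot> g') = Ident C z" using g' by simp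
 show ?thesis unfolding is_iso_def using 1 2 comp_in_Hom o f' g' by blast
qed

text \<open>Naturality with respect to a map gives naturality with respect to its inverse; this is what extends a
transformation to the formal inverses in a localization.\<close>
lemma (in category) inverse_square:
 assumes o: "x \<in> Obj C" "y \<in> Obj C" "x' \<in> Obj C" "y' \<in> Obj C"
  and h: "a \<in> Hom C x x'" "b \<in> Hom C y y'" "w \<in> Hom C x y" "w' \<in> Hom C x' y'"
   "v \<in> Hom C y x" "v' \<in> Hom C y' x'"
  and sq: "b \<cdot> w = w' \<cdot> a" and inv: "w \<cdot> v = Ident C y" "v' \<cdot> w' = Ident C x'"
 shows "a \<cdot> v = v' \<cdot> b"
proof -
 have "a \<cdot> v = (v' \<cdot> w') \<cdot> (a \<cdot> v)"
  using o h inv comp_in_Hom comp_ident_left[of y x' "a \<cdot> v"] by simp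
 also have "\<dots> = v' \<cdot> (w' \<cdot> (a \<cdot> v))" using o h comp_in_Hom by (intro comp_assoc[of y x' y' x']) auto
 also have "w' \<cdot> (a \<cdot> v) = (b \<cdot> w) \<cdot> v" unfolding sq
  using o h by (intro comp_assoc[of y x x' y', symmetric]) auto
 also have "\<dots> = b \<cdot> (w \<cdot> v)" using o h by (intro comp_assoc[of y x y y']) auto
 also have "\<dots> = b" using inv o h comp_ident_right by simp
 finally show ?thesis .
qed

lemma nat_isoD:
 "nat_iso C D F G \<eta> ==> nat_trans C D F G \<eta>"
 "nat_iso C D F G \<eta> ==> x \<in> Obj C ==> is_iso D (on_obj F x) (on_obj G x) (\<eta> x)"
 by (simp_all add: nat_iso_def)

lemma nat_iso_whisker_left:
 assumes "nat_iso C D H K \<alpha>" "is_functor D E G" "is_functor C D H" "is_functor C D K"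
 shows "nat_iso C E (comp_functor G H) (comp_functor G K)
  (%x. on_arr G (on_obj H x) (on_obj K x) (\<alpha> x))"
proof -
 have iso: "is_iso E (on_obj G (on_obj H x)) (on_obj G (on_obj K x))
   (on_arr G (on_obj H x) (on_obj K x) (\<alpha> x))" if "x \<in> Obj C" for x
  using functor_iso[OF assms(2)] nat_isoD(2)[OF assms(1) that] functor_obj[OF assms(3) that]
   functor_obj[OF assms(4) that] by auto
 have nat: "on_arr G (on_obj H y) (on_obj K y) (\<alpha> y) \<cdot>\<^bsub>E\<^esub> on_arr G (on_obj H x) (on_obj H y) (on_arr H x y f)
  = on_arr G (on_obj K x) (on_obj K y) (on_arr K x y f) \<cdot>\<^bsub>E\<^esub> on_arr G (on_obj H x) (on_obj K x) (\<alpha> x)"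
  if xy: "x \<in> Obj C" "y \<in> Obj C" "f \<in> Hom C x y" for x y f
 proof -
  have t: "\<alpha> x \<in> Hom D (on_obj H x) (on_obj K x)" "\<alpha> y \<in> Hom D (on_obj H y) (on_obj K y)"
   and e: "\<alpha> y \<cdot>\<^bsub>D\<^esub> on_arr H x y f = on_arr K x y f \<cdot>\<^bsub>D\<^esub> \<alpha> x"
   using nat_isoD(1)[OF assms(1)] xy by (auto simp: nat_trans_def)
  have o: "on_obj H x \<in> Obj D" "on_obj H y \<in> Obj D" "on_obj K x \<in> Obj D" "on_obj K y \<in> Obj D"
   using functor_obj assms(3,4) xy by metis+
  have m: "on_arr H x y f \<in> Hom D (on_obj H x) (on_obj H y)"
    "on_arr K x y f \<in> Hom D (on_obj K x) (on_obj K y)"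
   using functor_arr assms(3,4) xy by metis+
  show ?thesis
   unfolding functor_comp[OF assms(2) m(1) t(2) o(1,2,4), symmetric]
    functor_comp[OF assms(2) t(1) m(2) o(1,3,4), symmetric] e ..
 qed
 show ?thesis unfolding nat_iso_def nat_trans_def using iso nat by (simp add: is_iso_def)
qed

lemma nat_iso_whisker_right:
 assumes "nat_iso D E H K \<alpha>" "is_functor C D F"
 shows "nat_iso C E (comp_functor H F) (comp_functor K F) (%x. \<alpha> (on_obj F x))"
 using assms functor_obj[OF assms(2)] functor_arr[OF assms(2)]
 unfolding nat_iso_def nat_trans_def by simp

lemma nat_iso_vcomp:
 assumes D: "category D" and F: "is_functor C D F" and G: "is_functor C D G" and H: "is_functor C D H"
  and a: "nat_iso C D F G \<alpha>" and b: "nat_iso C D G H \<beta>"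
 shows "nat_iso C D F H (%x. \<beta> x \<cdot>\<^bsub>D\<^esub> \<alpha> x)"
proof -
 interpret category D by fact
 have iso: "is_iso D (on_obj F x) (on_obj H x) (\<beta> x \<cdot>\<^bsub>D\<^esub> \<alpha> x)" if "x \<in> Obj C" for x
  using is_iso_comp[OF _ _ _ nat_isoD(2)[OF a that] nat_isoD(2)[OF b that]] functor_obj that F G H by metis
 have nat: "(\<beta> y \<cdot>\<^bsub>D\<^esub> \<alpha> y) \<cdot>\<^bsub>D\<^esub> on_arr F x y f = on_arr H x y f \<cdot>\<^bsub>D\<^esub> (\<beta> x \<cdot>\<^bsub>D\<^esub> \<alpha> x)"
  if xy: "x \<in> Obj C" "y \<in> Obj C" "f \<in> Hom C x y" for x y f
 proof -
  have t: "\<alpha> x \<in> Hom D (on_obj F x) (on_obj G x)" "\<alpha> y \<in> Hom D (on_obj F y) (on_obj G y)"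
   "\<beta> x \<in> Hom D (on_obj G x) (on_obj H x)" "\<beta> y \<in> Hom D (on_obj G y) (on_obj H y)"
   and e: "\<alpha> y \<cdot>\<^bsub>D\<^esub> on_arr F x y f = on_arr G x y f \<cdot>\<^bsub>D\<^esub> \<alpha> x"
     "\<beta> y \<cdot>\<^bsub>D\<^esub> on_arr G x y f = on_arr H x y f \<cdot>\<^bsub>D\<^esub> \<beta> x"
   using nat_isoD(1)[OF a] nat_isoD(1)[OF b] xy by (auto simp: nat_trans_def)
  have o: "on_obj F x \<in> Obj D" "on_obj F y \<in> Obj D" "on_obj G x \<in> Obj D" "on_obj G y \<in> Obj D"
    "on_obj H x \<in> Obj D" "on_obj H y \<in> Obj D"
   using functor_obj F G H xy by metis+
  have m: "on_arr F x y f \<in> Hom D (on_obj F x) (on_obj F y)"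
    "on_arr G x y f \<in> Hom D (on_obj G x) (on_obj G y)"
    "on_arr H x y f \<in> Hom D (on_obj H x) (on_obj H y)"
   using functor_arr F G H xy by metis+
  have "(\<beta> y \<cdot>\<^bsub>D\<^esub> \<alpha> y) \<cdot>\<^bsub>D\<^esub> on_arr F x y f = \<beta> y \<cdot>\<^bsub>D\<^esub> (on_arr G x y f \<cdot>\<^bsub>D\<^esub> \<alpha> x)"
   using comp_assoc[OF o(1,2,4,6) m(1) t(2,4)] e by simp
  also have "\<dots> = (\<beta> y \<cdot>\<^bsub>D\<^esub> on_arr G x y f) \<cdot>\<^bsub>D\<^esub> \<alpha> x"
   using comp_assoc[OF o(1,3,4,6) t(1) m(2) t(4)] by simp
  also have "\<dots> = on_arr H x y f \<cdot>\<^bsub>D\<^esub> (\<beta> x \<cdot>\<^bsub>D\<^esub> \<alpha> x)"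
   using comp_assoc[OF o(1,3,5,6) t(1,3) m(3)] e by simp
  finally show ?thesis .
 qed
 show ?thesis unfolding nat_iso_def nat_trans_def using iso nat by (simp add: is_iso_def)
qed

text \<open>The comparison with the shift for a composite is \<open>\<theta>\<^sub>2 F\<^sub>1 \<circ> F\<^sub>2
\<theta>\<^sub>1\<close>. The hypothesis on triangles makes functoriality applicable to the third map of the image triangle.\<close>
lemma triangulated_equivalent_trans:
 assumes C: "category C" and D: "category D" and E: "category E"
  and SC: "is_functor C C (Shift C)" and SD: "is_functor D D (Shift D)" and SE: "is_functor E E (Shift E)"
  and triC: "!!x y z u v w. (x, y, z, u, v, w) \<in> Triangles C ==> x \<in> Obj C & z \<in> Obj C &
    w \<in> Hom C z (on_obj (Shift C) x)"
  and 1: "triangulated_equivalent C D" and 2: "triangulated_equivalent D E"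
 shows "triangulated_equivalent C E"
proof -
 obtain F1 \<theta>1 G1 \<eta>1 \<epsilon>1 where f1: "triangulated_functor C D F1 \<theta>1" and G1: "is_functor D C G1"
  and \<eta>1: "nat_iso C C id_functor (comp_functor G1 F1) \<eta>1"
  and \<epsilon>1: "nat_iso D D (comp_functor F1 G1) id_functor \<epsilon>1"
  using 1 by (auto simp: triangulated_equivalent_def)
 obtain F2 \<theta>2 G2 \<eta>2 \<epsilon>2 where f2: "triangulated_functor D E F2 \<theta>2" and G2: "is_functor E D G2"
  and \<eta>2: "nat_iso D D id_functor (comp_functor G2 F2) \<eta>2"
  and \<epsilon>2: "nat_iso E E (comp_functor F2 G2) id_functor \<epsilon>2"
  using 2 by (auto simp: triangulated_equivalent_def)
 note [intro] = is_functor_comp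
 have F1: "is_functor C D F1" and \<theta>1: "nat_iso C D (comp_functor F1 (Shift C)) (comp_functor (Shift D) F1) \<theta>1"
  and t1: "!!x y z u v w. (x, y, z, u, v, w) \<in> Triangles C ==>
    (on_obj F1 x, on_obj F1 y, on_obj F1 z, on_arr F1 x y u, on_arr F1 y z v,
     \<theta>1 x \<cdot>\<^bsub>D\<^esub> on_arr F1 z (on_obj (Shift C) x) w) \<in> Triangles D"
  using f1 unfolding triangulated_functor_def by blast+
 have F2: "is_functor D E F2" and \<theta>2: "nat_iso D E (comp_functor F2 (Shift D)) (comp_functor (Shift E) F2) \<theta>2"
  and t2: "!!x y z u v w. (x, y, z, u, v, w) \<in> Triangles D ==>
    (on_obj F2 x, on_obj F2 y, on_obj F2 z, on_arr F2 x y u, on_arr F2 y z v,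
     \<theta>2 x \<cdot>\<^bsub>E\<^esub> on_arr F2 z (on_obj (Shift D) x) w) \<in> Triangles E"
  using f2 unfolding triangulated_functor_def by blast+
 have id: "is_functor X X id_functor" for X :: "('t, 's, 'r) precategory_scheme"
  by (simp add: is_functor_def)
 let ?F = "comp_functor F2 F1" and ?G = "comp_functor G1 G2"
 let ?\<theta> = "%x. \<theta>2 (on_obj F1 x) \<cdot>\<^bsub>E\<^esub> on_arr F2 (on_obj F1 (on_obj (Shift C) x)) (on_obj (Shift D) (on_obj F1 x)) (\<theta>1 x)"
 have w1: "nat_iso C E (comp_functor F2 (comp_functor F1 (Shift C))) (comp_functor F2 (comp_functor (Shift D) F1))
  (%x. on_arr F2 (on_obj F1 (on_obj (Shift C) x)) (on_obj (Shift D) (on_obj F1 x)) (\<theta>1 x))"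
  using nat_iso_whisker_left[OF \<theta>1 F2] F1 SC SD by (simp add: is_functor_comp)
 have w2: "nat_iso C E (comp_functor F2 (comp_functor (Shift D) F1)) (comp_functor (Shift E) ?F)
  (%x. \<theta>2 (on_obj F1 x))"
  using nat_iso_whisker_right[OF \<theta>2 F1] by (simp add: comp_functor_assoc)
 have \<theta>: "nat_iso C E (comp_functor ?F (Shift C)) (comp_functor (Shift E) ?F) ?\<theta>"
  unfolding comp_functor_assoc
  by (rule nat_iso_vcomp[OF E _ _ _ w1 w2[unfolded comp_functor_assoc]]) (rule F1 F2 SC SD SE is_functor_comp)+
 have tri: "(on_obj ?F x, on_obj ?F y, on_obj ?F z, on_arr ?F x y u, on_arr ?F y z v,
     ?\<theta> x \<cdot>\<^bsub>E\<^esub> on_arr ?F z (on_obj (Shift C) x) w) \<in> Triangles E"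
  if t: "(x, y, z, u, v, w) \<in> Triangles C" for x y z u v w
 proof -
  interpret E: category E by fact
  have o: "x \<in> Obj C" "z \<in> Obj C" "w \<in> Hom C z (on_obj (Shift C) x)" using triC[OF t] by auto
  let ?w1 = "on_arr F1 z (on_obj (Shift C) x) w"
  have o1: "on_obj (Shift C) x \<in> Obj C" using SC o functor_obj by metis
  have o2: "on_obj F1 z \<in> Obj D" "on_obj F1 (on_obj (Shift C) x) \<in> Obj D" "on_obj F1 x \<in> Obj D"
    "on_obj (Shift D) (on_obj F1 x) \<in> Obj D"
   using F1 SD o o1 functor_obj by metis+
  have m1: "?w1 \<in> Hom D (on_obj F1 z) (on_obj F1 (on_obj (Shift C) x))"
   using functor_arr[OF F1 o(3,2) o1] .
  have m2: "\<theta>1 x \<in> Hom D (on_obj F1 (on_obj (Shift C) x)) (on_obj (Shift D) (on_obj F1 x))"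
   using \<theta>1 o by (simp add: nat_iso_def nat_trans_def)
  have m3: "\<theta>2 (on_obj F1 x) \<in> Hom E (on_obj F2 (on_obj (Shift D) (on_obj F1 x)))
    (on_obj (Shift E) (on_obj F2 (on_obj F1 x)))"
   using \<theta>2 o2 by (simp add: nat_iso_def nat_trans_def)
  have o3: "on_obj F2 (on_obj F1 z) \<in> Obj E" "on_obj F2 (on_obj F1 (on_obj (Shift C) x)) \<in> Obj E"
   "on_obj F2 (on_obj (Shift D) (on_obj F1 x)) \<in> Obj E" "on_obj (Shift E) (on_obj F2 (on_obj F1 x)) \<in> Obj E"
   using F2 SE o2 functor_obj by metis+
  have "?\<theta> x \<cdot>\<^bsub>E\<^esub> on_arr ?F z (on_obj (Shift C) x) w =
    \<theta>2 (on_obj F1 x) \<cdot>\<^bsub>E\<^esub> on_arr F2 (on_obj F1 z) (on_obj (Shift D) (on_obj F1 x)) (\<theta>1 x \<cdot>\<^bsub>D\<^esub> ?w1)"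
   using E.comp_assoc[OF o3 functor_arr[OF F2 m1 o2(1,2)] functor_arr[OF F2 m2 o2(2,4)] m3]
    functor_comp[OF F2 m1 m2 o2(1,2,4)] by simp
  then show ?thesis using t2[OF t1[OF t]] by simp
 qed
 have \<eta>: "\<exists>\<eta>. nat_iso C C id_functor (comp_functor ?G ?F) \<eta>"
 proof -
  have "nat_iso C C (comp_functor G1 (comp_functor id_functor F1)) (comp_functor G1 (comp_functor (comp_functor G2 F2) F1))
    (%x. on_arr G1 (on_obj (comp_functor id_functor F1) x) (on_obj (comp_functor (comp_functor G2 F2) F1) x) (\<eta>2 (on_obj F1 x)))"
   by (intro nat_iso_whisker_left[OF nat_iso_whisker_right[OF \<eta>2 F1] G1]) (rule F1 F2 G2 id is_functor_comp)+
  then have "nat_iso C C (comp_functor G1 F1) (comp_functor ?G ?F)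
    (%x. on_arr G1 (on_obj (comp_functor id_functor F1) x) (on_obj (comp_functor (comp_functor G2 F2) F1) x) (\<eta>2 (on_obj F1 x)))"
   by (simp add: comp_functor_assoc)
  from nat_iso_vcomp[OF C id is_functor_comp[OF F1 G1]
    is_functor_comp[OF is_functor_comp[OF F1 F2] is_functor_comp[OF G2 G1]] \<eta>1 this]
  show ?thesis by blast
 qed
 have \<epsilon>: "\<exists>\<epsilon>. nat_iso E E (comp_functor ?F ?G) id_functor \<epsilon>"
 proof -
  have "nat_iso E E (comp_functor F2 (comp_functor (comp_functor F1 G1) G2)) (comp_functor F2 (comp_functor id_functor G2))
    (%x. on_arr F2 (on_obj (comp_functor (comp_functor F1 G1) G2) x) (on_obj (comp_functor id_functor G2) x) (\<epsilon>1 (on_obj G2 x)))"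
   by (intro nat_iso_whisker_left[OF nat_iso_whisker_right[OF \<epsilon>1 G2] F2]) (rule F2 F1 G1 G2 id is_functor_comp)+
  then have "nat_iso E E (comp_functor ?F ?G) (comp_functor F2 G2)
    (%x. on_arr F2 (on_obj (comp_functor (comp_functor F1 G1) G2) x) (on_obj (comp_functor id_functor G2) x) (\<epsilon>1 (on_obj G2 x)))"
   by (simp add: comp_functor_assoc)
  from nat_iso_vcomp[OF E is_functor_comp[OF is_functor_comp[OF G2 G1] is_functor_comp[OF F1 F2]]
    is_functor_comp[OF G2 F2] id this \<epsilon>2]
  show ?thesis by blast
 qed
 have "triangulated_functor C E ?F ?\<theta>"
  unfolding triangulated_functor_def using F1 F2 \<theta> tri is_functor_comp by fast
 moreover have "is_functor E C ?G" using G1 G2 by blast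
 ultimately show ?thesis unfolding triangulated_equivalent_def using \<eta> \<epsilon> by blast
qed

section \<open>Localization\<close>

text \<open>Statements about the localization are proved on zigzags, by induction over their formation or
over the generated congruence.\<close>
locale localizable = category C for C :: "('o, 'm, 'z) precategory_scheme" (structure) +
 fixes W :: "'o => 'o => 'm set"
 assumes W_sub: "W x y \<subseteq> Hom C x y"
begin

lemma zigzag_hom_Obj: "zigzag_hom C W p x y ==> x \<in> Obj C & y \<in> Obj C"
 by (induction rule: zigzag_hom.induct) auto

abbreviation cls where "cls p \<equiv> zigzag_class C W p"

lemma class_eqI: "zigzag_eq C W p q ==> (cls p) = cls q"
 unfolding zigzag_class_def by (blast intro: zigzag_eq.sym zigzag_eq.trans)

lemma class_mem: "zigzag_hom C W p x y ==> p \<in> (cls p)"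
 unfolding zigzag_class_def by (blast intro: zigzag_eq.refl)

text \<open>Operations on the localization are defined by unions over representatives. Such a union collapses to one
value as soon as the operation respects the congruence.\<close>
lemma UN_class:
 assumes "zigzag_hom C W p x y" and "!!q. zigzag_eq C W p q ==> g q = g p"
 shows "(\<Union>q \<in> (cls p). g q) = g p"
 using class_mem[OF assms(1)] assms(2) unfolding zigzag_class_def by blast

lemma class_comp:
 assumes "zigzag_hom C W p x y" "zigzag_hom C W q y z"
 shows "cls q \<cdot>\<^bsub>localization C W\<^esub> (cls p) = (cls (Cat q p))"
proof -
 have "(\<Union>p' \<in> (cls p). (cls (Cat q' p'))) = (cls (Cat q p))" if "zigzag_eq C W q q'" for q'
 proof -
  have "(cls (Cat q' p')) = (cls (Cat q p))" if "zigzag_eq C W p p'" for p'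
   using class_eqI[OF zigzag_eq.cong[OF assms that \<open>zigzag_eq C W q q'\<close>]] by simp
  then show ?thesis using class_mem[OF assms(1)] unfolding zigzag_class_def by blast
 qed
 then show ?thesis using class_mem[OF assms(2)]
  unfolding localization_def zigzag_class_def by (simp) blast
qed

lemma Obj_loc [simp]: "Obj (localization C W) = Obj C" by (simp add: localization_def)

lemma Ident_loc: "Ident (localization C W) x = (cls (Arr x (Ident C x) x))" by (simp add: localization_def)

lemma Hom_loc: "Hom (localization C W) x y = {(cls p) | p. zigzag_hom C W p x y}" by (simp add: localization_def)

lemma Hom_locE:
 assumes "\<phi> \<in> Hom (localization C W) x y"
 obtains p where "zigzag_hom C W p x y" "\<phi> = cls p"
 using assms unfolding Hom_loc by blast

lemma Hom_locI: "zigzag_hom C W p x y ==> (cls p) \<in> Hom (localization C W) x y"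
 unfolding Hom_loc by blast

lemma category_localization: "category (localization C W)"
proof
 fix x assume "x \<in> Obj (localization C W)"
 then show "Ident (localization C W) x \<in> Hom (localization C W) x x"
  by (auto simp: Ident_loc intro!: Hom_locI zigzag_hom.Arr ident_in_Hom)
next
 fix x y z f g assume "f \<in> Hom (localization C W) x y" "g \<in> Hom (localization C W) y z"
 then show "g \<cdot>\<^bsub>localization C W\<^esub> f \<in> Hom (localization C W) x z"
  by (elim Hom_locE) (auto simp: class_comp intro: Hom_locI zigzag_hom.Cat)
next
 fix x y f assume "x \<in> Obj (localization C W)" "f \<in> Hom (localization C W) x y"
 then show "f \<cdot>\<^bsub>localization C W\<^esub> Ident (localization C W) x = f"
  by (elim Hom_locE) (simp add: Ident_loc class_comp[OF zigzag_hom.Arr[OF _ _ ident_in_Hom]] class_eqI zigzag_eq.ident_right)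
next
 fix x y f assume "y \<in> Obj (localization C W)" "f \<in> Hom (localization C W) x y"
 then show "Ident (localization C W) y \<cdot>\<^bsub>localization C W\<^esub> f = f"
  by (elim Hom_locE) (simp add: Ident_loc class_comp[OF _ zigzag_hom.Arr[OF _ _ ident_in_Hom]] class_eqI zigzag_eq.ident_left)
next
 fix w x y z f g h assume h: "f \<in> Hom (localization C W) w x" "g \<in> Hom (localization C W) x y" "h \<in> Hom (localization C W) y z"
 from h obtain p q r where p: "zigzag_hom C W p w x" "f = cls p" and q: "zigzag_hom C W q x y" "g = cls q"
  and r: "zigzag_hom C W r y z" "h = (cls r)" by (elim Hom_locE) auto
 then show "(h \<cdot>\<^bsub>localization C W\<^esub> g) \<cdot>\<^bsub>localization C W\<^esub> f = h \<cdot>\<^bsub>localization C W\<^esub> g \<cdot>\<^bsub>localization C W\<^esub> f"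
  using zigzag_eq.assoc[OF p(1) q(1) r(1)]
  by (simp add: class_comp[OF p(1) q(1)] class_comp[OF q(1) r(1)] class_comp[OF zigzag_hom.Cat[OF p(1) q(1)] r(1)]
   class_comp[OF p(1) zigzag_hom.Cat[OF q(1) r(1)]] class_eqI)
qed

lemma class_Inv:
 assumes "x \<in> Obj C" "y \<in> Obj C" "f \<in> W x y"
 shows "(cls (Inv x f y)) \<cdot>\<^bsub>localization C W\<^esub> (cls (Arr x f y)) = Ident (localization C W) x"
  "(cls (Arr x f y)) \<cdot>\<^bsub>localization C W\<^esub> (cls (Inv x f y)) = Ident (localization C W) y"
proof -
 have h: "zigzag_hom C W (Inv x f y) y x" "zigzag_hom C W (Arr x f y) x y"
  using assms W_sub by (blast intro: zigzag_hom.intros)+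
 show "(cls (Inv x f y)) \<cdot>\<^bsub>localization C W\<^esub> (cls (Arr x f y)) = Ident (localization C W) x"
  using h assms by (simp add: class_comp Ident_loc class_eqI zigzag_eq.inv_left)
 show "(cls (Arr x f y)) \<cdot>\<^bsub>localization C W\<^esub> (cls (Inv x f y)) = Ident (localization C W) y"
  using h assms by (simp add: class_comp Ident_loc class_eqI zigzag_eq.inv_right)
qed

lemma class_iso:
 assumes "x \<in> Obj C" "y \<in> Obj C" "f \<in> W x y"
 shows "is_iso (localization C W) x y (cls (Arr x f y))"
 unfolding is_iso_def using class_Inv[OF assms] assms W_sub
 by (blast intro: Hom_locI zigzag_hom.intros)

lemma class_Arr_comp:
 "x \<in> Obj C ==> y \<in> Obj C ==> z \<in> Obj C ==> f \<in> Hom C x y ==> g \<in> Hom C y z ==>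
  (cls (Arr y g z)) \<cdot>\<^bsub>localization C W\<^esub> (cls (Arr x f y)) = (cls (Arr x (g \<cdot> f) z))"
 by (subst class_comp[OF zigzag_hom.Arr zigzag_hom.Arr]) (auto intro!: class_eqI zigzag_eq.comp)

end

primrec zmap :: "('o, 'm, 'p, 'n) func => ('o, 'm) zigzag => ('p, 'n) zigzag" where
 "zmap F (Arr x f y) = Arr (on_obj F x) (on_arr F x y f) (on_obj F y)"
| "zmap F (Inv x f y) = Inv (on_obj F x) (on_arr F x y f) (on_obj F y)"
| "zmap F (Cat q p) = Cat (zmap F q) (zmap F p)"

lemma zmap_comp: "zmap (comp_functor G F) p = zmap G (zmap F p)"
 by (induction p) auto

lemma zmap_id [simp]: "zmap id_functor p = p"
 by (induction p) auto

definition loc_functor :: "('p, 'n, 'z) precategory_scheme => ('p => 'p => 'n set) => ('o, 'm, 'p, 'n) func =>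
  ('o, ('o, 'm) zigzag set, 'p, ('p, 'n) zigzag set) func" where
 "loc_functor C' W' F = \<lparr>on_obj = on_obj F, on_arr = (%x y \<phi>. \<Union>p \<in> \<phi>. zigzag_class C' W' (zmap F p))\<rparr>"

locale loc_pair = A: localizable C W + B: localizable C' W'
 for C :: "('o, 'm, 'z) precategory_scheme" and W :: "'o => 'o => 'm set"
  and C' :: "('p, 'n, 'y) precategory_scheme" and W' :: "'p => 'p => 'n set" +
 fixes F :: "('o, 'm, 'p, 'n) func"
 assumes F: "is_functor C C' F"
  and FW: "!!x y f. x \<in> Obj C ==> y \<in> Obj C ==> f \<in> W x y ==> on_arr F x y f \<in> W' (on_obj F x) (on_obj F y)"
begin

lemma zmap_hom: "zigzag_hom C W p x y ==> zigzag_hom C' W' (zmap F p) (on_obj F x) (on_obj F y)"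
 by (induction rule: zigzag_hom.induct)
  (auto intro: zigzag_hom.intros functor_obj[OF F] functor_arr[OF F] FW)

text \<open>Induction over the congruence. Each generating relation is
carried to the same relation in the target because \<open>F\<close> is a functor that preserves the
inverted arrows.\<close>
lemma zmap_eq: "zigzag_eq C W p q ==> zigzag_eq C' W' (zmap F p) (zmap F q)"
proof (induction rule: zigzag_eq.induct)
 case (refl p x y) then show ?case by (blast intro: zigzag_eq.refl zmap_hom)
next
 case (sym p q) then show ?case by (blast intro: zigzag_eq.sym)
next
 case (trans p q r) then show ?case by (blast intro: zigzag_eq.trans)
next
 case (cong p x y q z p' q') then show ?case by (auto intro: zigzag_eq.cong zmap_hom)
next
 case (assoc p w x q y r) then show ?case by (auto intro: zigzag_eq.assoc zmap_hom)
next
 case (ident_right p x y) then show ?case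
  using A.zigzag_hom_Obj[OF ident_right] zmap_hom[OF ident_right]
  by (simp add: functor_ident[OF F] zigzag_eq.ident_right)
next
 case (ident_left p x y) then show ?case
  using A.zigzag_hom_Obj[OF ident_left] zmap_hom[OF ident_left]
  by (simp add: functor_ident[OF F] zigzag_eq.ident_left)
next
 case (comp x y z f g) then show ?case
  by (simp add: functor_comp[OF F comp(4,5,1,2,3)])
   (intro zigzag_eq.comp functor_obj[OF F] functor_arr[OF F], auto)
next
 case (inv_left x y f) then show ?case
  by (simp add: functor_ident[OF F]) (intro zigzag_eq.inv_left functor_obj[OF F] FW, auto)
next
 case (inv_right x y f) then show ?case
  by (simp add: functor_ident[OF F]) (intro zigzag_eq.inv_right functor_obj[OF F] FW, auto)
qed

lemma on_obj_loc [simp]: "on_obj (loc_functor C' W' F) x = on_obj F x"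
 by (simp add: loc_functor_def)

lemma on_arr_loc:
 assumes "zigzag_hom C W p x y"
 shows "on_arr (loc_functor C' W' F) x' y' (A.cls p) = B.cls (zmap F p)"
 unfolding loc_functor_def using A.UN_class[OF assms, of "%q. B.cls (zmap F q)"] zmap_eq B.class_eqI
 by simp metis

lemma is_functor_loc: "is_functor (localization C W) (localization C' W') (loc_functor C' W' F)"
 unfolding is_functor_def
proof (intro conjI ballI)
 fix x assume x: "x \<in> Obj (localization C W)"
 then show "on_obj (loc_functor C' W' F) x \<in> Obj (localization C' W')"
  using functor_obj[OF F] by simp
 have "zigzag_hom C W (Arr x (Ident C x) x) x x"
  using x by (auto intro: zigzag_hom.Arr A.ident_in_Hom)
 then show "on_arr (loc_functor C' W' F) x x (Ident (localization C W) x) =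
    Ident (localization C' W') (on_obj (loc_functor C' W' F) x)"
  using x by (simp add: A.Ident_loc B.Ident_loc on_arr_loc functor_ident[OF F])
next
 fix x y f assume "f \<in> Hom (localization C W) x y"
 then show "on_arr (loc_functor C' W' F) x y f \<in>
   Hom (localization C' W') (on_obj (loc_functor C' W' F) x) (on_obj (loc_functor C' W' F) y)"
  by (elim A.Hom_locE) (simp add: on_arr_loc B.Hom_locI zmap_hom)
next
 fix x y z f g assume "f \<in> Hom (localization C W) x y" "g \<in> Hom (localization C W) y z"
 then obtain p q where p: "zigzag_hom C W p x y" "f = A.cls p" and q: "zigzag_hom C W q y z" "g = A.cls q"
  by (elim A.Hom_locE) auto
 show "on_arr (loc_functor C' W' F) x z (g \<cdot>\<^bsub>localization C W\<^esub> f) =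
  on_arr (loc_functor C' W' F) y z g \<cdot>\<^bsub>localization C' W'\<^esub> on_arr (loc_functor C' W' F) x y f"
  by (simp add: p(2) q(2) A.class_comp[OF p(1) q(1)] on_arr_loc[OF p(1)] on_arr_loc[OF q(1)]
    on_arr_loc[OF zigzag_hom.Cat[OF p(1) q(1)]] B.class_comp[OF zmap_hom[OF p(1)] zmap_hom[OF q(1)]])
qed

end

text \<open>A transformation whose components are inverted arrows becomes an isomorphism. Naturality is proved by
induction on zigzags: \<open>Arr\<close> is the given naturality, \<open>Inv\<close> follows from it by
\<open>inverse_square\<close>.\<close>
lemma nat_iso_loc:
 assumes "loc_pair C W C' W' F" "loc_pair C W C' W' G" and \<eta>: "nat_trans C C' F G \<eta>"
  and \<eta>W: "!!x. x \<in> Obj C ==> \<eta> x \<in> W' (on_obj F x) (on_obj G x)"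
 shows "nat_iso (localization C W) (localization C' W') (loc_functor C' W' F) (loc_functor C' W' G)
  (%x. zigzag_class C' W' (Arr (on_obj F x) (\<eta> x) (on_obj G x)))" (is "nat_iso _ _ _ _ ?\<eta>")
proof -
 interpret F: loc_pair C W C' W' F by fact
 interpret G: loc_pair C W C' W' G by fact
 interpret L: category "localization C' W'" by (rule F.B.category_localization)
 have hom: "\<eta> x \<in> Hom C' (on_obj F x) (on_obj G x)" if "x \<in> Obj C" for x
  using \<eta> that by (simp add: nat_trans_def)
 have homz: "zigzag_hom C' W' (Arr (on_obj F x) (\<eta> x) (on_obj G x)) (on_obj F x) (on_obj G x)" if "x \<in> Obj C" for x
  using that hom F.F G.F by (blast intro: zigzag_hom.Arr functor_obj)
 have homL: "?\<eta> x \<in> Hom (localization C' W') (on_obj F x) (on_obj G x)" if "x \<in> Obj C" for x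
  using homz[OF that] by (rule F.B.Hom_locI)
 have oF: "on_obj F x \<in> Obj C'" "on_obj G x \<in> Obj C'" if "x \<in> Obj C" for x
  using that F.F G.F functor_obj by metis+
 have arr: "?\<eta> y \<cdot>\<^bsub>localization C' W'\<^esub> F.B.cls (zmap F (Arr x f y)) = F.B.cls (zmap G (Arr x f y)) \<cdot>\<^bsub>localization C' W'\<^esub> ?\<eta> x"
  if "x \<in> Obj C" "y \<in> Obj C" "f \<in> Hom C x y" for x y f
  using that \<eta> oF hom functor_arr[OF F.F that(3,1,2)] functor_arr[OF G.F that(3,1,2)]
  by (simp add: F.B.class_Arr_comp nat_trans_def)
 have nat: "?\<eta> y \<cdot>\<^bsub>localization C' W'\<^esub> F.B.cls (zmap F p) = F.B.cls (zmap G p) \<cdot>\<^bsub>localization C' W'\<^esub> ?\<eta> x"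
  if "zigzag_hom C W p x y" for p x y
  using that
 proof (induction rule: zigzag_hom.induct)
  case (Arr x y f) then show ?case by (rule arr)
 next
  case (Inv x y f)
  have f: "f \<in> Hom C x y" using Inv F.A.W_sub by blast
  have fz: "zigzag_hom C W (Arr x f y) x y" "zigzag_hom C W (Inv x f y) y x"
   using f Inv by (blast intro: zigzag_hom.intros)+
  note H = F.B.Hom_locI
  have ob: "on_obj F x \<in> Obj (localization C' W')" "on_obj F y \<in> Obj (localization C' W')"
   "on_obj G x \<in> Obj (localization C' W')" "on_obj G y \<in> Obj (localization C' W')"
   using oF[OF Inv(1)] oF[OF Inv(2)] by simp_all
  have i1: "F.B.cls (zmap F (Arr x f y)) \<cdot>\<^bsub>localization C' W'\<^esub> F.B.cls (zmap F (Inv x f y)) =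
    Ident (localization C' W') (on_obj F y)"
   using F.B.class_Inv(2)[OF oF(1)[OF Inv(1)] oF(1)[OF Inv(2)] F.FW[OF Inv]] by simp
  have i2: "F.B.cls (zmap G (Inv x f y)) \<cdot>\<^bsub>localization C' W'\<^esub> F.B.cls (zmap G (Arr x f y)) =
    Ident (localization C' W') (on_obj G x)"
   using F.B.class_Inv(1)[OF oF(2)[OF Inv(1)] oF(2)[OF Inv(2)] G.FW[OF Inv]] by simp
  show ?case
   by (rule L.inverse_square[OF ob homL[OF Inv(1)] homL[OF Inv(2)] H[OF F.zmap_hom[OF fz(1)]]
     H[OF G.zmap_hom[OF fz(1)]] H[OF F.zmap_hom[OF fz(2)]] H[OF G.zmap_hom[OF fz(2)]]
     arr[OF Inv(1,2) f] i1 i2])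
 next
  case (Cat p x y q z)
  have o: "x \<in> Obj C" "y \<in> Obj C" "z \<in> Obj C"
   using F.A.zigzag_hom_Obj[OF Cat(1)] F.A.zigzag_hom_Obj[OF Cat(2)] by auto
  let ?c = "Comp (localization C' W')"
  note Fp = F.zmap_hom[OF Cat(1)] and Fq = F.zmap_hom[OF Cat(2)]
  note Gp = G.zmap_hom[OF Cat(1)] and Gq = G.zmap_hom[OF Cat(2)]
  note ob = oF[OF o(1)] oF[OF o(2)] oF[OF o(3)]
  note H = F.B.Hom_locI
  have "?c (?\<eta> z) (?c (F.B.cls (zmap F q)) (F.B.cls (zmap F p))) = ?c (?c (?\<eta> z) (F.B.cls (zmap F q))) (F.B.cls (zmap F p))"
   using L.comp_assoc[OF _ _ _ _ H[OF Fp] H[OF Fq] homL[OF o(3)]] ob by simp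
  also have "\<dots> = ?c (F.B.cls (zmap G q)) (?c (?\<eta> y) (F.B.cls (zmap F p)))"
   using L.comp_assoc[OF _ _ _ _ H[OF Fp] homL[OF o(2)] H[OF Gq]] ob Cat by simp
  also have "\<dots> = ?c (?c (F.B.cls (zmap G q)) (F.B.cls (zmap G p))) (?\<eta> x)"
   using L.comp_assoc[OF _ _ _ _ homL[OF o(1)] H[OF Gp] H[OF Gq]] ob Cat by simp
  finally show ?case by (simp add: F.B.class_comp[OF Fp Fq] F.B.class_comp[OF Gp Gq])
 qed
 show ?thesis unfolding nat_iso_def nat_trans_def
 proof (intro conjI ballI)
  fix x y \<phi> assume "\<phi> \<in> Hom (localization C W) x y"
  then show "?\<eta> y \<cdot>\<^bsub>localization C' W'\<^esub> on_arr (loc_functor C' W' F) x y \<phi> =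
    on_arr (loc_functor C' W' G) x y \<phi> \<cdot>\<^bsub>localization C' W'\<^esub> ?\<eta> x"
   by (elim F.A.Hom_locE) (simp add: F.on_arr_loc G.on_arr_loc nat)
 next
  fix x assume "x \<in> Obj (localization C W)"
  then have x: "x \<in> Obj C" by simp
  show "is_iso (localization C' W') (on_obj (loc_functor C' W' F) x) (on_obj (loc_functor C' W' G) x) (?\<eta> x)"
   using F.B.class_iso[OF oF[OF x] \<eta>W[OF x]] by simp
 qed (use homL in simp)
qed

text \<open>Functors out of the localization matter on its objects and arrows only; on other arguments the union in
their definition takes arbitrary values.\<close>
lemma nat_iso_cong:
 assumes "nat_iso C D F G \<eta>"
  and "!!x. x \<in> Obj C ==> on_obj F' x = on_obj F x & on_obj G' x = on_obj G x"
  and "!!x y f. x \<in> Obj C ==> y \<in> Obj C ==> f \<in> Hom C x y ==>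
   on_arr F' x y f = on_arr F x y f & on_arr G' x y f = on_arr G x y f"
 shows "nat_iso C D F' G' \<eta>"
 using assms unfolding nat_iso_def nat_trans_def by simp

lemma loc_functor_comp:
 assumes "loc_pair C W C' W' F" "loc_pair C' W' C'' W'' G"
 shows "loc_pair C W C'' W'' (comp_functor G F)"
  and "zigzag_hom C W p x y ==> on_arr (comp_functor (loc_functor C'' W'' G) (loc_functor C' W' F)) u v (zigzag_class C W p) =
   on_arr (loc_functor C'' W'' (comp_functor G F)) u v (zigzag_class C W p)"
proof -
 interpret F: loc_pair C W C' W' F by fact
 interpret G: loc_pair C' W' C'' W'' G by fact
 show GF: "loc_pair C W C'' W'' (comp_functor G F)"
  by unfold_locales (auto simp: is_functor_comp[OF F.F G.F] intro!: F.FW G.FW functor_obj[OF F.F])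
 then interpret GF: loc_pair C W C'' W'' "comp_functor G F" .
 show "zigzag_hom C W p x y ==> on_arr (comp_functor (loc_functor C'' W'' G) (loc_functor C' W' F)) u v (zigzag_class C W p) =
   on_arr (loc_functor C'' W'' (comp_functor G F)) u v (zigzag_class C W p)"
  by (simp add: F.on_arr_loc GF.on_arr_loc G.on_arr_loc[OF F.zmap_hom] zmap_comp)
qed

lemma loc_functor_id:
 assumes "localizable C W"
 shows "loc_pair C W C W id_functor"
  "zigzag_hom C W p x y ==> on_arr (loc_functor C W id_functor) u v (zigzag_class C W p) = zigzag_class C W p"
proof -
 interpret localizable C W by fact
 show I: "loc_pair C W C W id_functor"
  by unfold_locales (auto simp: is_functor_def)
 then interpret I: loc_pair C W C W id_functor .
 show "zigzag_hom C W p x y ==> on_arr (loc_functor C W id_functor) u v (zigzag_class C W p) = zigzag_class C W p"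
  by (simp add: I.on_arr_loc)
qed

section \<open>Preadditive categories and complexes\<close>

context preadditive_category
begin

lemma group_hom: "x \<in> Obj A ==> y \<in> Obj A ==> group (hom_group A x y)"
 using hom_comm_group comm_group_def by blast

lemma hom_group_sel [simp]: "carrier (hom_group A x y) = Hom A x y" "mult (hom_group A x y) = Plus A"
  "one (hom_group A x y) = Zero A x y"
 by (simp_all add: hom_group_def)

lemma zero_hom: "x \<in> Obj A ==> y \<in> Obj A ==> Zero A x y \<in> Hom A x y"
 using group.is_monoid[OF group_hom, THEN monoid.one_closed] by simp

lemma plus_hom: "x \<in> Obj A ==> y \<in> Obj A ==> f \<in> Hom A x y ==> g \<in> Hom A x y ==> f \<boxplus> g \<in> Hom A x y"
 using group.is_monoid[OF group_hom, THEN monoid.m_closed] by simp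

lemma neg_hom: "x \<in> Obj A ==> y \<in> Obj A ==> f \<in> Hom A x y ==> Neg A x y f \<in> Hom A x y"
 using group.inv_closed[OF group_hom] by simp

lemma plus_assoc: "x \<in> Obj A ==> y \<in> Obj A ==> f \<in> Hom A x y ==> g \<in> Hom A x y ==> h \<in> Hom A x y ==>
  (f \<boxplus> g) \<boxplus> h = f \<boxplus> (g \<boxplus> h)"
 using group.is_monoid[OF group_hom, THEN monoid.m_assoc] by simp

lemma plus_commute: "x \<in> Obj A ==> y \<in> Obj A ==> f \<in> Hom A x y ==> g \<in> Hom A x y ==> f \<boxplus> g = g \<boxplus> f"
 using hom_comm_group[THEN comm_group.axioms(1), THEN comm_monoid.m_comm] by simp

lemma plus_zero: "x \<in> Obj A ==> y \<in> Obj A ==> f \<in> Hom A x y ==> f \<boxplus> Zero A x y = f"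
 using group.is_monoid[OF group_hom, THEN monoid.r_one] by simp

lemma plus_neg: "x \<in> Obj A ==> y \<in> Obj A ==> f \<in> Hom A x y ==> f \<boxplus> Neg A x y f = Zero A x y"
 using group.r_inv[OF group_hom] by simp

lemma neg_unique: "x \<in> Obj A ==> y \<in> Obj A ==> f \<in> Hom A x y ==> g \<in> Hom A x y ==> f \<boxplus> g = Zero A x y ==>
  g = Neg A x y f"
 using group.inv_equality[OF group_hom, of x y g f] plus_commute by simp

lemma neg_neg: "x \<in> Obj A ==> y \<in> Obj A ==> f \<in> Hom A x y ==> Neg A x y (Neg A x y f) = f"
 using group.inv_inv[OF group_hom] by simp

lemma neg_zero: "x \<in> Obj A ==> y \<in> Obj A ==> Neg A x y (Zero A x y) = Zero A x y"
 using monoid.inv_one[OF group.is_monoid[OF group_hom]] by simp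

lemma neg_plus: "x \<in> Obj A ==> y \<in> Obj A ==> f \<in> Hom A x y ==> g \<in> Hom A x y ==>
  Neg A x y (f \<boxplus> g) = Neg A x y f \<boxplus> Neg A x y g"
 using comm_group.inv_mult[OF hom_comm_group] by simp

lemma idem_zero:
 assumes "x \<in> Obj A" "y \<in> Obj A" "f \<in> Hom A x y" "f \<boxplus> f = f" shows "f = Zero A x y"
proof -
 have "f = f \<boxplus> (f \<boxplus> Neg A x y f)" using assms by (simp add: plus_neg plus_zero)
 also have "\<dots> = Zero A x y" using assms by (subst plus_assoc[symmetric]) (auto simp: plus_neg neg_hom)
 finally show ?thesis .
qed

lemma comp_zero:
 assumes "x \<in> Obj A" "y \<in> Obj A" "z \<in> Obj A" "g \<in> Hom A y z"
 shows "g \<cdot> Zero A x y = Zero A x z"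
 using assms comp_plus_right[of x y z "Zero A x y" "Zero A x y" g]
 by (intro idem_zero) (auto simp: zero_hom plus_zero intro: comp_in_Hom)

lemma zero_comp:
 assumes "x \<in> Obj A" "y \<in> Obj A" "z \<in> Obj A" "f \<in> Hom A x y"
 shows "Zero A y z \<cdot> f = Zero A x z"
 using assms comp_plus_left[of x y z f "Zero A y z" "Zero A y z"]
 by (intro idem_zero) (auto simp: zero_hom plus_zero intro: comp_in_Hom)

lemma comp_neg:
 assumes "x \<in> Obj A" "y \<in> Obj A" "z \<in> Obj A" "f \<in> Hom A x y" "g \<in> Hom A y z"
 shows "g \<cdot> Neg A x y f = Neg A x z (g \<cdot> f)"
 using assms comp_plus_right[of x y z f "Neg A x y f" g]
 by (intro neg_unique) (auto simp: neg_hom plus_neg comp_zero intro: comp_in_Hom)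

lemma neg_comp:
 assumes "x \<in> Obj A" "y \<in> Obj A" "z \<in> Obj A" "f \<in> Hom A x y" "g \<in> Hom A y z"
 shows "Neg A y z g \<cdot> f = Neg A x z (g \<cdot> f)"
 using assms comp_plus_left[of x y z f g "Neg A y z g"]
 by (intro neg_unique) (auto simp: neg_hom plus_neg zero_comp intro: comp_in_Hom)

lemma neg_eq_zero: "x \<in> Obj A ==> y \<in> Obj A ==> f \<in> Hom A x y ==> Neg A x y f = Zero A x y \<longleftrightarrow> f = Zero A x y"
 using neg_neg neg_zero by metis

lemma cochainD:
 assumes "X \<in> Obj (complex_category A)"
 shows "deg X n \<in> Obj A" "diff X n \<in> Hom A (deg X n) (deg X (n+1))"
  "diff X (n+1) \<cdot> diff X n = Zero A (deg X n) (deg X (n+1+1))"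
 using assms by (auto simp: complex_category_def)

lemma cochain_mapD:
 assumes "f \<in> Hom (complex_category A) X Y"
 shows "f n \<in> Hom A (deg X n) (deg Y n)" "diff Y n \<cdot> f n = f (n+1) \<cdot> diff X n"
 using assms by (auto simp: complex_category_def)

lemma Comp_complex: "g \<cdot>\<^bsub>complex_category A\<^esub> f = (%n. g n \<cdot> f n)"
 by (simp add: complex_category_def)

lemma Ident_complex: "Ident (complex_category A) X = (%n. Ident A (deg X n))"
 by (simp add: complex_category_def)

lemma category_complex: "category (complex_category A)"
proof
 fix x assume x: "x \<in> Obj (complex_category A)"
 note [simp] = cochainD[OF x]
 show "Ident (complex_category A) x \<in> Hom (complex_category A) x x"
  by (auto simp: complex_category_def ident_in_Hom)
   (metis cochainD(1,2)[OF x] comp_ident_left comp_ident_right)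
next
 fix x y z f g
 assume o: "x \<in> Obj (complex_category A)" "y \<in> Obj (complex_category A)" "z \<in> Obj (complex_category A)"
  and f: "f \<in> Hom (complex_category A) x y" and g: "g \<in> Hom (complex_category A) y z"
 note d = cochainD[OF o(1)] cochainD[OF o(2)] cochainD[OF o(3)]
 have "diff z n \<cdot> g n \<cdot> f n = (g (n+1) \<cdot> f (n+1)) \<cdot> diff x n" for n
 proof -
  have "diff z n \<cdot> g n \<cdot> f n = (g (n+1) \<cdot> diff y n) \<cdot> f n"
   using comp_assoc[OF _ _ _ _ cochain_mapD(1)[OF f] cochain_mapD(1)[OF g] d(8)[of n]] d cochain_mapD(2)[OF g]
   by simp
  also have "\<dots> = g (n+1) \<cdot> f (n+1) \<cdot> diff x n"
   using comp_assoc[OF _ _ _ _ cochain_mapD(1)[OF f] d(5) cochain_mapD(1)[OF g]] d cochain_mapD(2)[OF f]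
   by simp
  also have "\<dots> = (g (n+1) \<cdot> f (n+1)) \<cdot> diff x n"
   using comp_assoc[OF _ _ _ _ d(2) cochain_mapD(1)[OF f] cochain_mapD(1)[OF g]] d by simp
  finally show ?thesis .
 qed
 then show "g \<cdot>\<^bsub>complex_category A\<^esub> f \<in> Hom (complex_category A) x z"
  using cochain_mapD(1)[OF f] cochain_mapD(1)[OF g] d(1,4,7)
  by (auto simp: complex_category_def intro!: comp_in_Hom[of "deg x _" "deg y _" "deg z _"])
next
 fix x y f assume o: "x \<in> Obj (complex_category A)" "y \<in> Obj (complex_category A)" "f \<in> Hom (complex_category A) x y"
 then show "f \<cdot>\<^bsub>complex_category A\<^esub> Ident (complex_category A) x = f"
  using cochain_mapD(1)[OF o(3)] cochainD(1) by (auto simp: Comp_complex Ident_complex intro!: comp_ident_right)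
 show "Ident (complex_category A) y \<cdot>\<^bsub>complex_category A\<^esub> f = f"
  using o cochain_mapD(1)[OF o(3)] cochainD(1) by (auto simp: Comp_complex Ident_complex intro!: comp_ident_left)
next
 fix w x y z f g h
 assume o: "w \<in> Obj (complex_category A)" "x \<in> Obj (complex_category A)" "y \<in> Obj (complex_category A)"
   "z \<in> Obj (complex_category A)"
  "f \<in> Hom (complex_category A) w x" "g \<in> Hom (complex_category A) x y" "h \<in> Hom (complex_category A) y z"
 then show "(h \<cdot>\<^bsub>complex_category A\<^esub> g) \<cdot>\<^bsub>complex_category A\<^esub> f = h \<cdot>\<^bsub>complex_category A\<^esub> g \<cdot>\<^bsub>complex_category A\<^esub> f"
  using cochain_mapD(1) cochainD(1) by (auto simp: Comp_complex fun_eq_iff intro!: comp_assoc)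
qed

lemma localizable_complex: "localizable (complex_category A) (quasi_iso A)"
 by (intro localizable.intro category_complex localizable_axioms.intro) (auto simp: quasi_iso_def)

definition shift_functor :: "(('o, 'm) cochain, int => 'm, ('o, 'm) cochain, int => 'm) func" where
 "shift_functor = \<lparr>on_obj = shift_complex A, on_arr = (%_ _. shift_map)\<rparr>"

lemma shift_sel [simp]: "deg (shift_complex A X) n = deg X (n+1)"
 "diff (shift_complex A X) n = Neg A (deg X (n+1)) (deg X (n+1+1)) (diff X (n+1))"
 "shift_map f n = f (n+1)"
 by (simp_all add: shift_complex_def shift_map_def)

lemma shift_Obj: assumes X: "X \<in> Obj (complex_category A)"
 shows "shift_complex A X \<in> Obj (complex_category A)"
proof -
 note d = cochainD[OF X]
 have "Neg A (deg X (n+1+1)) (deg X (n+1+1+1)) (diff X (n+1+1)) \<cdot> Neg A (deg X (n+1)) (deg X (n+1+1)) (diff X (n+1))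
   = Zero A (deg X (n+1)) (deg X (n+1+1+1))" for n
  using comp_neg[OF d(1) d(1) d(1) d(2)[of "n+1"] neg_hom[OF d(1) d(1) d(2)]]
   neg_comp[OF d(1) d(1) d(1) d(2) d(2)[of "n+1+1"]] d(3)[of "n+1"] neg_zero[OF d(1) d(1)]
  by metis
 moreover have "Neg A (deg X (n+1)) (deg X (n+1+1)) (diff X (n+1)) \<in> Hom A (deg X (n+1)) (deg X (n+1+1))" for n
  using neg_hom[OF d(1) d(1) d(2)] .
 ultimately show ?thesis using d(1) by (simp add: complex_category_def)
qed

lemma shift_Hom:
 assumes X: "X \<in> Obj (complex_category A)" and Y: "Y \<in> Obj (complex_category A)"
  and f: "f \<in> Hom (complex_category A) X Y"
 shows "shift_map f \<in> Hom (complex_category A) (shift_complex A X) (shift_complex A Y)"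
proof -
 note d = cochainD[OF X] cochainD[OF Y] and f = cochain_mapD[OF f]
 have "Neg A (deg Y (n+1)) (deg Y (n+1+1)) (diff Y (n+1)) \<cdot> f (n+1) =
   f (n+1+1) \<cdot> Neg A (deg X (n+1)) (deg X (n+1+1)) (diff X (n+1))" for n
  using neg_comp[OF d(1) d(4) d(4) f(1)[of "n+1"] d(5)[of "n+1"]] comp_neg[OF d(1) d(1) d(4) d(2)[of "n+1"] f(1)[of "n+1+1"]]
   f(2)[of "n+1"] by simp
 then show ?thesis using f(1) by (simp add: complex_category_def)
qed

lemma is_functor_shift: "is_functor (complex_category A) (complex_category A) shift_functor"
 unfolding is_functor_def shift_functor_def
 using shift_Obj shift_Hom by (simp add: Ident_complex Comp_complex fun_eq_iff)

text \<open>The shift changes the sign of the differential; kernels and cokernels do not see signs.\<close>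
lemma is_kernel_neg:
 assumes "x \<in> Obj A" "y \<in> Obj A" "f \<in> Hom A x y" "is_kernel A x y f K k"
 shows "is_kernel A x y (Neg A x y f) K k"
 using assms unfolding is_kernel_def
 by (auto simp: neg_comp neg_eq_zero comp_in_Hom zero_hom)

lemma is_cokernel_neg:
 assumes "x \<in> Obj A" "y \<in> Obj A" "f \<in> Hom A x y" "is_cokernel A x y f K k"
 shows "is_cokernel A x y (Neg A x y f) K k"
 using assms unfolding is_cokernel_def
 by (auto simp: comp_neg neg_eq_zero comp_in_Hom zero_hom)

lemma is_cohomology_shift:
 assumes X: "X \<in> Obj (complex_category A)" and h: "is_cohomology A X (n+1) K k H c"
 shows "is_cohomology A (shift_complex A X) n K k H c"
proof -
 note d = cochainD[OF X]
 from h obtain j where k: "is_kernel A (deg X (n+1)) (deg X (n+1+1)) (diff X (n+1)) K k"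
  and j: "j \<in> Hom A (deg X n) K" "k \<cdot> j = diff X n" and c: "is_cokernel A (deg X n) K j H c"
  unfolding is_cohomology_def by auto
 have kk: "K \<in> Obj A" "k \<in> Hom A K (deg X (n+1))" using k by (auto simp: is_kernel_def)
 have "k \<cdot> Neg A (deg X n) K j = Neg A (deg X n) (deg X (n+1)) (diff X n)"
  using comp_neg[OF d(1) kk(1) d(1) j(1) kk(2)] j by simp
 moreover have "is_cokernel A (deg X n) K (Neg A (deg X n) K j) H c"
  using is_cokernel_neg[OF d(1) kk(1) j(1) c] .
 ultimately show ?thesis
  unfolding is_cohomology_def
  using is_kernel_neg[OF d(1) d(1) d(2) k] neg_hom[OF d(1) kk(1) j(1)] by auto
qed

lemma quasi_iso_shift:
 assumes X: "X \<in> Obj (complex_category A)" and Y: "Y \<in> Obj (complex_category A)" and f: "f \<in> quasi_iso A X Y"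
 shows "shift_map f \<in> quasi_iso A (shift_complex A X) (shift_complex A Y)"
proof -
 have "\<exists>K k H c K' k' H' c'. is_cohomology A (shift_complex A X) n K k H c & is_cohomology A (shift_complex A Y) n K' k' H' c' &
    (\<exists>g \<in> Hom A K K'. k' \<cdot> g = f (n+1) \<cdot> k & (\<exists>h. is_iso A H H' h & h \<cdot> c = c' \<cdot> g))" for n
 proof -
  from f obtain K k H c K' k' H' c' where "is_cohomology A X (n+1) K k H c" "is_cohomology A Y (n+1) K' k' H' c'"
    "(\<exists>g \<in> Hom A K K'. k' \<cdot> g = f (n+1) \<cdot> k & (\<exists>h. is_iso A H H' h & h \<cdot> c = c' \<cdot> g))"
   unfolding quasi_iso_def by blast
  then show ?thesis using is_cohomology_shift[OF X] is_cohomology_shift[OF Y] by blast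
 qed
 then show ?thesis using f shift_Hom[OF X Y] unfolding quasi_iso_def by simp
qed

lemma loc_pair_shift: "loc_pair (complex_category A) (quasi_iso A) (complex_category A) (quasi_iso A) shift_functor"
 by (intro loc_pair.intro localizable_complex loc_pair_axioms.intro is_functor_shift)
  (simp add: shift_functor_def quasi_iso_shift)

lemma derived_shift_eq: "derived_shift A = loc_functor (complex_category A) (quasi_iso A) shift_functor"
proof -
 have "map_zigzag (shift_complex A) shift_map p = zmap shift_functor p" for p
  by (induction p) (auto simp: shift_functor_def)
 then show ?thesis by (simp add: derived_shift_def loc_functor_def shift_functor_def)
qed

lemma derived_sel:
 "Obj (derived_category A) = Obj (complex_category A)"
 "Hom (derived_category A) = Hom (derived_localization A)"
 "Comp (derived_category A) = Comp (derived_localization A)"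
 "Ident (derived_category A) = Ident (derived_localization A)"
 "Shift (derived_category A) = derived_shift A"
 "Triangles (derived_category A) = derived_triangles A"
 by (simp_all add: derived_category_def Let_def derived_localization_def localization_def)

lemma category_derived: "category (derived_category A)"
 using localizable.category_localization[OF localizable_complex]
 unfolding category_def derived_sel derived_localization_def by (simp add: localization_def)

end

lemma is_functor_derived:
 assumes "preadditive_category A" "preadditive_category B"
 shows "is_functor (derived_category A) (derived_category B) = is_functor (derived_localization A) (derived_localization B)"
 using assms by (auto simp: is_functor_def fun_eq_iff preadditive_category.derived_sel derived_localization_def localization_def)

lemma nat_iso_derived:
 assumes "preadditive_category A" "preadditive_category B"
 shows "nat_iso (derived_category A) (derived_category B) = nat_iso (derived_localization A) (derived_localization B)"
 using assms by (auto simp: nat_iso_def nat_trans_def is_iso_def fun_eq_iff preadditive_category.derived_sel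
  derived_localization_def localization_def)

lemma (in preadditive_category) is_functor_derived_shift: "is_functor (derived_category A) (derived_category A) (derived_shift A)"
proof -
 interpret loc_pair "complex_category A" "quasi_iso A" "complex_category A" "quasi_iso A" shift_functor by (rule loc_pair_shift)
 show ?thesis using is_functor_loc
  by (simp add: is_functor_derived preadditive_category_axioms derived_shift_eq derived_localization_def)
qed

lemma derived_equivalent_trans:
 assumes "preadditive_category A" "preadditive_category B" "preadditive_category C"
  "triangulated_equivalent (derived_category A) (derived_category B)"
  "triangulated_equivalent (derived_category B) (derived_category C)"
 shows "triangulated_equivalent (derived_category A) (derived_category C)"
proof (rule triangulated_equivalent_trans[OF _ _ _ _ _ _ _ assms(4,5)])
 fix x y z u v w assume "(x, y, z, u, v, w) \<in> Triangles (derived_category A)"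
 then show "x \<in> Obj (derived_category A) & z \<in> Obj (derived_category A) &
    w \<in> Hom (derived_category A) z (on_obj (Shift (derived_category A)) x)"
  by (simp add: preadditive_category.derived_sel[OF assms(1)] derived_triangles_def Let_def
   derived_localization_def localization_def)
qed (simp_all add: assms preadditive_category.category_derived preadditive_category.derived_sel
  preadditive_category.is_functor_derived_shift)

text \<open>All data live on complexes: functors \<open>F\<close>, \<open>G\<close>, and strictly natural
quasi-isomorphisms. They descend to the localizations. For the triangles, an arbitrary distinguished
triangle is isomorphic to the one of a cone; its image under \<open>F\<close> is isomorphic to the image
of that cone, which is a cone again once its third map has been corrected by \<open>\<theta>\<close>.\<close>
lemma derived_equivalentI:
 fixes A :: "('o, 'm, 'z) preadditive_scheme" and B :: "('p, 'n, 'y) preadditive_scheme"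
 defines "CA \<equiv> complex_category A" and "CB \<equiv> complex_category B"
 assumes A: "preadditive_category A" and B: "preadditive_category B"
  and F: "is_functor CA CB F" and G: "is_functor CB CA G"
  and Fq: "!!X Y f. X \<in> Obj CA ==> Y \<in> Obj CA ==> f \<in> quasi_iso A X Y ==>
    on_arr F X Y f \<in> quasi_iso B (on_obj F X) (on_obj F Y)"
  and Gq: "!!X Y f. X \<in> Obj CB ==> Y \<in> Obj CB ==> f \<in> quasi_iso B X Y ==>
    on_arr G X Y f \<in> quasi_iso A (on_obj G X) (on_obj G Y)"
  and \<eta>: "nat_trans CA CA id_functor (comp_functor G F) \<eta>"
   "!!X. X \<in> Obj CA ==> \<eta> X \<in> quasi_iso A X (on_obj G (on_obj F X))"
  and \<epsilon>: "nat_trans CB CB (comp_functor F G) id_functor \<epsilon>"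
   "!!X. X \<in> Obj CB ==> \<epsilon> X \<in> quasi_iso B (on_obj F (on_obj G X)) X"
  and \<theta>: "nat_trans CA CB (comp_functor F (preadditive_category.shift_functor A))
    (comp_functor (preadditive_category.shift_functor B) F) \<theta>"
   "!!X. X \<in> Obj CA ==> \<theta> X \<in> quasi_iso B (on_obj F (shift_complex A X)) (shift_complex B (on_obj F X))"
  and cone_maps: "!!X Y Z f i p. X \<in> Obj CA ==> Y \<in> Obj CA ==> Z \<in> Obj CA ==> f \<in> Hom CA X Y ==>
    is_mapping_cone A X Y f Z i p ==> i \<in> Hom CA Y Z & p \<in> Hom CA Z (shift_complex A X)"
  and cone: "!!X Y Z f i p. X \<in> Obj CA ==> Y \<in> Obj CA ==> Z \<in> Obj CA ==> f \<in> Hom CA X Y ==>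
    is_mapping_cone A X Y f Z i p ==>
    is_mapping_cone B (on_obj F X) (on_obj F Y) (on_arr F X Y f) (on_obj F Z) (on_arr F Y Z i)
     (\<theta> X \<cdot>\<^bsub>CB\<^esub> on_arr F Z (shift_complex A X) p)"
 shows "triangulated_equivalent (derived_category A) (derived_category B)"
proof -
 interpret A: preadditive_category A by fact
 interpret B: preadditive_category B by fact
 let ?WA = "quasi_iso A" and ?WB = "quasi_iso B"
 let ?LA = "localization CA ?WA" and ?LB = "localization CB ?WB" and ?SA = "shift_complex A" and ?SB = "shift_complex B"
 let ?TA = "A.shift_functor" and ?TB = "B.shift_functor"
 interpret LA: localizable CA ?WA unfolding CA_def by (rule A.localizable_complex)
 interpret LB: localizable CB ?WB unfolding CB_def by (rule B.localizable_complex)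
 interpret F: loc_pair CA ?WA CB ?WB F by unfold_locales (use F Fq in auto)
 interpret G: loc_pair CB ?WB CA ?WA G by unfold_locales (use G Gq in auto)
 interpret TA: loc_pair CA ?WA CA ?WA ?TA unfolding CA_def by (rule A.loc_pair_shift)
 interpret TB: loc_pair CB ?WB CB ?WB ?TB unfolding CB_def by (rule B.loc_pair_shift)
 have DA: "derived_localization A = ?LA" and DB: "derived_localization B = ?LB"
  by (simp_all add: derived_localization_def CA_def CB_def)
 have tA: "derived_shift A = loc_functor CA ?WA ?TA" and tB: "derived_shift B = loc_functor CB ?WB ?TB"
  by (simp_all add: A.derived_shift_eq B.derived_shift_eq CA_def CB_def)
 let ?F = "loc_functor CB ?WB F" and ?G = "loc_functor CA ?WA G"
 have TAo [simp]: "on_obj ?TA X = ?SA X" "on_arr ?TA X Y f = shift_map f" for X Y f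
  by (simp_all add: A.shift_functor_def)
 have TBo [simp]: "on_obj ?TB X = ?SB X" "on_arr ?TB X Y f = shift_map f" for X Y f
  by (simp_all add: B.shift_functor_def)
 define \<theta>' where "\<theta>' X = LB.cls (Arr (on_obj F (?SA X)) (\<theta> X) (?SB (on_obj F X)))" for X
 have ni\<theta>: "nat_iso (?LA) (?LB) (comp_functor ?F (loc_functor CA ?WA ?TA))
   (comp_functor (loc_functor CB ?WB ?TB) ?F) \<theta>'"
 proof (rule nat_iso_cong)
  show "nat_iso (?LA) (?LB) (loc_functor CB ?WB (comp_functor F ?TA))
   (loc_functor CB ?WB (comp_functor ?TB F)) \<theta>'"
   using nat_iso_loc[OF loc_functor_comp(1)[OF TA.loc_pair_axioms F.loc_pair_axioms]
    loc_functor_comp(1)[OF F.loc_pair_axioms TB.loc_pair_axioms] \<theta>(1)] \<theta>(2) by (simp add: \<theta>'_def[abs_def])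
 next
  fix x y \<phi> assume "\<phi> \<in> Hom (?LA) x y"
  then show "on_arr (comp_functor ?F (loc_functor CA ?WA ?TA)) x y \<phi> = on_arr (loc_functor CB ?WB (comp_functor F ?TA)) x y \<phi>
   & on_arr (comp_functor (loc_functor CB ?WB ?TB) ?F) x y \<phi> = on_arr (loc_functor CB ?WB (comp_functor ?TB F)) x y \<phi>"
   by (elim LA.Hom_locE) (simp only: loc_functor_comp(2)[OF TA.loc_pair_axioms F.loc_pair_axioms]
    loc_functor_comp(2)[OF F.loc_pair_axioms TB.loc_pair_axioms] simp_thms)
 qed (simp add: loc_functor_def)
 have ni\<eta>: "\<exists>\<eta>. nat_iso (?LA) (?LA) id_functor (comp_functor ?G ?F) \<eta>"
 proof (rule exI, rule nat_iso_cong)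
  show "nat_iso (?LA) (?LA) (loc_functor CA ?WA id_functor)
   (loc_functor CA ?WA (comp_functor G F)) (%x. LA.cls (Arr (on_obj id_functor x) (\<eta> x) (on_obj (comp_functor G F) x)))"
   using nat_iso_loc[OF loc_functor_id(1)[OF LA.localizable_axioms]
    loc_functor_comp(1)[OF F.loc_pair_axioms G.loc_pair_axioms] \<eta>(1)] \<eta>(2) by simp
 next
  fix x y \<phi> assume "\<phi> \<in> Hom (?LA) x y"
  then show "on_arr id_functor x y \<phi> = on_arr (loc_functor CA ?WA id_functor) x y \<phi>
   & on_arr (comp_functor ?G ?F) x y \<phi> = on_arr (loc_functor CA ?WA (comp_functor G F)) x y \<phi>"
   by (elim LA.Hom_locE) (simp only: loc_functor_comp(2)[OF F.loc_pair_axioms G.loc_pair_axioms]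
    loc_functor_id(2)[OF LA.localizable_axioms] simp_thms id_functor_sel)
 qed (simp add: loc_functor_def)
 have ni\<epsilon>: "\<exists>\<epsilon>. nat_iso (?LB) (?LB) (comp_functor ?F ?G) id_functor \<epsilon>"
 proof (rule exI, rule nat_iso_cong)
  show "nat_iso (?LB) (?LB) (loc_functor CB ?WB (comp_functor F G))
   (loc_functor CB ?WB id_functor) (%x. LB.cls (Arr (on_obj (comp_functor F G) x) (\<epsilon> x) (on_obj id_functor x)))"
   using nat_iso_loc[OF loc_functor_comp(1)[OF G.loc_pair_axioms F.loc_pair_axioms]
    loc_functor_id(1)[OF LB.localizable_axioms] \<epsilon>(1)] \<epsilon>(2) by simp
 next
  fix x y \<phi> assume "\<phi> \<in> Hom (?LB) x y"
  then show "on_arr (comp_functor ?F ?G) x y \<phi> = on_arr (loc_functor CB ?WB (comp_functor F G)) x y \<phi>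
   & on_arr id_functor x y \<phi> = on_arr (loc_functor CB ?WB id_functor) x y \<phi>"
   by (elim LB.Hom_locE) (simp only: loc_functor_comp(2)[OF G.loc_pair_axioms F.loc_pair_axioms]
    loc_functor_id(2)[OF LB.localizable_axioms] simp_thms id_functor_sel)
 qed (simp add: loc_functor_def)
 have tri: "(on_obj ?F X, on_obj ?F Y, on_obj ?F Z, on_arr ?F X Y u, on_arr ?F Y Z v,
     \<theta>' X \<cdot>\<^bsub>derived_localization B\<^esub> on_arr ?F Z (on_obj (derived_shift A) X) w) \<in> derived_triangles B"
  if t: "(X, Y, Z, u, v, w) \<in> derived_triangles A" for X Y Z u v w
 proof -
  interpret cA: category "?LA" by (rule LA.category_localization)
  interpret cB: category "?LB" by (rule LB.category_localization)
  have arrA: "derived_arrow A X Y f = LA.cls (Arr X f Y)" and arrB: "derived_arrow B X' Y' f' = LB.cls (Arr X' f' Y')"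
   for X Y f X' Y' f' by (simp_all add: derived_arrow_def CA_def CB_def)
  from t obtain X' Y' Z' f i p a b c where o: "X \<in> Obj CA" "Y \<in> Obj CA" "Z \<in> Obj CA"
    and uvw: "u \<in> Hom ?LA X Y" "v \<in> Hom ?LA Y Z" "w \<in> Hom ?LA Z (?SA X)"
    and o': "X' \<in> Obj CA" "Y' \<in> Obj CA" "Z' \<in> Obj CA"
    and f: "f \<in> Hom CA X' Y'" and mc: "is_mapping_cone A X' Y' f Z' i p"
    and abc: "is_iso ?LA X' X a" "is_iso ?LA Y' Y b" "is_iso ?LA Z' Z c"
    and sq: "b \<cdot>\<^bsub>?LA\<^esub> LA.cls (Arr X' f Y') = u \<cdot>\<^bsub>?LA\<^esub> a"
      "c \<cdot>\<^bsub>?LA\<^esub> LA.cls (Arr Y' i Z') = v \<cdot>\<^bsub>?LA\<^esub> b"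
      "on_arr (derived_shift A) X' X a \<cdot>\<^bsub>?LA\<^esub> LA.cls (Arr Z' p (?SA X')) = w \<cdot>\<^bsub>?LA\<^esub> c"
   unfolding derived_triangles_def Let_def DA arrA CA_def[symmetric] LA.Obj_loc derived_shift_def
   by clarsimp
  have ip: "i \<in> Hom CA Y' Z'" "p \<in> Hom CA Z' (?SA X')"
   using cone_maps[OF o' f mc] by auto
  have sh: "?SA X \<in> Obj CA" "?SA X' \<in> Obj CA"
   using A.shift_Obj o(1) o'(1) by (auto simp: CA_def)
  have shB: "?SB (on_obj F X) \<in> Obj CB" "?SB (on_obj F X') \<in> Obj CB"
   using B.shift_Obj o(1) o'(1) functor_obj[OF F] by (auto simp: CB_def)
  have abcm: "a \<in> Hom ?LA X' X" "b \<in> Hom ?LA Y' Y" "c \<in> Hom ?LA Z' Z" using abc by (auto simp: is_iso_def)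
  note L = F.is_functor_loc
  have homA: "LA.cls (Arr U g V) \<in> Hom ?LA U V" if "U \<in> Obj CA" "V \<in> Obj CA" "g \<in> Hom CA U V" for U V g
   using that by (blast intro: LA.Hom_locI zigzag_hom.Arr)
  have Farr: "on_arr ?F U V (LA.cls (Arr U g V)) = LB.cls (Arr (on_obj F U) (on_arr F U V g) (on_obj F V))"
   if "U \<in> Obj CA" "V \<in> Obj CA" "g \<in> Hom CA U V" for U V g
   using F.on_arr_loc[OF zigzag_hom.Arr[OF that]] by simp
  have Fsq: "on_arr ?F V V' r \<cdot>\<^bsub>?LB\<^esub> on_arr ?F U V q = on_arr ?F U' V' s \<cdot>\<^bsub>?LB\<^esub> on_arr ?F U U' t"
   if "r \<cdot>\<^bsub>?LA\<^esub> q = s \<cdot>\<^bsub>?LA\<^esub> t" "U \<in> Obj CA" "V \<in> Obj CA" "U' \<in> Obj CA" "V' \<in> Obj CA"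
    "r \<in> Hom ?LA V V'" "q \<in> Hom ?LA U V" "s \<in> Hom ?LA U' V'" "t \<in> Hom ?LA U U'" for r q s t U V U' V'
   using functor_comp[OF L that(7,6)] functor_comp[OF L that(9,8)] that by simp
  have Tp: "on_arr (derived_shift A) X' X a \<in> Hom ?LA (?SA X') (?SA X)"
   using functor_arr[OF TA.is_functor_loc abcm(1)] o o' by (simp add: tA)
  have \<theta>h: "\<theta> X' \<in> Hom CB (on_obj F (?SA X')) (?SB (on_obj F X'))"
   using \<theta>(2)[OF o'(1)] by (auto simp: quasi_iso_def CB_def)
  have \<theta>m: "\<theta>' U \<in> Hom ?LB (on_obj F (?SA U)) (?SB (on_obj F U))" if "U \<in> Obj CA" for U
   using nat_isoD(2)[OF ni\<theta>, of U] that by (simp add: is_iso_def)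
  have fo: "on_obj F U \<in> Obj CB" if "U \<in> Obj CA" for U using functor_obj[OF F that] .
  have Fw: "on_arr ?F Z (?SA X) w \<in> Hom ?LB (on_obj F Z) (on_obj F (?SA X))"
   using functor_arr[OF L uvw(3)] o sh by simp
  have Fp: "on_arr F Z' (?SA X') p \<in> Hom CB (on_obj F Z') (on_obj F (?SA X'))"
   using functor_arr[OF F ip(2)] o' sh by simp
  let ?p' = "\<theta> X' \<cdot>\<^bsub>CB\<^esub> on_arr F Z' (?SA X') p"
  have sqB3: "on_arr (loc_functor CB ?WB ?TB) (on_obj F X') (on_obj F X) (on_arr ?F X' X a) \<cdot>\<^bsub>?LB\<^esub>
    LB.cls (Arr (on_obj F Z') ?p' (?SB (on_obj F X'))) =
    (\<theta>' X \<cdot>\<^bsub>?LB\<^esub> on_arr ?F Z (?SA X) w) \<cdot>\<^bsub>?LB\<^esub> on_arr ?F Z' Z c"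
  proof -
   let ?TFa = "on_arr (loc_functor CB ?WB ?TB) (on_obj F X') (on_obj F X) (on_arr ?F X' X a)"
   let ?Ta = "on_arr (derived_shift A) X' X a"
   let ?Fpc = "LB.cls (Arr (on_obj F Z') (on_arr F Z' (?SA X') p) (on_obj F (?SA X')))"
   have Fpc: "?Fpc \<in> Hom ?LB (on_obj F Z') (on_obj F (?SA X'))"
    using Fp fo o' sh by (blast intro: LB.Hom_locI zigzag_hom.Arr)
   have FTa: "on_arr ?F (?SA X') (?SA X) ?Ta \<in>
     Hom ?LB (on_obj F (?SA X')) (on_obj F (?SA X))"
    using functor_arr[OF L Tp] sh by simp
   have TFa: "?TFa \<in> Hom ?LB (?SB (on_obj F X')) (?SB (on_obj F X))"
    using functor_arr[OF TB.is_functor_loc functor_arr[OF L abcm(1)]] o o' fo by simp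
   have Fc: "on_arr ?F Z' Z c \<in> Hom ?LB (on_obj F Z') (on_obj F Z)"
    using functor_arr[OF L abcm(3)] o o' by simp
   have nat: "\<theta>' X \<cdot>\<^bsub>?LB\<^esub> on_arr ?F (?SA X') (?SA X) ?Ta = ?TFa \<cdot>\<^bsub>?LB\<^esub> \<theta>' X'"
    using nat_isoD(1)[OF ni\<theta>] o o' abcm(1) by (simp add: nat_trans_def tA)
   have "LB.cls (Arr (on_obj F Z') ?p' (?SB (on_obj F X'))) = \<theta>' X' \<cdot>\<^bsub>?LB\<^esub> ?Fpc"
    unfolding \<theta>'_def using LB.class_Arr_comp[OF _ _ _ Fp \<theta>h] fo o' sh shB by simp
   then have "?TFa \<cdot>\<^bsub>?LB\<^esub> LB.cls (Arr (on_obj F Z') ?p' (?SB (on_obj F X')))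
     = (?TFa \<cdot>\<^bsub>?LB\<^esub> \<theta>' X') \<cdot>\<^bsub>?LB\<^esub> ?Fpc"
    using cB.comp_assoc[OF _ _ _ _ Fpc \<theta>m[OF o'(1)] TFa] fo o' sh shB by simp
   also have "\<dots> = \<theta>' X \<cdot>\<^bsub>?LB\<^esub> on_arr ?F (?SA X') (?SA X) ?Ta \<cdot>\<^bsub>?LB\<^esub> ?Fpc"
    unfolding nat[symmetric] using cB.comp_assoc[OF _ _ _ _ Fpc FTa \<theta>m[OF o(1)]] fo o' sh shB by simp
   also have "on_arr ?F (?SA X') (?SA X) ?Ta \<cdot>\<^bsub>?LB\<^esub> ?Fpc =
    on_arr ?F Z (?SA X) w \<cdot>\<^bsub>?LB\<^esub> on_arr ?F Z' Z c"
    using Fsq[OF sq(3) o'(3) sh(2) o(3) sh(1) Tp homA uvw(3) abcm(3)] o' sh ip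
    by (simp add: Farr)
   also have "\<theta>' X \<cdot>\<^bsub>?LB\<^esub> on_arr ?F Z (?SA X) w \<cdot>\<^bsub>?LB\<^esub> on_arr ?F Z' Z c =
     (\<theta>' X \<cdot>\<^bsub>?LB\<^esub> on_arr ?F Z (?SA X) w) \<cdot>\<^bsub>?LB\<^esub> on_arr ?F Z' Z c"
    using cB.comp_assoc[OF _ _ _ _ Fc Fw \<theta>m[OF o(1)]] fo o o' sh shB by simp
   finally show ?thesis .
  qed
  have isoF: "is_iso ?LB (on_obj F U) (on_obj F V) (on_arr ?F U V r)" if "is_iso ?LA U V r" "U \<in> Obj CA" "V \<in> Obj CA" for U V r
   using functor_iso[OF L] that by simp
  show ?thesis
   unfolding derived_triangles_def Let_def DB arrB CB_def[symmetric] LB.Obj_loc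
  proof (clarsimp, intro conjI)
   show "\<theta>' X \<cdot>\<^bsub>?LB\<^esub> on_arr ?F Z (on_obj (derived_shift A) X) w \<in> Hom ?LB (on_obj F Z) (on_obj (derived_shift B) (on_obj F X))"
    using cB.comp_in_Hom[OF _ _ _ Fw \<theta>m[OF o(1)]] fo o sh shB by (simp add: derived_shift_def)
   show "\<exists>X'. X' \<in> Obj CB & (\<exists>Y'. Y' \<in> Obj CB & (\<exists>Z'. Z' \<in> Obj CB & (\<exists>f. f \<in> Hom CB X' Y' &
     (\<exists>i p. is_mapping_cone B X' Y' f Z' i p & (\<exists>a. is_iso ?LB X' (on_obj F X) a &
     (\<exists>b. is_iso ?LB Y' (on_obj F Y) b & (\<exists>c. is_iso ?LB Z' (on_obj F Z) c &
      b \<cdot>\<^bsub>?LB\<^esub> LB.cls (Arr X' f Y') = on_arr ?F X Y u \<cdot>\<^bsub>?LB\<^esub> a &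
      c \<cdot>\<^bsub>?LB\<^esub> LB.cls (Arr Y' i Z') = on_arr ?F Y Z v \<cdot>\<^bsub>?LB\<^esub> b &
      on_arr (derived_shift B) X' (on_obj F X) a \<cdot>\<^bsub>?LB\<^esub> LB.cls (Arr Z' p (?SB X')) =
      (\<theta>' X \<cdot>\<^bsub>?LB\<^esub> on_arr ?F Z (on_obj (derived_shift A) X) w) \<cdot>\<^bsub>?LB\<^esub> c)))))))"
    by (rule exI[of _ "on_obj F X'"], intro conjI fo o', rule exI[of _ "on_obj F Y'"], intro conjI fo o',
      rule exI[of _ "on_obj F Z'"], intro conjI fo o', rule exI[of _ "on_arr F X' Y' f"], intro conjI functor_arr[OF F f] o',
      rule exI[of _ "on_arr F Y' Z' i"], rule exI[of _ ?p'], intro conjI cone o' f mc,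
      rule exI[of _ "on_arr ?F X' X a"], intro conjI isoF abc o o',
      rule exI[of _ "on_arr ?F Y' Y b"], intro conjI isoF abc o o',
      rule exI[of _ "on_arr ?F Z' Z c"], intro conjI isoF abc o o')
     (use Fsq[OF sq(1) o'(1,2) o(1,2) abcm(2) homA uvw(1) abcm(1)] Fsq[OF sq(2) o'(2,3) o(2,3) abcm(3) homA uvw(2) abcm(2)]
       o o' f ip sqB3 in \<open>simp_all add: Farr tB A.shift_functor_def derived_shift_def[of A]\<close>)
  qed (use o fo functor_arr[OF L uvw(1)] functor_arr[OF L uvw(2)] in simp_all)
 qed
 have "triangulated_functor (derived_category A) (derived_category B) ?F \<theta>'"
  unfolding triangulated_functor_def
  using F.is_functor_loc ni\<theta> tri
  by (auto simp: is_functor_derived nat_iso_derived A B A.derived_sel B.derived_sel DA DB tA tB)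
 moreover have "is_functor (derived_category B) (derived_category A) ?G"
  using G.is_functor_loc by (simp add: is_functor_derived A B DA DB)
 ultimately show ?thesis
  unfolding triangulated_equivalent_def using ni\<eta> ni\<epsilon> by (auto simp: nat_iso_derived A B DA DB)
qed

section \<open>Kernels and cokernels of diagrams\<close>

context preadditive_category
begin

lemma kernel_cancel:
 assumes k: "is_kernel A x y f K k" and o: "x \<in> Obj A" "y \<in> Obj A" "z \<in> Obj A"
  and f: "f \<in> Hom A x y" and u: "u \<in> Hom A z K" "v \<in> Hom A z K" and e: "k \<cdot> u = k \<cdot> v"
 shows "u = v"
proof -
 have kk: "K \<in> Obj A" "k \<in> Hom A K x" "f \<cdot> k = Zero A K y" using k by (auto simp: is_kernel_def)
 have "k \<cdot> v \<in> Hom A z x" using comp_in_Hom[OF o(3) kk(1) o(1) u(2) kk(2)] .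
 moreover have "f \<cdot> (k \<cdot> v) = Zero A z y"
  using comp_assoc[OF o(3) kk(1) o(1,2) u(2) kk(2) f] kk(3) zero_comp[OF o(3) kk(1) o(2) u(2)] by simp
 ultimately have "\<exists>!h. h \<in> Hom A z K & k \<cdot> h = k \<cdot> v" using k o(3) by (simp add: is_kernel_def)
 then show ?thesis using u e by blast
qed

lemma cokernel_cancel:
 assumes k: "is_cokernel A x y f Q q" and o: "x \<in> Obj A" "y \<in> Obj A" "z \<in> Obj A"
  and f: "f \<in> Hom A x y" and u: "u \<in> Hom A Q z" "v \<in> Hom A Q z" and e: "u \<cdot> q = v \<cdot> q"
 shows "u = v"
proof -
 have kk: "Q \<in> Obj A" "q \<in> Hom A y Q" "q \<cdot> f = Zero A x Q" using k by (auto simp: is_cokernel_def)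
 have "v \<cdot> q \<in> Hom A y z" using comp_in_Hom[OF o(2) kk(1) o(3) kk(2) u(2)] .
 moreover have "(v \<cdot> q) \<cdot> f = Zero A x z"
  using comp_assoc[OF o(1,2) kk(1) o(3) f kk(2) u(2)] kk(3) comp_zero[OF o(1) kk(1) o(3) u(2)] by simp
 ultimately have "\<exists>!h. h \<in> Hom A Q z & h \<cdot> q = v \<cdot> q" using k o(3) by (simp add: is_cokernel_def)
 then show ?thesis using u e by blast
qed

lemma kernel_unique:
 assumes o: "x \<in> Obj A" "y \<in> Obj A" and f: "f \<in> Hom A x y"
  and k: "is_kernel A x y f K k" and k': "is_kernel A x y f K' k'"
 obtains u where "is_iso A K' K u" "k \<cdot> u = k'"
proof -
 have kk: "K \<in> Obj A" "k \<in> Hom A K x" "f \<cdot> k = Zero A K y"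
  and kk': "K' \<in> Obj A" "k' \<in> Hom A K' x" "f \<cdot> k' = Zero A K' y"
  using k k' by (auto simp: is_kernel_def)
 obtain u where u: "u \<in> Hom A K' K" "k \<cdot> u = k'" using k kk' unfolding is_kernel_def by blast
 obtain v where v: "v \<in> Hom A K K'" "k' \<cdot> v = k" using k' kk unfolding is_kernel_def by blast
 have "k \<cdot> (u \<cdot> v) = k \<cdot> Ident A K"
  using comp_assoc[OF kk(1) kk'(1) kk(1) o(1) v(1) u(1) kk(2)] u v kk comp_ident_right o by simp
 then have 1: "u \<cdot> v = Ident A K"
  using kernel_cancel[OF k o kk(1) f] comp_in_Hom[OF kk(1) kk'(1) kk(1) v(1) u(1)] ident_in_Hom[OF kk(1)] by blast
 have "k' \<cdot> (v \<cdot> u) = k' \<cdot> Ident A K'"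
  using comp_assoc[OF kk'(1) kk(1) kk'(1) o(1) u(1) v(1) kk'(2)] u v kk' comp_ident_right o by simp
 then have 2: "v \<cdot> u = Ident A K'"
  using kernel_cancel[OF k' o kk'(1) f] comp_in_Hom[OF kk'(1) kk(1) kk'(1) u(1) v(1)] ident_in_Hom[OF kk'(1)] by blast
 show thesis by (rule that[OF _ u(2)]) (use u v 1 2 in \<open>auto simp: is_iso_def\<close>)
qed

lemma cokernel_unique:
 assumes o: "x \<in> Obj A" "y \<in> Obj A" and f: "f \<in> Hom A x y"
  and k: "is_cokernel A x y f K k" and k': "is_cokernel A x y f K' k'"
 obtains u where "is_iso A K K' u" "u \<cdot> k = k'"
proof -
 have kk: "K \<in> Obj A" "k \<in> Hom A y K" "k \<cdot> f = Zero A x K"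
  and kk': "K' \<in> Obj A" "k' \<in> Hom A y K'" "k' \<cdot> f = Zero A x K'"
  using k k' by (auto simp: is_cokernel_def)
 obtain u where u: "u \<in> Hom A K K'" "u \<cdot> k = k'" using k kk' unfolding is_cokernel_def by blast
 obtain v where v: "v \<in> Hom A K' K" "v \<cdot> k' = k" using k' kk unfolding is_cokernel_def by blast
 have "(v \<cdot> u) \<cdot> k = Ident A K \<cdot> k"
  using comp_assoc[OF o(2) kk(1) kk'(1) kk(1) kk(2) u(1) v(1)] u v kk comp_ident_left o by simp
 then have 1: "v \<cdot> u = Ident A K"
  using cokernel_cancel[OF k o kk(1) f] comp_in_Hom[OF kk(1) kk'(1) kk(1) u(1) v(1)] ident_in_Hom[OF kk(1)] by blast
 have "(u \<cdot> v) \<cdot> k' = Ident A K' \<cdot> k'"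
  using comp_assoc[OF o(2) kk'(1) kk(1) kk'(1) kk'(2) v(1) u(1)] u v kk' comp_ident_left o by simp
 then have 2: "u \<cdot> v = Ident A K'"
  using cokernel_cancel[OF k' o kk'(1) f] comp_in_Hom[OF kk'(1) kk(1) kk'(1) v(1) u(1)] ident_in_Hom[OF kk'(1)] by blast
 show thesis by (rule that[OF _ u(2)]) (use u v 1 2 in \<open>auto simp: is_iso_def\<close>)
qed

text \<open>A kernel of one arrow is also a kernel of an isomorphic arrow, and a kernel may be replaced by an
isomorphic object; pointwise constructions need this since the kernels chosen at different points are
unrelated.\<close>
lemma kernel_transport:
 assumes o: "x \<in> Obj A" "y \<in> Obj A" "K' \<in> Obj A" and f: "f \<in> Hom A x y" and k: "is_kernel A x y f K k" and u: "is_iso A K' K u"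
 shows "is_kernel A x y f K' (k \<cdot> u)"
proof -
 have kk: "K \<in> Obj A" "k \<in> Hom A K x" "f \<cdot> k = Zero A K y" using k by (auto simp: is_kernel_def)
 obtain v where uv: "u \<in> Hom A K' K" "v \<in> Hom A K K'" "v \<cdot> u = Ident A K'" "u \<cdot> v = Ident A K"
  using u by (auto simp: is_iso_def)
 have m: "k \<cdot> u \<in> Hom A K' x" using comp_in_Hom[OF o(3) kk(1) o(1) uv(1) kk(2)] .
 have z: "f \<cdot> k \<cdot> u = Zero A K' y"
  using comp_assoc[OF o(3) kk(1) o(1,2) uv(1) kk(2) f] kk(3) zero_comp[OF o(3) kk(1) o(2) uv(1)] by simp
 have "\<exists>!h. h \<in> Hom A z K' & (k \<cdot> u) \<cdot> h = g"
  if g: "z \<in> Obj A" "g \<in> Hom A z x" "f \<cdot> g = Zero A z y" for z g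
 proof -
  obtain h where h: "h \<in> Hom A z K" "k \<cdot> h = g" using k g unfolding is_kernel_def by blast
  have vh: "v \<cdot> h \<in> Hom A z K'" using comp_in_Hom[OF g(1) kk(1) o(3) h(1) uv(2)] .
  have "(k \<cdot> u) \<cdot> v \<cdot> h = k \<cdot> u \<cdot> v \<cdot> h" using comp_assoc[OF g(1) o(3) kk(1) o(1) vh uv(1) kk(2)] .
  also have "u \<cdot> v \<cdot> h = h" using comp_assoc[OF g(1) kk(1) o(3) kk(1) h(1) uv(2,1)] uv(4) comp_ident_left[OF g(1) kk(1) h(1)] by simp
  finally have 1: "(k \<cdot> u) \<cdot> v \<cdot> h = g" using h by simp
  have "h1 = h2" if "h1 \<in> Hom A z K'" "h2 \<in> Hom A z K'" "(k \<cdot> u) \<cdot> h1 = (k \<cdot> u) \<cdot> h2" for h1 h2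
  proof -
   have "k \<cdot> (u \<cdot> h1) = k \<cdot> (u \<cdot> h2)"
    using comp_assoc[OF g(1) o(3) kk(1) o(1) _ uv(1) kk(2)] that by simp
   then have "u \<cdot> h1 = u \<cdot> h2"
    using kernel_cancel[OF k o(1,2) g(1) f] comp_in_Hom[OF g(1) o(3) kk(1) _ uv(1)] that by blast
   then have "v \<cdot> u \<cdot> h1 = v \<cdot> u \<cdot> h2" by simp
   then show ?thesis
    using comp_assoc[OF g(1) o(3) kk(1) o(3) _ uv(1,2)] that uv(3) comp_ident_left[OF g(1) o(3)] by simp
  qed
  then show ?thesis using 1 vh by blast
 qed
 then show ?thesis using m z o by (simp add: is_kernel_def)
qed

lemma cokernel_transport:
 assumes o: "x \<in> Obj A" "y \<in> Obj A" "K' \<in> Obj A" and f: "f \<in> Hom A x y" and k: "is_cokernel A x y f K k" and u: "is_iso A K K' u"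
 shows "is_cokernel A x y f K' (u \<cdot> k)"
proof -
 have kk: "K \<in> Obj A" "k \<in> Hom A y K" "k \<cdot> f = Zero A x K" using k by (auto simp: is_cokernel_def)
 obtain v where uv: "u \<in> Hom A K K'" "v \<in> Hom A K' K" "v \<cdot> u = Ident A K" "u \<cdot> v = Ident A K'"
  using u by (auto simp: is_iso_def)
 have m: "u \<cdot> k \<in> Hom A y K'" using comp_in_Hom[OF o(2) kk(1) o(3) kk(2) uv(1)] .
 have z: "(u \<cdot> k) \<cdot> f = Zero A x K'"
  using comp_assoc[OF o(1,2) kk(1) o(3) f kk(2) uv(1)] kk(3) comp_zero[OF o(1) kk(1) o(3) uv(1)] by simp
 have "\<exists>!h. h \<in> Hom A K' z & h \<cdot> (u \<cdot> k) = g"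
  if g: "z \<in> Obj A" "g \<in> Hom A y z" "g \<cdot> f = Zero A x z" for z g
 proof -
  obtain h where h: "h \<in> Hom A K z" "h \<cdot> k = g" using k g unfolding is_cokernel_def by blast
  have vh: "h \<cdot> v \<in> Hom A K' z" using comp_in_Hom[OF o(3) kk(1) g(1) uv(2) h(1)] .
  have "(h \<cdot> v) \<cdot> u \<cdot> k = h \<cdot> (v \<cdot> u \<cdot> k)"
   using comp_assoc[OF o(2) o(3) kk(1) g(1) m uv(2) h(1)] .
  also have "v \<cdot> u \<cdot> k = k" using comp_assoc[OF o(2) kk(1) o(3) kk(1) kk(2) uv(1,2)] uv(3) comp_ident_left[OF o(2) kk(1,2)] by simp
  finally have 1: "(h \<cdot> v) \<cdot> u \<cdot> k = g" using h by simp
  have "h1 = h2" if "h1 \<in> Hom A K' z" "h2 \<in> Hom A K' z" "h1 \<cdot> (u \<cdot> k) = h2 \<cdot> (u \<cdot> k)" for h1 h2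
  proof -
   have "(h1 \<cdot> u) \<cdot> k = (h2 \<cdot> u) \<cdot> k"
    using comp_assoc[OF o(2) kk(1) o(3) g(1) kk(2) uv(1)] that by simp
   then have "h1 \<cdot> u = h2 \<cdot> u"
    using cokernel_cancel[OF k o(1,2) g(1) f] comp_in_Hom[OF kk(1) o(3) g(1) uv(1)] that by blast
   then have "(h1 \<cdot> u) \<cdot> v = (h2 \<cdot> u) \<cdot> v" by simp
   then show ?thesis
    using comp_assoc[OF o(3) kk(1) o(3) g(1) uv(2,1)] that uv(4) comp_ident_right[OF o(3) g(1)] by simp
  qed
  then show ?thesis using 1 vh by blast
 qed
 then show ?thesis using m z o by (simp add: is_cokernel_def)
qed

end

locale preordered_set =
 fixes X :: "'x set" and r :: "'x rel"
 assumes r_sub: "r \<subseteq> X \<times> X" and r_refl: "!!x. x \<in> X ==> (x, x) \<in> r"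
  and r_trans: "!!x y z. (x, y) \<in> r ==> (y, z) \<in> r ==> (x, z) \<in> r"
begin

lemma r_in: "(x, y) \<in> r ==> x \<in> X" "(x, y) \<in> r ==> y \<in> X" using r_sub by auto

end

locale diagrams = preadditive_category A + preordered_set X r
 for A :: "('o, 'm, 'z) preadditive_scheme" (structure) and X :: "'x set" and r :: "'x rel"
begin

definition FC :: "(('x, unit, 'o, 'm) func, 'x => 'm) preadditive" where
 "FC = functor_category (poset_category X r) A"

abbreviation FC_comp (infixr "\<bullet>" 75) where "g \<bullet> f \<equiv> g \<cdot>\<^bsub>FC\<^esub> f"

lemma FC_Obj: "M \<in> Obj FC \<longleftrightarrow>
  (\<forall>x\<in>X. on_obj M x \<in> Obj A & on_arr M x x () = Ident A (on_obj M x)) &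
  (\<forall>(x, y)\<in>r. on_arr M x y () \<in> Hom A (on_obj M x) (on_obj M y)) &
  (\<forall>x y z. (x, y) \<in> r & (y, z) \<in> r --> on_arr M x z () = on_arr M y z () \<cdot> on_arr M x y ()) &
  (\<forall>x. x \<notin> X --> on_obj M x = undefined) & (\<forall>x y. (x, y) \<notin> r --> on_arr M x y () = undefined)"
proof -
 have 1: "(\<forall>x\<in>X. \<forall>y\<in>X. \<forall>f\<in>(if (x, y) \<in> r then {()} else {}). Q x y f) \<longleftrightarrow> (\<forall>(x, y)\<in>r. Q x y ())"
  for Q :: "'x => 'x => unit => bool"
  using r_in by (auto split: if_splits)
 have 2: "(\<forall>x\<in>X. \<forall>y\<in>X. \<forall>z\<in>X. \<forall>f\<in>(if (x, y) \<in> r then {()} else {}). \<forall>g\<in>(if (y, z) \<in> r then {()} else {}). Q x y z f g)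
   \<longleftrightarrow> (\<forall>x y z. (x, y) \<in> r & (y, z) \<in> r --> Q x y z () ())" for Q :: "'x => 'x => 'x => unit => unit => bool"
  using r_in by (auto split: if_splits)
 have 3: "(\<forall>x y f. \<not> (x \<in> X & y \<in> X & f \<in> (if (x, y) \<in> r then {()} else {})) --> Q x y f) \<longleftrightarrow>
   (\<forall>x y. (x, y) \<notin> r --> Q x y ())" for Q :: "'x => 'x => unit => bool"
  using r_in by (auto split: if_splits)
 show ?thesis
  unfolding FC_def functor_category_def poset_category_def is_functor_def extensional_def
  by (simp only: precategory.simps preadditive.simps mem_Collect_eq 1 2 3 simp_thms) blast
qed

lemma FC_Hom: "\<eta> \<in> Hom FC M N \<longleftrightarrow> (\<forall>x\<in>X. \<eta> x \<in> Hom A (on_obj M x) (on_obj N x)) &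
  (\<forall>(x, y)\<in>r. \<eta> y \<cdot> on_arr M x y () = on_arr N x y () \<cdot> \<eta> x) & (\<forall>x. x \<notin> X --> \<eta> x = undefined)"
proof -
 have 1: "(\<forall>x\<in>X. \<forall>y\<in>X. \<forall>f\<in>(if (x, y) \<in> r then {()} else {}). Q x y f) \<longleftrightarrow> (\<forall>(x, y)\<in>r. Q x y ())"
  for Q :: "'x => 'x => unit => bool"
  using r_in by (auto split: if_splits)
 show ?thesis
  unfolding FC_def functor_category_def poset_category_def nat_trans_def extensional_def
  by (simp only: precategory.simps preadditive.simps mem_Collect_eq 1 simp_thms) blast
qed

lemma FC_sel: "Comp FC \<theta> \<eta> = (\<lambda>x\<in>X. \<theta> x \<cdot> \<eta> x)" "Ident FC M = (\<lambda>x\<in>X. Ident A (on_obj M x))"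
 "Plus FC \<theta> \<eta> = (\<lambda>x\<in>X. \<theta> x \<boxplus> \<eta> x)" "Zero FC M N = (\<lambda>x\<in>X. Zero A (on_obj M x) (on_obj N x))"
 by (simp_all add: FC_def functor_category_def poset_category_def)

lemma FC_objD:
 assumes "M \<in> Obj FC"
 shows "x \<in> X ==> on_obj M x \<in> Obj A" "(x, y) \<in> r ==> on_arr M x y () \<in> Hom A (on_obj M x) (on_obj M y)"
  "x \<in> X ==> on_arr M x x () = Ident A (on_obj M x)"
  "(x, y) \<in> r ==> (y, z) \<in> r ==> on_arr M x z () = on_arr M y z () \<cdot> on_arr M x y ()"
 using assms unfolding FC_Obj by blast+

lemma FC_homD:
 assumes "\<eta> \<in> Hom FC M N"
 shows "x \<in> X ==> \<eta> x \<in> Hom A (on_obj M x) (on_obj N x)"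
  "(x, y) \<in> r ==> \<eta> y \<cdot> on_arr M x y () = on_arr N x y () \<cdot> \<eta> x"
  "x \<notin> X ==> \<eta> x = undefined"
 using assms unfolding FC_Hom by blast+

lemma FC_hom_eqI:
 assumes "\<eta> \<in> Hom FC M N" "\<theta> \<in> Hom FC M' N'" "!!x. x \<in> X ==> \<eta> x = \<theta> x"
 shows "\<eta> = \<theta>"
 using assms FC_homD(3) by (metis ext)

lemma FC_comp_hom:
 assumes "M \<in> Obj FC" "N \<in> Obj FC" "L \<in> Obj FC" "\<eta> \<in> Hom FC M N" "\<theta> \<in> Hom FC N L"
 shows "Comp FC \<theta> \<eta> \<in> Hom FC M L"
 unfolding FC_Hom FC_sel
proof (intro conjI ballI allI impI, goal_cases)
 case (1 x) then show ?case
  using comp_in_Hom[of "on_obj M x" "on_obj N x" "on_obj L x"] FC_objD(1) FC_homD(1) assms by simp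
next
 case (2 p)
 obtain x y where p: "p = (x, y)" by (cases p)
 then have xy: "(x, y) \<in> r" "x \<in> X" "y \<in> X" using 2 r_in by auto
 note o = FC_objD(1)[OF assms(1)] FC_objD(1)[OF assms(2)] FC_objD(1)[OF assms(3)]
 note h = FC_homD(1)[OF assms(4)] FC_homD(1)[OF assms(5)]
 have "(\<theta> y \<cdot> \<eta> y) \<cdot> on_arr M x y () = \<theta> y \<cdot> \<eta> y \<cdot> on_arr M x y ()"
  using comp_assoc[OF o(1)[OF xy(2)] o(1)[OF xy(3)] o(2)[OF xy(3)] o(3)[OF xy(3)] FC_objD(2)[OF assms(1) xy(1)] h(1)[OF xy(3)] h(2)[OF xy(3)]] .
 also have "\<dots> = (\<theta> y \<cdot> on_arr N x y ()) \<cdot> \<eta> x"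
  using comp_assoc[OF o(1)[OF xy(2)] o(2)[OF xy(2)] o(2)[OF xy(3)] o(3)[OF xy(3)] h(1)[OF xy(2)] FC_objD(2)[OF assms(2) xy(1)] h(2)[OF xy(3)]]
   FC_homD(2)[OF assms(4) xy(1)] by simp
 also have "\<dots> = on_arr L x y () \<cdot> \<theta> x \<cdot> \<eta> x"
  using comp_assoc[OF o(1)[OF xy(2)] o(2)[OF xy(2)] o(3)[OF xy(2)] o(3)[OF xy(3)] h(1)[OF xy(2)] h(2)[OF xy(2)] FC_objD(2)[OF assms(3) xy(1)]]
   FC_homD(2)[OF assms(5) xy(1)] by simp
 finally show ?case using xy p by simp
qed simp

lemma FC_zero_hom:
 assumes "M \<in> Obj FC" "N \<in> Obj FC" shows "Zero FC M N \<in> Hom FC M N"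
 unfolding FC_Hom FC_sel
proof (intro conjI ballI allI impI, goal_cases)
 case (1 x) then show ?case using zero_hom FC_objD(1) assms by simp
next
 case (2 p)
 obtain x y where p: "p = (x, y)" by (cases p)
 then have xy: "(x, y) \<in> r" "x \<in> X" "y \<in> X" using 2 r_in by auto
 note o = FC_objD(1)[OF assms(1)] FC_objD(1)[OF assms(2)]
 show ?case
  using zero_comp[OF o(1)[OF xy(2)] o(1)[OF xy(3)] o(2)[OF xy(3)] FC_objD(2)[OF assms(1) xy(1)]]
   comp_zero[OF o(1)[OF xy(2)] o(2)[OF xy(2)] o(2)[OF xy(3)] FC_objD(2)[OF assms(2) xy(1)]] xy p by simp
qed simp

lemma FC_plus_hom:
 assumes "M \<in> Obj FC" "N \<in> Obj FC" "\<eta> \<in> Hom FC M N" "\<theta> \<in> Hom FC M N"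
 shows "Plus FC \<eta> \<theta> \<in> Hom FC M N"
 unfolding FC_Hom FC_sel
proof (intro conjI ballI allI impI, goal_cases)
 case (1 x) then show ?case using plus_hom FC_objD(1) FC_homD(1) assms by simp
next
 case (2 p)
 obtain x y where p: "p = (x, y)" by (cases p)
 then have xy: "(x, y) \<in> r" "x \<in> X" "y \<in> X" using 2 r_in by auto
 note o = FC_objD(1)[OF assms(1)] FC_objD(1)[OF assms(2)]
 note h = FC_homD(1)[OF assms(3)] FC_homD(1)[OF assms(4)]
 show ?case
  using comp_plus_left[OF o(1)[OF xy(2)] o(1)[OF xy(3)] o(2)[OF xy(3)] FC_objD(2)[OF assms(1) xy(1)] h(1)[OF xy(3)] h(2)[OF xy(3)]]
   comp_plus_right[OF o(1)[OF xy(2)] o(2)[OF xy(2)] o(2)[OF xy(3)] h(1)[OF xy(2)] h(2)[OF xy(2)] FC_objD(2)[OF assms(2) xy(1)]]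
   FC_homD(2)[OF assms(3) xy(1)] FC_homD(2)[OF assms(4) xy(1)] xy p by simp
qed simp

lemma FC_neg_hom:
 assumes "M \<in> Obj FC" "N \<in> Obj FC" "\<eta> \<in> Hom FC M N"
 shows "(\<lambda>x\<in>X. Neg A (on_obj M x) (on_obj N x) (\<eta> x)) \<in> Hom FC M N"
 unfolding FC_Hom
proof (intro conjI ballI allI impI, goal_cases)
 case (1 x) then show ?case using neg_hom FC_objD(1) FC_homD(1) assms by simp
next
 case (2 p)
 obtain x y where p: "p = (x, y)" by (cases p)
 then have xy: "(x, y) \<in> r" "x \<in> X" "y \<in> X" using 2 r_in by auto
 note o = FC_objD(1)[OF assms(1)] FC_objD(1)[OF assms(2)]
 note h = FC_homD(1)[OF assms(3)]
 show ?case
  using neg_comp[OF o(1)[OF xy(2)] o(1)[OF xy(3)] o(2)[OF xy(3)] FC_objD(2)[OF assms(1) xy(1)] h(1)[OF xy(3)]]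
   comp_neg[OF o(1)[OF xy(2)] o(2)[OF xy(2)] o(2)[OF xy(3)] h(1)[OF xy(2)] FC_objD(2)[OF assms(2) xy(1)]]
   FC_homD(2)[OF assms(3) xy(1)] xy p by simp
qed simp

lemma FC_ident_hom: assumes "M \<in> Obj FC" shows "Ident FC M \<in> Hom FC M M"
 unfolding FC_Hom FC_sel
proof (intro conjI ballI allI impI, goal_cases)
 case (1 x) then show ?case using ident_in_Hom FC_objD(1) assms by simp
next
 case (2 p)
 obtain x y where p: "p = (x, y)" by (cases p)
 then have xy: "(x, y) \<in> r" "x \<in> X" "y \<in> X" using 2 r_in by auto
 note o = FC_objD(1)[OF assms]
 show ?case
  using comp_ident_left[OF o[OF xy(2)] o[OF xy(3)] FC_objD(2)[OF assms xy(1)]]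
   comp_ident_right[OF o[OF xy(2)] o[OF xy(3)] FC_objD(2)[OF assms xy(1)]] xy p by simp
qed simp

lemma FC_category: "category FC"
proof
 fix w x y z f g h assume o: "w \<in> Obj FC" "x \<in> Obj FC" "y \<in> Obj FC" "z \<in> Obj FC"
  and h: "f \<in> Hom FC w x" "g \<in> Hom FC x y" "h \<in> Hom FC y z"
 show "(h \<bullet> g) \<bullet> f = h \<bullet> g \<bullet> f"
  by (auto simp: FC_sel restrict_def fun_eq_iff intro!: comp_assoc[OF FC_objD(1)[OF o(1)] FC_objD(1)[OF o(2)] FC_objD(1)[OF o(3)] FC_objD(1)[OF o(4)]
    FC_homD(1)[OF h(1)] FC_homD(1)[OF h(2)] FC_homD(1)[OF h(3)]])
next
 fix x y f assume o: "x \<in> Obj FC" "y \<in> Obj FC" "f \<in> Hom FC x y"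
 then show "f \<bullet> Ident FC x = f"
  by (auto simp: FC_sel restrict_def fun_eq_iff FC_homD(3) intro!: comp_ident_right[OF FC_objD(1)[OF o(1)] FC_objD(1)[OF o(2)] FC_homD(1)[OF o(3)]])
next
 fix x y f assume o: "x \<in> Obj FC" "y \<in> Obj FC" "f \<in> Hom FC x y"
 then show "Ident FC y \<bullet> f = f"
  by (auto simp: FC_sel restrict_def fun_eq_iff FC_homD(3) intro!: comp_ident_left[OF FC_objD(1)[OF o(1)] FC_objD(1)[OF o(2)] FC_homD(1)[OF o(3)]])
qed (simp_all add: FC_ident_hom FC_comp_hom)

lemma FC_preadditive: "preadditive_category FC"
proof (intro preadditive_category.intro FC_category preadditive_category_axioms.intro)
 fix M N assume MN: "M \<in> Obj FC" "N \<in> Obj FC"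
 show "comm_group (hom_group FC M N)"
 proof (rule comm_groupI)
  fix f assume f: "f \<in> carrier (hom_group FC M N)"
  show "\<one>\<^bsub>hom_group FC M N\<^esub> \<otimes>\<^bsub>hom_group FC M N\<^esub> f = f"
   using f MN
   by (auto simp: hom_group_def FC_sel restrict_def fun_eq_iff FC_homD(3)
     plus_commute[OF FC_objD(1) FC_objD(1) zero_hom[OF FC_objD(1) FC_objD(1)] FC_homD(1)]
     intro!: plus_zero[OF FC_objD(1) FC_objD(1) FC_homD(1)])
  show "\<exists>g\<in>carrier (hom_group FC M N). g \<otimes>\<^bsub>hom_group FC M N\<^esub> f = \<one>\<^bsub>hom_group FC M N\<^esub>"
   using f MN FC_neg_hom[of M N f]
   by (intro bexI[of _ "\<lambda>x\<in>X. Neg A (on_obj M x) (on_obj N x) (f x)"])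
    (auto simp: hom_group_def FC_sel restrict_def fun_eq_iff plus_neg[simplified hom_group_def] FC_objD FC_homD
     plus_commute[OF _ _ neg_hom[simplified hom_group_def]])
 next
  fix f g h assume "f \<in> carrier (hom_group FC M N)" "g \<in> carrier (hom_group FC M N)" "h \<in> carrier (hom_group FC M N)"
  then show "f \<otimes>\<^bsub>hom_group FC M N\<^esub> g \<otimes>\<^bsub>hom_group FC M N\<^esub> h = f \<otimes>\<^bsub>hom_group FC M N\<^esub> (g \<otimes>\<^bsub>hom_group FC M N\<^esub> h)"
   by (auto simp: hom_group_def FC_sel restrict_def fun_eq_iff
    intro!: plus_assoc[OF FC_objD(1)[OF MN(1)] FC_objD(1)[OF MN(2)] FC_homD(1) FC_homD(1) FC_homD(1)])
 next
  fix f g assume "f \<in> carrier (hom_group FC M N)" "g \<in> carrier (hom_group FC M N)"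
  then show "f \<otimes>\<^bsub>hom_group FC M N\<^esub> g = g \<otimes>\<^bsub>hom_group FC M N\<^esub> f"
   by (auto simp: hom_group_def FC_sel restrict_def fun_eq_iff
    intro!: plus_commute[OF FC_objD(1)[OF MN(1)] FC_objD(1)[OF MN(2)] FC_homD(1) FC_homD(1)])
 qed (use MN FC_zero_hom FC_plus_hom in \<open>auto simp: hom_group_def\<close>)
next
 fix x y z f f' g assume o: "x \<in> Obj FC" "y \<in> Obj FC" "z \<in> Obj FC" and h: "f \<in> Hom FC x y" "f' \<in> Hom FC x y" "g \<in> Hom FC y z"
 show "g \<bullet> (f \<boxplus>\<^bsub>FC\<^esub> f') = g \<bullet> f \<boxplus>\<^bsub>FC\<^esub> g \<bullet> f'"
  by (auto simp: FC_sel restrict_def fun_eq_iff intro!: comp_plus_right[OF FC_objD(1)[OF o(1)] FC_objD(1)[OF o(2)] FC_objD(1)[OF o(3)]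
   FC_homD(1)[OF h(1)] FC_homD(1)[OF h(2)] FC_homD(1)[OF h(3)]])
next
 fix x y z f g g' assume o: "x \<in> Obj FC" "y \<in> Obj FC" "z \<in> Obj FC" and h: "f \<in> Hom FC x y" "g \<in> Hom FC y z" "g' \<in> Hom FC y z"
 show "(g \<boxplus>\<^bsub>FC\<^esub> g') \<bullet> f = g \<bullet> f \<boxplus>\<^bsub>FC\<^esub> g' \<bullet> f"
  by (auto simp: FC_sel restrict_def fun_eq_iff intro!: comp_plus_left[OF FC_objD(1)[OF o(1)] FC_objD(1)[OF o(2)] FC_objD(1)[OF o(3)]
   FC_homD(1)[OF h(1)] FC_homD(1)[OF h(2)] FC_homD(1)[OF h(3)]])
qed

lemma FC_Neg:
 assumes "M \<in> Obj FC" "N \<in> Obj FC" "\<eta> \<in> Hom FC M N"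
 shows "Neg FC M N \<eta> = (\<lambda>x\<in>X. Neg A (on_obj M x) (on_obj N x) (\<eta> x))"
proof -
 interpret FC: preadditive_category FC by (rule FC_preadditive)
 show ?thesis
  using assms FC_neg_hom[OF assms] plus_neg FC_homD(1) FC_objD(1)
  by (intro FC.neg_unique[symmetric]) (auto simp: FC_sel restrict_def fun_eq_iff)
qed

lemma FC_isoD:
 assumes "is_iso FC M N \<eta>" "x \<in> X" shows "is_iso A (on_obj M x) (on_obj N x) (\<eta> x)"
proof -
 obtain \<theta> where h: "\<eta> \<in> Hom FC M N" "\<theta> \<in> Hom FC N M" and e: "Comp FC \<theta> \<eta> = Ident FC M" "Comp FC \<eta> \<theta> = Ident FC N"
  using assms by (auto simp: is_iso_def)
 show ?thesis unfolding is_iso_def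
  using FC_homD(1)[OF h(1) assms(2)] FC_homD(1)[OF h(2) assms(2)] fun_cong[OF e(1), of x] fun_cong[OF e(2), of x] assms(2)
  by (auto simp: FC_sel)
qed

lemma FC_isoI:
 assumes M: "M \<in> Obj FC" and N: "N \<in> Obj FC" and h: "\<eta> \<in> Hom FC M N"
  and i: "!!x. x \<in> X ==> is_iso A (on_obj M x) (on_obj N x) (\<eta> x)"
 shows "is_iso FC M N \<eta>"
proof -
 obtain \<theta> where t: "!!x. x \<in> X ==> \<theta> x \<in> Hom A (on_obj N x) (on_obj M x) & \<theta> x \<cdot> \<eta> x = Ident A (on_obj M x) & \<eta> x \<cdot> \<theta> x = Ident A (on_obj N x)"
  using i unfolding is_iso_def by metis
 interpret category A by (rule category_axioms)
 have "restrict \<theta> X \<in> Hom FC N M"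
  unfolding FC_Hom
 proof (intro conjI ballI allI impI, goal_cases)
  case (2 p)
  obtain x y where p: "p = (x, y)" by (cases p)
  then have xy: "(x, y) \<in> r" "x \<in> X" "y \<in> X" using 2 r_in by auto
  have "on_arr M x y () \<cdot> \<theta> x = \<theta> y \<cdot> on_arr N x y ()"
   using inverse_square[of "on_obj M x" "on_obj N x" "on_obj M y" "on_obj N y" "on_arr M x y ()" "on_arr N x y ()" "\<eta> x" "\<eta> y" "\<theta> x" "\<theta> y"]
    t[OF xy(2)] t[OF xy(3)] FC_objD(1,2)[OF M] FC_objD(1,2)[OF N] FC_homD(1,2)[OF h] xy by simp
  then show ?case using xy p by simp
 qed (use t in auto)
 moreover have "Comp FC (restrict \<theta> X) \<eta> = Ident FC M" "Comp FC \<eta> (restrict \<theta> X) = Ident FC N"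
  using t by (auto simp: FC_sel restrict_def fun_eq_iff)
 ultimately show ?thesis using h by (auto simp: is_iso_def)
qed

text \<open>Kernels of diagrams are formed pointwise: choose a kernel at each point; the transition maps are the
unique factorisations through the kernel inclusions.\<close>
lemma FC_kernel_assemble:
 assumes M: "M \<in> Obj FC" and N: "N \<in> Obj FC" and f: "f \<in> Hom FC M N"
  and k: "!!x. x \<in> X ==> is_kernel A (on_obj M x) (on_obj N x) (f x) (K x) (k x)"
 obtains K' where "!!x. x \<in> X ==> on_obj K' x = K x" "is_kernel FC M N f K' (restrict k X)"
proof -
 note oM = FC_objD[OF M] and oN = FC_objD[OF N] and hf = FC_homD[OF f]
 have kk: "K x \<in> Obj A" "k x \<in> Hom A (K x) (on_obj M x)" "f x \<cdot> k x = Zero A (K x) (on_obj N x)" if "x \<in> X" for x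
  using k[OF that] by (auto simp: is_kernel_def)
 note cancel = kernel_cancel[OF k oM(1) oN(1) _ hf(1)]
 have "\<exists>t. t \<in> Hom A (K x) (K y) & k y \<cdot> t = on_arr M x y () \<cdot> k x" if xy: "(x, y) \<in> r" for x y
 proof -
  have X: "x \<in> X" "y \<in> X" using r_in xy by auto
  have 1: "on_arr M x y () \<cdot> k x \<in> Hom A (K x) (on_obj M y)"
   using comp_in_Hom[OF kk(1) oM(1) oM(1) kk(2) oM(2)] X xy by simp
  have "f y \<cdot> on_arr M x y () \<cdot> k x = (on_arr N x y () \<cdot> f x) \<cdot> k x"
   using comp_assoc[OF kk(1)[OF X(1)] oM(1)[OF X(1)] oM(1)[OF X(2)] oN(1)[OF X(2)] kk(2)[OF X(1)] oM(2)[OF xy] hf(1)[OF X(2)], symmetric]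
    hf(2)[OF xy] by simp
  also have "\<dots> = on_arr N x y () \<cdot> Zero A (K x) (on_obj N x)"
   using comp_assoc[OF kk(1) oM(1) oN(1) oN(1) kk(2) hf(1) oN(2)] X xy kk(3) by simp
  also have "\<dots> = Zero A (K x) (on_obj N y)" using comp_zero[OF kk(1) oN(1) oN(1) oN(2)] X xy by simp
  finally show ?thesis using 1 k[OF X(2)] kk(1)[OF X(1)] unfolding is_kernel_def by blast
 qed
 then obtain t where t: "!!x y. (x, y) \<in> r ==> t x y \<in> Hom A (K x) (K y)"
   "!!x y. (x, y) \<in> r ==> k y \<cdot> t x y = on_arr M x y () \<cdot> k x" by metis
 define K' where "K' = \<lparr>on_obj = restrict K X, on_arr = (%x y (u::unit). if (x, y) \<in> r then t x y else undefined)\<rparr>"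
 have K'o: "K' \<in> Obj FC"
  unfolding FC_Obj
 proof (intro conjI ballI allI impI, goal_cases)
  case (1 x) then show ?case by (simp add: K'_def kk)
 next
  case (2 x)
  have "t x x = Ident A (K x)"
   by (rule cancel[OF 2 2 2 kk(1)[OF 2] 2 t(1)[OF r_refl[OF 2]] ident_in_Hom[OF kk(1)[OF 2]]])
    (simp add: t(2) r_refl 2 oM(3) comp_ident_left[OF kk(1) oM(1) kk(2)] comp_ident_right[OF kk(1) oM(1) kk(2)])
  then show ?case using 2 r_refl by (simp add: K'_def)
 next
  case (3 p) then show ?case using t(1) r_in by (auto simp: K'_def)
 next
  case (4 x y z)
  then have xy: "(x, y) \<in> r" "(y, z) \<in> r" "(x, z) \<in> r" using r_trans by auto
  have X: "x \<in> X" "y \<in> X" "z \<in> X" using r_in xy by auto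
  have c: "t y z \<cdot> t x y \<in> Hom A (K x) (K z)"
   using comp_in_Hom[OF kk(1) kk(1) kk(1) t(1) t(1)] X xy by simp
  have "k z \<cdot> t y z \<cdot> t x y = (on_arr M y z () \<cdot> k y) \<cdot> t x y"
   using comp_assoc[OF kk(1) kk(1) kk(1) oM(1) t(1) t(1) kk(2)] X xy t(2) by simp
  also have "\<dots> = on_arr M y z () \<cdot> on_arr M x y () \<cdot> k x"
   using comp_assoc[OF kk(1) kk(1) oM(1) oM(1) t(1) kk(2) oM(2)] X xy t(2) by simp
  also have "\<dots> = on_arr M x z () \<cdot> k x"
   using comp_assoc[OF kk(1) oM(1) oM(1) oM(1) kk(2) oM(2) oM(2)] X xy oM(4) by simp
  finally have "t x z = t y z \<cdot> t x y"
   by - (rule cancel[OF X(3) X(3) X(3) kk(1)[OF X(1)] X(3) t(1) c], simp_all add: t(2) xy)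
  then show ?case using xy by (simp add: K'_def)
 qed (auto simp: K'_def)
 have k'h: "restrict k X \<in> Hom FC K' M"
  using t(2) r_in kk(2) by (auto simp: FC_Hom K'_def)
 have univ: "\<exists>!h. h \<in> Hom FC Z K' & Comp FC (restrict k X) h = g"
  if Z: "Z \<in> Obj FC" and g: "g \<in> Hom FC Z M" and fg: "Comp FC f g = Zero FC Z N" for Z g
 proof -
  note oZ = FC_objD[OF Z] and hg = FC_homD[OF g]
  have "\<exists>!h. h \<in> Hom A (on_obj Z x) (K x) & k x \<cdot> h = g x" if "x \<in> X" for x
   using k[OF that] oZ(1)[OF that] hg(1)[OF that] fun_cong[OF fg, of x] that unfolding is_kernel_def by (simp add: FC_sel)
  then obtain h where h: "!!x. x \<in> X ==> h x \<in> Hom A (on_obj Z x) (K x)" "!!x. x \<in> X ==> k x \<cdot> h x = g x"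
   by metis
  have nat: "h y \<cdot> on_arr Z x y () = t x y \<cdot> h x" if xy: "(x, y) \<in> r" for x y
  proof -
   have X: "x \<in> X" "y \<in> X" using r_in xy by auto
   have "k y \<cdot> h y \<cdot> on_arr Z x y () = on_arr M x y () \<cdot> g x"
    using comp_assoc[OF oZ(1) oZ(1) kk(1) oM(1) oZ(2) h(1) kk(2)] X xy h(2) hg(2) by simp
   also have "\<dots> = (k y \<cdot> t x y) \<cdot> h x"
    using comp_assoc[OF oZ(1) kk(1) oM(1) oM(1) h(1) kk(2) oM(2)] X xy h(2) t(2) by simp
   also have "\<dots> = k y \<cdot> t x y \<cdot> h x"
    using comp_assoc[OF oZ(1) kk(1) kk(1) oM(1) h(1) t(1) kk(2)] X xy by simp
   finally show ?thesis
    by - (rule cancel[OF X(2) X(2) X(2) oZ(1)[OF X(1)] X(2)],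
     use X xy comp_in_Hom[OF oZ(1) oZ(1) kk(1) oZ(2) h(1)] comp_in_Hom[OF oZ(1) kk(1) kk(1) h(1) t(1)] in auto)
  qed
  have "restrict h X \<in> Hom FC Z K'" using nat h(1) r_in by (auto simp: FC_Hom K'_def)
  moreover have "Comp FC (restrict k X) (restrict h X) = g"
   using h(2) hg(3) by (auto simp: FC_sel restrict_def fun_eq_iff)
  moreover have "h' = restrict h X" if h': "h' \<in> Hom FC Z K'" "Comp FC (restrict k X) h' = g" for h'
  proof (rule FC_hom_eqI[OF h'(1)])
   fix x assume x: "x \<in> X"
   have "k x \<cdot> h' x = g x" using fun_cong[OF h'(2), of x] x by (simp add: FC_sel)
   then show "h' x = restrict h X x"
    using cancel[OF x x x oZ(1)[OF x] x, of "h' x" "h x"] FC_homD(1)[OF h'(1) x] h x by (simp add: K'_def)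
  qed fact
  ultimately show ?thesis by blast
 qed
 have z: "Comp FC f (restrict k X) = Zero FC K' N"
  using kk(3) by (auto simp: FC_sel restrict_def fun_eq_iff K'_def)
 show thesis
  by (rule that[of K']) (use K'o k'h z univ in \<open>auto simp: is_kernel_def K'_def\<close>)
qed

lemma FC_cokernel_assemble:
 assumes M: "M \<in> Obj FC" and N: "N \<in> Obj FC" and f: "f \<in> Hom FC M N"
  and k: "!!x. x \<in> X ==> is_cokernel A (on_obj M x) (on_obj N x) (f x) (K x) (k x)"
 obtains K' where "!!x. x \<in> X ==> on_obj K' x = K x" "is_cokernel FC M N f K' (restrict k X)"
proof -
 note oM = FC_objD[OF M] and oN = FC_objD[OF N] and hf = FC_homD[OF f]
 have kk: "K x \<in> Obj A" "k x \<in> Hom A (on_obj N x) (K x)" "k x \<cdot> f x = Zero A (on_obj M x) (K x)" if "x \<in> X" for x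
  using k[OF that] by (auto simp: is_cokernel_def)
 note cancel = cokernel_cancel[OF k oM(1) oN(1) _ hf(1)]
 have "\<exists>t. t \<in> Hom A (K x) (K y) & t \<cdot> k x = k y \<cdot> on_arr N x y ()" if xy: "(x, y) \<in> r" for x y
 proof -
  have X: "x \<in> X" "y \<in> X" using r_in xy by auto
  have 1: "k y \<cdot> on_arr N x y () \<in> Hom A (on_obj N x) (K y)"
   using comp_in_Hom[OF oN(1) oN(1) kk(1) oN(2) kk(2)] X xy by simp
  have "(k y \<cdot> on_arr N x y ()) \<cdot> f x = k y \<cdot> f y \<cdot> on_arr M x y ()"
   using comp_assoc[OF oM(1) oN(1) oN(1) kk(1) hf(1) oN(2) kk(2)] X xy hf(2)[OF xy] by simp
  also have "\<dots> = Zero A (on_obj M y) (K y) \<cdot> on_arr M x y ()"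
   using comp_assoc[OF oM(1) oM(1) oN(1) kk(1) oM(2) hf(1) kk(2)] X xy kk(3) by simp
  also have "\<dots> = Zero A (on_obj M x) (K y)" using zero_comp[OF oM(1) oM(1) kk(1) oM(2)] X xy by simp
  finally show ?thesis using 1 k[OF X(1)] kk(1)[OF X(2)] unfolding is_cokernel_def by blast
 qed
 then obtain t where t: "!!x y. (x, y) \<in> r ==> t x y \<in> Hom A (K x) (K y)"
   "!!x y. (x, y) \<in> r ==> t x y \<cdot> k x = k y \<cdot> on_arr N x y ()" by metis
 define K' where "K' = \<lparr>on_obj = restrict K X, on_arr = (%x y (u::unit). if (x, y) \<in> r then t x y else undefined)\<rparr>"
 have K'o: "K' \<in> Obj FC"
  unfolding FC_Obj
 proof (intro conjI ballI allI impI, goal_cases)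
  case (1 x) then show ?case by (simp add: K'_def kk)
 next
  case (2 x)
  have "t x x = Ident A (K x)"
   by (rule cancel[OF 2 2 2 kk(1)[OF 2] 2 t(1)[OF r_refl[OF 2]] ident_in_Hom[OF kk(1)[OF 2]]])
    (simp add: t(2) r_refl 2 oN(3) comp_ident_left[OF oN(1) kk(1) kk(2)] comp_ident_right[OF oN(1) kk(1) kk(2)])
  then show ?case using 2 r_refl by (simp add: K'_def)
 next
  case (3 p) then show ?case using t(1) r_in by (auto simp: K'_def)
 next
  case (4 x y z)
  then have xy: "(x, y) \<in> r" "(y, z) \<in> r" "(x, z) \<in> r" using r_trans by auto
  have X: "x \<in> X" "y \<in> X" "z \<in> X" using r_in xy by auto
  have c: "t y z \<cdot> t x y \<in> Hom A (K x) (K z)"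
   using comp_in_Hom[OF kk(1) kk(1) kk(1) t(1) t(1)] X xy by simp
  have "(t y z \<cdot> t x y) \<cdot> k x = t y z \<cdot> k y \<cdot> on_arr N x y ()"
   using comp_assoc[OF oN(1) kk(1) kk(1) kk(1) kk(2) t(1) t(1)] X xy t(2) by simp
  also have "\<dots> = (k z \<cdot> on_arr N y z ()) \<cdot> on_arr N x y ()"
   using comp_assoc[OF oN(1) oN(1) kk(1) kk(1) oN(2) kk(2) t(1)] X xy t(2) by simp
  also have "\<dots> = k z \<cdot> on_arr N x z ()"
   using comp_assoc[OF oN(1) oN(1) oN(1) kk(1) oN(2) oN(2) kk(2)] X xy oN(4) by simp
  finally have "t x z = t y z \<cdot> t x y"
   by - (rule cancel[OF X(1) X(1) X(1) kk(1)[OF X(3)] X(1) t(1) c], simp_all add: t(2) xy)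
  then show ?case using xy by (simp add: K'_def)
 qed (auto simp: K'_def)
 have k'h: "restrict k X \<in> Hom FC N K'"
  using t(2) r_in kk(2) by (auto simp: FC_Hom K'_def)
 have univ: "\<exists>!h. h \<in> Hom FC K' Z & Comp FC h (restrict k X) = g"
  if Z: "Z \<in> Obj FC" and g: "g \<in> Hom FC N Z" and fg: "Comp FC g f = Zero FC M Z" for Z g
 proof -
  note oZ = FC_objD[OF Z] and hg = FC_homD[OF g]
  have "\<exists>!h. h \<in> Hom A (K x) (on_obj Z x) & h \<cdot> k x = g x" if "x \<in> X" for x
   using k[OF that] oZ(1)[OF that] hg(1)[OF that] fun_cong[OF fg, of x] that unfolding is_cokernel_def by (simp add: FC_sel)
  then obtain h where h: "!!x. x \<in> X ==> h x \<in> Hom A (K x) (on_obj Z x)" "!!x. x \<in> X ==> h x \<cdot> k x = g x"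
   by metis
  have nat: "h y \<cdot> t x y = on_arr Z x y () \<cdot> h x" if xy: "(x, y) \<in> r" for x y
  proof -
   have X: "x \<in> X" "y \<in> X" using r_in xy by auto
   have "(on_arr Z x y () \<cdot> h x) \<cdot> k x = g y \<cdot> on_arr N x y ()"
    using comp_assoc[OF oN(1) kk(1) oZ(1) oZ(1) kk(2) h(1) oZ(2)] X xy h(2) hg(2) by simp
   also have "\<dots> = h y \<cdot> t x y \<cdot> k x"
    using comp_assoc[OF oN(1) oN(1) kk(1) oZ(1) oN(2) kk(2) h(1)] X xy h(2) t(2) by simp
   also have "\<dots> = (h y \<cdot> t x y) \<cdot> k x"
    using comp_assoc[OF oN(1) kk(1) kk(1) oZ(1) kk(2) t(1) h(1)] X xy by simp
   finally show ?thesis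
    by - (rule cancel[OF X(1) X(1) X(1) oZ(1)[OF X(2)] X(1)],
     use X xy comp_in_Hom[OF kk(1) kk(1) oZ(1) t(1) h(1)] comp_in_Hom[OF kk(1) oZ(1) oZ(1) h(1) oZ(2)] in auto)
  qed
  have "restrict h X \<in> Hom FC K' Z" using nat h(1) r_in by (auto simp: FC_Hom K'_def)
  moreover have "Comp FC (restrict h X) (restrict k X) = g"
   using h(2) hg(3) by (auto simp: FC_sel restrict_def fun_eq_iff)
  moreover have "h' = restrict h X" if h': "h' \<in> Hom FC K' Z" "Comp FC h' (restrict k X) = g" for h'
  proof (rule FC_hom_eqI[OF h'(1)])
   fix x assume x: "x \<in> X"
   have "h' x \<cdot> k x = g x" using fun_cong[OF h'(2), of x] x by (simp add: FC_sel)
   then show "h' x = restrict h X x"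
    using cancel[OF x x x oZ(1)[OF x] x, of "h' x" "h x"] FC_homD(1)[OF h'(1) x] h x by (simp add: K'_def)
  qed fact
  ultimately show ?thesis by blast
 qed
 have z: "Comp FC (restrict k X) f = Zero FC M K'"
  using kk(3) by (auto simp: FC_sel restrict_def fun_eq_iff K'_def)
 show thesis
  by (rule that[of K']) (use K'o k'h z univ in \<open>auto simp: is_cokernel_def K'_def\<close>)
qed

end

locale abelian_diagrams = diagrams A X r + abelian_category A
 for A :: "('o, 'm, 'z) preadditive_scheme" (structure) and X :: "'x set" and r :: "'x rel"
begin

text \<open>Conversely a kernel in the diagram category is a kernel at each point, since it is isomorphic to the
pointwise kernel and isomorphisms of diagrams are pointwise.\<close>
lemma FC_kernelD:
 assumes M: "M \<in> Obj FC" and N: "N \<in> Obj FC" and f: "f \<in> Hom FC M N" and k: "is_kernel FC M N f K k" and x: "x \<in> X"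
 shows "is_kernel A (on_obj M x) (on_obj N x) (f x) (on_obj K x) (k x)"
proof -
 interpret FC: preadditive_category FC by (rule FC_preadditive)
 have "\<exists>K k. is_kernel A (on_obj M x) (on_obj N x) (f x) K k" if "x \<in> X" for x
  using kernels FC_objD(1)[OF M that] FC_objD(1)[OF N that] FC_homD(1)[OF f that] by blast
 then obtain K0 k0 where k0: "!!x. x \<in> X ==> is_kernel A (on_obj M x) (on_obj N x) (f x) (K0 x) (k0 x)" by metis
 obtain K' where K': "!!x. x \<in> X ==> on_obj K' x = K0 x" "is_kernel FC M N f K' (restrict k0 X)"
  using FC_kernel_assemble[OF M N f k0] by blast
 obtain u where u: "is_iso FC K K' u" "Comp FC (restrict k0 X) u = k" using FC.kernel_unique[OF M N f K'(2) k] .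
 have "K \<in> Obj FC" using k by (simp add: is_kernel_def)
 then have "is_kernel A (on_obj M x) (on_obj N x) (f x) (on_obj K x) (k0 x \<cdot> u x)"
  using kernel_transport[OF _ _ _ _ k0[OF x], of "on_obj K x" "u x"] FC_isoD[OF u(1) x] K'(1)[OF x]
   FC_objD(1)[OF _ x] FC_homD(1)[OF f x] M N by simp
 then show ?thesis using u(2) x by (auto simp: FC_sel)
qed

lemma FC_cokernelD:
 assumes M: "M \<in> Obj FC" and N: "N \<in> Obj FC" and f: "f \<in> Hom FC M N" and k: "is_cokernel FC M N f K k" and x: "x \<in> X"
 shows "is_cokernel A (on_obj M x) (on_obj N x) (f x) (on_obj K x) (k x)"
proof -
 interpret FC: preadditive_category FC by (rule FC_preadditive)
 have "\<exists>K k. is_cokernel A (on_obj M x) (on_obj N x) (f x) K k" if "x \<in> X" for x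
  using cokernels FC_objD(1)[OF M that] FC_objD(1)[OF N that] FC_homD(1)[OF f that] by blast
 then obtain K0 k0 where k0: "!!x. x \<in> X ==> is_cokernel A (on_obj M x) (on_obj N x) (f x) (K0 x) (k0 x)" by metis
 obtain K' where K': "!!x. x \<in> X ==> on_obj K' x = K0 x" "is_cokernel FC M N f K' (restrict k0 X)"
  using FC_cokernel_assemble[OF M N f k0] by blast
 obtain u where u: "is_iso FC K' K u" "Comp FC u (restrict k0 X) = k" using FC.cokernel_unique[OF M N f K'(2) k] .
 have "K \<in> Obj FC" using k by (simp add: is_cokernel_def)
 then have "is_cokernel A (on_obj M x) (on_obj N x) (f x) (on_obj K x) (u x \<cdot> k0 x)"
  using cokernel_transport[OF _ _ _ _ k0[OF x], of "on_obj K x" "u x"] FC_isoD[OF u(1) x] K'(1)[OF x]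
   FC_objD(1)[OF _ x] FC_homD(1)[OF f x] M N by simp
 then show ?thesis using u(2) x by (auto simp: FC_sel)
qed

text \<open>Evaluation at a point, applied degreewise to a complex of diagrams.\<close>
definition ev :: "(('x, unit, 'o, 'm) func, 'x => 'm) cochain => 'x => ('o, 'm) cochain" where
 "ev M x = \<lparr>deg = (%n. on_obj (deg M n) x), diff = (%n. diff M n x)\<rparr>"

lemma ev_sel [simp]: "deg (ev M x) n = on_obj (deg M n) x" "diff (ev M x) n = diff M n x"
 by (simp_all add: ev_def)

lemma complexD:
 assumes "M \<in> Obj (complex_category FC)"
 shows "deg M n \<in> Obj FC" "diff M n \<in> Hom FC (deg M n) (deg M (n+1))"
  "diff M (n+1) \<bullet> diff M n = Zero FC (deg M n) (deg M (n+1+1))"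
 using assms by (auto simp: complex_category_def)

lemma ev_cohomology:
 assumes M: "M \<in> Obj (complex_category FC)" and h: "is_cohomology FC M n K k H c" and x: "x \<in> X"
 shows "is_cohomology A (ev M x) n (on_obj K x) (k x) (on_obj H x) (c x)"
proof -
 note d = complexD[OF M]
 from h obtain j where k: "is_kernel FC (deg M n) (deg M (n+1)) (diff M n) K k"
  and j: "j \<in> Hom FC (deg M (n-1)) K" "k \<bullet> j = diff M (n-1)" and c: "is_cokernel FC (deg M (n-1)) K j H c"
  unfolding is_cohomology_def by auto
 have K: "K \<in> Obj FC" using k by (simp add: is_kernel_def)
 show ?thesis unfolding is_cohomology_def ev_sel
  using FC_kernelD[OF d(1) d(1) d(2) k x] FC_cokernelD[OF d(1) K j(1) c x] FC_homD(1)[OF j(1) x] fun_cong[OF j(2), of x] x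
  by (auto simp: FC_sel)
qed

lemma cohomology_assemble:
 assumes M: "M \<in> Obj (complex_category FC)"
  and h: "!!x. x \<in> X ==> is_cohomology A (ev M x) n (K x) (k x) (H x) (c x)"
 obtains K' H' where "!!x. x \<in> X ==> on_obj K' x = K x" "!!x. x \<in> X ==> on_obj H' x = H x"
  "is_cohomology FC M n K' (restrict k X) H' (restrict c X)"
proof -
 note d = complexD[OF M]
 have d2: "diff M (n-1) \<in> Hom FC (deg M (n-1)) (deg M n)" "diff M n \<bullet> diff M (n-1) = Zero FC (deg M (n-1)) (deg M (n+1))"
  using d(2)[of "n-1"] d(3)[of "n-1"] by (simp_all add: algebra_simps)
 have k: "is_kernel A (on_obj (deg M n) x) (on_obj (deg M (n+1)) x) (diff M n x) (K x) (k x)" if "x \<in> X" for x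
  using h[OF that] by (simp add: is_cohomology_def)
 obtain K' where K': "!!x. x \<in> X ==> on_obj K' x = K x" "is_kernel FC (deg M n) (deg M (n+1)) (diff M n) K' (restrict k X)"
  using FC_kernel_assemble[OF d(1) d(1) d(2) k] by blast
 have K'o: "K' \<in> Obj FC" using K' by (simp add: is_kernel_def)
 obtain j where j: "j \<in> Hom FC (deg M (n-1)) K'" "restrict k X \<bullet> j = diff M (n-1)"
  using K'(2) d2 d(1) unfolding is_kernel_def by blast
 have "is_cokernel A (on_obj (deg M (n-1)) x) (on_obj K' x) (j x) (H x) (c x)" if x: "x \<in> X" for x
 proof -
  obtain j' where j': "j' \<in> Hom A (on_obj (deg M (n-1)) x) (K x)" "k x \<cdot> j' = diff M (n-1) x"
   "is_cokernel A (on_obj (deg M (n-1)) x) (K x) j' (H x) (c x)"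
   using h[OF x] by (auto simp: is_cohomology_def)
  have "k x \<cdot> j x = diff M (n-1) x" using fun_cong[OF j(2), of x] x by (simp add: FC_sel)
  then have "j x = j'"
   using kernel_cancel[OF k[OF x] FC_objD(1)[OF d(1) x] FC_objD(1)[OF d(1) x] FC_objD(1)[OF d(1) x] FC_homD(1)[OF d(2) x], where u = "j x" and v = j']
    j' FC_homD(1)[OF j(1) x] K'(1)[OF x] by simp
  then show ?thesis using j'(3) K'(1)[OF x] by simp
 qed
 then obtain H' where H': "!!x. x \<in> X ==> on_obj H' x = H x" "is_cokernel FC (deg M (n-1)) K' j H' (restrict c X)"
  using FC_cokernel_assemble[OF d(1) K'o j(1)] by blast
 show thesis by (rule that[OF K'(1) H'(1)]) (use K'(2) H'(2) j in \<open>auto simp: is_cohomology_def\<close>)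
qed

lemma ev_Obj:
 assumes M: "M \<in> Obj (complex_category FC)" and x: "x \<in> X"
 shows "ev M x \<in> Obj (complex_category A)"
 using FC_objD(1)[OF complexD(1)[OF M] x] FC_homD(1)[OF complexD(2)[OF M] x] fun_cong[OF complexD(3)[OF M], where x = x] x
 by (simp add: complex_category_def FC_sel)

lemma ev_Hom:
 assumes f: "f \<in> Hom (complex_category FC) M N" and x: "x \<in> X"
 shows "(%n. f n x) \<in> Hom (complex_category A) (ev M x) (ev N x)"
proof -
 have "f n \<in> Hom FC (deg M n) (deg N n)" "diff N n \<bullet> f n = f (n+1) \<bullet> diff M n" for n
  using f by (auto simp: complex_category_def)
 from FC_homD(1)[OF this(1) x] fun_cong[OF this(2), where x = x] show ?thesis
  using x by (simp add: complex_category_def FC_sel)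
qed

text \<open>From left to right cohomology data are evaluated at a point. From right to left, cohomology data are
assembled from pointwise choices, and the induced map of diagrams is an isomorphism since it is one at
each point.\<close>
lemma quasi_iso_pointwise:
 assumes M: "M \<in> Obj (complex_category FC)" and N: "N \<in> Obj (complex_category FC)"
  and f: "f \<in> Hom (complex_category FC) M N"
 shows "f \<in> quasi_iso FC M N \<longleftrightarrow> (\<forall>x\<in>X. (%n. f n x) \<in> quasi_iso A (ev M x) (ev N x))"
proof (intro iffI ballI)
 fix x assume q: "f \<in> quasi_iso FC M N" and x: "x \<in> X"
 have "\<exists>K k H c K' k' H' c'. is_cohomology A (ev M x) n K k H c & is_cohomology A (ev N x) n K' k' H' c' &
    (\<exists>g \<in> Hom A K K'. k' \<cdot> g = f n x \<cdot> k & (\<exists>h. is_iso A H H' h & h \<cdot> c = c' \<cdot> g))" for n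
 proof -
  obtain K k H c K' k' H' c' g h where c: "is_cohomology FC M n K k H c" "is_cohomology FC N n K' k' H' c'"
    and g: "g \<in> Hom FC K K'" "k' \<bullet> g = f n \<bullet> k" and h: "is_iso FC H H' h" "h \<bullet> c = c' \<bullet> g"
   using q unfolding quasi_iso_def by blast
  show ?thesis
   using ev_cohomology[OF M c(1) x] ev_cohomology[OF N c(2) x] FC_homD(1)[OF g(1) x] FC_isoD[OF h(1) x]
    fun_cong[OF g(2), of x] fun_cong[OF h(2), of x] x by (simp add: FC_sel) blast
 qed
 then show "(%n. f n x) \<in> quasi_iso A (ev M x) (ev N x)" using ev_Hom[OF f x] by (simp add: quasi_iso_def)
next
 assume q: "\<forall>x\<in>X. (%n. f n x) \<in> quasi_iso A (ev M x) (ev N x)"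
 interpret FC: preadditive_category FC by (rule FC_preadditive)
 have fh: "f n \<in> Hom FC (deg M n) (deg N n)" "diff N n \<bullet> f n = f (n+1) \<bullet> diff M n" for n
  using f by (auto simp: complex_category_def)
 have "\<exists>K k H c K' k' H' c'. is_cohomology FC M n K k H c & is_cohomology FC N n K' k' H' c' &
    (\<exists>g \<in> Hom FC K K'. k' \<bullet> g = f n \<bullet> k & (\<exists>h. is_iso FC H H' h & h \<bullet> c = c' \<bullet> g))" for n
 proof -
  have "\<forall>x\<in>X. \<exists>K k H c K' k' H' c' g h. is_cohomology A (ev M x) n K k H c & is_cohomology A (ev N x) n K' k' H' c' &
    g \<in> Hom A K K' & k' \<cdot> g = f n x \<cdot> k & is_iso A H H' h & h \<cdot> c = c' \<cdot> g"
  proof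
   fix x assume "x \<in> X"
   then have "(%n. f n x) \<in> quasi_iso A (ev M x) (ev N x)" using q by blast
   then show "\<exists>K k H c K' k' H' c' g h. is_cohomology A (ev M x) n K k H c & is_cohomology A (ev N x) n K' k' H' c' &
    g \<in> Hom A K K' & k' \<cdot> g = f n x \<cdot> k & is_iso A H H' h & h \<cdot> c = c' \<cdot> g"
    unfolding quasi_iso_def by blast
  qed
  then obtain K k H c K' k' H' c' g h where
    all: "\<forall>x\<in>X. is_cohomology A (ev M x) n (K x) (k x) (H x) (c x) &
     is_cohomology A (ev N x) n (K' x) (k' x) (H' x) (c' x) & g x \<in> Hom A (K x) (K' x) & k' x \<cdot> g x = f n x \<cdot> k x &
     is_iso A (H x) (H' x) (h x) & h x \<cdot> c x = c' x \<cdot> g x"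
   unfolding bchoice_iff by blast
  have c: "!!x. x \<in> X ==> is_cohomology A (ev M x) n (K x) (k x) (H x) (c x)"
     "!!x. x \<in> X ==> is_cohomology A (ev N x) n (K' x) (k' x) (H' x) (c' x)"
    and gh: "!!x. x \<in> X ==> g x \<in> Hom A (K x) (K' x) & k' x \<cdot> g x = f n x \<cdot> k x & is_iso A (H x) (H' x) (h x) & h x \<cdot> c x = c' x \<cdot> g x"
   using all by blast+
  obtain Kf Hf where Kf: "!!x. x \<in> X ==> on_obj Kf x = K x" "!!x. x \<in> X ==> on_obj Hf x = H x"
   "is_cohomology FC M n Kf (restrict k X) Hf (restrict c X)" using cohomology_assemble[OF M c(1)] by blast
  obtain Kf' Hf' where Kf': "!!x. x \<in> X ==> on_obj Kf' x = K' x" "!!x. x \<in> X ==> on_obj Hf' x = H' x"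
   "is_cohomology FC N n Kf' (restrict k' X) Hf' (restrict c' X)" using cohomology_assemble[OF N c(2)] by blast
  obtain j where kM: "is_kernel FC (deg M n) (deg M (n+1)) (diff M n) Kf (restrict k X)"
   and jM: "j \<in> Hom FC (deg M (n-1)) Kf" "restrict k X \<bullet> j = diff M (n-1)"
   and cM: "is_cokernel FC (deg M (n-1)) Kf j Hf (restrict c X)" using Kf(3) by (auto simp: is_cohomology_def)
  obtain j' where kN: "is_kernel FC (deg N n) (deg N (n+1)) (diff N n) Kf' (restrict k' X)"
   and jN: "j' \<in> Hom FC (deg N (n-1)) Kf'" "restrict k' X \<bullet> j' = diff N (n-1)"
   and cN: "is_cokernel FC (deg N (n-1)) Kf' j' Hf' (restrict c' X)" using Kf'(3) by (auto simp: is_cohomology_def)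
  have KM: "Kf \<in> Obj FC" "restrict k X \<in> Hom FC Kf (deg M n)" "diff M n \<bullet> restrict k X = Zero FC Kf (deg M (n+1))"
   and HM: "Hf \<in> Obj FC" "restrict c X \<in> Hom FC Kf Hf" "restrict c X \<bullet> j = Zero FC (deg M (n-1)) Hf"
   and KN: "Kf' \<in> Obj FC" "restrict k' X \<in> Hom FC Kf' (deg N n)" and HN: "Hf' \<in> Obj FC" "restrict c' X \<in> Hom FC Kf' Hf'"
    "restrict c' X \<bullet> j' = Zero FC (deg N (n-1)) Hf'"
   using kM cM kN cN by (auto simp: is_kernel_def is_cokernel_def)
  note dM = complexD[OF M] and dN = complexD[OF N]
  have fk: "f n \<bullet> restrict k X \<in> Hom FC Kf (deg N n)" using FC_comp_hom[OF KM(1) dM(1) dN(1) KM(2) fh(1)] .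
  have "diff N n \<bullet> f n \<bullet> restrict k X = f (n+1) \<bullet> diff M n \<bullet> restrict k X"
   using FC.comp_assoc[OF KM(1) dM(1) dN(1) dN(1) KM(2) fh(1) dN(2)] FC.comp_assoc[OF KM(1) dM(1) dM(1) dN(1) KM(2) dM(2) fh(1)] fh(2)[of n] by simp
  also have "\<dots> = Zero FC Kf (deg N (n+1))" using KM(3) FC.comp_zero[OF KM(1) dM(1) dN(1) fh(1)] by simp
  finally obtain G where G: "G \<in> Hom FC Kf Kf'" "restrict k' X \<bullet> G = f n \<bullet> restrict k X"
   using kN fk KM(1) unfolding is_kernel_def by blast
  have Gg: "G x = g x" if x: "x \<in> X" for x
  proof (rule kernel_cancel[OF FC_kernelD[OF dN(1) dN(1) dN(2) kN x]])
   show "restrict k' X x \<cdot> G x = restrict k' X x \<cdot> g x"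
    using fun_cong[OF G(2), of x] gh[OF x] x by (simp add: FC_sel)
  qed (use FC_objD(1)[OF dN(1) x] FC_objD(1)[OF KM(1) x] FC_homD(1)[OF dN(2) x] FC_homD(1)[OF G(1) x] gh[OF x] x Kf Kf' in auto)
  have nat: "restrict h X \<in> Hom FC Hf Hf'"
   unfolding FC_Hom
  proof (intro conjI ballI allI impI, goal_cases)
   case (2 p)
   obtain x y where p: "p = (x, y)" by (cases p)
   then have xy: "(x, y) \<in> r" "x \<in> X" "y \<in> X" using 2 r_in by auto
   have hh: "h z \<in> Hom A (on_obj Hf z) (on_obj Hf' z)" "h z \<cdot> c z = c' z \<cdot> G z" if "z \<in> X" for z
    using gh[OF that] Gg[OF that] Kf(2) Kf'(2) that by (auto simp: is_iso_def)
   have cc: "c z \<in> Hom A (on_obj Kf z) (on_obj Hf z)" "c' z \<in> Hom A (on_obj Kf' z) (on_obj Hf' z)" if "z \<in> X" for z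
    using FC_homD(1)[OF HM(2) that] FC_homD(1)[OF HN(2) that] that by auto
   have cn: "c y \<cdot> on_arr Kf x y () = on_arr Hf x y () \<cdot> c x" "c' y \<cdot> on_arr Kf' x y () = on_arr Hf' x y () \<cdot> c' x"
    using FC_homD(2)[OF HM(2) xy(1)] FC_homD(2)[OF HN(2) xy(1)] xy by auto
   note oo = FC_objD(1)[OF KM(1)] FC_objD(1)[OF HM(1)] FC_objD(1)[OF KN(1)] FC_objD(1)[OF HN(1)]
   note ar = FC_objD(2)[OF KM(1) xy(1)] FC_objD(2)[OF HM(1) xy(1)] FC_objD(2)[OF KN(1) xy(1)] FC_objD(2)[OF HN(1) xy(1)]
   have "(h y \<cdot> on_arr Hf x y ()) \<cdot> c x = (h y \<cdot> c y) \<cdot> on_arr Kf x y ()"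
    using comp_assoc[OF oo(1) oo(2) oo(2) oo(4) cc(1) ar(2) hh(1)] comp_assoc[OF oo(1) oo(1) oo(2) oo(4) ar(1) cc(1) hh(1)] cn xy by simp
   also have "\<dots> = c' y \<cdot> on_arr Kf' x y () \<cdot> G x"
    using comp_assoc[OF oo(1) oo(1) oo(3) oo(4) ar(1) FC_homD(1)[OF G(1)] cc(2)] hh(2) xy FC_homD(2)[OF G(1) xy(1)] by simp
   also have "\<dots> = (on_arr Hf' x y () \<cdot> c' x) \<cdot> G x"
    using comp_assoc[OF oo(1) oo(3) oo(3) oo(4) FC_homD(1)[OF G(1)] ar(3) cc(2)] cn xy by simp
   also have "\<dots> = (on_arr Hf' x y () \<cdot> h x) \<cdot> c x"
    using comp_assoc[OF oo(1) oo(3) oo(4) oo(4) FC_homD(1)[OF G(1)] cc(2) ar(4)]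
     comp_assoc[OF oo(1) oo(2) oo(4) oo(4) cc(1) hh(1) ar(4)] hh(2) xy by simp
   finally have "h y \<cdot> on_arr Hf x y () = on_arr Hf' x y () \<cdot> h x"
    using cokernel_cancel[OF FC_cokernelD[OF dM(1) KM(1) jM(1) cM xy(2)] _ _ _ FC_homD(1)[OF jM(1) xy(2)],
      of "on_obj Hf' y" "h y \<cdot> on_arr Hf x y ()" "on_arr Hf' x y () \<cdot> h x"]
     comp_in_Hom[OF oo(2) oo(2) oo(4) ar(2) hh(1)] comp_in_Hom[OF oo(2) oo(4) oo(4) hh(1) ar(4)] xy FC_objD(1)[OF dM(1)] oo
    by simp
   then show ?case using xy p by simp
  qed (use gh Kf Kf' in \<open>auto simp: is_iso_def\<close>)
  have iso: "is_iso FC Hf Hf' (restrict h X)"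
   using FC_isoI[OF HM(1) HN(1) nat] gh Kf Kf' by simp
  have "restrict h X \<bullet> restrict c X = restrict c' X \<bullet> G"
   using gh Gg by (auto simp: FC_sel restrict_def fun_eq_iff)
  then show ?thesis using Kf(3) Kf'(3) G iso by blast
 qed
 then show "f \<in> quasi_iso FC M N" using f by (simp add: quasi_iso_def)
qed

end

section \<open>Tagged arrows\<close>

type_synonym ('o, 'm) tarr = "('o \<times> 'm \<times> 'o) option"
type_synonym ('o, 'm) gmap = "int => ('o, 'm) tarr"

definition dm :: "('o, 'm) tarr => 'o" where "dm t = fst (the t)"
definition cd :: "('o, 'm) tarr => 'o" where "cd t = snd (snd (the t))"
definition un :: "('o, 'm) tarr => 'm" where "un t = fst (snd (the t))"

lemma dcu_Some [simp]: "dm (Some (x, f, y)) = x" "cd (Some (x, f, y)) = y" "un (Some (x, f, y)) = f"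
 by (simp_all add: dm_def cd_def un_def)

context preadditive_category
begin

definition ar :: "('o, 'm) tarr => bool" where
 "ar t \<longleftrightarrow> t ~= None & dm t \<in> Obj A & cd t \<in> Obj A & un t \<in> Hom A (dm t) (cd t)"

text \<open>Arrows are tagged with source and target, and composition and sum are made total with value
\<open>None\<close> on ill-typed arguments. Then associativity and distributivity hold without side
conditions (both sides are \<open>None\<close> together), so that matrix identities can be proved by
rewriting.\<close>
definition cmp :: "('o, 'm) tarr => ('o, 'm) tarr => ('o, 'm) tarr" (infixr "**" 75) where
 "g ** f = (if ar g & ar f & dm g = cd f then Some (dm f, un g \<cdot> un f, cd g) else None)"

definition pls :: "('o, 'm) tarr => ('o, 'm) tarr => ('o, 'm) tarr" (infixr "\<oplus>" 65) where
 "f \<oplus> g = (if ar f & ar g & dm f = dm g & cd f = cd g then Some (dm f, un f \<boxplus> un g, cd f) else None)"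

definition ng :: "('o, 'm) tarr => ('o, 'm) tarr" ("\<ominus> _" [80] 80) where
 "\<ominus> f = (if ar f then Some (dm f, Neg A (dm f) (cd f) (un f), cd f) else None)"

definition zr :: "'o => 'o => ('o, 'm) tarr" where
 "zr x y = (if x \<in> Obj A & y \<in> Obj A then Some (x, Zero A x y, y) else None)"

definition idn :: "'o => ('o, 'm) tarr" where
 "idn x = (if x \<in> Obj A then Some (x, Ident A x, x) else None)"

lemma ar_None [simp]: "\<not> ar None" by (simp add: ar_def)

lemma ar_Some [simp]: "ar (Some (x, f, y)) \<longleftrightarrow> x \<in> Obj A & y \<in> Obj A & f \<in> Hom A x y"
 by (auto simp: ar_def)

lemma ar_ob [simp]: "ar f ==> dm f \<in> Obj A" "ar f ==> cd f \<in> Obj A"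
 by (simp_all add: ar_def)

lemma arE: assumes "ar f" obtains x f' y where "f = Some (x, f', y)" "x \<in> Obj A" "y \<in> Obj A" "f' \<in> Hom A x y"
proof -
 obtain x f' y where f: "f = Some (x, f', y)" using assms by (metis ar_None option.exhaust prod_cases3)
 show thesis using that[OF f] assms unfolding f by simp
qed

lemma ar_un: "ar f ==> un f \<in> Hom A (dm f) (cd f)"
 unfolding ar_def by blast

lemma ar_cmp [simp]: "ar (g ** f) \<longleftrightarrow> ar g & ar f & dm g = cd f"
 using ar_un[of f] ar_un[of g] by (auto simp: cmp_def intro!: comp_in_Hom[of "dm f" "cd f" "cd g"])

lemma dc_cmp [simp]: "ar g ==> ar f ==> dm g = cd f ==> dm (g ** f) = dm f"
 "ar g ==> ar f ==> dm g = cd f ==> cd (g ** f) = cd g"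
 by (auto simp: cmp_def)

lemma ar_pls [simp]: "ar (f \<oplus> g) \<longleftrightarrow> ar g & ar f & dm f = dm g & cd f = cd g"
 using ar_un[of f] ar_un[of g] by (auto simp: pls_def intro!: plus_hom)

lemma dc_pls [simp]: "ar g ==> ar f ==> dm f = dm g ==> cd f = cd g ==> dm (f \<oplus> g) = dm f"
 "ar g ==> ar f ==> dm f = dm g ==> cd f = cd g ==> cd (f \<oplus> g) = cd f"
 by (auto simp: pls_def)

lemma ar_ng [simp]: "ar (\<ominus> f) \<longleftrightarrow> ar f"
 using ar_un[of f] neg_hom[of "dm f" "cd f" "un f"] by (auto simp: ng_def)

lemma dc_ng [simp]: "ar f ==> dm (\<ominus> f) = dm f" "ar f ==> cd (\<ominus> f) = cd f"
 by (auto simp: ng_def)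

lemma ar_zr [simp]: "ar (zr x y) \<longleftrightarrow> x \<in> Obj A & y \<in> Obj A"
 "x \<in> Obj A ==> y \<in> Obj A ==> dm (zr x y) = x" "x \<in> Obj A ==> y \<in> Obj A ==> cd (zr x y) = y"
 by (auto simp: zr_def zero_hom)

lemma ar_idn [simp]: "ar (idn x) \<longleftrightarrow> x \<in> Obj A" "x \<in> Obj A ==> dm (idn x) = x" "x \<in> Obj A ==> cd (idn x) = x"
 by (auto simp: idn_def ident_in_Hom)

lemma cmp_assoc [simp]: "(h ** g) ** f = h ** g ** f"
proof (cases "ar h & ar g & ar f & dm h = cd g & dm g = cd f")
 case True
 then obtain a b c where "ar h" "ar g" "ar f" "dm h = cd g" "dm g = cd f" by blast
 then show ?thesis by (auto elim!: arE simp: cmp_def comp_in_Hom comp_assoc)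
next
 case False
 then have "\<not> ar ((h ** g) ** f)" "\<not> ar (h ** g ** f)" by auto
 then show ?thesis by (metis ar_cmp cmp_def)
qed

text \<open>Composites are normalised to the right; this restores an equation for a composite that occurs as an
initial part of a longer one.\<close>
lemma cmp_left: "a ** b = z ==> a ** b ** c = z ** c"
 by (simp add: cmp_assoc[symmetric] del: cmp_assoc)

lemma pls_assoc [simp]: "(h \<oplus> g) \<oplus> f = h \<oplus> g \<oplus> f"
proof (cases "ar h & ar g & ar f & dm h = dm g & dm g = dm f & cd h = cd g & cd g = cd f")
 case True then show ?thesis by (auto elim!: arE simp: pls_def plus_hom plus_assoc)
next
 case False
 then have "\<not> ar ((h \<oplus> g) \<oplus> f)" "\<not> ar (h \<oplus> g \<oplus> f)" by auto
 then show ?thesis by (metis ar_pls pls_def)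
qed

lemma pls_commute: "f \<oplus> g = g \<oplus> f"
proof (cases "ar g & ar f & dm g = dm f & cd g = cd f")
 case True then show ?thesis by (auto elim!: arE simp: pls_def plus_commute)
qed (auto simp: pls_def)

lemma pls_left_commute: "f \<oplus> g \<oplus> h = g \<oplus> f \<oplus> h"
 by (metis pls_assoc pls_commute)

lemmas pls_ac = pls_commute pls_left_commute

lemma cmp_pls [simp]: "h ** (f \<oplus> g) = h ** f \<oplus> h ** g"
proof (cases "ar h & ar g & ar f & dm h = cd g & cd g = cd f & dm g = dm f")
 case True then show ?thesis by (auto elim!: arE simp: pls_def cmp_def plus_hom comp_in_Hom comp_plus_right)
next
 case False
 then have "\<not> ar (h ** (f \<oplus> g))" "\<not> ar (h ** f \<oplus> h ** g)" by auto
 then show ?thesis by (metis ar_pls ar_cmp pls_def cmp_def)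
qed

lemma pls_cmp [simp]: "(f \<oplus> g) ** h = f ** h \<oplus> g ** h"
proof (cases "ar h & ar g & ar f & cd h = dm g & cd g = cd f & dm g = dm f")
 case True then show ?thesis by (auto elim!: arE simp: pls_def cmp_def plus_hom comp_in_Hom comp_plus_left)
next
 case False
 then have "\<not> ar ((f \<oplus> g) ** h)" "\<not> ar (f ** h \<oplus> g ** h)" by auto
 then show ?thesis by (metis ar_pls ar_cmp pls_def cmp_def)
qed

lemma cmp_ng [simp]: "h ** \<ominus> f = \<ominus> (h ** f)"
proof (cases "ar h & ar f & dm h = cd f")
 case True then show ?thesis by (auto elim!: arE simp: ng_def cmp_def neg_hom[simplified] comp_in_Hom comp_neg[simplified])
qed (auto simp: cmp_def ng_def)

lemma ng_cmp [simp]: "(\<ominus> h) ** f = \<ominus> (h ** f)"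
proof (cases "ar h & ar f & dm h = cd f")
 case True then show ?thesis by (auto elim!: arE simp: ng_def cmp_def neg_hom[simplified] comp_in_Hom neg_comp[simplified])
qed (auto simp: cmp_def ng_def)

lemma ng_ng [simp]: "ar f ==> \<ominus> \<ominus> f = f"
 by (auto elim!: arE simp: ng_def neg_hom neg_neg)

lemma ng_pls [simp]: "\<ominus> (f \<oplus> g) = \<ominus> f \<oplus> \<ominus> g"
proof (cases "ar g & ar f & dm g = dm f & cd g = cd f")
 case True then show ?thesis by (auto elim!: arE simp: pls_def ng_def plus_hom neg_hom neg_plus)
qed (auto simp: pls_def ng_def)

lemma ng_zr [simp]: "\<ominus> (zr x y) = zr x y"
 by (auto simp: zr_def ng_def zero_hom neg_zero)

lemma zr_cmp [simp]: "ar f ==> cd f = y ==> zr y z ** f = zr (dm f) z"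
 by (auto elim!: arE simp: zr_def cmp_def zero_hom zero_comp)

lemma cmp_zr [simp]: "ar f ==> dm f = y ==> f ** zr x y = zr x (cd f)"
 by (auto elim!: arE simp: zr_def cmp_def zero_hom comp_zero)

lemma pls_zr [simp]: "ar f ==> dm f = x ==> cd f = y ==> f \<oplus> zr x y = f"
 by (auto elim!: arE simp: zr_def pls_def zero_hom plus_zero)

lemma zr_pls [simp]: "ar f ==> dm f = x ==> cd f = y ==> zr x y \<oplus> f = f"
 by (simp add: pls_commute)

lemma cmp_idn [simp]: "ar f ==> dm f = x ==> f ** idn x = f"
 by (auto elim!: arE simp: idn_def cmp_def ident_in_Hom comp_ident_right)

lemma idn_cmp [simp]: "ar f ==> cd f = x ==> idn x ** f = f"
 by (auto elim!: arE simp: idn_def cmp_def ident_in_Hom comp_ident_left)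

lemma pls_ng [simp]: "ar f ==> f \<oplus> \<ominus> f = zr (dm f) (cd f)"
 by (auto elim!: arE simp: zr_def pls_def ng_def neg_hom plus_neg)

lemma ng_pls_self [simp]: "ar f ==> \<ominus> f \<oplus> f = zr (dm f) (cd f)"
 by (simp add: pls_commute)

lemma pls_ng2 [simp]: "ar f ==> ar g ==> dm f = dm g ==> cd f = cd g ==> f \<oplus> \<ominus> f \<oplus> g = g"
 by (subst pls_assoc[symmetric]) simp

lemma ng_pls2 [simp]: "ar f ==> ar g ==> dm f = dm g ==> cd f = cd g ==> \<ominus> f \<oplus> f \<oplus> g = g"
 by (subst pls_assoc[symmetric]) simp

lemma pls_cancel: "ar f ==> ar g ==> ar h ==> dm f = dm g ==> cd f = cd g ==> dm f = dm h ==> cd f = cd h ==>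
  f \<oplus> g = f \<oplus> h ==> g = h"
 by (metis ng_pls2)

lemma eq_ngI: "ar f ==> ar g ==> dm f = dm g ==> cd f = cd g ==> f \<oplus> g = zr (dm f) (cd f) ==> f = \<ominus> g"
 by (metis ar_ng dc_ng pls_cancel pls_commute pls_ng)

lemma diff_zero: "ar f ==> ar g ==> dm f = dm g ==> cd f = cd g ==> f \<oplus> \<ominus> g = zr (dm f) (cd f) ==> f = g"
 by (metis ar_ng dc_ng eq_ngI ng_ng)

definition tepi :: "('o, 'm) tarr => bool" where
 "tepi e \<longleftrightarrow> ar e & (\<forall>g. ar g & dm g = cd e & g ** e = zr (dm e) (cd g) --> g = zr (cd e) (cd g))"

definition tmono :: "('o, 'm) tarr => bool" where
 "tmono k \<longleftrightarrow> ar k & (\<forall>h. ar h & cd h = dm k & k ** h = zr (dm h) (cd k) --> h = zr (dm h) (dm k))"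

definition tker :: "('o, 'm) tarr => ('o, 'm) tarr => bool" where
 "tker f k \<longleftrightarrow> ar f & tmono k & cd k = dm f & f ** k = zr (dm k) (cd f) &
  (\<forall>g. ar g & cd g = dm f & f ** g = zr (dm g) (cd f) --> (\<exists>h. ar h & dm h = dm g & cd h = dm k & k ** h = g))"

definition tcok :: "('o, 'm) tarr => ('o, 'm) tarr => bool" where
 "tcok f c \<longleftrightarrow> ar f & tepi c & dm c = cd f & c ** f = zr (dm f) (cd c) &
  (\<forall>g. ar g & dm g = cd f & g ** f = zr (dm f) (cd g) --> (\<exists>h. ar h & dm h = cd c & cd h = cd g & h ** c = g))"

lemma tepi_ar [simp]: "tepi e ==> ar e" and tmono_ar [simp]: "tmono e ==> ar e"
 unfolding tepi_def tmono_def by blast+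

lemma tepiD: "tepi e ==> ar g ==> dm g = cd e ==> g ** e = zr (dm e) (cd g) ==> g = zr (cd e) (cd g)"
 unfolding tepi_def by blast

lemma tmonoD: "tmono k ==> ar h ==> cd h = dm k ==> k ** h = zr (dm h) (cd k) ==> h = zr (dm h) (dm k)"
 unfolding tmono_def by blast

lemma tepi_cancel: "tepi e ==> ar g ==> ar h ==> dm g = cd e ==> dm h = cd e ==> cd g = cd h ==> g ** e = h ** e ==> g = h"
proof -
 assume a: "tepi e" "ar g" "ar h" "dm g = cd e" "dm h = cd e" "cd g = cd h" "g ** e = h ** e"
 have "g \<oplus> \<ominus> h = zr (cd e) (cd (g \<oplus> \<ominus> h))"
  by (rule tepiD[OF a(1)]) (simp_all add: a)
 then have "g \<oplus> \<ominus> h = zr (dm g) (cd g)" by (simp add: a)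
 then show ?thesis using a by - (rule diff_zero, simp_all)
qed

lemma tmono_cancel: "tmono k ==> ar g ==> ar h ==> cd g = dm k ==> cd h = dm k ==> dm g = dm h ==> k ** g = k ** h ==> g = h"
proof -
 assume a: "tmono k" "ar g" "ar h" "cd g = dm k" "cd h = dm k" "dm g = dm h" "k ** g = k ** h"
 have "g \<oplus> \<ominus> h = zr (dm (g \<oplus> \<ominus> h)) (dm k)"
  by (rule tmonoD[OF a(1)]) (simp_all add: a)
 then have "g \<oplus> \<ominus> h = zr (dm g) (cd g)" by (simp add: a)
 then show ?thesis using a by - (rule diff_zero, simp_all)
qed

lemma tepi_cmp [intro]: "tepi e ==> tepi f ==> dm e = cd f ==> tepi (e ** f)"
proof -
 assume a: "tepi e" "tepi f" "dm e = cd f"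
 have "g = zr (cd e) (cd g)" if g: "ar g" "dm g = cd e" "g ** e ** f = zr (dm f) (cd g)" for g
 proof -
  have "g ** e = zr (cd f) (cd (g ** e))" by (rule tepiD[OF a(2)]) (simp_all add: a g)
  then have "g ** e = zr (dm e) (cd g)" by (simp add: a g)
  then show ?thesis by (intro tepiD a g)
 qed
 then show ?thesis unfolding tepi_def[of "e ** f"] using a by simp
qed

lemma tker_lift: "tker f k ==> ar g ==> cd g = dm f ==> f ** g = zr (dm g) (cd f) ==>
  \<exists>h. ar h & dm h = dm g & cd h = dm k & k ** h = g"
 unfolding tker_def by blast

lemma tcok_lift: "tcok f c ==> ar g ==> dm g = cd f ==> g ** f = zr (dm f) (cd g) ==>
  \<exists>h. ar h & dm h = cd c & cd h = cd g & h ** c = g"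
 unfolding tcok_def by blast

lemma tepi_idn [simp]: "x \<in> Obj A ==> tepi (idn x)"
 unfolding tepi_def by auto

lemma cmp_Some: "x \<in> Obj A ==> y \<in> Obj A ==> z \<in> Obj A ==> f \<in> Hom A x y ==> g \<in> Hom A y z ==>
  Some (y, g, z) ** Some (x, f, y) = Some (x, g \<cdot> f, z)"
 by (simp add: cmp_def)

lemma kernel_tker:
 assumes o: "x \<in> Obj A" "y \<in> Obj A" and f: "f \<in> Hom A x y" and k: "is_kernel A x y f K k"
 shows "tker (Some (x, f, y)) (Some (K, k, x))"
proof -
 have kk: "K \<in> Obj A" "k \<in> Hom A K x" "f \<cdot> k = Zero A K y" using k by (auto simp: is_kernel_def)
 have m: "h = zr (dm h) K" if h: "ar h" "cd h = K" "Some (K, k, x) ** h = zr (dm h) x" for h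
 proof -
  obtain z h' where h': "h = Some (z, h', K)" "z \<in> Obj A" "h' \<in> Hom A z K" using h by (auto elim!: arE)
  then have "k \<cdot> h' = k \<cdot> Zero A z K" using h kk o by (simp add: cmp_Some zr_def comp_zero)
  then show ?thesis using kernel_cancel[OF k o h'(2) f h'(3) zero_hom[OF h'(2) kk(1)]] h' kk by (simp add: zr_def)
 qed
 have e: "\<exists>h. ar h & dm h = dm g & cd h = K & Some (K, k, x) ** h = g"
  if g: "ar g" "cd g = x" "Some (x, f, y) ** g = zr (dm g) y" for g
 proof -
  obtain z g' where g': "g = Some (z, g', x)" "z \<in> Obj A" "g' \<in> Hom A z x" using g by (auto elim!: arE)
  then have "f \<cdot> g' = Zero A z y" using g f o by (simp add: cmp_Some zr_def)
  then obtain h where h: "h \<in> Hom A z K" "k \<cdot> h = g'" using k g' unfolding is_kernel_def by blast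
  then show ?thesis using g' kk o by (intro exI[of _ "Some (z, h, K)"]) (simp add: cmp_Some)
 qed
 show ?thesis unfolding tker_def tmono_def using o f kk m e by (simp add: cmp_Some zr_def)
qed

lemma cokernel_tcok:
 assumes o: "x \<in> Obj A" "y \<in> Obj A" and f: "f \<in> Hom A x y" and k: "is_cokernel A x y f K k"
 shows "tcok (Some (x, f, y)) (Some (y, k, K))"
proof -
 have kk: "K \<in> Obj A" "k \<in> Hom A y K" "k \<cdot> f = Zero A x K" using k by (auto simp: is_cokernel_def)
 have m: "h = zr K (cd h)" if h: "ar h" "dm h = K" "h ** Some (y, k, K) = zr y (cd h)" for h
 proof -
  obtain z h' where h': "h = Some (K, h', z)" "z \<in> Obj A" "h' \<in> Hom A K z" using h by (auto elim!: arE)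
  then have "h' \<cdot> k = Zero A K z \<cdot> k" using h kk o by (simp add: cmp_Some zr_def zero_comp)
  then show ?thesis using cokernel_cancel[OF k o h'(2) f h'(3) zero_hom[OF kk(1) h'(2)]] h' kk by (simp add: zr_def)
 qed
 have e: "\<exists>h. ar h & dm h = K & cd h = cd g & h ** Some (y, k, K) = g"
  if g: "ar g" "dm g = y" "g ** Some (x, f, y) = zr x (cd g)" for g
 proof -
  obtain z g' where g': "g = Some (y, g', z)" "z \<in> Obj A" "g' \<in> Hom A y z" using g by (auto elim!: arE)
  then have "g' \<cdot> f = Zero A x z" using g f o by (simp add: cmp_Some zr_def)
  then obtain h where h: "h \<in> Hom A K z" "h \<cdot> k = g'" using k g' unfolding is_cokernel_def by blast
  then show ?thesis using g' kk o by (intro exI[of _ "Some (K, h, z)"]) (simp add: cmp_Some)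
 qed
 show ?thesis unfolding tcok_def tepi_def using o f kk m e by (simp add: cmp_Some zr_def)
qed

definition tbip :: "'o => 'o => ('o, 'm) tarr => ('o, 'm) tarr => ('o, 'm) tarr => ('o, 'm) tarr => bool" where
 "tbip x y j i p q \<longleftrightarrow> ar j & ar i & ar p & ar q & dm j = x & dm i = y & cd i = cd j & dm p = cd j & dm q = cd j &
   cd p = x & cd q = y & p ** j = idn x & q ** i = idn y & p ** i = zr y x & q ** j = zr x y &
   j ** p \<oplus> i ** q = idn (cd j)"

lemma is_biproduct_tbip:
 assumes "x \<in> Obj A" "y \<in> Obj A"
 shows "is_biproduct A x y b j i p q \<longleftrightarrow> b \<in> Obj A & j \<in> Hom A x b & i \<in> Hom A y b & p \<in> Hom A b x & q \<in> Hom A b y &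
  tbip x y (Some (x, j, b)) (Some (y, i, b)) (Some (b, p, x)) (Some (b, q, y))"
 using assms unfolding is_biproduct_def tbip_def
 by (auto simp: cmp_Some zr_def idn_def pls_def comp_in_Hom)

definition cpx :: "('o, 'm) gmap => bool" where
 "cpx d \<longleftrightarrow> (\<forall>n. ar (d n) & cd (d n) = dm (d (n+1)) & d (n+1) ** d n = zr (dm (d n)) (cd (d (n+1))))"

definition cmor :: "('o, 'm) gmap => ('o, 'm) gmap => ('o, 'm) gmap => bool" where
 "cmor d f d' \<longleftrightarrow> (\<forall>n. ar (f n) & dm (f n) = dm (d n) & cd (f n) = dm (d' n) & d' n ** f n = f (n+1) ** d n)"

text \<open>Elements of an object are arrows into it, and may be restricted along epimorphisms. In
these terms \<open>qsurj\<close> says that \<open>f\<close> is onto on cohomology in degree \<open>n +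
1\<close>: each cocycle is, after restriction, the image of a cocycle up to a coboundary. The degree is
shifted by one so that the preceding differential can be written \<open>d n\<close>.\<close>
definition qsurj :: "('o, 'm) gmap => ('o, 'm) gmap => ('o, 'm) gmap => int => bool" where
 "qsurj d f d' n \<longleftrightarrow> (\<forall>y. ar y & cd y = dm (d' (n+1)) & d' (n+1) ** y = zr (dm y) (cd (d' (n+1))) -->
   (\<exists>e x w. tepi e & cd e = dm y & ar x & dm x = dm e & cd x = dm (d (n+1)) & d (n+1) ** x = zr (dm e) (cd (d (n+1))) &
    ar w & dm w = dm e & cd w = dm (d' n) & f (n+1) ** x = y ** e \<oplus> d' n ** w))"

text \<open>The map \<open>f\<close> is injective on cohomology in degree \<open>n + 1\<close>: a cocycle whose image
bounds is, after restriction, a coboundary.\<close>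
definition qinj :: "('o, 'm) gmap => ('o, 'm) gmap => ('o, 'm) gmap => int => bool" where
 "qinj d f d' n \<longleftrightarrow> (\<forall>x w. ar x & cd x = dm (d (n+1)) & d (n+1) ** x = zr (dm x) (cd (d (n+1))) &
   ar w & dm w = dm x & cd w = dm (d' n) & f (n+1) ** x = d' n ** w -->
   (\<exists>e u. tepi e & cd e = dm x & ar u & dm u = dm e & cd u = dm (d n) & d n ** u = x ** e))"

definition qi :: "('o, 'm) gmap => ('o, 'm) gmap => ('o, 'm) gmap => bool" where
 "qi d f d' \<longleftrightarrow> (\<forall>n. qsurj d f d' n & qinj d f d' n)"

end

context abelian_category
begin

lemma tker_ex: assumes "ar f" obtains k where "tker f k"
 using assms kernels kernel_tker by (metis arE)

lemma tmono_normal: assumes m: "tmono f" obtains g where "tker g f"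
proof -
 obtain x f' y where f: "f = Some (x, f', y)" "x \<in> Obj A" "y \<in> Obj A" "f' \<in> Hom A x y" using m tmono_ar by (blast elim: arE)
 have "is_mono A x y f'"
  unfolding is_mono_def
 proof (intro conjI ballI impI f)
  fix z g h assume "z \<in> Obj A" "g \<in> Hom A z x" "h \<in> Hom A z x" "f' \<cdot> g = f' \<cdot> h"
  then show "g = h" using tmono_cancel[OF m, of "Some (z, g, x)" "Some (z, h, x)"] f by (simp add: cmp_Some)
 qed
 from mono_normal[OF f(2,3) this] show thesis using that kernel_tker f by blast
qed

lemma tepi_normal: assumes m: "tepi f" obtains g where "tcok g f"
proof -
 obtain x f' y where f: "f = Some (x, f', y)" "x \<in> Obj A" "y \<in> Obj A" "f' \<in> Hom A x y" using m tepi_ar by (blast elim: arE)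
 have "is_epi A x y f'"
  unfolding is_epi_def
 proof (intro conjI ballI impI f)
  fix z g h assume "z \<in> Obj A" "g \<in> Hom A y z" "h \<in> Hom A y z" "g \<cdot> f' = h \<cdot> f'"
  then show "g = h" using tepi_cancel[OF m, of "Some (y, g, z)" "Some (y, h, z)"] f by (simp add: cmp_Some)
 qed
 from epi_normal[OF f(2,3) this] show thesis using that cokernel_tcok f by blast
qed

definition biprod where
 "biprod x y = (SOME (j, i, p, q). tbip x y j i p q)"
definition bj where "bj x y = fst (biprod x y)"
definition bi where "bi x y = fst (snd (biprod x y))"
definition bp where "bp x y = fst (snd (snd (biprod x y)))"
definition bq where "bq x y = snd (snd (snd (biprod x y)))"
definition bo where "bo x y = cd (bj x y)"

lemma tbip_biprod:
 assumes "x \<in> Obj A" "y \<in> Obj A" shows "tbip x y (bj x y) (bi x y) (bp x y) (bq x y)"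
proof -
 obtain b j i p q where "is_biproduct A x y b j i p q" using biproducts[OF assms] by blast
 then have "tbip x y (Some (x, j, b)) (Some (y, i, b)) (Some (b, p, x)) (Some (b, q, y))"
  using is_biproduct_tbip[OF assms] by blast
 then have "case (Some (x, j, b), Some (y, i, b), Some (b, p, x), Some (b, q, y)) of (j, i, p, q) => tbip x y j i p q" by simp
 then have "case biprod x y of (j, i, p, q) => tbip x y j i p q" unfolding biprod_def by (rule someI)
 then show ?thesis by (simp add: bj_def bi_def bp_def bq_def split: prod.splits)
qed

lemma bip [simp]:
 assumes "x \<in> Obj A" "y \<in> Obj A"
 shows "bo x y \<in> Obj A" "ar (bj x y)" "dm (bj x y) = x" "cd (bj x y) = bo x y" "ar (bi x y)" "dm (bi x y) = y" "cd (bi x y) = bo x y"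
  "ar (bp x y)" "dm (bp x y) = bo x y" "cd (bp x y) = x" "ar (bq x y)" "dm (bq x y) = bo x y" "cd (bq x y) = y"
  "bp x y ** bj x y = idn x" "bq x y ** bi x y = idn y" "bp x y ** bi x y = zr y x" "bq x y ** bj x y = zr x y"
  "bj x y ** bp x y \<oplus> bi x y ** bq x y = idn (bo x y)"
 using tbip_biprod[OF assms] unfolding tbip_def bo_def by simp_all

lemma bip2 [simp]:
 assumes "x \<in> Obj A" "y \<in> Obj A"
 shows "ar t ==> cd t = x ==> bp x y ** bj x y ** t = t"
  "ar t ==> cd t = y ==> bq x y ** bi x y ** t = t"
  "ar t ==> cd t = y ==> bp x y ** bi x y ** t = zr (dm t) x"
  "ar t ==> cd t = x ==> bq x y ** bj x y ** t = zr (dm t) y"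
 using assms by (simp_all add: cmp_assoc[symmetric] del: cmp_assoc)

lemma epi_is_cok:
 assumes e: "tepi f" and k: "tker f k" shows "tcok k f"
proof -
 obtain g where g: "tcok g f" using tepi_normal[OF e] .
 have fg: "dm f = cd g" "f ** g = zr (dm g) (cd f)" "ar g" using g by (simp_all add: tcok_def)
 have kk: "tmono k" "ar k" "cd k = dm f" "f ** k = zr (dm k) (cd f)" using k by (simp_all add: tker_def)
 obtain h where h: "ar h" "dm h = dm g" "cd h = dm k" "k ** h = g" using tker_lift[OF k, of g] fg by auto
 have "\<exists>s. ar s & dm s = cd f & cd s = cd t & s ** f = t" if t: "ar t" "dm t = cd k" "t ** k = zr (dm k) (cd t)" for t
 proof -
  have "t ** g = (t ** k) ** h" using h by simp
  then have "t ** g = zr (dm g) (cd t)" using t h by (simp del: cmp_assoc)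
  then show ?thesis using tcok_lift[OF g, of t] t kk fg by auto
 qed
 then show ?thesis unfolding tcok_def using kk e by simp
qed

text \<open>Pullbacks of epimorphisms are epimorphisms: this is what allows an element to be lifted along an
epimorphism after restriction. The pullback is the kernel of the row
\<open>(p, - u)\<close>, which is epi along with \<open>p\<close> and therefore the cokernel of its kernel.\<close>
lemma pullback_epi:
 assumes p: "tepi p" and u: "ar u" "cd u = cd p"
 obtains e w where "tepi e" "cd e = dm u" "ar w" "dm w = dm e" "cd w = dm p" "p ** w = u ** e"
proof -
 let ?x = "dm p" and ?y = "dm u"
 have o [simp]: "?x \<in> Obj A" "?y \<in> Obj A" "ar p" using p u by auto
 define r where "r = p ** bp ?x ?y \<oplus> \<ominus> (u ** bq ?x ?y)"
 have r [simp]: "ar r" "dm r = bo ?x ?y" "cd r = cd p" using u by (auto simp: r_def)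
 have rj: "r ** bj ?x ?y = p" and ri: "r ** bi ?x ?y = \<ominus> u" using u by (simp_all add: r_def)
 have er: "tepi r"
  unfolding tepi_def
 proof (intro conjI allI impI r; elim conjE)
  fix g assume g: "ar g" "dm g = cd r" "g ** r = zr (dm r) (cd g)"
  have "g ** p = (g ** r) ** bj ?x ?y" using rj by simp
  then have "g ** p = zr (dm p) (cd g)" using g by (simp del: cmp_assoc)
  then have "g = zr (cd p) (cd g)" by (intro tepiD[OF p]) (simp_all add: g)
  then show "g = zr (cd r) (cd g)" by simp
 qed
 obtain k where k: "tker r k" using tker_ex[OF r(1)] .
 have kk [simp]: "ar k" "cd k = bo ?x ?y" and rk: "r ** k = zr (dm k) (cd r)" using k by (simp_all add: tker_def)
 have cok: "tcok k r" using epi_is_cok[OF er k] .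
 let ?e = "bq ?x ?y ** k" and ?w = "bp ?x ?y ** k"
 have ee: "tepi ?e"
  unfolding tepi_def
 proof (intro conjI allI impI; (elim conjE)?)
  fix g assume g: "ar g" "dm g = cd ?e" "g ** ?e = zr (dm ?e) (cd g)"
  then have g' [simp]: "dm g = ?y" by simp
  have "(g ** bq ?x ?y) ** k = zr (dm k) (cd g)" using g by simp
  moreover have "ar (g ** bq ?x ?y)" "dm (g ** bq ?x ?y) = cd k" "cd (g ** bq ?x ?y) = cd g" using g by simp_all
  ultimately obtain h where h: "ar h" "dm h = cd p" "cd h = cd g" "h ** r = g ** bq ?x ?y"
   using tcok_lift[OF cok, of "g ** bq ?x ?y"] g by auto
  have "h ** p = (h ** r) ** bj ?x ?y" using rj by simp
  then have "h ** p = zr (dm p) (cd h)" using h g by simp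
  then have "h = zr (cd p) (cd h)" by (intro tepiD[OF p] h)
  then have h0: "h = zr (cd p) (cd g)" unfolding h(3) .
  have "g = (h ** r) ** bi ?x ?y" using h g by simp
  also have "\<dots> = zr ?y (cd g)" using g u p unfolding h0 by (simp add: ri)
  finally show "g = zr (cd ?e) (cd g)" by simp
 qed simp
 have "p ** ?w = u ** ?e"
  using rk u unfolding r_def by - (rule diff_zero, simp_all)
 then show thesis using that[OF ee, of ?w] by simp
qed

text \<open>An element of the target that dies in the cokernel of \<open>j\<close> comes, after restriction, from an
element of the source: it lies in the image of \<open>j\<close>, and \<open>j\<close> maps onto its image.\<close>
lemma cok_lift:
 assumes c: "tcok j c" and u: "ar u" "cd u = cd j" "c ** u = zr (dm u) (cd c)"
 obtains e w where "tepi e" "cd e = dm u" "ar w" "dm w = dm e" "cd w = dm j" "j ** w = u ** e"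
proof -
 have cc [simp]: "ar c" "ar j" "dm c = cd j" "c ** j = zr (dm j) (cd c)" using c by (simp_all add: tcok_def)
 obtain m where m: "tker c m" using tker_ex[OF cc(1)] .
 have mm [simp]: "tmono m" "ar m" "cd m = cd j" "c ** m = zr (dm m) (cd c)" using m by (simp_all add: tker_def)
 obtain j0 where j0 [simp]: "ar j0" "dm j0 = dm j" "cd j0 = dm m" "m ** j0 = j" using tker_lift[OF m, of j] cc by auto
 obtain u0 where u0: "ar u0" "dm u0 = dm u" "cd u0 = dm m" "m ** u0 = u" using tker_lift[OF m, of u] u by auto
 have "tepi j0"
  unfolding tepi_def
 proof (intro conjI allI impI j0; elim conjE)
  fix t assume t: "ar t" "dm t = cd j0" "t ** j0 = zr (dm j0) (cd t)"
  obtain k where k: "tker t k" using tker_ex[OF t(1)] .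
  have kk [simp]: "tmono k" "ar k" "cd k = dm m" "t ** k = zr (dm k) (cd t)" using k t by (simp_all add: tker_def)
  obtain j1 where j1: "ar j1" "dm j1 = dm j" "cd j1 = dm k" "k ** j1 = j0" using tker_lift[OF k, of j0] t by auto
  have mk: "tmono (m ** k)"
   unfolding tmono_def
  proof (intro conjI allI impI; (elim conjE)?)
   fix h assume h: "ar h" "cd h = dm (m ** k)" "(m ** k) ** h = zr (dm h) (cd (m ** k))"
   then have "k ** h = zr (dm h) (dm m)" using tmono_cancel[OF mm(1), of "k ** h" "zr (dm h) (dm m)"] by simp
   then show "h = zr (dm h) (dm (m ** k))" using tmono_cancel[OF kk(1), of h "zr (dm h) (dm k)"] h by simp
  qed simp
  obtain g where g: "tker g (m ** k)" using tmono_normal[OF mk] .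
  have gg: "ar g" "dm g = cd j" "g ** m ** k = zr (dm k) (cd g)" using g by (simp_all add: tker_def)
  have "g ** j = (g ** m ** k) ** j1" using j1 by simp
  then have "g ** j = zr (dm j) (cd g)" using gg j1 by (simp del: cmp_assoc)
  then obtain g' where g': "ar g'" "dm g' = cd c" "g' ** c = g" using tcok_lift[OF c, of g] gg by auto
  have "g ** m = zr (dm m) (cd g)" using g' by (auto simp: g'(3)[symmetric])
  then obtain s where s: "ar s" "dm s = dm m" "cd s = dm k" "(m ** k) ** s = m" using tker_lift[OF g, of m] gg by auto
  have "k ** s = idn (dm m)" using tmono_cancel[OF mm(1), of "k ** s" "idn (dm m)"] s by simp
  moreover have "t ** k ** s = zr (dm m) (cd t)" using cmp_left[OF kk(4), of s] s t(1) by simp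
  ultimately show "t = zr (cd j0) (cd t)" using t(1,2) by simp
 qed
 from pullback_epi[OF this u0(1)] u0 obtain e w where e: "tepi e" "cd e = dm u" "ar w" "dm w = dm e" "cd w = dm j0" "j0 ** w = u0 ** e" by auto
 have "j ** w = m ** (j0 ** w)" by (simp add: cmp_assoc[symmetric] del: cmp_assoc)
 also have "\<dots> = u ** e" unfolding e(6) using u0 by (simp add: cmp_assoc[symmetric] del: cmp_assoc)
 finally show thesis using that[OF e(1,2,3,4)] e(5) by simp
qed

lemma mono_epi_iso:
 assumes "tepi f" "tmono f" obtains l where "ar l" "dm l = cd f" "cd l = dm f" "l ** f = idn (dm f)" "f ** l = idn (cd f)"
proof -
 have [simp]: "ar f" using assms by simp
 obtain k where k: "tker f k" using tker_ex[of f] assms by auto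
 have c: "tcok k f" using epi_is_cok[OF assms(1) k] .
 have kk [simp]: "ar k" "cd k = dm f" "f ** k = zr (dm k) (cd f)" using k by (simp_all add: tker_def)
 have "k = zr (dm k) (dm f)" using tmono_cancel[OF assms(2), of k "zr (dm k) (dm f)"] by simp
 then have "idn (dm f) ** k = zr (dm k) (cd (idn (dm f)))" using kk by simp
 then obtain l where l: "ar l" "dm l = cd f" "cd l = dm f" "l ** f = idn (dm f)"
  using tcok_lift[OF c, of "idn (dm f)"] by auto
 have "(f ** l) ** f = idn (cd f) ** f" using l by simp
 then have "f ** l = idn (cd f)" using tepi_cancel[OF assms(1), of "f ** l" "idn (cd f)"] l by simp
 then show thesis using that l by blast
qed

text \<open>The map \<open>h\<close> induced on cohomology in degree \<open>n + 1\<close> is an epimorphism iff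
\<open>qsurj\<close> and a monomorphism iff \<open>qinj\<close>; in an abelian category both together make
it invertible.\<close>
lemma cohomology_iso_iff:
 assumes d: "cpx d" "cpx d'" and f: "cmor d f d'"
  and k: "tker (d (n+1)) k" and j: "ar j" "dm j = dm (d n)" "cd j = dm k" "k ** j = d n" and c: "tcok j c"
  and k': "tker (d' (n+1)) k'" and j': "ar j'" "dm j' = dm (d' n)" "cd j' = dm k'" "k' ** j' = d' n" and c': "tcok j' c'"
  and g: "ar g" "dm g = dm k" "cd g = dm k'" "k' ** g = f (n+1) ** k"
  and h: "ar h" "dm h = cd c" "cd h = cd c'" "h ** c = c' ** g"
 shows "(tepi h & tmono h) \<longleftrightarrow> (qsurj d f d' n & qinj d f d' n)"
proof -
 note [simp] = j(1-3) j'(1-3) g(1-3) h(1-3)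
 have dd [simp]: "ar (d m)" "cd (d m) = dm (d (m+1))" "ar (d' m)" "cd (d' m) = dm (d' (m+1))" for m
  using d by (auto simp: cpx_def)
 have ff [simp]: "ar (f m)" "dm (f m) = dm (d m)" "cd (f m) = dm (d' m)" for m using f by (auto simp: cmor_def)
 have kk [simp]: "tmono k" "ar k" "cd k = dm (d (n+1))" "d (n+1) ** k = zr (dm k) (cd (d (n+1)))"
   "tmono k'" "ar k'" "cd k' = dm (d' (n+1))" "d' (n+1) ** k' = zr (dm k') (cd (d' (n+1)))"
  using k k' unfolding tker_def by simp_all
 have cc [simp]: "tepi c" "ar c" "dm c = dm k" "tepi c'" "ar c'" "dm c' = dm k'" "c ** j = zr (dm (d n)) (cd c)" "c' ** j' = zr (dm (d' n)) (cd c')"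
  using c c' unfolding tcok_def by simp_all
 have epic: "tepi h ==> tepi (c' ** g)" unfolding h(4)[symmetric] by (rule tepi_cmp) simp_all
 have S: "qsurj d f d' n" if eh: "tepi h"
  unfolding qsurj_def
 proof (intro allI impI, elim conjE, goal_cases)
  case (1 y)
  note y = 1(1-3)
  then obtain y0 where y0 [simp]: "ar y0" "dm y0 = dm y" "cd y0 = dm k'" and y0': "k' ** y0 = y" using tker_lift[OF k', of y] y by auto
  obtain e x where e [simp]: "tepi e" "cd e = dm y" "ar x" "dm x = dm e" "cd x = dm k" and ex: "c' ** g ** x = c' ** y0 ** e"
   using pullback_epi[OF epic[OF eh], of "c' ** y0"] by auto
  have [simp]: "ar e" by (rule tepi_ar) simp
  have "c' ** (g ** x \<oplus> \<ominus> (y0 ** e)) = zr (dm e) (cd c')" using ex by simp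
  then obtain e2 w where e2 [simp]: "tepi e2" "cd e2 = dm e" "ar w" "dm w = dm e2" "cd w = dm (d' n)"
   and w: "j' ** w = (g ** x \<oplus> \<ominus> (y0 ** e)) ** e2"
   using cok_lift[OF c', of "g ** x \<oplus> \<ominus> (y0 ** e)"] by auto
  have [simp]: "ar e2" by (rule tepi_ar) simp
  have "d' n ** w = k' ** j' ** w" unfolding j'(4)[symmetric] by simp
  also have "\<dots> = (k' ** g) ** x ** e2 \<oplus> \<ominus> ((k' ** y0) ** e ** e2)" unfolding w by simp
  also have "\<dots> = f (n+1) ** k ** x ** e2 \<oplus> \<ominus> (y ** e ** e2)" unfolding g(4) y0' by simp
  finally have eq: "f (n+1) ** (k ** x ** e2) = y ** (e ** e2) \<oplus> d' n ** w"
   using y by (simp add: pls_left_commute[of "y ** e ** e2"])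
  have z: "d (n+1) ** k ** x ** e2 = zr (dm e2) (cd (d (n+1)))" using cmp_left[OF kk(4), of "x ** e2"] by simp
  show ?case
   by (rule exI[of _ "e ** e2"], rule exI[of _ "k ** x ** e2"], rule exI[of _ w]) (use eq z in \<open>auto intro!: tepi_cmp\<close>)
 qed
 have I: "qinj d f d' n" if mh: "tmono h"
  unfolding qinj_def
 proof (intro allI impI, elim conjE, goal_cases)
  case (1 x w)
  note x [simp] = 1(1-2) and dx = 1(3) and w [simp] = 1(4-6) and fx = 1(7)
  from dx obtain x0 where x0 [simp]: "ar x0" "dm x0 = dm x" "cd x0 = dm k" and x0': "k ** x0 = x"
   using tker_lift[OF k, of x] by auto
  have "k' ** g ** x0 = (k' ** g) ** x0" by simp
  also have "\<dots> = d' n ** w" unfolding g(4) using x0' fx by simp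
  also have "\<dots> = k' ** j' ** w" unfolding j'(4)[symmetric] by simp
  finally have "g ** x0 = j' ** w" by - (rule tmono_cancel[OF kk(5)], simp_all)
  then have "(c' ** g) ** x0 = zr (dm x) (cd c')" using cmp_left[OF cc(8), of w] by simp
  then have "h ** c ** x0 = zr (dm x) (cd h)" unfolding h(4)[symmetric] by (simp add: cc(8))
  then have "c ** x0 = zr (dm x) (cd c)" using tmono_cancel[OF mh, of "c ** x0" "zr (dm x) (cd c)"] by simp
  then obtain e u where e [simp]: "tepi e" "cd e = dm x" "ar u" "dm u = dm e" "cd u = dm (d n)" and u: "j ** u = x0 ** e"
   using cok_lift[OF c, of x0] by auto
  have "d n ** u = k ** j ** u" unfolding j(4)[symmetric] by simp
  also have "\<dots> = x ** e" unfolding u x0'[symmetric] by simp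
  finally show ?case
   by (intro exI[of _ e] exI[of _ u]) simp
 qed
 have E: "tepi h" if s: "qsurj d f d' n"
  unfolding tepi_def
 proof (intro conjI allI impI h(1); elim conjE)
  fix m assume m [simp]: "ar m" "dm m = cd h" and mh: "m ** h = zr (dm h) (cd m)"
  obtain e x w where e [simp]: "tepi e" "cd e = dm k'" "ar x" "dm x = dm e" "cd x = dm (d (n+1))" "ar w" "dm w = dm e" "cd w = dm (d' n)"
   and dx: "d (n+1) ** x = zr (dm e) (cd (d (n+1)))" and fx: "f (n+1) ** x = k' ** e \<oplus> d' n ** w"
   using s[unfolded qsurj_def, rule_format, of k'] by auto
  have [simp]: "ar e" by (rule tepi_ar) simp
  obtain x0 where x0 [simp]: "ar x0" "dm x0 = dm e" "cd x0 = dm k" and x0': "k ** x0 = x"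
   using tker_lift[OF k, of x] dx by auto
  have "k' ** g ** x0 = (k' ** g) ** x0" by simp
  also have "\<dots> = k' ** e \<oplus> (k' ** j') ** w" unfolding g(4) using x0' fx j'(4) by simp
  also have "\<dots> = k' ** (e \<oplus> j' ** w)" by simp
  finally have gx: "g ** x0 = e \<oplus> j' ** w" by - (rule tmono_cancel[OF kk(5)], simp_all)
  have cj: "c' ** j' ** w = zr (dm e) (cd c')" by (simp add: cc(8) cmp_assoc[symmetric] del: cmp_assoc)
  have "c' ** g ** x0 = c' ** e" unfolding gx using cj by simp
  moreover have "c' ** g ** x0 = h ** c ** x0" using h(4) by (metis cmp_assoc)
  ultimately have "m ** c' ** e = (m ** h) ** c ** x0" by simp
  then have "(m ** c') ** e = zr (dm e) (cd m)" unfolding mh by simp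
  then have "m ** c' = zr (dm k') (cd m)" using tepi_cancel[OF e(1), of "m ** c'" "zr (dm k') (cd m)"] by simp
  then show "m = zr (cd h) (cd m)" using tepi_cancel[OF cc(4), of m "zr (cd h) (cd m)"] by simp
 qed
 have M: "tmono h" if i: "qinj d f d' n"
  unfolding tmono_def
 proof (intro conjI allI impI h(1); elim conjE)
  fix t assume t [simp]: "ar t" "cd t = dm h" and ht: "h ** t = zr (dm t) (cd h)"
  obtain e s where e [simp]: "tepi e" "cd e = dm t" "ar s" "dm s = dm e" "cd s = dm k" and cs: "c ** s = t ** e"
   using pullback_epi[OF cc(1), of t] by auto
  have [simp]: "ar e" by (rule tepi_ar) simp
  have "c' ** g ** s = h ** c ** s" using h(4) by (metis cmp_assoc)
  also have "\<dots> = (h ** t) ** e" unfolding cs by simp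
  also have "\<dots> = zr (dm e) (cd c')" unfolding ht by simp
  finally obtain e2 w where e2 [simp]: "tepi e2" "cd e2 = dm e" "ar w" "dm w = dm e2" "cd w = dm (d' n)" and w: "j' ** w = g ** s ** e2"
   using cok_lift[OF c', of "g ** s"] by auto
  have [simp]: "ar e2" by (rule tepi_ar) simp
  have "f (n+1) ** k ** s ** e2 = (k' ** g) ** s ** e2" unfolding g(4) by simp
  also have "\<dots> = (k' ** j') ** w" using w by simp
  finally have fx: "f (n+1) ** k ** s ** e2 = d' n ** w" unfolding j'(4) .
  have z: "d (n+1) ** k ** s ** e2 = zr (dm e2) (cd (d (n+1)))" using cmp_left[OF kk(4), of "s ** e2"] by simp
  obtain e3 u where e3 [simp]: "tepi e3" "cd e3 = dm e2" "ar u" "dm u = dm e3" "cd u = dm (d n)" and u: "d n ** u = k ** s ** e2 ** e3"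
   using i[unfolded qinj_def, rule_format, of "k ** s ** e2" w] fx z by auto
  have [simp]: "ar e3" by (rule tepi_ar) simp
  have "k ** j ** u = k ** s ** e2 ** e3" unfolding u[symmetric] j(4)[symmetric] by simp
  then have "j ** u = s ** e2 ** e3" by - (rule tmono_cancel[OF kk(1)], simp_all)
  then have "c ** s ** e2 ** e3 = zr (dm e3) (cd c)" using cmp_left[OF cc(7), of u] by simp
  then have "t ** (e ** e2 ** e3) = zr (dm e3) (cd c)" using cmp_left[OF cs, of "e2 ** e3"] by simp
  then show "t = zr (dm t) (dm h)" by - (rule tepi_cancel[of "e ** e2 ** e3"], simp_all add: tepi_cmp)
 qed
 show ?thesis using S I E M by blast
qed

definition st :: "('o, 'm) cochain => ('o, 'm) gmap" where
 "st X n = Some (deg X n, diff X n, deg X (n+1))"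
definition stm :: "('o, 'm) cochain => ('o, 'm) cochain => (int => 'm) => ('o, 'm) gmap" where
 "stm X Y f n = Some (deg X n, f n, deg Y n)"

lemma cpx_st: "cpx (st X) \<longleftrightarrow> X \<in> Obj (complex_category A)"
proof
 show "cpx (st X)" if X: "X \<in> Obj (complex_category A)"
  using cochainD[OF X] cochainD(3)[OF X, simplified] cochainD(2)[OF X, of "_+1", simplified]
  unfolding cpx_def st_def by (auto simp: cmp_def zr_def)
next
 assume c: "cpx (st X)"
 have "deg X n \<in> Obj A & diff X n \<in> Hom A (deg X n) (deg X (n+1)) &
    diff X (n+1) \<cdot> diff X n = Zero A (deg X n) (deg X (n+1+1))" for n
 proof -
  have o: "deg X m \<in> Obj A" "diff X m \<in> Hom A (deg X m) (deg X (m+1))" for m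
   using c[unfolded cpx_def, rule_format, of m] by (simp_all add: st_def)
  have "st X (n+1) ** st X n = Some (deg X n, diff X (n+1) \<cdot> diff X n, deg X (n+1+1))"
   unfolding st_def by (rule cmp_Some) (intro o)+
  then show ?thesis using c[unfolded cpx_def, rule_format, of n] o by (simp add: st_def zr_def)
 qed
 then show "X \<in> Obj (complex_category A)" by (simp add: complex_category_def)
qed

lemma cmor_st:
 assumes X: "X \<in> Obj (complex_category A)" and Y: "Y \<in> Obj (complex_category A)"
 shows "cmor (st X) (stm X Y f) (st Y) \<longleftrightarrow> f \<in> Hom (complex_category A) X Y"
 using cochainD(1,2)[OF X] cochainD(1,2)[OF Y]
 by (auto simp: cmor_def st_def stm_def complex_category_def cmp_def)

lemma iso_Some:
 assumes "x \<in> Obj A" "y \<in> Obj A" "f \<in> Hom A x y"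
 shows "is_iso A x y f \<longleftrightarrow> tepi (Some (x, f, y)) & tmono (Some (x, f, y))"
proof
 assume "is_iso A x y f"
 then obtain g where g: "g \<in> Hom A y x" "g \<cdot> f = Ident A x" "f \<cdot> g = Ident A y" by (auto simp: is_iso_def)
 let ?f = "Some (x, f, y)" and ?g = "Some (y, g, x)"
 have e: "?g ** ?f = idn x" "?f ** ?g = idn y" "ar ?f" "ar ?g" using assms g by (simp_all add: cmp_Some idn_def)
 have "h = zr y (cd h)" if h: "ar h" "dm h = y" "h ** ?f = zr x (cd h)" for h
 proof -
  have "h = (h ** ?f) ** ?g" using e(2) h(1,2) by simp
  also have "\<dots> = zr y (cd h)" unfolding h(3) using e(4) h(1) assms by simp
  finally show ?thesis .
 qed
 moreover have "h = zr (dm h) x" if h: "ar h" "cd h = x" "?f ** h = zr (dm h) y" for h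
 proof -
  have "h = (?g ** ?f) ** h" unfolding e(1) using h(1,2) by simp
  also have "\<dots> = zr (dm h) x" using h(3) e(4) h(1) assms by simp
  finally show ?thesis .
 qed
 ultimately show "tepi ?f & tmono ?f" unfolding tepi_def tmono_def using e(3) assms by auto
next
 assume "tepi (Some (x, f, y)) & tmono (Some (x, f, y))"
 then obtain l where l: "ar l" "dm l = y" "cd l = x" "l ** Some (x, f, y) = idn x" "Some (x, f, y) ** l = idn y"
  using mono_epi_iso[of "Some (x, f, y)"] by auto
 then obtain l' where "l = Some (y, l', x)" "l' \<in> Hom A y x" by (auto elim!: arE)
 then show "is_iso A x y f" using l assms by (auto simp: is_iso_def cmp_Some idn_def)
qed

lemma quasi_iso_iff_qi:
 assumes X: "X \<in> Obj (complex_category A)" and Y: "Y \<in> Obj (complex_category A)" and f: "f \<in> Hom (complex_category A) X Y"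
 shows "f \<in> quasi_iso A X Y \<longleftrightarrow> qi (st X) (stm X Y f) (st Y)"
proof -
 note dX = cochainD[OF X] and dY = cochainD[OF Y] and ff = cochain_mapD[OF f]
 have cX: "cpx (st X)" and cY: "cpx (st Y)" and cf: "cmor (st X) (stm X Y f) (st Y)"
  using X Y f cpx_st cmor_st by auto
 let ?P = "%m. \<exists>K k H c K' k' H' c'. is_cohomology A X m K k H c & is_cohomology A Y m K' k' H' c' &
    (\<exists>g \<in> Hom A K K'. k' \<cdot> g = f m \<cdot> k & (\<exists>h. is_iso A H H' h & h \<cdot> c = c' \<cdot> g))"
 have coh: "\<exists>K k H c. is_cohomology A Z (n+1) K k H c" if Z: "Z \<in> Obj (complex_category A)" for Z n
 proof -
  note dZ = cochainD[OF Z]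
  obtain K k where k: "is_kernel A (deg Z (n+1)) (deg Z (n+1+1)) (diff Z (n+1)) K k"
   using kernels[OF dZ(1) dZ(1) dZ(2)] by blast
  obtain j where j: "j \<in> Hom A (deg Z n) K" "k \<cdot> j = diff Z n"
   using k dZ(1,2,3) unfolding is_kernel_def by blast
  have "K \<in> Obj A" using k by (simp add: is_kernel_def)
  then obtain H c where "is_cokernel A (deg Z n) K j H c" using cokernels[OF dZ(1) _ j(1)] by blast
  then show ?thesis using k j unfolding is_cohomology_def by simp blast
 qed
 have star: "\<exists>j. tker (st Z (n+1)) (Some (K, k, deg Z (n+1))) & ar j & dm j = dm (st Z n) & cd j = K &
    Some (K, k, deg Z (n+1)) ** j = st Z n & tcok j (Some (K, c, H)) & K \<in> Obj A & H \<in> Obj A & c \<in> Hom A K H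
    & k \<in> Hom A K (deg Z (n+1))"
  if Z: "Z \<in> Obj (complex_category A)" and h: "is_cohomology A Z (n+1) K k H c" for Z n K k H c
 proof -
  note dZ = cochainD[OF Z]
  from h obtain j where k: "is_kernel A (deg Z (n+1)) (deg Z (n+1+1)) (diff Z (n+1)) K k"
   and j: "j \<in> Hom A (deg Z n) K" "k \<cdot> j = diff Z n" and c: "is_cokernel A (deg Z n) K j H c"
   unfolding is_cohomology_def by auto
  have kk: "K \<in> Obj A" "k \<in> Hom A K (deg Z (n+1))" using k by (simp_all add: is_kernel_def)
  have cc: "H \<in> Obj A" "c \<in> Hom A K H" using c by (simp_all add: is_cokernel_def)
  show ?thesis
   using kernel_tker[OF dZ(1) dZ(1) dZ(2) k] cokernel_tcok[OF dZ(1) kk(1) j(1) c] kk cc j dZ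
   by (intro exI[of _ "Some (deg Z n, j, K)"]) (auto simp: st_def cmp_Some)
 qed
 have main: "?P (n+1) \<longleftrightarrow> qsurj (st X) (stm X Y f) (st Y) n & qinj (st X) (stm X Y f) (st Y) n" for n
 proof
  assume "?P (n+1)"
  then obtain K k H c K' k' H' c' g h where h: "is_cohomology A X (n+1) K k H c" "is_cohomology A Y (n+1) K' k' H' c'"
   and g: "g \<in> Hom A K K'" "k' \<cdot> g = f (n+1) \<cdot> k" and hi: "is_iso A H H' h" "h \<cdot> c = c' \<cdot> g" by blast
  obtain j where sX: "tker (st X (n+1)) (Some (K, k, deg X (n+1)))" "ar j" "dm j = dm (st X n)" "cd j = K"
    "Some (K, k, deg X (n+1)) ** j = st X n" "tcok j (Some (K, c, H))" "K \<in> Obj A" "H \<in> Obj A" "c \<in> Hom A K H" "k \<in> Hom A K (deg X (n+1))"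
   using star[OF X h(1)] by blast
  obtain j' where sY: "tker (st Y (n+1)) (Some (K', k', deg Y (n+1)))" "ar j'" "dm j' = dm (st Y n)" "cd j' = K'"
    "Some (K', k', deg Y (n+1)) ** j' = st Y n" "tcok j' (Some (K', c', H'))" "K' \<in> Obj A" "H' \<in> Obj A" "c' \<in> Hom A K' H'" "k' \<in> Hom A K' (deg Y (n+1))"
   using star[OF Y h(2)] by blast
  have hh: "h \<in> Hom A H H'" using hi by (simp add: is_iso_def)
  show "qsurj (st X) (stm X Y f) (st Y) n & qinj (st X) (stm X Y f) (st Y) n"
   using cohomology_iso_iff[OF cX cY cf sX(1) sX(2,3) _ sX(5) sX(6) sY(1) sY(2,3) _ sY(5) sY(6), of "Some (K, g, K')" "Some (H, h, H')"]
    iso_Some[OF sX(8) sY(8) hh] sX(4,7-10) sY(4,7-10) g hi hh dX(1) dY(1) ff(1) by (simp add: stm_def cmp_Some)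
 next
  assume q: "qsurj (st X) (stm X Y f) (st Y) n & qinj (st X) (stm X Y f) (st Y) n"
  obtain K k H c K' k' H' c' where h: "is_cohomology A X (n+1) K k H c" "is_cohomology A Y (n+1) K' k' H' c'"
   using coh[OF X] coh[OF Y] by metis
  obtain j where sX: "tker (st X (n+1)) (Some (K, k, deg X (n+1)))" "ar j" "dm j = dm (st X n)" "cd j = K"
    "Some (K, k, deg X (n+1)) ** j = st X n" "tcok j (Some (K, c, H))" "K \<in> Obj A" "H \<in> Obj A" "c \<in> Hom A K H" "k \<in> Hom A K (deg X (n+1))"
   using star[OF X h(1)] by blast
  obtain j' where sY: "tker (st Y (n+1)) (Some (K', k', deg Y (n+1)))" "ar j'" "dm j' = dm (st Y n)" "cd j' = K'"
    "Some (K', k', deg Y (n+1)) ** j' = st Y n" "tcok j' (Some (K', c', H'))" "K' \<in> Obj A" "H' \<in> Obj A" "c' \<in> Hom A K' H'" "k' \<in> Hom A K' (deg Y (n+1))"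
   using star[OF Y h(2)] by blast
  let ?k = "Some (K, k, deg X (n+1))" and ?k' = "Some (K', k', deg Y (n+1))" and ?f = "stm X Y f"
  have [simp]: "ar (st X m)" "dm (st X m) = deg X m" "cd (st X m) = deg X (m+1)" "ar (st Y m)" "dm (st Y m) = deg Y m" "cd (st Y m) = deg Y (m+1)"
    "ar (?f m)" "dm (?f m) = deg X m" "cd (?f m) = deg Y m" for m
   using dX dY ff by (simp_all add: st_def stm_def)
  have fd: "st Y m ** ?f m = ?f (m+1) ** st X m" for m using cf by (simp add: cmor_def)
  have ak: "ar ?k" "ar ?k'" using sX sY dX(1) dY(1) by simp_all
  have "st Y (n+1) ** ?f (n+1) ** ?k = (?f (n+1+1) ** st X (n+1)) ** ?k" unfolding fd[symmetric] by simp
  also have "\<dots> = zr K (deg Y (n+1+1))" using sX(1,7) ak dX dY unfolding tker_def by simp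
  finally have "st Y (n+1) ** ?f (n+1) ** ?k = zr (dm (?f (n+1) ** ?k)) (cd (st Y (n+1)))" using ak by simp
  moreover have "ar (?f (n+1) ** ?k)" "cd (?f (n+1) ** ?k) = dm (st Y (n+1))" using ak by simp_all
  ultimately obtain g where g: "ar g" "dm g = dm (?f (n+1) ** ?k)" "cd g = dm ?k'" "?k' ** g = ?f (n+1) ** ?k"
   using tker_lift[OF sY(1), of "?f (n+1) ** ?k"] by auto
  have g2: "dm g = K" "cd g = K'" using g ak by simp_all
  have "?k' ** g ** j = (?k' ** g) ** j" by simp
  also have "\<dots> = ?f (n+1) ** st X n" unfolding g(4) using sX(5) by simp
  also have "\<dots> = ?k' ** j' ** ?f n" unfolding fd[symmetric] cmp_left[OF sY(5)] ..
  finally have "g ** j = j' ** ?f n" using sX sY g g2 ak by - (rule tmono_cancel[of ?k'], auto simp: tker_def)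
  then have "(Some (K', c', H') ** g) ** j = (Some (K', c', H') ** j') ** ?f n" by simp
  also have "\<dots> = zr (dm j) H'" using sY(6) sX(3) sY(3,4) unfolding tcok_def by simp
  finally obtain h' where h': "ar h'" "dm h' = H" "cd h' = H'" "h' ** Some (K, c, H) = Some (K', c', H') ** g"
   using tcok_lift[OF sX(6), of "Some (K', c', H') ** g"] sX(2,3,4,7-9) sY(7-9) g(1) g2 by auto
  have "tepi h' & tmono h'"
   using cohomology_iso_iff[OF cX cY cf sX(1) sX(2,3) _ sX(5) sX(6) sY(1) sY(2,3) _ sY(5) sY(6) g(1) _ g(3,4) h'(1)] q g2 h' sX(4) sY(4) by simp
  moreover obtain g' h'' where gh: "g = Some (K, g', K')" "g' \<in> Hom A K K'" "h' = Some (H, h'', H')" "h'' \<in> Hom A H H'"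
   using g(1) g2 h' by (auto elim!: arE)
  ultimately have "is_iso A H H' h''" using iso_Some[OF sX(8) sY(8) gh(4)] by simp
  moreover have "h'' \<cdot> c = c' \<cdot> g'" using h'(4) gh sX sY by (simp add: cmp_Some)
  moreover have "k' \<cdot> g' = f (n+1) \<cdot> k" using g(4) gh sX sY dX(1) dY(1) ff(1) by (simp add: cmp_Some stm_def)
  ultimately show "?P (n+1)" using h gh by blast
 qed
 have reindex: "(\<forall>m::int. R m) \<longleftrightarrow> (\<forall>n. R (n+1))" for R by (metis diff_add_cancel)
 have "f \<in> quasi_iso A X Y \<longleftrightarrow> (\<forall>m. ?P m)" using f by (simp add: quasi_iso_def)
 also have "\<dots> \<longleftrightarrow> (\<forall>n. ?P (n+1))" by (rule reindex)
 finally show ?thesis unfolding main qi_def .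
qed

end

section \<open>Complexes of tagged arrows\<close>

context preadditive_category
begin

text \<open>Cancellation of a summand against its negative when other summands stand in between.\<close>
lemma canc:
 assumes "ar f" "ar g" "dm f = dm g" "cd f = cd g"
 shows "f \<oplus> g \<oplus> \<ominus> f = g" "\<ominus> f \<oplus> g \<oplus> f = g"
  "ar h ==> dm h = dm g ==> cd h = cd g ==> f \<oplus> g \<oplus> \<ominus> f \<oplus> h = g \<oplus> h"
  "ar h ==> dm h = dm g ==> cd h = cd g ==> \<ominus> f \<oplus> g \<oplus> f \<oplus> h = g \<oplus> h"
proof -
 show 1: "f \<oplus> g \<oplus> \<ominus> f = g" "\<ominus> f \<oplus> g \<oplus> f = g"
  using assms by (simp_all add: pls_left_commute[of _ g])
 show "ar h ==> dm h = dm g ==> cd h = cd g ==> f \<oplus> g \<oplus> \<ominus> f \<oplus> h = g \<oplus> h"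
  using assms by (simp add: pls_left_commute[of g])
 show "ar h ==> dm h = dm g ==> cd h = cd g ==> \<ominus> f \<oplus> g \<oplus> f \<oplus> h = g \<oplus> h"
  using assms by (simp add: pls_left_commute[of g])
qed

lemma cpxD:
 assumes "cpx d"
 shows "ar (d n)" "cd (d n) = dm (d (n+1))" "m = n+1 ==> d m ** d n = zr (dm (d n)) (dm (d (m+1)))"
  "m = n+1 ==> ar t ==> cd t = dm (d n) ==> d m ** d n ** t = zr (dm t) (dm (d (m+1)))"
proof -
 show 1: "ar (d n)" "cd (d n) = dm (d (n+1))" for n using assms by (auto simp: cpx_def)
 show 2: "m = n+1 ==> d m ** d n = zr (dm (d n)) (dm (d (m+1)))" using assms by (auto simp: cpx_def)
 show "m = n+1 ==> ar t ==> cd t = dm (d n) ==> d m ** d n ** t = zr (dm t) (dm (d (m+1)))"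
  using cmp_left[OF 2, of t] 1 by simp
qed

lemma cpxI:
 assumes "!!n. ar (d n)" "!!n. cd (d n) = dm (d (n+1))" "!!n. d (n+1) ** d n = zr (dm (d n)) (dm (d (n+1+1)))"
 shows "cpx d"
 unfolding cpx_def
proof (intro allI conjI assms)
 fix n show "d (n+1) ** d n = zr (dm (d n)) (cd (d (n+1)))" using assms(3)[of n] assms(2)[of "n+1"] by simp
qed

lemma cmorD:
 assumes "cmor d f d'"
 shows "ar (f n)" "dm (f n) = dm (d n)" "cd (f n) = dm (d' n)" "d' n ** f n = f (n+1) ** d n"
  "d' n ** f n ** t = f (n+1) ** d n ** t"
proof -
 show 1: "ar (f n)" "dm (f n) = dm (d n)" "cd (f n) = dm (d' n)" "d' n ** f n = f (n+1) ** d n"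
  using assms by (auto simp: cmor_def)
 show "d' n ** f n ** t = f (n+1) ** d n ** t" using cmp_left[OF 1(4), of t] by simp
qed

lemma cmorI:
 "(!!n. ar (f n)) ==> (!!n. dm (f n) = dm (d n)) ==> (!!n. cd (f n) = dm (d' n)) ==>
  (!!n. d' n ** f n = f (n+1) ** d n) ==> cmor d f d'"
 by (auto simp: cmor_def)

lemma cmor_comp: "cmor d f d' ==> cmor d' g d'' ==> cmor d (%n. g n ** f n) d''"
 by (rule cmorI) (simp_all add: cmorD)

lemma cmor_idn: "cpx d ==> cmor d (%n. idn (dm (d n))) d"
 by (rule cmorI) (simp_all add: cpxD)

text \<open>The shift by \<open>k\<close> with the sign that is correct for odd \<open>k\<close>; only \<open>k =
1\<close> and \<open>k = -1\<close> are used.\<close>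
definition shk :: "int => ('o, 'm) gmap => ('o, 'm) gmap" where
 "shk k d n = \<ominus> (d (n + k))"

lemma shk_simps:
 assumes "cpx d"
 shows "ar (shk k d n)" "dm (shk k d n) = dm (d (n + k))" "cd (shk k d n) = dm (d (n + k+1))"
  "shk k d n ** t = \<ominus> (d (n + k) ** t)" "t ** shk k d n = \<ominus> (t ** d (n + k))"
 using cpxD[OF assms] by (simp_all add: shk_def)

lemma shk_cpx: "cpx d ==> cpx (shk k d)"
 by (rule cpxI) (simp_all add: shk_simps cpxD ac_simps)

lemma shk_cmor: "cpx d ==> cpx d' ==> cmor d f d' ==> cmor (shk k d) (%n. f (n + k)) (shk k d')"
 by (rule cmorI) (simp_all add: shk_simps cmorD cpxD ac_simps)

lemma shk_qi:
 assumes d: "cpx d" "cpx d'" and f: "cmor d f d'" and q: "qi d f d'"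
 shows "qi (shk k d) (%n. f (n + k)) (shk k d')"
 unfolding qi_def
proof (intro allI conjI)
 fix n
 note [simp] = cpxD(1,2)[OF d(1)] cpxD(1,2)[OF d(2)] cmorD(1-3)[OF f] shk_simps[OF d(1)] shk_simps[OF d(2)]
 have nk: "n+1 + k = n + k+1" by simp
 have zz: "\<ominus> t = zr x y \<longleftrightarrow> t = zr x y" if "ar t" for t x y
  using that by (metis ng_ng ng_zr)
 show "qsurj (shk k d) (%n. f (n + k)) (shk k d') n"
  unfolding qsurj_def nk
 proof (intro allI impI, elim conjE, goal_cases)
  case (1 y)
  note y = 1(1-3)
  then have y': "cd y = dm (d' (n + k+1))" "d' (n + k+1) ** y = zr (dm y) (cd (d' (n + k+1)))"
   by (simp_all add: zz nk)
  from q[unfolded qi_def qsurj_def, THEN spec[of _ "n + k"], THEN conjunct1, rule_format, of y] y(1) y'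
  obtain e x w where w: "tepi e" "cd e = dm y" "ar x" "dm x = dm e" "cd x = dm (d (n + k+1))"
    "d (n + k+1) ** x = zr (dm e) (cd (d (n + k+1)))"
    "ar w" "dm w = dm e" "cd w = dm (d' (n + k))" "f (n + k+1) ** x = y ** e \<oplus> d' (n + k) ** w" by blast
  then show ?case
   by - (rule exI[of _ e], rule exI[of _ x], rule exI[of _ "\<ominus> w"], simp add: nk)
 qed
 show "qinj (shk k d) (%n. f (n + k)) (shk k d') n"
  unfolding qinj_def nk
 proof (intro allI impI, elim conjE, goal_cases)
  case (1 x w)
  note x = 1(1-3) and w = 1(4-7)
  then have "cd x = dm (d (n + k+1))" "d (n + k+1) ** x = zr (dm x) (cd (d (n + k+1)))"
   "f (n + k+1) ** x = d' (n + k) ** \<ominus> w" "cd (\<ominus> w) = dm (d' (n + k))" by (simp_all add: zz nk)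
  with q[unfolded qi_def qinj_def, THEN spec[of _ "n + k"], THEN conjunct2, rule_format, of x "\<ominus> w"] x(1) w(1,2)
  obtain e u where "tepi e" "cd e = dm x" "ar u" "dm u = dm e" "cd u = dm (d (n + k))" "d (n + k) ** u = x ** e" by auto
  then show ?case
   by - (rule exI[of _ e], rule exI[of _ "\<ominus> u"], simp add: nk x(1))
 qed
qed

lemma qi_iso:
 assumes d: "cpx d" "cpx d'" and f: "cmor d f d'"
  and g: "!!n. ar (g n) & dm (g n) = dm (d' n) & cd (g n) = dm (d n) & g n ** f n = idn (dm (d n)) & f n ** g n = idn (dm (d' n))"
 shows "qi d f d'"
proof -
 note [simp] = cpxD[OF d(1)] cpxD[OF d(2)] cmorD[OF f]
 have g1 [simp]: "ar (g n)" "dm (g n) = dm (d' n)" "cd (g n) = dm (d n)" "g n ** f n = idn (dm (d n))" "f n ** g n = idn (dm (d' n))" for n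
  using g by auto
 have gg: "g n ** f n ** t = t" if "ar t" "cd t = dm (d n)" for n t using cmp_left[OF g1(4), of n t] that by simp
 have fg: "f n ** g n ** t = t" if "ar t" "cd t = dm (d' n)" for n t using cmp_left[OF g1(5), of n t] that by simp
 have dg: "d n ** g n ** t = g (n+1) ** d' n ** t" if t: "ar t" "cd t = dm (d' n)" for n t
 proof -
  have "d n ** g n ** t = g (n+1) ** f (n+1) ** d n ** g n ** t" using t by (simp add: gg)
  also have "\<dots> = g (n+1) ** d' n ** f n ** g n ** t" by simp
  also have "\<dots> = g (n+1) ** d' n ** t" using fg[OF t] by simp
  finally show ?thesis .
 qed
 have s: "qsurj d f d' n" for n
  unfolding qsurj_def
 proof (intro allI impI, elim conjE, goal_cases)
  case (1 y)
  note y [simp] = 1(1-2) and dy = 1(3)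
  show ?case
   by (rule exI[of _ "idn (dm y)"], rule exI[of _ "g (n+1) ** y"], rule exI[of _ "zr (dm y) (dm (d' n))"])
    (simp add: fg dg[of y "n+1", simplified] dy[simplified])
 qed
 moreover have "qinj d f d' n" for n
  unfolding qinj_def
 proof (intro allI impI, elim conjE)
  fix x w assume x [simp]: "ar x" "cd x = dm (d (n+1))" and w [simp]: "ar w" "dm w = dm x" "cd w = dm (d' n)"
   and fx: "f (n+1) ** x = d' n ** w"
  have "x = g (n+1) ** f (n+1) ** x" by (simp add: gg)
  also have "\<dots> = d n ** g n ** w" unfolding fx by (simp add: dg)
  finally have e: "d n ** g n ** w = x" ..
  show "\<exists>e u. tepi e & cd e = dm x & ar u & dm u = dm e & cd u = dm (d n) & d n ** u = x ** e"
   by - (rule exI[of _ "idn (dm x)"], rule exI[of _ "g n ** w"], simp add: e)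
 qed
 ultimately show ?thesis by (simp add: qi_def)
qed

end

context abelian_category
begin

text \<open>Column \<open>(u, w)\<close> and, below, row \<open>(s, t)\<close> with respect to chosen biproducts.\<close>
definition pr :: "('o, 'm) tarr => ('o, 'm) tarr => ('o, 'm) tarr" where
 "pr u w = bj (cd u) (cd w) ** u \<oplus> bi (cd u) (cd w) ** w"
definition row :: "('o, 'm) tarr => ('o, 'm) tarr => ('o, 'm) tarr" where
 "row s t = s ** bp (dm s) (dm t) \<oplus> t ** bq (dm s) (dm t)"

lemma ar_pr [simp]: "ar (pr u w) \<longleftrightarrow> ar u & ar w & dm u = dm w"
 "ar u ==> ar w ==> dm u = dm w ==> dm (pr u w) = dm u"
 "ar u ==> ar w ==> dm u = dm w ==> cd (pr u w) = bo (cd u) (cd w)"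
 unfolding pr_def by auto

lemma ar_row [simp]: "ar (row s t) \<longleftrightarrow> ar s & ar t & cd s = cd t"
 "ar s ==> ar t ==> cd s = cd t ==> dm (row s t) = bo (dm s) (dm t)"
 "ar s ==> ar t ==> cd s = cd t ==> cd (row s t) = cd s"
 unfolding row_def by auto

lemma pr_cmp [simp]: "ar u ==> ar w ==> ar h ==> dm u = cd h ==> dm w = cd h ==> pr u w ** h = pr (u ** h) (w ** h)"
 by (simp add: pr_def)

lemma cmp_row [simp]: "ar s ==> ar t ==> ar h ==> cd s = dm h ==> cd t = dm h ==> h ** row s t = row (h ** s) (h ** t)"
 by (simp add: row_def)

lemma row_pr [simp]: "ar s ==> ar t ==> ar u ==> ar w ==> dm s = cd u ==> dm t = cd w ==> cd s = cd t ==> dm u = dm w ==>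
  row s t ** pr u w = s ** u \<oplus> t ** w"
 by (simp add: pr_def row_def)

lemma bp_pr [simp]: "ar u ==> ar w ==> dm u = dm w ==> cd u = x ==> cd w = y ==> bp x y ** pr u w = u"
 "ar u ==> ar w ==> dm u = dm w ==> cd u = x ==> cd w = y ==> bq x y ** pr u w = w"
 by (auto simp: pr_def)

lemma row_bi [simp]: "ar s ==> ar t ==> cd s = cd t ==> dm s = x ==> dm t = y ==> row s t ** bj x y = s"
 "ar s ==> ar t ==> cd s = cd t ==> dm s = x ==> dm t = y ==> row s t ** bi x y = t"
 by (auto simp: row_def)

lemma pr_pls [simp]: "ar u ==> ar w ==> ar u' ==> ar w' ==> dm u = dm w ==> dm u' = dm w ==> dm w' = dm w ==> cd u = cd u' ==> cd w = cd w' ==>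
  pr u w \<oplus> pr u' w' = pr (u \<oplus> u') (w \<oplus> w')"
 by (simp add: pr_def pls_left_commute)

lemma row_pls [simp]: "ar u ==> ar w ==> ar u' ==> ar w' ==> cd u = cd w ==> cd u' = cd w ==> cd w' = cd w ==> dm u = dm u' ==> dm w = dm w' ==>
  row u w \<oplus> row u' w' = row (u \<oplus> u') (w \<oplus> w')"
 by (simp add: row_def pls_left_commute)

lemma pr_ng [simp]: "ar u ==> ar w ==> dm u = dm w ==> \<ominus> pr u w = pr (\<ominus> u) (\<ominus> w)"
 by (simp add: pr_def)

lemma row_ng [simp]: "ar u ==> ar w ==> cd u = cd w ==> \<ominus> row u w = row (\<ominus> u) (\<ominus> w)"
 by (simp add: row_def)

lemma zr_bo [simp]: "x \<in> Obj A ==> y \<in> Obj A ==> z \<in> Obj A ==> pr (zr z x) (zr z y) = zr z (bo x y)"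
 "x \<in> Obj A ==> y \<in> Obj A ==> z \<in> Obj A ==> row (zr x z) (zr y z) = zr (bo x y) z"
 by (simp_all add: pr_def row_def)

lemma bo_expand:
 assumes "x \<in> Obj A" "y \<in> Obj A"
 shows "idn (bo x y) = pr (row (idn x) (zr y x)) (row (zr x y) (idn y))"
  "bi x y = pr (zr y x) (idn y)" "bp x y = row (idn x) (zr y x)" "bj x y = pr (idn x) (zr x y)" "bq x y = row (zr x y) (idn y)"
 using assms by (simp_all add: pr_def row_def)

lemma pr_surj: assumes "ar u" "cd u = bo x y" "x \<in> Obj A" "y \<in> Obj A" shows "u = pr (bp x y ** u) (bq x y ** u)"
proof -
 have "bj x y ** bp x y ** u \<oplus> bi x y ** bq x y ** u = (bj x y ** bp x y \<oplus> bi x y ** bq x y) ** u"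
  by (simp only: pls_cmp cmp_assoc)
 also have "\<dots> = u" unfolding bip(18)[OF assms(3,4)] using assms by simp
 finally show ?thesis using assms by (simp add: pr_def)
qed

lemma prE:
 assumes "ar u" "cd u = bo x y" "x \<in> Obj A" "y \<in> Obj A"
 obtains v w where "u = pr v w" "ar v" "ar w" "dm v = dm u" "dm w = dm u" "cd v = x" "cd w = y"
 using pr_surj[OF assms] that assms by (metis ar_cmp bip(8-13) dc_cmp)

lemma pr_inject: "ar u ==> ar w ==> ar u' ==> ar w' ==> dm u = dm w ==> dm u' = dm w' ==> cd u = cd u' ==> cd w = cd w' ==>
  pr u w = pr u' w' \<longleftrightarrow> u = u' & w = w'"
 by (metis bp_pr)

lemma pr_eq_zr: "ar u ==> ar w ==> dm u = z ==> dm w = z ==> cd u = x ==> cd w = y ==>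
  pr u w = zr z (bo x y) \<longleftrightarrow> u = zr z x & w = zr z y"
 using pr_inject[of u w "zr z x" "zr z y"] by auto

definition diag2 :: "('o, 'm) tarr => ('o, 'm) tarr => ('o, 'm) tarr" where
 "diag2 a b = pr (row a (zr (dm b) (cd a))) (row (zr (dm a) (cd b)) b)"

lemma ar_diag2 [simp]: "ar a ==> ar b ==> ar (diag2 a b)"
 "ar a ==> ar b ==> dm (diag2 a b) = bo (dm a) (dm b)" "ar a ==> ar b ==> cd (diag2 a b) = bo (cd a) (cd b)"
 by (simp_all add: diag2_def)

lemma diag2_pr [simp]: "ar a ==> ar b ==> ar u ==> ar w ==> dm a = cd u ==> dm b = cd w ==> dm u = dm w ==>
  diag2 a b ** pr u w = pr (a ** u) (b ** w)"
 by (simp add: diag2_def)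

lemma row_diag2 [simp]: "ar a ==> ar b ==> ar s ==> ar t ==> cd a = dm s ==> cd b = dm t ==> cd s = cd t ==>
  row s t ** diag2 a b = row (s ** a) (t ** b)"
 by (simp add: diag2_def)

lemma diag2_diag2 [simp]: "ar a ==> ar b ==> ar c ==> ar e ==> dm a = cd c ==> dm b = cd e ==>
  diag2 a b ** diag2 c e = diag2 (a ** c) (b ** e)"
 by (simp add: diag2_def)

lemma diag2_pls: "ar a ==> ar b ==> ar c ==> ar e ==> dm a = dm c ==> cd a = cd c ==> dm b = dm e ==> cd b = cd e ==>
  diag2 a b \<oplus> diag2 c e = diag2 (a \<oplus> c) (b \<oplus> e)"
 by (simp add: diag2_def)

lemma diag2_ng: "ar a ==> ar b ==> \<ominus> diag2 a b = diag2 (\<ominus> a) (\<ominus> b)"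
 by (simp add: diag2_def)

lemma diag2_idn: "x \<in> Obj A ==> y \<in> Obj A ==> diag2 (idn x) (idn y) = idn (bo x y)"
 by (simp add: diag2_def bo_expand)

lemma diag2_zr: "x \<in> Obj A ==> y \<in> Obj A ==> x' \<in> Obj A ==> y' \<in> Obj A ==> diag2 (zr x x') (zr y y') = zr (bo x y) (bo x' y')"
 by (simp add: diag2_def)

lemma diag2_bi [simp]: "ar a ==> ar b ==> dm a = x ==> dm b = y ==> diag2 a b ** bi x y = bi (cd a) (cd b) ** b"
 "ar a ==> ar b ==> cd a = x ==> cd b = y ==> bp x y ** diag2 a b = a ** bp (dm a) (dm b)"
 by (simp_all add: bo_expand) (auto simp: diag2_def)

section \<open>Twisted sums\<close>

text \<open>The sum of \<open>d\<close> and \<open>d'\<close> with differential \<open>((d, 0), (\<phi>, d'))\<close>.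
Cones, fibres and direct sums are all of this form, which lets one chase serve for three constructions.\<close>
definition tw :: "('o, 'm) gmap => ('o, 'm) gmap => ('o, 'm) gmap => ('o, 'm) gmap" where
 "tw d \<phi> d' n = pr (row (d n) (zr (dm (d' n)) (cd (d n)))) (row (\<phi> n) (d' n))"

definition twist :: "('o, 'm) gmap => ('o, 'm) gmap => ('o, 'm) gmap => bool" where
 "twist d \<phi> d' \<longleftrightarrow> cpx d & cpx d' & (\<forall>n. ar (\<phi> n) & dm (\<phi> n) = dm (d n) & cd (\<phi> n) = dm (d' (n+1)) &
   d' (n+1) ** \<phi> n = \<ominus> (\<phi> (n+1) ** d n))"

lemma twistD:
 assumes "twist d \<phi> d'"
 shows "cpx d" "cpx d'" "ar (\<phi> n)" "dm (\<phi> n) = dm (d n)" "cd (\<phi> n) = dm (d' (n+1))"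
  "m = n+1 ==> d' m ** \<phi> n = \<ominus> (\<phi> m ** d n)" "m = n+1 ==> d' m ** \<phi> n ** t = \<ominus> (\<phi> m ** d n ** t)"
proof -
 show 1: "cpx d" "cpx d'" "ar (\<phi> n)" "dm (\<phi> n) = dm (d n)" "cd (\<phi> n) = dm (d' (n+1))"
  "m = n+1 ==> d' m ** \<phi> n = \<ominus> (\<phi> m ** d n)" using assms unfolding twist_def by auto
 show "m = n+1 ==> d' m ** \<phi> n ** t = \<ominus> (\<phi> m ** d n ** t)" using cmp_left[OF 1(6), of t] by simp
qed

lemma tw_ar:
 assumes "twist d \<phi> d'"
 shows "ar (tw d \<phi> d' n)" "dm (tw d \<phi> d' n) = bo (dm (d n)) (dm (d' n))" "cd (tw d \<phi> d' n) = bo (dm (d (n+1))) (dm (d' (n+1)))"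
 using twistD[OF assms] cpxD[OF twistD(1)[OF assms]] cpxD[OF twistD(2)[OF assms]] by (simp_all add: tw_def)

lemma tw_pr:
 assumes "twist d \<phi> d'" "ar u" "ar w" "cd u = dm (d n)" "cd w = dm (d' n)" "dm u = dm w"
 shows "tw d \<phi> d' n ** pr u w = pr (d n ** u) (\<phi> n ** u \<oplus> d' n ** w)"
 using twistD[OF assms(1)] cpxD[OF twistD(1)[OF assms(1)]] cpxD[OF twistD(2)[OF assms(1)]] assms(2-) by (simp add: tw_def)

lemma tw_cpx: assumes "twist d \<phi> d'" shows "cpx (tw d \<phi> d')"
proof (rule cpxI)
 note [simp] = twistD(3-)[OF assms] cpxD[OF twistD(1)[OF assms]] cpxD[OF twistD(2)[OF assms]]
 fix n
 show "tw d \<phi> d' (n+1) ** tw d \<phi> d' n = zr (dm (tw d \<phi> d' n)) (dm (tw d \<phi> d' (n+1+1)))"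
  by (simp add: tw_ar[OF assms]) (simp add: tw_def)
qed (simp_all add: tw_ar[OF assms])

lemma tinc_cmor: assumes "twist d \<phi> d'" shows "cmor d' (%n. bi (dm (d n)) (dm (d' n))) (tw d \<phi> d')"
proof -
 note [simp] = twistD(3-)[OF assms] cpxD[OF twistD(1)[OF assms]] cpxD[OF twistD(2)[OF assms]]
 show ?thesis by (rule cmorI) (simp_all add: tw_ar[OF assms], simp add: tw_def bo_expand)
qed

lemma tprj_cmor: assumes "twist d \<phi> d'" shows "cmor (tw d \<phi> d') (%n. bp (dm (d n)) (dm (d' n))) d"
proof -
 note [simp] = twistD(3-)[OF assms] cpxD[OF twistD(1)[OF assms]] cpxD[OF twistD(2)[OF assms]]
 show ?thesis by (rule cmorI) (simp_all add: tw_ar[OF assms], simp add: tw_def bo_expand)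
qed

lemma tmap_cmor:
 assumes t: "twist d \<phi> d'" "twist e \<psi> e'" and a: "cmor d a e" and b: "cmor d' b e'"
  and c: "!!n. \<psi> n ** a n = b (n+1) ** \<phi> n"
 shows "cmor (tw d \<phi> d') (%n. diag2 (a n) (b n)) (tw e \<psi> e')"
proof -
 note [simp] = twistD(3-)[OF t(1)] cpxD[OF twistD(1)[OF t(1)]] cpxD[OF twistD(2)[OF t(1)]]
  twistD(3-)[OF t(2)] cpxD[OF twistD(1)[OF t(2)]] cpxD[OF twistD(2)[OF t(2)]] cmorD[OF a] cmorD[OF b] c
 show ?thesis by (rule cmorI) (simp_all add: tw_ar[OF t(1)] tw_ar[OF t(2)], simp add: tw_def diag2_def)
qed

text \<open>The five lemma for the extension of \<open>d\<close> by \<open>d'\<close>, carried out on elements.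
Surjectivity uses surjectivity of \<open>a\<close>, then injectivity of \<open>b\<close> one degree up to
make the lift a cocycle, then surjectivity of \<open>b\<close>; injectivity uses injectivity of
\<open>a\<close>, surjectivity of \<open>a\<close> one degree down, and injectivity of \<open>b\<close>.\<close>
lemma tmap_qi:
 assumes t: "twist d \<phi> d'" "twist e \<psi> e'" and a: "cmor d a e" and b: "cmor d' b e'"
  and c: "!!n. \<psi> n ** a n = b (n+1) ** \<phi> n" and qa: "qi d a e" and qb: "qi d' b e'"
 shows "qi (tw d \<phi> d') (%n. diag2 (a n) (b n)) (tw e \<psi> e')"
proof -
 note [simp] = twistD(3-)[OF t(1)] cpxD[OF twistD(1)[OF t(1)]] cpxD[OF twistD(2)[OF t(1)]]
  twistD(3-)[OF t(2)] cpxD[OF twistD(1)[OF t(2)]] cpxD[OF twistD(2)[OF t(2)]] cmorD[OF a] cmorD[OF b]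
 have c2: "\<psi> n ** a n ** h = b (n+1) ** \<phi> n ** h" for n h using cmp_left[OF c, of n h] by simp
 have sa: "qsurj d a e n" and ia: "qinj d a e n" and sb: "qsurj d' b e' n" and ib: "qinj d' b e' n" for n
  using qa qb by (auto simp: qi_def)
 note [simp] = tw_ar[OF t(1)] tw_ar[OF t(2)]
 have "qsurj (tw d \<phi> d') (%n. diag2 (a n) (b n)) (tw e \<psi> e') n" for n
  unfolding qsurj_def
 proof (intro allI impI, elim conjE, goal_cases)
  case (1 y)
  note y = 1(1-3)
  have co: "cd y = bo (dm (e (n+1))) (dm (e' (n+1)))" "dm (e (n+1)) \<in> Obj A" "dm (e' (n+1)) \<in> Obj A"
   by (simp_all add: y(2))
  obtain u w where uw: "y = pr u w" and uw' [simp]: "ar u" "ar w" "dm u = dm y" "dm w = dm y" "cd u = dm (e (n+1))" "cd w = dm (e' (n+1))"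
   using prE[OF y(1) co] by blast
  have "pr (e (n+1) ** u) (\<psi> (n+1) ** u \<oplus> e' (n+1) ** w) = zr (dm y) (bo (dm (e (n+1+1))) (dm (e' (n+1+1))))"
   using y(3) unfolding uw by (simp add: tw_pr[OF t(2)])
  then have eu: "e (n+1) ** u = zr (dm y) (dm (e (n+1+1)))" and uw0: "\<psi> (n+1) ** u \<oplus> e' (n+1) ** w = zr (dm y) (dm (e' (n+1+1)))"
   by (simp_all add: pr_eq_zr)
  have yu: "ar y" by (rule y)
  have pu: "\<psi> (n+1) ** u = \<ominus> (e' (n+1) ** w)" by (rule eq_ngI) (simp_all add: uw0)
  from sa[of n, unfolded qsurj_def, rule_format, of u] eu
  obtain e1 x s where x [simp]: "tepi e1" "cd e1 = dm y" "ar x" "dm x = dm e1" "cd x = dm (d (n+1))"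
    and dx: "d (n+1) ** x = zr (dm e1) (dm (d (n+1+1)))"
    and s [simp]: "ar s" "dm s = dm e1" "cd s = dm (e n)" and ax: "a (n+1) ** x = u ** e1 \<oplus> e n ** s" by auto
  have [simp]: "ar e1" by (rule tepi_ar) simp
  have bx: "b (n+1+1) ** \<phi> (n+1) ** x = e' (n+1) ** (\<ominus> (w ** e1) \<oplus> \<ominus> (\<psi> n ** s))"
   using cmp_left[OF pu, of e1] unfolding c2[symmetric] ax by simp
  have cyc: "d' (n+1+1) ** \<phi> (n+1) ** x = zr (dm e1) (cd (d' (n+1+1)))" using dx by simp
   (* the lift x of u need not satisfy the second cocycle condition; injectivity of b one degree up
      bounds the defect phi x by some r, which corrects it *)
  from ib[of "n+1", unfolded qinj_def, rule_format, of "\<phi> (n+1) ** x" "\<ominus> (w ** e1) \<oplus> \<ominus> (\<psi> n ** s)"] bx cyc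
  obtain e2 r where r [simp]: "tepi e2" "cd e2 = dm e1" "ar r" "dm r = dm e2" "cd r = dm (d' (n+1))"
   and dr: "d' (n+1) ** r = \<phi> (n+1) ** x ** e2" by auto
  have [simp]: "ar e2" by (rule tepi_ar) simp
  let ?y' = "w ** e1 ** e2 \<oplus> \<psi> n ** s ** e2 \<oplus> b (n+1) ** r"
  have "e' (n+1) ** b (n+1) ** r = (b (n+1+1) ** \<phi> (n+1) ** x) ** e2" using dr by simp
  also have "\<dots> = \<ominus> (e' (n+1) ** (w ** e1 ** e2 \<oplus> \<psi> n ** s ** e2))" unfolding bx by simp
  finally have "e' (n+1) ** ?y' = (e' (n+1) ** (w ** e1 ** e2 \<oplus> \<psi> n ** s ** e2)) \<oplus> \<ominus> (e' (n+1) ** (w ** e1 ** e2 \<oplus> \<psi> n ** s ** e2))"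
   by (simp del: cmorD[OF b])
  also have "\<dots> = zr (dm e2) (dm (e' (n+1+1)))" by (subst pls_ng) simp_all
  finally have cy: "e' (n+1) ** ?y' = zr (dm e2) (dm (e' (n+1+1)))" .
  from sb[of n, unfolded qsurj_def, rule_format, of ?y'] cy
  obtain e3 x' w' where x' [simp]: "tepi e3" "cd e3 = dm e2" "ar x'" "dm x' = dm e3" "cd x' = dm (d' (n+1))"
    and dx': "d' (n+1) ** x' = zr (dm e3) (dm (d' (n+1+1)))"
    and w' [simp]: "ar w'" "dm w' = dm e3" "cd w' = dm (e' n)" and bx': "b (n+1) ** x' = ?y' ** e3 \<oplus> e' n ** w'" by auto
  have [simp]: "ar e3" by (rule tepi_ar) simp
  let ?X = "pr (x ** e2 ** e3) (x' \<oplus> \<ominus> (r ** e3))" and ?W = "pr (s ** e2 ** e3) w'"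
  have X: "tw d \<phi> d' (n+1) ** ?X = zr (dm e3) (bo (dm (d (n+1+1))) (dm (d' (n+1+1))))"
   using cmp_left[OF dx, of "e2 ** e3"] cmp_left[OF dr, of e3] dx' by (simp add: tw_pr[OF t(1)])
  have im: "diag2 (a (n+1)) (b (n+1)) ** ?X = y ** e1 ** e2 ** e3 \<oplus> tw e \<psi> e' n ** ?W"
  proof -
   have "a (n+1) ** x ** e2 ** e3 = u ** e1 ** e2 ** e3 \<oplus> e n ** s ** e2 ** e3" using cmp_left[OF ax, of "e2 ** e3"] by simp
   moreover have "b (n+1) ** (x' \<oplus> \<ominus> (r ** e3)) = w ** e1 ** e2 ** e3 \<oplus> \<psi> n ** s ** e2 ** e3 \<oplus> e' n ** w'"
    using bx' by (simp add: canc pls_left_commute[of "b (n+1) ** r ** e3"] pls_commute[of "e' n ** w'"])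
   ultimately show ?thesis unfolding uw by (simp add: tw_pr[OF t(2)])
  qed
  show ?case
   by (rule exI[of _ "e1 ** e2 ** e3"], rule exI[of _ ?X], rule exI[of _ ?W])
    (use X im in \<open>simp add: tepi_cmp\<close>)
 qed
 moreover have "qinj (tw d \<phi> d') (%n. diag2 (a n) (b n)) (tw e \<psi> e') n" for n
  unfolding qinj_def
 proof (intro allI impI, elim conjE, goal_cases)
  case (1 X W)
  note X = 1(1-3) and W = 1(4-6) and im = 1(7)
  have cX: "cd X = bo (dm (d (n+1))) (dm (d' (n+1)))" "dm (d (n+1)) \<in> Obj A" "dm (d' (n+1)) \<in> Obj A"
   and cW: "cd W = bo (dm (e n)) (dm (e' n))" "dm (e n) \<in> Obj A" "dm (e' n) \<in> Obj A"
   by (simp_all add: X(2) W(3))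
  obtain x x' where xx: "X = pr x x'" and x [simp]: "ar x" "ar x'" "dm x = dm X" "dm x' = dm X" "cd x = dm (d (n+1))" "cd x' = dm (d' (n+1))"
   using prE[OF X(1) cX] by blast
  obtain s w where sw: "W = pr s w" and s [simp]: "ar s" "ar w" "dm s = dm X" "dm w = dm X" "cd s = dm (e n)" "cd w = dm (e' n)"
   using prE[OF W(1) cW] unfolding W(2) by blast
  have "pr (d (n+1) ** x) (\<phi> (n+1) ** x \<oplus> d' (n+1) ** x') = zr (dm X) (bo (dm (d (n+1+1))) (dm (d' (n+1+1))))"
   using X(3) unfolding xx by (simp add: tw_pr[OF t(1)])
  then have dx: "d (n+1) ** x = zr (dm X) (dm (d (n+1+1)))" and xx0: "\<phi> (n+1) ** x \<oplus> d' (n+1) ** x' = zr (dm X) (dm (d' (n+1+1)))"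
   by (simp_all add: pr_eq_zr)
  have [simp]: "ar X" by (rule X)
  have dx': "d' (n+1) ** x' = \<ominus> (\<phi> (n+1) ** x)" by (rule eq_ngI) (simp_all add: xx0 pls_commute)
  have "pr (a (n+1) ** x) (b (n+1) ** x') = pr (e n ** s) (\<psi> n ** s \<oplus> e' n ** w)"
   using im unfolding xx sw by (simp add: tw_pr[OF t(2)])
  then have ax: "a (n+1) ** x = e n ** s" and bx: "b (n+1) ** x' = \<psi> n ** s \<oplus> e' n ** w"
   by (simp_all add: pr_inject)
  from ia[of n, unfolded qinj_def, rule_format, of x s] dx ax
  obtain e1 r where r [simp]: "tepi e1" "cd e1 = dm X" "ar r" "dm r = dm e1" "cd r = dm (d n)" and dr: "d n ** r = x ** e1" by auto
  have [simp]: "ar e1" by (rule tepi_ar) simp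
  have "e n ** (a n ** r \<oplus> \<ominus> (s ** e1)) = zr (dm e1) (dm (e (n+1)))" using cmp_left[OF ax, of e1] dr by simp
   (* a r and s bound the same element, so they differ by a cocycle, which lifts to q *)
  with sa[of "n-1", unfolded qsurj_def, rule_format, of "a n ** r \<oplus> \<ominus> (s ** e1)"]
  obtain e2 q v where q [simp]: "tepi e2" "cd e2 = dm e1" "ar q" "dm q = dm e2" "cd q = dm (d n)"
   and dq: "d n ** q = zr (dm e2) (dm (d (n+1)))"
   and v [simp]: "ar v" "dm v = dm e2" "cd v = dm (e (n-1))" and aq: "a n ** q = (a n ** r \<oplus> \<ominus> (s ** e1)) ** e2 \<oplus> e (n-1) ** v" by auto
  have [simp]: "ar e2" by (rule tepi_ar) simp
  let ?t = "r ** e2 \<oplus> \<ominus> q"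
  have dt: "d n ** ?t = x ** e1 ** e2" using dq cmp_left[OF dr, of e2] by simp
  have at: "a n ** ?t = s ** e1 ** e2 \<oplus> \<ominus> (e (n-1) ** v)" using aq by simp
  let ?z = "x' ** e1 ** e2 \<oplus> \<ominus> (\<phi> n ** ?t)"
  have tt: "ar ?t" "dm ?t = dm e2" "cd ?t = dm (d n)" by simp_all
  have "d' (n+1) ** ?z = \<ominus> (\<phi> (n+1) ** x ** e1 ** e2) \<oplus> \<phi> (n+1) ** (d n ** ?t)"
   using cmp_left[OF dx', of "e1 ** e2"] by simp
  also have "\<dots> = zr (dm e2) (dm (d' (n+1+1)))" unfolding dt by simp
  finally have dz: "d' (n+1) ** ?z = zr (dm e2) (dm (d' (n+1+1)))" .
  have "b (n+1) ** ?z = \<psi> n ** s ** e1 ** e2 \<oplus> e' n ** w ** e1 ** e2 \<oplus> \<ominus> (\<psi> n ** (a n ** ?t))"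
   using cmp_left[OF bx, of "e1 ** e2"] c2[of n ?t] by simp
  also have "\<dots> = e' n ** w ** e1 ** e2 \<oplus> \<psi> n ** e (n-1) ** v" unfolding at by (simp add: canc)
  also have "\<dots> = e' n ** (w ** e1 ** e2 \<oplus> \<ominus> (\<psi> (n-1) ** v))" by simp
  finally have bz: "b (n+1) ** ?z = e' n ** (w ** e1 ** e2 \<oplus> \<ominus> (\<psi> (n-1) ** v))" .
  from ib[of n, unfolded qinj_def, rule_format, of ?z "w ** e1 ** e2 \<oplus> \<ominus> (\<psi> (n-1) ** v)"] bz dz
  obtain e3 p where p [simp]: "tepi e3" "cd e3 = dm e2" "ar p" "dm p = dm e3" "cd p = dm (d' n)" and dp: "d' n ** p = ?z ** e3" by auto
  have [simp]: "ar e3" by (rule tepi_ar) simp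
  have "\<phi> n ** (?t ** e3) \<oplus> d' n ** p = x' ** e1 ** e2 ** e3"
   using canc(1)[of "\<phi> n ** ?t ** e3" "x' ** e1 ** e2 ** e3"] unfolding dp by (simp del: cmp_pls pls_cmp add: pls_cmp[of "x' ** e1 ** e2"])
  then have "tw d \<phi> d' n ** pr (?t ** e3) p = X ** e1 ** e2 ** e3"
   using cmp_left[OF dt, of e3] unfolding xx by (simp add: tw_pr[OF t(1)] del: pls_cmp cmp_pls)
  then show ?case
   by - (rule exI[of _ "e1 ** e2 ** e3"], rule exI[of _ "pr (?t ** e3) p"], simp add: tepi_cmp)
 qed
 ultimately show ?thesis by (simp add: qi_def)
qed

end

context abelian_category
begin

section \<open>Cones and fibres\<close>

lemma one_plus: "1 + n = n + (1::int)" by simp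

definition cone :: "('o, 'm) gmap => ('o, 'm) gmap => ('o, 'm) gmap => ('o, 'm) gmap" where
 "cone d f d' = tw (shk 1 d) (%n. f (n+1)) d'"

text \<open>The shifted cone. The sign of \<open>f\<close> makes the second summand, with differential \<open>-
d'\<close>, match the first.\<close>
definition fib :: "('o, 'm) gmap => ('o, 'm) gmap => ('o, 'm) gmap => ('o, 'm) gmap" where
 "fib d f d' = tw d (%n. \<ominus> f n) (shk (- 1) d')"

definition cinc :: "('o, 'm) gmap => ('o, 'm) gmap => ('o, 'm) gmap" where
 "cinc d d' n = bi (dm (d (n+1))) (dm (d' n))"

definition fprj :: "('o, 'm) gmap => ('o, 'm) gmap => ('o, 'm) gmap" where
 "fprj d d' n = bp (dm (d n)) (dm (d' (n-1)))"

lemma twist_cone: assumes "cpx d" "cpx d'" "cmor d f d'" shows "twist (shk 1 d) (%n. f (n+1)) d'"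
 unfolding twist_def using assms shk_cpx[OF assms(1)]
 by (simp add: shk_simps cpxD cmorD)

lemma twist_fib: assumes "cpx d" "cpx d'" "cmor d f d'" shows "twist d (%n. \<ominus> f n) (shk (- 1) d')"
 unfolding twist_def using assms shk_cpx[OF assms(2)]
 by (simp add: shk_simps cpxD cmorD)

context
 fixes d d' f assumes d: "cpx d" and d': "cpx d'" and f: "cmor d f d'"
begin

lemma cone_cpx: "cpx (cone d f d')" unfolding cone_def by (intro tw_cpx twist_cone d d' f)

lemma fib_cpx: "cpx (fib d f d')" unfolding fib_def by (intro tw_cpx twist_fib d d' f)

lemma dm_cone: "dm (cone d f d' n) = bo (dm (d (n+1))) (dm (d' n))"
 unfolding cone_def by (simp add: tw_ar[OF twist_cone[OF d d' f]] shk_simps[OF d])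

lemma dm_fib: "dm (fib d f d' n) = bo (dm (d n)) (dm (d' (n-1)))"
 unfolding fib_def by (simp add: tw_ar[OF twist_fib[OF d d' f]] shk_simps[OF d'])

lemma cone_pr: "ar u ==> ar w ==> cd u = dm (d (n+1)) ==> cd w = dm (d' n) ==> dm u = dm w ==>
  cone d f d' n ** pr u w = pr (\<ominus> (d (n+1) ** u)) (f (n+1) ** u \<oplus> d' n ** w)"
 unfolding cone_def by (simp add: tw_pr[OF twist_cone[OF d d' f]] shk_simps[OF d])

lemma fib_pr: "ar u ==> ar w ==> cd u = dm (d n) ==> cd w = dm (d' (n-1)) ==> dm u = dm w ==>
  fib d f d' n ** pr u w = pr (d n ** u) (\<ominus> (f n ** u) \<oplus> \<ominus> (d' (n-1) ** w))"
 unfolding fib_def using cmorD[OF f] by (simp add: tw_pr[OF twist_fib[OF d d' f]] shk_simps[OF d'])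

lemma cone_row: "cone d f d' n = pr (row (\<ominus> d (n+1)) (zr (dm (d' n)) (dm (d (n+1+1))))) (row (f (n+1)) (d' n))"
 using cpxD[OF d] by (simp add: cone_def tw_def shk_def)

lemma fib_row: "fib d f d' n = pr (row (d n) (zr (dm (d' (n-1))) (dm (d (n+1))))) (row (\<ominus> f n) (\<ominus> d' (n-1)))"
 using cpxD[OF d] cpxD[OF d'] by (simp add: fib_def tw_def shk_def)

lemma cinc_cmor: "cmor d' (cinc d d') (cone d f d')"
 using tinc_cmor[OF twist_cone[OF d d' f]] unfolding cone_def cinc_def[abs_def] shk_simps(2)[OF d] .

lemma fprj_cmor: "cmor (fib d f d') (fprj d d') d"
 using tprj_cmor[OF twist_fib[OF d d' f]] unfolding fib_def fprj_def[abs_def] shk_simps(2)[OF d'] by simp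

end

definition cmap :: "('o, 'm) gmap => ('o, 'm) gmap => ('o, 'm) gmap" where
 "cmap a b n = diag2 (a (n+1)) (b n)"
definition fmap :: "('o, 'm) gmap => ('o, 'm) gmap => ('o, 'm) gmap" where
 "fmap a b n = diag2 (a n) (b (n-1))"

lemma cmap_cmor:
 assumes d: "cpx d" "cpx d'" "cmor d f d'" "cpx e" "cpx e'" "cmor e g e'" and a: "cmor d a e" and b: "cmor d' b e'"
  and c: "!!n. g n ** a n = b n ** f n"
 shows "cmor (cone d f d') (cmap a b) (cone e g e')" "qi d a e ==> qi d' b e' ==> qi (cone d f d') (cmap a b) (cone e g e')"
 unfolding cone_def cmap_def[abs_def]
 using tmap_cmor[OF twist_cone twist_cone, of d d' f e e' g "%n. a (n+1)" b]
  tmap_qi[OF twist_cone twist_cone, of d d' f e e' g "%n. a (n+1)" b] shk_cmor[of d e a 1] shk_qi[of d e a 1] assms by auto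

lemma fmap_cmor:
 assumes d: "cpx d" "cpx d'" "cmor d f d'" "cpx e" "cpx e'" "cmor e g e'" and a: "cmor d a e" and b: "cmor d' b e'"
  and c: "!!n. g n ** a n = b n ** f n"
 shows "cmor (fib d f d') (fmap a b) (fib e g e')" "qi d a e ==> qi d' b e' ==> qi (fib d f d') (fmap a b) (fib e g e')"
 unfolding fib_def fmap_def[abs_def]
 using tmap_cmor[OF twist_fib twist_fib, of d d' f e e' g a "%n. b (n-1)"]
  tmap_qi[OF twist_fib twist_fib, of d d' f e e' g a "%n. b (n-1)"] shk_cmor[of d' e' b "- 1"] shk_qi[of d' e' b "- 1"] assms
 by simp_all

text \<open>The map \<open>x \<mapsto> (f x, (- x, 0))\<close> from \<open>d\<close> to the fibre of the inclusion of
\<open>d'\<close> into the cone of \<open>f\<close>.\<close>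
definition eta :: "('o, 'm) gmap => ('o, 'm) gmap => ('o, 'm) gmap => ('o, 'm) gmap" where
 "eta d f d' n = pr (f n) (pr (\<ominus> idn (dm (d n))) (zr (dm (d n)) (dm (d' (n-1)))))"

text \<open>The map \<open>((y, z), y') \<mapsto> - z + g y'\<close> to \<open>d'\<close> from the cone of the
projection of the fibre of \<open>g\<close> onto \<open>d\<close>.\<close>
definition eps :: "('o, 'm) gmap => ('o, 'm) gmap => ('o, 'm) gmap => ('o, 'm) gmap" where
 "eps d g d' n = row (row (zr (dm (d (n+1))) (dm (d' n))) (\<ominus> idn (dm (d' n)))) (g n)"

context
 fixes d d' f assumes d: "cpx d" and d': "cpx d'" and f: "cmor d f d'"
begin

lemma eta_cmor: "cmor d (eta d f d') (fib d' (cinc d d') (cone d f d'))"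
proof (rule cmorI)
 note [simp] = cpxD[OF d] cpxD[OF d'] cmorD[OF f] dm_cone[OF d d' f]
 note F = d' cone_cpx[OF d d' f] cinc_cmor[OF d d' f]
 fix n
 show "ar (eta d f d' n)" "dm (eta d f d' n) = dm (d n)" "cd (eta d f d' n) = dm (fib d' (cinc d d') (cone d f d') n)"
  by (simp_all add: eta_def dm_fib[OF F])
 show "fib d' (cinc d d') (cone d f d') n ** eta d f d' n = eta d f d' (n+1) ** d n"
  unfolding eta_def by (simp add: fib_pr[OF F] cone_pr[OF d d' f] cinc_def bo_expand)
qed

lemma fprj_eta: "fprj d' (cone d f d') n ** eta d f d' n = f n"
 using cpxD[OF d] cpxD[OF d'] cmorD[OF f] by (simp add: eta_def fprj_def dm_cone[OF d d' f])

text \<open>A cocycle \<open>(y, (x, t))\<close> of the target satisfies \<open>y = - f x - d' t\<close>, so it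
differs from the image of \<open>- x\<close> by the coboundary of \<open>(t, 0)\<close>.\<close>
lemma eta_qi: "qi d (eta d f d') (fib d' (cinc d d') (cone d f d'))"
proof -
 note [simp] = cpxD[OF d] cpxD[OF d'] cmorD[OF f] dm_cone[OF d d' f]
 note F = d' cone_cpx[OF d d' f] cinc_cmor[OF d d' f]
 note [simp] = one_plus
 let ?F = "fib d' (cinc d d') (cone d f d')"
 note [simp] = cpxD(1,2)[OF fib_cpx[OF F]] dm_fib[OF F]
 have Fpr: "?F n ** pr y (pr x t) = pr (d' n ** y) (pr (d n ** x) (\<ominus> y \<oplus> \<ominus> (f n ** x) \<oplus> \<ominus> (d' (n-1) ** t)))"
  if "ar y" "ar x" "ar t" "dm x = dm y" "dm t = dm y" "cd y = dm (d' n)" "cd x = dm (d n)" "cd t = dm (d' (n-1))" for n y x t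
  using that by (simp add: fib_pr[OF F] cone_pr[OF d d' f] cinc_def bo_expand)
 have "qsurj d (eta d f d') ?F n" for n
  unfolding qsurj_def
 proof (intro allI impI, elim conjE, goal_cases)
  case (1 Y)
  note Y = 1(1-3)
  have cY: "cd Y = bo (dm (d' (n+1))) (bo (dm (d (n+1))) (dm (d' n)))" "dm (d' (n+1)) \<in> Obj A"
   "bo (dm (d (n+1))) (dm (d' n)) \<in> Obj A" by (simp_all add: Y(2))
  obtain y v where yv: "Y = pr y v" "ar y" "ar v" "dm y = dm Y" "dm v = dm Y" "cd y = dm (d' (n+1))" "cd v = bo (dm (d (n+1))) (dm (d' n))"
   using prE[OF Y(1) cY] by blast
  have ob: "dm (d (n+1)) \<in> Obj A" "dm (d' n) \<in> Obj A" by simp_all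
  obtain x t where xt: "v = pr x t" "ar x" "ar t" "dm x = dm v" "dm t = dm v" "cd x = dm (d (n+1))" "cd t = dm (d' n)"
   using prE[OF yv(3,7) ob] by blast
  note [simp] = yv(2,4,6) xt(2-)[unfolded yv(5)]
  have aY: "ar Y" by (rule Y)
  have Yeq: "Y = pr y (pr x t)" by (rule yv(1)[unfolded xt(1)])
  have "pr (d' (n+1) ** y) (pr (d (n+1) ** x) (\<ominus> y \<oplus> \<ominus> (f (n+1) ** x) \<oplus> \<ominus> (d' n ** t))) =
    zr (dm Y) (bo (dm (d' (n+1+1))) (bo (dm (d (n+1+1))) (dm (d' (n+1)))))"
   using Y(3) unfolding Yeq by (simp add: Fpr)
  then have z: "d (n+1) ** x = zr (dm Y) (dm (d (n+1+1)))"
   "\<ominus> y \<oplus> \<ominus> (f (n+1) ** x) \<oplus> \<ominus> (d' n ** t) = zr (dm Y) (dm (d' (n+1)))"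
   using aY by (simp_all add: pr_eq_zr)
  have y: "\<ominus> (f (n+1) ** x) = y \<oplus> d' n ** t"
   using z(2) by - (rule pls_cancel[of "\<ominus> y \<oplus> \<ominus> (d' n ** t)"], simp_all add: pls_ac canc)
  let ?w = "pr t (pr (zr (dm Y) (dm (d n))) (zr (dm Y) (dm (d' (n-1)))))"
  have "eta d f d' (n+1) ** \<ominus> x = pr y (pr x t) \<oplus> ?F n ** ?w"
   using aY y by (simp add: Fpr eta_def del: zr_bo)
  then have key: "eta d f d' (n+1) ** \<ominus> x = Y \<oplus> ?F n ** ?w" unfolding Yeq[symmetric] .
  show ?case
   by (rule exI[of _ "idn (dm Y)"], rule exI[of _ "\<ominus> x"], rule exI[of _ ?w])
    (use aY z(1) key in simp)
 qed
 moreover have "qinj d (eta d f d') ?F n" for n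
  unfolding qinj_def
 proof (intro allI impI, elim conjE)
  fix x W assume x [simp]: "ar x" "cd x = dm (d (n+1))" and W: "ar W" "dm W = dm x" "cd W = dm (?F n)"
   and ex: "eta d f d' (n+1) ** x = ?F n ** W"
  have cW: "cd W = bo (dm (d' n)) (bo (dm (d n)) (dm (d' (n-1))))" "dm (d' n) \<in> Obj A"
   "bo (dm (d n)) (dm (d' (n-1))) \<in> Obj A" by (simp_all add: W(3))
  obtain y v where yv: "W = pr y v" "ar y" "ar v" "dm y = dm x" "dm v = dm x" "cd y = dm (d' n)" "cd v = bo (dm (d n)) (dm (d' (n-1)))"
   using prE[OF W(1) cW] unfolding W(2) by blast
  have ob: "dm (d n) \<in> Obj A" "dm (d' (n-1)) \<in> Obj A" by simp_all
  obtain s t where xt: "v = pr s t" "ar s" "ar t" "dm s = dm v" "dm t = dm v" "cd s = dm (d n)" "cd t = dm (d' (n-1))"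
   using prE[OF yv(3,7) ob] by blast
  note [simp] = yv(2,4,6) xt(2-)[unfolded yv(5)]
  have Weq: "W = pr y (pr s t)" by (rule yv(1)[unfolded xt(1)])
  have "\<ominus> x = d n ** s" using ex unfolding Weq by (simp add: Fpr eta_def pr_inject)
  then have "d n ** \<ominus> s = x" by (metis cmp_ng ng_ng x(1))
  then show "\<exists>e u. tepi e & cd e = dm x & ar u & dm u = dm e & cd u = dm (d n) & d n ** u = x ** e"
   by - (rule exI[of _ "idn (dm x)"], rule exI[of _ "\<ominus> s"], simp)
 qed
 ultimately show ?thesis by (simp add: qi_def)
qed

lemma eps_cmor: "cmor (cone (fib d f d') (fprj d d') d) (eps d f d') d'"
proof (rule cmorI)
 note [simp] = one_plus
 note [simp] = cpxD[OF d] cpxD[OF d'] cmorD[OF f] dm_fib[OF d d' f]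
 note F = fib_cpx[OF d d' f] d fprj_cmor[OF d d' f]
 note [simp] = cpxD(1,2)[OF F(1)]
 fix n
 show "ar (eps d f d' n)" "dm (eps d f d' n) = dm (cone (fib d f d') (fprj d d') d n)" "cd (eps d f d' n) = dm (d' n)"
  by (simp_all add: eps_def dm_cone[OF F])
 show "d' n ** eps d f d' n = eps d f d' (n+1) ** cone (fib d f d') (fprj d d') d n"
  by (simp add: eps_def cone_row[OF F] fib_row[OF d d' f] fprj_def bo_expand)
qed

lemma eps_cinc: "eps d f d' n ** cinc (fib d f d') d n = f n"
 using cpxD[OF d] cpxD[OF d'] cmorD[OF f] by (simp add: eps_def cinc_def dm_fib[OF d d' f])

text \<open>Onto: \<open>z\<close> is the image of \<open>((0, - z), 0)\<close>. Injective: a cocycle \<open>((y, z),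
t)\<close> has \<open>y = - d t\<close>, and if its image is the boundary of \<open>w\<close> then it is
the boundary of \<open>((t, - w), 0)\<close>.\<close>
lemma eps_qi: "qi (cone (fib d f d') (fprj d d') d) (eps d f d') d'"
proof -
 note [simp] = cpxD[OF d] cpxD[OF d'] cmorD[OF f] dm_fib[OF d d' f]
 note F = fib_cpx[OF d d' f] d fprj_cmor[OF d d' f]
 note [simp] = cpxD(1,2)[OF F(1)] dm_cone[OF F] cpxD(1,2)[OF cone_cpx[OF F]]
 note [simp] = one_plus
 let ?C = "cone (fib d f d') (fprj d d') d"
 have Cpr: "?C n ** pr (pr y z) t = pr (pr (\<ominus> (d (n+1) ** y)) (f (n+1) ** y \<oplus> d' n ** z)) (y \<oplus> d n ** t)"
  if "ar y" "ar z" "ar t" "dm z = dm y" "dm t = dm y" "cd y = dm (d (n+1))" "cd z = dm (d' n)" "cd t = dm (d n)" for n y z t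
  using that by (simp add: cone_pr[OF F] fib_pr[OF d d' f] fprj_def)
 have "qsurj ?C (eps d f d') d' n" for n
  unfolding qsurj_def
 proof (intro allI impI, elim conjE, goal_cases)
  case (1 z)
  note z [simp] = 1(1-2) and dz = 1(3)
  show ?case
   by (rule exI[of _ "idn (dm z)"], rule exI[of _ "pr (pr (zr (dm z) (dm (d (n+1+1)))) (\<ominus> z)) (zr (dm z) (dm (d (n+1))))"],
     rule exI[of _ "zr (dm z) (dm (d' n))"])
    (use dz in \<open>simp add: Cpr eps_def\<close>)
 qed
 moreover have "qinj ?C (eps d f d') d' n" for n
  unfolding qinj_def
 proof (intro allI impI, elim conjE, goal_cases)
  case (1 X w)
  note X = 1(1-3) and w = 1(4-6) and ex = 1(7)
  have cX: "cd X = bo (bo (dm (d (n+1+1))) (dm (d' (n+1)))) (dm (d (n+1)))" "bo (dm (d (n+1+1))) (dm (d' (n+1))) \<in> Obj A"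
   "dm (d (n+1)) \<in> Obj A" by (simp_all add: X(2))
  obtain v t where vt: "X = pr v t" "ar v" "ar t" "dm v = dm X" "dm t = dm X" "cd v = bo (dm (d (n+1+1))) (dm (d' (n+1)))" "cd t = dm (d (n+1))"
   using prE[OF X(1) cX] by blast
  have ob: "dm (d (n+1+1)) \<in> Obj A" "dm (d' (n+1)) \<in> Obj A" by simp_all
  obtain y z where yz: "v = pr y z" "ar y" "ar z" "dm y = dm v" "dm z = dm v" "cd y = dm (d (n+1+1))" "cd z = dm (d' (n+1))"
   using prE[OF vt(2,6) ob] by blast
  note yz' = yz(2-)[unfolded vt(4)]
  note [simp] = vt(3,5,7) yz' yz'[simplified] w
  have aX: "ar X" by (rule X)
  have Xeq: "X = pr (pr y z) t" by (rule vt(1)[unfolded yz(1)])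
  have "pr (pr (\<ominus> (d (n+1+1) ** y)) (f (n+1+1) ** y \<oplus> d' (n+1) ** z)) (y \<oplus> d (n+1) ** t) =
    zr (dm X) (bo (bo (dm (d (n+1+1+1))) (dm (d' (n+1+1)))) (dm (d (n+1+1))))"
   using X(3) unfolding Xeq by (simp add: Cpr)
  then have "y \<oplus> d (n+1) ** t = zr (dm X) (dm (d (n+1+1)))"
   using aX by (simp add: pr_eq_zr)
  then have y: "y = \<ominus> (d (n+1) ** t)" by - (rule eq_ngI, simp_all)
  have "\<ominus> z \<oplus> f (n+1) ** t = d' n ** w" using ex aX unfolding Xeq by (simp add: eps_def)
  then have z: "f (n+1) ** t \<oplus> \<ominus> (d' n ** w) = z"
   by - (rule pls_cancel[of "\<ominus> z \<oplus> d' n ** w"], simp_all add: pls_ac canc)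
  have "?C n ** pr (pr t (\<ominus> w)) (zr (dm X) (dm (d n))) = X"
   unfolding Xeq using aX by (simp add: Cpr z y)
  then show ?case
   using aX by - (rule exI[of _ "idn (dm X)"], rule exI[of _ "pr (pr t (\<ominus> w)) (zr (dm X) (dm (d n)))"], simp)
 qed
 ultimately show ?thesis by (simp add: qi_def)
qed

end

lemma eta_natural:
 assumes d: "cpx d" "cpx d'" "cmor d f d'" "cpx e" "cpx e'" "cmor e g e'" and a: "cmor d a e" and b: "cmor d' b e'"
  and c: "!!n. g n ** a n = b n ** f n"
 shows "fmap b (cmap a b) n ** eta d f d' n = eta e g e' n ** a n"
 using cpxD[OF d(1)] cpxD[OF d(2)] cpxD[OF d(4)] cpxD[OF d(5)] cmorD[OF d(3)] cmorD[OF d(6)] cmorD[OF a] cmorD[OF b] c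
 by (simp add: fmap_def cmap_def eta_def)

lemma eps_natural:
 assumes d: "cpx d" "cpx d'" "cmor d f d'" "cpx e" "cpx e'" "cmor e g e'" and a: "cmor d a e" and b: "cmor d' b e'"
  and c: "!!n. g n ** a n = b n ** f n"
 shows "eps e g e' n ** cmap (fmap a b) a n = b n ** eps d f d' n"
 using cpxD[OF d(1)] cpxD[OF d(2)] cpxD[OF d(4)] cpxD[OF d(5)] cmorD[OF d(3)] cmorD[OF d(6)] cmorD[OF a] cmorD[OF b] c
 by (simp add: fmap_def cmap_def eps_def)

text \<open>Cone of the shift and shift of the cone differ by a sign on the first summand.\<close>
definition theta :: "('o, 'm) gmap => ('o, 'm) gmap => ('o, 'm) gmap" where
 "theta d d' n = diag2 (\<ominus> idn (dm (d (n+1+1)))) (idn (dm (d' (n+1))))"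

lemma theta_cmor:
 assumes d: "cpx d" "cpx d'" "cmor d f d'"
 shows "cmor (cone (shk 1 d) (%n. f (n+1)) (shk 1 d')) (theta d d') (shk 1 (cone d f d'))"
  "qi (cone (shk 1 d) (%n. f (n+1)) (shk 1 d')) (theta d d') (shk 1 (cone d f d'))"
proof -
 note [simp] = cpxD[OF d(1)] cpxD[OF d(2)] cmorD[OF d(3)]
 note S = shk_cpx[OF d(1), of 1] shk_cpx[OF d(2), of 1] shk_cmor[OF d, of 1]
 note C = cone_cpx[OF d]
 show 1: "cmor (cone (shk 1 d) (%n. f (n+1)) (shk 1 d')) (theta d d') (shk 1 (cone d f d'))"
  by (rule cmorI) (simp_all add: theta_def shk_simps[OF C] shk_simps[OF d(1)] shk_simps[OF d(2)] dm_cone[OF d] dm_cone[OF S] cpxD(1,2)[OF C],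
   simp add: cone_row[OF d] cone_row[OF S] shk_simps[OF d(1)] shk_simps[OF d(2)] diag2_def shk_def)
 show "qi (cone (shk 1 d) (%n. f (n+1)) (shk 1 d')) (theta d d') (shk 1 (cone d f d'))"
  by (rule qi_iso[OF cone_cpx[OF S] shk_cpx[OF C] 1, of "theta d d'"])
   (simp add: theta_def dm_cone[OF S] shk_simps[OF C] shk_simps[OF d(1)] shk_simps[OF d(2)] dm_cone[OF d] diag2_idn)
qed

lemma theta_natural:
 assumes d: "cpx d" "cpx d'" "cpx e" "cpx e'" and a: "cmor d a e" and b: "cmor d' b e'"
 shows "theta e e' n ** cmap (%n. a (n+1)) (%n. b (n+1)) n = cmap a b (n+1) ** theta d d' n"
 using cpxD[OF d(1)] cpxD[OF d(2)] cpxD[OF d(3)] cpxD[OF d(4)] cmorD[OF a] cmorD[OF b]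
 by (simp add: theta_def cmap_def ac_simps)

section \<open>Mapping cones\<close>

text \<open>Mapping cones in tagged form, with the splitting \<open>j\<close>, \<open>q\<close> made explicit.\<close>
definition tmc where
 "tmc dX dY f dZ i p j q \<longleftrightarrow> (\<forall>n. tbip (dm (dX (n+1))) (dm (dY n)) (j n) (i n) (p n) (q n) & cd (j n) = dm (dZ n) &
  dZ n = j (n+1) ** \<ominus> dX (n+1) ** p n \<oplus> i (n+1) ** f (n+1) ** p n \<oplus> i (n+1) ** dY n ** q n)"

lemma tmcD:
 assumes "tmc dX dY f dZ i p j q"
 shows "ar (j n)" "ar (i n)" "ar (p n)" "ar (q n)" "dm (j n) = dm (dX (n+1))" "dm (i n) = dm (dY n)" "cd (i n) = dm (dZ n)"
   "cd (j n) = dm (dZ n)" "dm (p n) = dm (dZ n)" "dm (q n) = dm (dZ n)"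
   "cd (p n) = dm (dX (n+1))" "cd (q n) = dm (dY n)" "p n ** j n = idn (dm (dX (n+1)))" "q n ** i n = idn (dm (dY n))"
   "p n ** i n = zr (dm (dY n)) (dm (dX (n+1)))" "q n ** j n = zr (dm (dX (n+1))) (dm (dY n))"
   "j n ** p n \<oplus> i n ** q n = idn (dm (dZ n))"
   "dZ n = j (n+1) ** \<ominus> dX (n+1) ** p n \<oplus> i (n+1) ** f (n+1) ** p n \<oplus> i (n+1) ** dY n ** q n"
 using assms unfolding tmc_def tbip_def by metis+

lemma tmcI:
 assumes "!!n. tbip (dm (dX (n+1))) (dm (dY n)) (j n) (i n) (p n) (q n)" "!!n. cd (j n) = dm (dZ n)"
  "!!n. dZ n = j (n+1) ** \<ominus> dX (n+1) ** p n \<oplus> i (n+1) ** f (n+1) ** p n \<oplus> i (n+1) ** dY n ** q n"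
 shows "tmc dX dY f dZ i p j q"
 using assms unfolding tmc_def by blast

lemma tmc_cmor:
 assumes X: "cpx dX" and Y: "cpx dY" and f: "cmor dX f dY" and t: "tmc dX dY f dZ i p j q"
 shows "cmor dY i dZ" "cmor dZ p (shk 1 dX)"
proof -
 note [simp] = cpxD[OF X] cpxD[OF Y] cmorD[OF f] tmcD(1-17)[OF t]
 have [simp]: "dm (dZ n) \<in> Obj A" for n using ar_ob(1)[of "p n"] by simp
 have pi: "p m ** i m ** h = zr (dm h) (dm (dX (m+1)))" if "ar h" "cd h = dm (dY m)" for m h
  using that cmp_left[OF tmcD(15)[OF t], of m h] by simp
 have pj: "p m ** j m ** h = h" if "ar h" "cd h = dm (dX (m+1))" for m h
  using that cmp_left[OF tmcD(13)[OF t], of m h] by simp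
 have i1: "dZ n ** i n = i (n+1) ** dY n" for n
  by (subst tmcD(18)[OF t]) simp
 have p1: "\<ominus> (dX (n+1) ** p n) = p (n+1) ** dZ n" for n
  by (subst tmcD(18)[OF t]) (simp add: pi[of _ "n+1", simplified] pj[of _ "n+1", simplified])
 show "cmor dY i dZ" by (rule cmorI) (simp_all add: i1)
 show "cmor dZ p (shk 1 dX)" by (rule cmorI) (simp_all add: p1 shk_simps[OF X])
qed

text \<open>Taking cones of the vertical maps \<open>a\<close>, \<open>b\<close>, \<open>c\<close> turns two mapping
cones into a mapping cone. Compatibility of \<open>c\<close> with \<open>j\<close> and \<open>i\<close> determines \<open>c\<close>. The sign in \<open>-
j\<close> is that of \<open>theta\<close>.\<close>
lemma tmc_cone:
 assumes X: "cpx dX" and Y: "cpx dY" and f: "cmor dX f dY" and Z: "cpx dZ" and t: "tmc dX dY f dZ i p j q"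
  and X': "cpx sX" and Y': "cpx sY" and f': "cmor sX f' sY" and Z': "cpx sZ" and t': "tmc sX sY f' sZ i' p' j' q'"
  and a: "cmor dX a sX" and b: "cmor dY b sY" and c: "cmor dZ c sZ"
  and cj: "!!n. c n ** j n = j' n ** a (n+1)" and ci: "!!n. c n ** i n = i' n ** b n"
 shows "tmc (cone dX a sX) (cone dY b sY) (cmap f f') (cone dZ c sZ) (cmap i i')
  (%n. theta dX sX n ** cmap p p' n) (%n. diag2 (\<ominus> j (n+1)) (j' n)) (%n. diag2 (q (n+1)) (q' n))"
proof -
 note [simp] = cpxD[OF X] cpxD[OF Y] cmorD[OF f] tmcD(1-17)[OF t] cpxD[OF X'] cpxD[OF Y'] cmorD[OF f'] tmcD(1-17)[OF t']
  cmorD(1-3)[OF a] cmorD(1-3)[OF b] cmorD(1-3)[OF c] cpxD(1,2)[OF Z] cpxD(1,2)[OF Z']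
  dm_cone[OF X X' a] dm_cone[OF Y Y' b] dm_cone[OF Z Z' c]
 have P: "theta dX sX n ** cmap p p' n = diag2 (\<ominus> p (n+1)) (p' n)" for n
  by (simp add: theta_def cmap_def)
 have jp: "j n ** p n \<oplus> i n ** q n = idn (dm (dZ n))" "j' n ** p' n \<oplus> i' n ** q' n = idn (dm (sZ n))" for n
  using tmcD(17)[OF t] tmcD(17)[OF t'] by auto
 have c_dec: "c n = j' n ** a (n+1) ** p n \<oplus> i' n ** b n ** q n" for n
 proof -
  have "c n = c n ** (j n ** p n \<oplus> i n ** q n)" unfolding jp by simp
  also have "\<dots> = (c n ** j n) ** p n \<oplus> (c n ** i n) ** q n" by (simp only: cmp_pls cmp_assoc)
  finally show ?thesis unfolding cj ci by simp
 qed
 show ?thesis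
  unfolding P
 proof (rule tmcI)
  fix n
  show "tbip (dm (cone dX a sX (n+1))) (dm (cone dY b sY n)) (diag2 (\<ominus> j (n+1)) (j' n)) (cmap i i' n) (diag2 (\<ominus> p (n+1)) (p' n)) (diag2 (q (n+1)) (q' n))"
   unfolding tbip_def cmap_def
   by (simp add: diag2_idn diag2_zr diag2_pls)
  show "cd (diag2 (\<ominus> j (n+1)) (j' n)) = dm (cone dZ c sZ n)" by simp
  have dZ: "dZ (n+1) = j (n+1+1) ** \<ominus> dX (n+1+1) ** p (n+1) \<oplus> i (n+1+1) ** f (n+1+1) ** p (n+1) \<oplus> i (n+1+1) ** dY (n+1) ** q (n+1)"
   by (rule tmcD(18)[OF t])
  have sZ: "sZ n = j' (n+1) ** \<ominus> sX (n+1) ** p' n \<oplus> i' (n+1) ** f' (n+1) ** p' n \<oplus> i' (n+1) ** sY n ** q' n"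
   by (rule tmcD(18)[OF t'])
  show "cone dZ c sZ n = diag2 (\<ominus> j (n+1+1)) (j' (n+1)) ** \<ominus> cone dX a sX (n+1) ** diag2 (\<ominus> p (n+1)) (p' n)
    \<oplus> cmap i i' (n+1) ** cmap f f' (n+1) ** diag2 (\<ominus> p (n+1)) (p' n) \<oplus> cmap i i' (n+1) ** cone dY b sY n ** diag2 (q (n+1)) (q' n)"
   unfolding cone_row[OF X X' a] cone_row[OF Y Y' b] cone_row[OF Z Z' c] cmap_def
   unfolding dZ sZ c_dec[of "n+1"]
   by (simp add: diag2_def)
 qed
qed

section \<open>Finite sums\<close>

definition z0 :: 'o where "z0 = (SOME z. is_zero_object A z)"

lemma z0: "z0 \<in> Obj A" "ar f ==> dm f = z0 ==> f = zr z0 (cd f)" "ar f ==> cd f = z0 ==> f = zr (dm f) z0"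
proof -
 have z: "is_zero_object A z0" unfolding z0_def using zero_object by (rule someI_ex)
 then show 1: "z0 \<in> Obj A" by (simp add: is_zero_object_def)
 show "f = zr z0 (cd f)" if f: "ar f" "dm f = z0"
 proof -
  obtain f' y where f': "f = Some (z0, f', y)" "y \<in> Obj A" "f' \<in> Hom A z0 y" using f by (elim arE) auto
  have "f' = Zero A z0 y" using z f' zero_hom[OF 1 f'(2)] unfolding is_zero_object_def by blast
  then show ?thesis using f' 1 by (simp add: zr_def)
 qed
 show "f = zr (dm f) z0" if f: "ar f" "cd f = z0"
 proof -
  obtain f' y where f': "f = Some (y, f', z0)" "y \<in> Obj A" "f' \<in> Hom A y z0" using f by (elim arE) auto
  have "f' = Zero A y z0" using z f' zero_hom[OF f'(2) 1] unfolding is_zero_object_def by blast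
  then show ?thesis using f' 1 by (simp add: zr_def)
 qed
qed

lemma z0_simps [simp]: "z0 \<in> Obj A" "idn z0 = zr z0 z0"
 using z0(1) z0(2)[of "idn z0"] by simp_all

text \<open>Sums over a list, iterating the chosen biproducts; \<open>tup\<close> and \<open>cot\<close> are the maps
into and out of a sum given by their components, \<open>smap\<close> is diagonal.\<close>
primrec so :: "'s list => ('s => 'o) => 'o" where
 "so [] c = z0" | "so (s # ss) c = bo (c s) (so ss c)"
primrec smap :: "'s list => ('s => ('o, 'm) tarr) => ('o, 'm) tarr" where
 "smap [] f = zr z0 z0" | "smap (s # ss) f = diag2 (f s) (smap ss f)"
primrec tup :: "'o => 's list => ('s => ('o, 'm) tarr) => ('o, 'm) tarr" where
 "tup z [] u = zr z z0" | "tup z (s # ss) u = pr (u s) (tup z ss u)"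
primrec cot :: "'o => 's list => ('s => ('o, 'm) tarr) => ('o, 'm) tarr" where
 "cot z [] u = zr z0 z" | "cot z (s # ss) u = row (u s) (cot z ss u)"

lemma so_cong: "(!!s. s \<in> set ss ==> c s = c' s) ==> so ss c = so ss c'" by (induction ss) auto
lemma smap_cong: "(!!s. s \<in> set ss ==> c s = c' s) ==> smap ss c = smap ss c'" by (induction ss) auto
lemma tup_cong: "(!!s. s \<in> set ss ==> c s = c' s) ==> tup z ss c = tup z ss c'" by (induction ss) auto
lemma cot_cong: "(!!s. s \<in> set ss ==> c s = c' s) ==> cot z ss c = cot z ss c'" by (induction ss) auto

lemma so_Obj: "(!!s. s \<in> set ss ==> c s \<in> Obj A) ==> so ss c \<in> Obj A" by (induction ss) auto

lemma smap_ar: "(!!s. s \<in> set ss ==> ar (f s)) ==> ar (smap ss f) & dm (smap ss f) = so ss (%s. dm (f s)) & cd (smap ss f) = so ss (%s. cd (f s))"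
 by (induction ss) auto

lemma tup_ar: "z \<in> Obj A ==> (!!s. s \<in> set ss ==> ar (u s) & dm (u s) = z) ==>
  ar (tup z ss u) & dm (tup z ss u) = z & cd (tup z ss u) = so ss (%s. cd (u s))"
 by (induction ss) auto

lemma cot_ar: "z \<in> Obj A ==> (!!s. s \<in> set ss ==> ar (u s) & cd (u s) = z) ==>
  ar (cot z ss u) & cd (cot z ss u) = z & dm (cot z ss u) = so ss (%s. dm (u s))"
 by (induction ss) auto

lemma smap_smap: "(!!s. s \<in> set ss ==> ar (f s) & ar (g s) & dm (g s) = cd (f s)) ==>
  smap ss g ** smap ss f = smap ss (%s. g s ** f s)"
proof (induction ss)
 case (Cons s ss)
 have "ar (smap ss f)" "ar (smap ss g)" "dm (smap ss g) = cd (smap ss f)"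
  using Cons.prems smap_ar[of ss f] smap_ar[of ss g] so_cong[of ss "%s. dm (g s)" "%s. cd (f s)"] by auto
 then show ?case using Cons by simp
qed simp

lemma smap_tup: "z \<in> Obj A ==> (!!s. s \<in> set ss ==> ar (f s) & ar (u s) & dm (f s) = cd (u s) & dm (u s) = z) ==>
  smap ss f ** tup z ss u = tup z ss (%s. f s ** u s)"
proof (induction ss)
 case (Cons s ss)
 have "ar (smap ss f)" "ar (tup z ss u)" "dm (smap ss f) = cd (tup z ss u)" "dm (tup z ss u) = z"
  using Cons.prems smap_ar[of ss f] tup_ar[of z ss u] so_cong[of ss "%s. dm (f s)" "%s. cd (u s)"] by auto
 then show ?case using Cons by simp
qed simp

lemma cot_smap: "z \<in> Obj A ==> (!!s. s \<in> set ss ==> ar (f s) & ar (u s) & cd (f s) = dm (u s) & cd (u s) = z) ==>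
  cot z ss u ** smap ss f = cot z ss (%s. u s ** f s)"
proof (induction ss)
 case (Cons s ss)
 have "ar (smap ss f)" "ar (cot z ss u)" "cd (smap ss f) = dm (cot z ss u)" "cd (cot z ss u) = z"
  using Cons.prems smap_ar[of ss f] cot_ar[of z ss u] so_cong[of ss "%s. cd (f s)" "%s. dm (u s)"] by auto
 then show ?case using Cons by simp
qed simp

lemma tup_cmp: "z \<in> Obj A ==> ar h ==> cd h = z ==> (!!s. s \<in> set ss ==> ar (u s) & dm (u s) = z) ==>
  tup z ss u ** h = tup (dm h) ss (%s. u s ** h)"
proof (induction ss)
 case (Cons s ss)
 then show ?case using tup_ar[of z ss u] by simp
qed simp

lemma cmp_cot: "z \<in> Obj A ==> ar h ==> dm h = z ==> (!!s. s \<in> set ss ==> ar (u s) & cd (u s) = z) ==>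
  h ** cot z ss u = cot (cd h) ss (%s. h ** u s)"
proof (induction ss)
 case (Cons s ss)
 then show ?case using cot_ar[of z ss u] by simp
qed simp

lemma cot_tup_zero: "z \<in> Obj A ==> z' \<in> Obj A ==> (!!t. t \<in> set ss ==> ar (v t) & ar (u t) & dm (v t) = cd (u t) & dm (u t) = z & cd (v t) = z' & v t ** u t = zr z z') ==>
  cot z' ss v ** tup z ss u = zr z z'"
proof (induction ss)
 case (Cons s ss)
 have "ar (cot z' ss v)" "ar (tup z ss u)" "dm (cot z' ss v) = cd (tup z ss u)" "dm (tup z ss u) = z" "cd (cot z' ss v) = z'"
  using Cons.prems cot_ar[of z' ss v] tup_ar[of z ss u] so_cong[of ss "%s. dm (v s)" "%s. cd (u s)"] by auto
 then show ?case using Cons by simp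
qed simp

lemma cot_tup_single: "z \<in> Obj A ==> z' \<in> Obj A ==> distinct ss ==> s \<in> set ss ==>
  (!!t. t \<in> set ss ==> ar (v t) & ar (u t) & dm (v t) = cd (u t) & dm (u t) = z & cd (v t) = z' & (t ~= s --> v t ** u t = zr z z')) ==>
  cot z' ss v ** tup z ss u = v s ** u s"
proof (induction ss)
 case (Cons t ss)
 have T: "ar (cot z' ss v)" "ar (tup z ss u)" "dm (cot z' ss v) = cd (tup z ss u)" "dm (tup z ss u) = z" "cd (cot z' ss v) = z'"
  using Cons.prems cot_ar[of z' ss v] tup_ar[of z ss u] so_cong[of ss "%s. dm (v s)" "%s. cd (u s)"] by auto
 show ?case
 proof (cases "t = s")
  case True
  then have "cot z' ss v ** tup z ss u = zr z z'" using Cons.prems by (intro cot_tup_zero) auto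
  then show ?thesis using True Cons.prems T by simp
 next
  case False
  then have "cot z' ss v ** tup z ss u = v s ** u s" using Cons by auto
  then show ?thesis using False Cons.prems T by auto
 qed
qed simp

text \<open>Entries of the identity matrix.\<close>
definition delta :: "('s => 'o) => 's => 's => ('o, 'm) tarr" where
 "delta c s t = (if s = t then idn (c s) else zr (c s) (c t))"

lemma delta_ar: "c s \<in> Obj A ==> c t \<in> Obj A ==> ar (delta c s t) & dm (delta c s t) = c s & cd (delta c s t) = c t"
 by (simp add: delta_def)

lemma tup_zero: "z \<in> Obj A ==> (!!s. s \<in> set ss ==> c s \<in> Obj A) ==> tup z ss (%s. zr z (c s)) = zr z (so ss c)"
 by (induction ss) (auto simp: so_Obj)

lemma cot_zero: "z \<in> Obj A ==> (!!s. s \<in> set ss ==> c s \<in> Obj A) ==> cot z ss (%s. zr (c s) z) = zr (so ss c) z"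
 by (induction ss) (auto simp: so_Obj)

lemma cot_pr: "x \<in> Obj A ==> y \<in> Obj A ==> (!!s. s \<in> set ss ==> ar (u s) & ar (w s) & dm (u s) = dm (w s) & cd (u s) = x & cd (w s) = y) ==>
  cot (bo x y) ss (%s. pr (u s) (w s)) = pr (cot x ss u) (cot y ss w)"
proof (induction ss)
 case (Cons s ss)
 have T: "ar (cot x ss u)" "ar (cot y ss w)" "cd (cot x ss u) = x" "cd (cot y ss w) = y" "dm (cot x ss u) = dm (cot y ss w)"
  using Cons.prems cot_ar[of x ss u] cot_ar[of y ss w] so_cong[of ss "%s. dm (u s)" "%s. dm (w s)"] by auto
 have "cot (bo x y) (s # ss) (%s. pr (u s) (w s)) = row (pr (u s) (w s)) (pr (cot x ss u) (cot y ss w))" using Cons by simp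
 also have "\<dots> = pr (row (u s) (cot x ss u)) (row (w s) (cot y ss w))"
  using T Cons.prems(1,2) Cons.prems(3)[of s]
  unfolding row_def[of "pr (u s) (w s)"] by simp (simp add: row_def)
 finally show ?case by simp
qed simp

lemma tup_row: "x \<in> Obj A ==> y \<in> Obj A ==> (!!s. s \<in> set ss ==> ar (u s) & ar (w s) & cd (u s) = cd (w s) & dm (u s) = x & dm (w s) = y) ==>
  tup (bo x y) ss (%s. row (u s) (w s)) = row (tup x ss u) (tup y ss w)"
proof (induction ss)
 case (Cons s ss)
 have T: "ar (tup x ss u)" "ar (tup y ss w)" "dm (tup x ss u) = x" "dm (tup y ss w) = y" "cd (tup x ss u) = cd (tup y ss w)"
  using Cons.prems tup_ar[of x ss u] tup_ar[of y ss w] so_cong[of ss "%s. cd (u s)" "%s. cd (w s)"] by auto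
 have "tup (bo x y) (s # ss) (%s. row (u s) (w s)) = pr (row (u s) (w s)) (row (tup x ss u) (tup y ss w))" using Cons by simp
 also have "\<dots> = row (pr (u s) (tup x ss u)) (pr (w s) (tup y ss w))"
  using T Cons.prems(1,2) Cons.prems(3)[of s]
  unfolding row_def[of "pr (u s) (tup x ss u)"] by simp (simp add: row_def)
 finally show ?case by simp
qed simp

lemma cot_tup_delta:
 assumes "distinct ss" "!!s. s \<in> set ss ==> c s \<in> Obj A"
 shows "cot (so ss c) ss (%s. tup (c s) ss (delta c s)) = idn (so ss c)"
 using assms
proof (induction ss)
 case (Cons s ss)
 have o: "c s \<in> Obj A" "so ss c \<in> Obj A" "!!t. t \<in> set ss ==> c t \<in> Obj A" using Cons.prems by (auto intro: so_Obj)
 have 1: "tup (c s) ss (delta c s) = zr (c s) (so ss c)"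
 proof -
  have "tup (c s) ss (delta c s) = tup (c s) ss (%t. zr (c s) (c t))"
   by (rule tup_cong) (use Cons.prems in \<open>auto simp: delta_def\<close>)
  then show ?thesis using o by (simp add: tup_zero)
 qed
 have ta: "ar (tup (c t) ss (delta c t)) & dm (tup (c t) ss (delta c t)) = c t & cd (tup (c t) ss (delta c t)) = so ss c" if "t \<in> set ss" for t
 proof -
  have "ar (tup (c t) ss (delta c t)) & dm (tup (c t) ss (delta c t)) = c t & cd (tup (c t) ss (delta c t)) = so ss (%s. cd (delta c t s))"
   by (rule tup_ar) (use o(3) that in \<open>auto simp: delta_ar\<close>)
  then show ?thesis using so_cong[of ss "%s. cd (delta c t s)" c] o(3) that by (auto simp: delta_ar)
 qed
 have "cot (bo (c s) (so ss c)) ss (%t. pr (delta c t s) (tup (c t) ss (delta c t))) =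
  cot (bo (c s) (so ss c)) ss (%t. pr (zr (c t) (c s)) (tup (c t) ss (delta c t)))"
  by (rule cot_cong) (use Cons.prems in \<open>auto simp: delta_def\<close>)
 also have "\<dots> = pr (cot (c s) ss (%t. zr (c t) (c s))) (cot (so ss c) ss (%s. tup (c s) ss (delta c s)))"
  by (rule cot_pr) (use o ta in auto)
 also have "\<dots> = pr (zr (so ss c) (c s)) (idn (so ss c))" using Cons o by (simp add: cot_zero)
 finally have 2: "cot (bo (c s) (so ss c)) ss (%t. pr (delta c t s) (tup (c t) ss (delta c t))) = pr (zr (so ss c) (c s)) (idn (so ss c))" .
 have "row (pr (idn (c s)) (zr (c s) (so ss c))) (pr (zr (so ss c) (c s)) (idn (so ss c))) = idn (bo (c s) (so ss c))"
  using o by (simp add: row_def bo_expand(2,4)[symmetric])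
 moreover have "delta c s s = idn (c s)" by (simp add: delta_def)
 ultimately show ?case using 1 2 by simp
qed simp

lemma tup_cot_delta:
 assumes "distinct ss" "!!s. s \<in> set ss ==> c s \<in> Obj A"
 shows "tup (so ss c) ss (%s. cot (c s) ss (%t. delta c t s)) = idn (so ss c)"
 using assms
proof (induction ss)
 case (Cons s ss)
 have o: "c s \<in> Obj A" "so ss c \<in> Obj A" "!!t. t \<in> set ss ==> c t \<in> Obj A" using Cons.prems by (auto intro: so_Obj)
 have 1: "cot (c s) ss (%t. delta c t s) = zr (so ss c) (c s)"
 proof -
  have "cot (c s) ss (%t. delta c t s) = cot (c s) ss (%t. zr (c t) (c s))"
   by (rule cot_cong) (use Cons.prems in \<open>auto simp: delta_def\<close>)
  then show ?thesis using o by (simp add: cot_zero)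
 qed
 have ta: "ar (cot (c t) ss (%r. delta c r t)) & cd (cot (c t) ss (%r. delta c r t)) = c t & dm (cot (c t) ss (%r. delta c r t)) = so ss c" if "t \<in> set ss" for t
 proof -
  have "ar (cot (c t) ss (%r. delta c r t)) & cd (cot (c t) ss (%r. delta c r t)) = c t & dm (cot (c t) ss (%r. delta c r t)) = so ss (%s. dm (delta c s t))"
   by (rule cot_ar) (use o(3) that in \<open>auto simp: delta_ar\<close>)
  then show ?thesis using so_cong[of ss "%s. dm (delta c s t)" c] o(3) that by (auto simp: delta_ar)
 qed
 have "tup (bo (c s) (so ss c)) ss (%t. row (delta c s t) (cot (c t) ss (%r. delta c r t))) =
  tup (bo (c s) (so ss c)) ss (%t. row (zr (c s) (c t)) (cot (c t) ss (%r. delta c r t)))"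
  by (rule tup_cong) (use Cons.prems in \<open>auto simp: delta_def\<close>)
 also have "\<dots> = row (tup (c s) ss (%t. zr (c s) (c t))) (tup (so ss c) ss (%t. cot (c t) ss (%r. delta c r t)))"
  by (rule tup_row) (use o ta in auto)
 also have "\<dots> = row (zr (c s) (so ss c)) (idn (so ss c))" using Cons o by (simp add: tup_zero)
 finally have 2: "tup (bo (c s) (so ss c)) ss (%t. row (delta c s t) (cot (c t) ss (%r. delta c r t))) = row (zr (c s) (so ss c)) (idn (so ss c))" .
 have "pr (row (idn (c s)) (zr (so ss c) (c s))) (row (zr (c s) (so ss c)) (idn (so ss c))) = idn (bo (c s) (so ss c))"
  using o by (simp add: bo_expand(1))
 moreover have "delta c s s = idn (c s)" by (simp add: delta_def)
 ultimately show ?case using 1 2 by simp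
qed simp

lemma smap_idn: "(!!s. s \<in> set ss ==> c s \<in> Obj A) ==> smap ss (%s. idn (c s)) = idn (so ss c)"
 by (induction ss) (auto simp: diag2_idn so_Obj)

lemma smap_zr: "(!!s. s \<in> set ss ==> c s \<in> Obj A & c' s \<in> Obj A) ==> smap ss (%s. zr (c s) (c' s)) = zr (so ss c) (so ss c')"
 by (induction ss) (auto simp: diag2_zr so_Obj)

lemma smap_pls: "(!!s. s \<in> set ss ==> ar (f s) & ar (g s) & dm (f s) = dm (g s) & cd (f s) = cd (g s)) ==>
  smap ss f \<oplus> smap ss g = smap ss (%s. f s \<oplus> g s)"
proof (induction ss)
 case (Cons s ss)
 have "ar (smap ss f)" "ar (smap ss g)" "dm (smap ss f) = dm (smap ss g)" "cd (smap ss f) = cd (smap ss g)"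
  using Cons.prems smap_ar[of ss f] smap_ar[of ss g] so_cong[of ss "%s. dm (f s)" "%s. dm (g s)"] so_cong[of ss "%s. cd (f s)" "%s. cd (g s)"] by auto
 then show ?case using Cons by (simp add: diag2_pls)
qed simp

lemma smap_ng: "(!!s. s \<in> set ss ==> ar (f s)) ==> \<ominus> smap ss f = smap ss (%s. \<ominus> f s)"
proof (induction ss)
 case (Cons s ss)
 then show ?case using smap_ar[of ss f] by (simp add: diag2_ng)
qed simp

lemma smap_cpx:
 assumes "!!s. s \<in> set ss ==> cpx (d s)"
 shows "cpx (%n. smap ss (%s. d s n))"
proof (rule cpxI)
 fix n
 have a: "ar (smap ss (%s. d s n)) & dm (smap ss (%s. d s n)) = so ss (%s. dm (d s n)) & cd (smap ss (%s. d s n)) = so ss (%s. dm (d s (n+1)))" for n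
  using smap_ar[of ss "%s. d s n"] so_cong[of ss "%s. cd (d s n)" "%s. dm (d s (n+1))"] cpxD(1,2)[OF assms] by auto
 show "ar (smap ss (%s. d s n))" "cd (smap ss (%s. d s n)) = dm (smap ss (%s. d s (n+1)))" using a by auto
 have "smap ss (%s. d s (n+1)) ** smap ss (%s. d s n) = smap ss (%s. zr (dm (d s n)) (dm (d s (n+1+1))))"
  by (subst smap_smap) (auto simp: cpxD assms intro!: smap_cong)
 also have "\<dots> = zr (dm (smap ss (%s. d s n))) (dm (smap ss (%s. d s (n+1+1))))"
  using a[of n] a[of "n+1+1"] cpxD(1)[OF assms] by (simp add: smap_zr)
 finally show "smap ss (%s. d s (n+1)) ** smap ss (%s. d s n) = zr (dm (smap ss (%s. d s n))) (dm (smap ss (%s. d s (n+1+1))))" .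
qed

lemma dm_smap: "(!!s. s \<in> set ss ==> cpx (d s)) ==> dm (smap ss (%s. d s n)) = so ss (%s. dm (d s n))"
 using smap_ar[of ss "%s. d s n"] cpxD(1) by blast

lemma smap_cmor:
 assumes "!!s. s \<in> set ss ==> cpx (d s)" "!!s. s \<in> set ss ==> cpx (e s)" "!!s. s \<in> set ss ==> cmor (d s) (f s) (e s)"
 shows "cmor (%n. smap ss (%s. d s n)) (%n. smap ss (%s. f s n)) (%n. smap ss (%s. e s n))"
proof (rule cmorI)
 fix n
 note F = cmorD[OF assms(3)]
 show "ar (smap ss (%s. f s n))" "dm (smap ss (%s. f s n)) = dm (smap ss (%s. d s n))" "cd (smap ss (%s. f s n)) = dm (smap ss (%s. e s n))"
  using smap_ar[of ss "%s. f s n"] F so_cong[of ss "%s. dm (f s n)" "%s. dm (d s n)"] so_cong[of ss "%s. cd (f s n)" "%s. dm (e s n)"]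
   dm_smap[of ss d n] dm_smap[of ss e n] assms by auto
 show "smap ss (%s. e s n) ** smap ss (%s. f s n) = smap ss (%s. f s (n+1)) ** smap ss (%s. d s n)"
  by (subst (1 2) smap_smap) (auto simp: F cpxD assms intro!: smap_cong)
qed

text \<open>Induction on the list: a binary sum is the twisted sum with twist zero.\<close>
lemma smap_qi:
 assumes "!!s. s \<in> set ss ==> cpx (d s)" "!!s. s \<in> set ss ==> cpx (e s)" "!!s. s \<in> set ss ==> cmor (d s) (f s) (e s)"
  "!!s. s \<in> set ss ==> qi (d s) (f s) (e s)"
 shows "qi (%n. smap ss (%s. d s n)) (%n. smap ss (%s. f s n)) (%n. smap ss (%s. e s n))"
 using assms
proof (induction ss)
 case Nil
 have "cpx (%n. zr z0 z0)" by (rule cpxI) simp_all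
 then show ?case by (simp, intro qi_iso[of _ _ _ "%n. zr z0 z0"]) (auto intro!: cmorI)
next
 case (Cons s ss)
 let ?d' = "%n. smap ss (%s. d s n)" and ?e' = "%n. smap ss (%s. e s n)" and ?f' = "%n. smap ss (%s. f s n)"
 have c: "cpx ?d'" "cpx ?e'" "cmor ?d' ?f' ?e'" "qi ?d' ?f' ?e'" using Cons by (auto intro: smap_cpx smap_cmor)
 have s: "cpx (d s)" "cpx (e s)" "cmor (d s) (f s) (e s)" "qi (d s) (f s) (e s)" using Cons.prems by auto
 note [simp] = cpxD(1,2)[OF c(1)] cpxD(1,2)[OF c(2)] cpxD(1,2)[OF s(1)] cpxD(1,2)[OF s(2)]
 have t: "twist (d s) (%n. zr (dm (d s n)) (dm (?d' (n+1)))) ?d'" "twist (e s) (%n. zr (dm (e s n)) (dm (?e' (n+1)))) ?e'"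
  unfolding twist_def using c s by auto
 have "qi (tw (d s) (%n. zr (dm (d s n)) (dm (?d' (n+1)))) ?d') (%n. diag2 (f s n) (?f' n)) (tw (e s) (%n. zr (dm (e s n)) (dm (?e' (n+1)))) ?e')"
  by (rule tmap_qi[OF t s(3) c(3) _ s(4) c(4)]) (use cmorD(1-3)[OF s(3)] cmorD(1-3)[OF c(3)] in simp)
 moreover have "tw (d s) (%n. zr (dm (d s n)) (dm (?d' (n+1)))) ?d' = (%n. diag2 (d s n) (?d' n))"
  "tw (e s) (%n. zr (dm (e s n)) (dm (?e' (n+1)))) ?e' = (%n. diag2 (e s n) (?e' n))"
  by (simp_all add: tw_def diag2_def fun_eq_iff)
 ultimately show ?case by simp
qed

lemma smap_tmc:
 assumes X: "!!s. s \<in> set ss ==> cpx (dX s)" and Y: "!!s. s \<in> set ss ==> cpx (dY s)" and Z: "!!s. s \<in> set ss ==> cpx (dZ s)"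
  and f: "!!s. s \<in> set ss ==> cmor (dX s) (f s) (dY s)"
  and t: "!!s. s \<in> set ss ==> tmc (dX s) (dY s) (f s) (dZ s) (i s) (p s) (j s) (q s)"
 shows "tmc (%n. smap ss (%s. dX s n)) (%n. smap ss (%s. dY s n)) (%n. smap ss (%s. f s n)) (%n. smap ss (%s. dZ s n))
  (%n. smap ss (%s. i s n)) (%n. smap ss (%s. p s n)) (%n. smap ss (%s. j s n)) (%n. smap ss (%s. q s n))"
proof (rule tmcI)
 fix n
 note D = tmcD[OF t] and F = cmorD[OF f] and C = cpxD(1,2)[OF X] cpxD(1,2)[OF Y] cpxD(1,2)[OF Z]
 note dms = dm_smap[of ss dX, OF X] dm_smap[of ss dY, OF Y] dm_smap[of ss dZ, OF Z]
 have a: "ar (smap ss (%s. j s n)) & dm (smap ss (%s. j s n)) = so ss (%s. dm (dX s (n+1))) & cd (smap ss (%s. j s n)) = so ss (%s. dm (dZ s n))"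
   "ar (smap ss (%s. i s n)) & dm (smap ss (%s. i s n)) = so ss (%s. dm (dY s n)) & cd (smap ss (%s. i s n)) = so ss (%s. dm (dZ s n))"
   "ar (smap ss (%s. p s n)) & dm (smap ss (%s. p s n)) = so ss (%s. dm (dZ s n)) & cd (smap ss (%s. p s n)) = so ss (%s. dm (dX s (n+1)))"
   "ar (smap ss (%s. q s n)) & dm (smap ss (%s. q s n)) = so ss (%s. dm (dZ s n)) & cd (smap ss (%s. q s n)) = so ss (%s. dm (dY s n))" for n
  using smap_ar[of ss "%s. j s n"] smap_ar[of ss "%s. i s n"] smap_ar[of ss "%s. p s n"] smap_ar[of ss "%s. q s n"]
  by (simp_all add: D(1-12) cong: so_cong)
 have m: "smap ss (%s. p s n) ** smap ss (%s. j s n) = idn (so ss (%s. dm (dX s (n+1))))"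
  "smap ss (%s. q s n) ** smap ss (%s. i s n) = idn (so ss (%s. dm (dY s n)))"
  "smap ss (%s. p s n) ** smap ss (%s. i s n) = zr (so ss (%s. dm (dY s n))) (so ss (%s. dm (dX s (n+1))))"
  "smap ss (%s. q s n) ** smap ss (%s. j s n) = zr (so ss (%s. dm (dX s (n+1)))) (so ss (%s. dm (dY s n)))"
  "smap ss (%s. j s n) ** smap ss (%s. p s n) \<oplus> smap ss (%s. i s n) ** smap ss (%s. q s n) = idn (so ss (%s. dm (dZ s n)))" for n
  by (simp_all add: smap_smap D(1-17) C smap_idn smap_zr smap_pls cong: smap_cong)
 show "tbip (dm (smap ss (%s. dX s (n+1)))) (dm (smap ss (%s. dY s n))) (smap ss (%s. j s n)) (smap ss (%s. i s n)) (smap ss (%s. p s n)) (smap ss (%s. q s n))"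
  unfolding tbip_def using a[of n] m[of n] by (simp add: dms)
 show "cd (smap ss (%s. j s n)) = dm (smap ss (%s. dZ s n))" using a[of n] by (simp add: dms)
 show "smap ss (%s. dZ s n) = smap ss (%s. j s (n+1)) ** \<ominus> smap ss (%s. dX s (n+1)) ** smap ss (%s. p s n)
   \<oplus> smap ss (%s. i s (n+1)) ** smap ss (%s. f s (n+1)) ** smap ss (%s. p s n)
   \<oplus> smap ss (%s. i s (n+1)) ** smap ss (%s. dY s n) ** smap ss (%s. q s n)"
 proof -
  have e0: "\<ominus> smap ss (%s. dX s (n+1)) = smap ss (%s. \<ominus> dX s (n+1))" by (rule smap_ng) (simp add: C)
  have e1: "smap ss (%s. j s (n+1)) ** smap ss (%s. \<ominus> dX s (n+1)) ** smap ss (%s. p s n) =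
    smap ss (%s. j s (n+1) ** \<ominus> dX s (n+1) ** p s n)"
   by (subst smap_smap, simp add: D(1-12) C, subst smap_smap, simp_all add: D(1-12) C)
  have e2: "smap ss (%s. i s (n+1)) ** smap ss (%s. f s (n+1)) ** smap ss (%s. p s n) =
    smap ss (%s. i s (n+1) ** f s (n+1) ** p s n)"
   by (subst smap_smap, simp add: D(1-12) C F(1-3), subst smap_smap, simp_all add: D(1-12) C F(1-3))
  have e3: "smap ss (%s. i s (n+1)) ** smap ss (%s. dY s n) ** smap ss (%s. q s n) =
    smap ss (%s. i s (n+1) ** dY s n ** q s n)"
   by (subst smap_smap, simp add: D(1-12) C, subst smap_smap, simp_all add: D(1-12) C)
  show ?thesis unfolding e0 e1 e2 e3
   by (subst smap_pls, simp add: D(1-12) C F(1-3), subst smap_pls, simp add: D(1-12) C F(1-3))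
    (rule smap_cong, rule tmcD(18)[OF t])
 qed
qed

end

section \<open>Diagrams of complexes\<close>

context preadditive_category
begin

lemma ar_eq: "ar t ==> t = Some (dm t, un t, cd t)"
 by (elim arE) simp

lemma un_simps:
 "ar g ==> ar f ==> dm g = cd f ==> un (g ** f) = un g \<cdot> un f"
 "ar g ==> ar f ==> dm g = dm f ==> cd g = cd f ==> un (g \<oplus> f) = un g \<boxplus> un f"
 "ar f ==> un (\<ominus> f) = Neg A (dm f) (cd f) (un f)"
 "x \<in> Obj A ==> un (idn x) = Ident A x" "x \<in> Obj A ==> y \<in> Obj A ==> un (zr x y) = Zero A x y"
 by (simp_all add: cmp_def pls_def ng_def idn_def zr_def)

lemma None_cmp [simp]: "None ** f = None" "f ** None = None" "\<ominus> None = None"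
 by (simp_all add: cmp_def ng_def)

lemma un_hom: "ar t ==> dm t = x ==> cd t = y ==> un t \<in> Hom A x y"
 using ar_un by blast

lemma pls_Some: "x \<in> Obj A ==> y \<in> Obj A ==> f \<in> Hom A x y ==> g \<in> Hom A x y ==>
  Some (x, f, y) \<oplus> Some (x, g, y) = Some (x, f \<boxplus> g, y)"
 by (simp add: pls_def)

lemma ng_Some: "x \<in> Obj A ==> y \<in> Obj A ==> f \<in> Hom A x y ==> \<ominus> Some (x, f, y) = Some (x, Neg A x y f, y)"
 by (simp add: ng_def)

end

lemma nat_transD:
 assumes "nat_trans C D F G \<eta>"
 shows "x \<in> Obj C ==> \<eta> x \<in> Hom D (on_obj F x) (on_obj G x)"
  "x \<in> Obj C ==> y \<in> Obj C ==> f \<in> Hom C x y ==> \<eta> y \<cdot>\<^bsub>D\<^esub> on_arr F x y f = on_arr G x y f \<cdot>\<^bsub>D\<^esub> \<eta> x"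
 using assms by (simp_all add: nat_trans_def)

type_synonym ('x, 'o, 'm) sdiag = "('x => ('o, 'm) gmap) \<times> ('x => 'x => ('o, 'm) gmap)"
type_synonym ('x, 'o, 'm) smor = "'x => ('o, 'm) gmap"

context abelian_category
begin

text \<open>A complex of diagrams in tagged form: a complex at each point and transition maps between them. Outside
the carrier the value is fixed, so that equality of such data is equality on the carrier.\<close>
definition is_diag :: "'x set => 'x rel => ('x, 'o, 'm) sdiag => bool" where
 "is_diag X r M \<longleftrightarrow> (\<forall>x\<in>X. cpx (fst M x)) & (\<forall>x y. (x, y) \<in> r --> cmor (fst M x) (snd M x y) (fst M y)) &
   (\<forall>x\<in>X. \<forall>n. snd M x x n = idn (dm (fst M x n))) &
   (\<forall>x y z n. (x, y) \<in> r & (y, z) \<in> r --> snd M x z n = snd M y z n ** snd M x y n) &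
   (\<forall>x. x \<notin> X --> fst M x = (%_. None)) & (\<forall>x y. (x, y) \<notin> r --> snd M x y = (%_. None))"

definition is_dmor :: "'x set => 'x rel => ('x, 'o, 'm) sdiag => ('x, 'o, 'm) smor => ('x, 'o, 'm) sdiag => bool" where
 "is_dmor X r M f N \<longleftrightarrow> (\<forall>x\<in>X. cmor (fst M x) (f x) (fst N x)) &
   (\<forall>x y n. (x, y) \<in> r --> snd N x y n ** f x n = f y n ** snd M x y n) & (\<forall>x. x \<notin> X --> f x = (%_. None))"

definition DG :: "'x set => 'x rel => (('x, 'o, 'm) sdiag, ('x, 'o, 'm) smor) precategory" where
 "DG X r = \<lparr>Obj = {M. is_diag X r M}, Hom = (%M N. {f. is_dmor X r M f N}),
   Comp = (%g f x n. g x n ** f x n), Ident = (%M x n. if x \<in> X then idn (dm (fst M x n)) else None)\<rparr>"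

lemma DG_sel [simp]: "Obj (DG X r) = {M. is_diag X r M}" "Hom (DG X r) M N = {f. is_dmor X r M f N}"
  "Comp (DG X r) g f = (%x n. g x n ** f x n)" "Ident (DG X r) M = (%x n. if x \<in> X then idn (dm (fst M x n)) else None)"
 by (simp_all add: DG_def)

lemma is_diagD:
 assumes "is_diag X r M"
 shows "x \<in> X ==> cpx (fst M x)" "(x, y) \<in> r ==> cmor (fst M x) (snd M x y) (fst M y)"
  "x \<in> X ==> snd M x x n = idn (dm (fst M x n))"
  "(x, y) \<in> r ==> (y, z) \<in> r ==> snd M x z n = snd M y z n ** snd M x y n"
  "x \<notin> X ==> fst M x = (%_. None)" "(x, y) \<notin> r ==> snd M x y = (%_. None)"
 using assms unfolding is_diag_def by blast+

lemma is_dmorD: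
 assumes "is_dmor X r M f N"
 shows "x \<in> X ==> cmor (fst M x) (f x) (fst N x)"
  "(x, y) \<in> r ==> snd N x y n ** f x n = f y n ** snd M x y n" "x \<notin> X ==> f x = (%_. None)"
 using assms unfolding is_dmor_def by blast+

definition dshift :: "(('x, 'o, 'm) sdiag, ('x, 'o, 'm) smor, ('x, 'o, 'm) sdiag, ('x, 'o, 'm) smor) func" where
 "dshift = \<lparr>on_obj = (%M. (%x. shk 1 (fst M x), %x y n. snd M x y (n+1))), on_arr = (%_ _ f x n. f x (n+1))\<rparr>"

lemma dshift_sel [simp]: "on_obj dshift M = (%x. shk 1 (fst M x), %x y n. snd M x y (n+1))" "on_arr dshift M N f = (%x n. f x (n+1))"
 by (simp_all add: dshift_def)

text \<open>The splittings of a cone of diagrams have to be maps of diagrams in each degree, but not maps of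
complexes.\<close>
definition dmc :: "'x set => 'x rel => ('x, 'o, 'm) sdiag => ('x, 'o, 'm) sdiag => ('x, 'o, 'm) smor => ('x, 'o, 'm) sdiag =>
  ('x, 'o, 'm) smor => ('x, 'o, 'm) smor => bool" where
 "dmc X r M N f Z i p \<longleftrightarrow> (\<exists>j q. (\<forall>x\<in>X. tmc (fst M x) (fst N x) (f x) (fst Z x) (i x) (p x) (j x) (q x)) &
   (\<forall>x y n. (x, y) \<in> r --> snd Z x y n ** j x n = j y n ** snd M x y (n+1) & q y n ** snd Z x y n = snd N x y n ** q x n))"

text \<open>Passage from tagged data to complexes in the functor category; \<open>tgC\<close> below is its inverse,
and the two are strict isomorphisms of categories.\<close>
definition mkC :: "'x set => 'x rel => ('x, 'o, 'm) sdiag => (('x, unit, 'o, 'm) func, 'x => 'm) cochain" where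
 "mkC X r M = \<lparr>deg = (%n. \<lparr>on_obj = (%x. if x \<in> X then dm (fst M x n) else undefined),
   on_arr = (%x y u. if (x, y) \<in> r then un (snd M x y n) else undefined)\<rparr>),
  diff = (%n x. if x \<in> X then un (fst M x n) else undefined)\<rparr>"

definition mkm :: "'x set => ('x, 'o, 'm) smor => int => 'x => 'm" where
 "mkm X f = (%n x. if x \<in> X then un (f x n) else undefined)"

definition tgC :: "'x set => 'x rel => (('x, unit, 'o, 'm) func, 'x => 'm) cochain => ('x, 'o, 'm) sdiag" where
 "tgC X r M = (%x n. if x \<in> X then Some (on_obj (deg M n) x, diff M n x, on_obj (deg M (n+1)) x) else None,
   %x y n. if (x, y) \<in> r then Some (on_obj (deg M n) x, on_arr (deg M n) x y (), on_obj (deg M n) y) else None)"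

definition tgm :: "'x set => (('x, unit, 'o, 'm) func, 'x => 'm) cochain => (('x, unit, 'o, 'm) func, 'x => 'm) cochain =>
  (int => 'x => 'm) => ('x, 'o, 'm) smor" where
 "tgm X M N f = (%x n. if x \<in> X then Some (on_obj (deg M n) x, f n x, on_obj (deg N n) x) else None)"

end

context abelian_diagrams
begin

abbreviation "CF \<equiv> complex_category FC"

lemma CF_hom:
 assumes "f \<in> Hom CF M N" shows "f n \<in> Hom FC (deg M n) (deg N n)" "diff N n \<bullet> f n = f (n+1) \<bullet> diff M n"
 using assms by (auto simp: complex_category_def)

lemma tgC_fst: "x \<in> X ==> fst (tgC X r M) x = st (ev M x)"
 by (simp add: tgC_def st_def fun_eq_iff)

lemma tgm_stm: "x \<in> X ==> tgm X M N f x = stm (ev M x) (ev N x) (%n. f n x)"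
 by (simp add: tgm_def stm_def fun_eq_iff)

lemma tgC_diag:
 assumes M: "M \<in> Obj CF" shows "is_diag X r (tgC X r M)"
 unfolding is_diag_def
proof (intro conjI allI ballI impI)
 note d = complexD[OF M]
 note o = FC_objD[OF d(1)] and h = FC_homD[OF d(2)]
 show "cpx (fst (tgC X r M) x)" if "x \<in> X" for x
  using ev_Obj[OF M that] by (simp add: tgC_fst that cpx_st)
 show "cmor (fst (tgC X r M) x) (snd (tgC X r M) x y) (fst (tgC X r M) y)" if xy: "(x, y) \<in> r" for x y
 proof (rule cmorI)
  fix n
  note X = r_in[OF xy]
  note hom = h(1)[OF X(1)] h(1)[OF X(2)] o(2)[OF xy] and ob = o(1)[OF X(1)] o(1)[OF X(2)]
  have "Some (on_obj (deg M n) y, diff M n y, on_obj (deg M (n+1)) y) ** Some (on_obj (deg M n) x, on_arr (deg M n) x y (), on_obj (deg M n) y) =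
   Some (on_obj (deg M (n+1)) x, on_arr (deg M (n+1)) x y (), on_obj (deg M (n+1)) y) ** Some (on_obj (deg M n) x, diff M n x, on_obj (deg M (n+1)) x)"
   unfolding cmp_Some[OF ob(1) ob(2) ob(2) hom(3) hom(2)] cmp_Some[OF ob(1) ob(1) ob(2) hom(1) hom(3)] h(2)[OF xy] ..
  then show "fst (tgC X r M) y n ** snd (tgC X r M) x y n = snd (tgC X r M) x y (n+1) ** fst (tgC X r M) x n"
   using xy X by (simp add: tgC_def)
 qed (use xy r_in[OF xy] o(1,2) in \<open>simp_all add: tgC_def\<close>)
 show "snd (tgC X r M) x x n = idn (dm (fst (tgC X r M) x n))" if "x \<in> X" for x n
  using that o(1,3) r_refl by (simp add: tgC_def idn_def)
 show "snd (tgC X r M) x z n = snd (tgC X r M) y z n ** snd (tgC X r M) x y n" if "(x, y) \<in> r & (y, z) \<in> r" for x y z n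
  using that o(1,2,4) r_trans[of x y z] r_in[of x y] r_in[of y z] by (simp add: tgC_def cmp_Some)
qed (auto simp: tgC_def fun_eq_iff)

lemma tgm_dmor:
 assumes M: "M \<in> Obj CF" and N: "N \<in> Obj CF" and f: "f \<in> Hom CF M N"
 shows "is_dmor X r (tgC X r M) (tgm X M N f) (tgC X r N)"
 unfolding is_dmor_def
proof (intro conjI allI ballI impI)
 show "cmor (fst (tgC X r M) x) (tgm X M N f x) (fst (tgC X r N) x)" if "x \<in> X" for x
  using ev_Obj[OF M that] ev_Obj[OF N that] ev_Hom[OF f that] by (simp add: tgC_fst tgm_stm that cmor_st)
 show "snd (tgC X r N) x y n ** tgm X M N f x n = tgm X M N f y n ** snd (tgC X r M) x y n" if xy: "(x, y) \<in> r" for x y n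
  using xy r_in[OF xy] FC_objD(1,2)[OF complexD(1)[OF M]] FC_objD(1,2)[OF complexD(1)[OF N]] FC_homD(1,2)[OF CF_hom(1)[OF f]]
  by (simp add: tgC_def tgm_def cmp_Some)
qed (auto simp: tgm_def fun_eq_iff)

lemma mkC_Obj:
 assumes M: "is_diag X r M" shows "mkC X r M \<in> Obj CF"
proof -
 note D = is_diagD[OF M] and C = cpxD[OF is_diagD(1)[OF M]] and T = cmorD[OF is_diagD(2)[OF M]]
 have o: "deg (mkC X r M) n \<in> Obj FC" for n
  unfolding FC_Obj mkC_def
 proof (intro conjI ballI allI impI, goal_cases)
  case (1 x) then show ?case by (simp add: C(1))
 next
  case (2 x) then show ?case by (simp add: r_refl D(3) C(1) un_simps)
 next
  case (3 p) then show ?case by (cases p) (auto simp: r_in T(1-3) intro!: un_hom)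
 next
  case (4 x y z)
  then have xy: "(x, y) \<in> r" "(y, z) \<in> r" "(x, z) \<in> r" using r_trans by auto
  have "un (snd M x z n) = un (snd M y z n ** snd M x y n)" using D(4)[OF xy(1,2)] by simp
  then show ?case using xy by (simp add: un_simps T(1-3))
 qed simp_all
 have d: "diff (mkC X r M) n \<in> Hom FC (deg (mkC X r M) n) (deg (mkC X r M) (n+1))" for n
  unfolding FC_Hom mkC_def
 proof (intro conjI ballI allI impI, goal_cases)
  case (2 p)
  then obtain x y where p: "p = (x, y)" "(x, y) \<in> r" by (cases p) auto
  have "un (fst M y n ** snd M x y n) = un (snd M x y (n+1) ** fst M x n)" using p T(4) by simp
  then show ?case using p r_in[OF p(2)] by (simp add: un_simps C(1,2) T(1-3))
 qed (simp_all add: un_hom C)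
 have "diff (mkC X r M) (n+1) \<bullet> diff (mkC X r M) n = Zero FC (deg (mkC X r M) n) (deg (mkC X r M) (n+1+1))" for n
 proof -
  have "un (fst M x (n+1)) \<cdot> un (fst M x n) = Zero A (dm (fst M x n)) (dm (fst M x (n+1+1)))" if "x \<in> X" for x
  proof -
   have "un (fst M x (n+1)) \<cdot> un (fst M x n) = un (fst M x (n+1) ** fst M x n)" using C(1,2) that by (simp add: un_simps(1))
   also have "\<dots> = Zero A (dm (fst M x n)) (dm (fst M x (n+1+1)))" using C that by (simp add: un_simps(5))
   finally show ?thesis .
  qed
  then show ?thesis by (auto simp: FC_sel mkC_def restrict_def fun_eq_iff)
 qed
 then show ?thesis using o d by (simp add: complex_category_def)
qed

lemma mkm_Hom:
 assumes M: "is_diag X r M" and N: "is_diag X r N" and f: "is_dmor X r M f N"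
 shows "mkm X f \<in> Hom CF (mkC X r M) (mkC X r N)"
proof -
 note C = cpxD[OF is_diagD(1)[OF M]] cpxD[OF is_diagD(1)[OF N]] and T = cmorD[OF is_diagD(2)[OF M]] cmorD[OF is_diagD(2)[OF N]]
  and F = cmorD[OF is_dmorD(1)[OF f]]
 have "mkm X f n \<in> Hom FC (deg (mkC X r M) n) (deg (mkC X r N) n)" for n
  unfolding FC_Hom mkC_def mkm_def
 proof (intro conjI ballI allI impI, goal_cases)
  case (2 p)
  then obtain x y where p: "p = (x, y)" "(x, y) \<in> r" by (cases p) auto
  have "un (snd N x y n ** f x n) = un (f y n ** snd M x y n)" using p is_dmorD(2)[OF f] by simp
  then show ?case using p r_in[OF p(2)] by (simp add: un_simps T(1-3,6-8) F(1-3))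
 qed (simp_all add: un_hom F)
 moreover have "diff (mkC X r N) n \<bullet> mkm X f n = mkm X f (n+1) \<bullet> diff (mkC X r M) n" for n
 proof -
  have "un (fst N x n ** f x n) = un (f x (n+1) ** fst M x n)" if "x \<in> X" for x
   using F(4) that by simp
  then show ?thesis by (auto simp: FC_sel mkC_def mkm_def restrict_def fun_eq_iff un_simps(1) C(1,2,5,6) F(1-3))
 qed
 ultimately show ?thesis by (simp add: complex_category_def)
qed

lemma tg_mk:
 assumes M: "is_diag X r M" shows "tgC X r (mkC X r M) = M"
proof -
 note D = is_diagD[OF M] and C = cpxD[OF is_diagD(1)[OF M]] and T = cmorD[OF is_diagD(2)[OF M]]
 have 1: "fst (tgC X r (mkC X r M)) x n = fst M x n" for x n
  using ar_eq[of "fst M x n"] C(1,2)[of x n] D(5)[of x] by (cases "x \<in> X") (auto simp: tgC_def mkC_def)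
 have 2: "snd (tgC X r (mkC X r M)) x y n = snd M x y n" for x y n
  using ar_eq[of "snd M x y n"] T(1,2,3)[of x y n] r_in[of x y] D(6)[of x y] by (cases "(x, y) \<in> r") (auto simp: tgC_def mkC_def)
 show ?thesis using 1 2 by (simp add: prod_eq_iff fun_eq_iff)
qed

lemma mk_tg:
 assumes M: "M \<in> Obj CF" shows "mkC X r (tgC X r M) = M"
proof -
 note d = complexD[OF M]
 have 1: "on_obj (deg M n) x = undefined" if "x \<notin> X" for x n using d(1)[of n] that unfolding FC_Obj by blast
 have 2: "on_arr (deg M n) x y () = undefined" if "(x, y) \<notin> r" for x y n using d(1)[of n] that unfolding FC_Obj by blast
 have "deg (mkC X r (tgC X r M)) n = deg M n" for n
  using 1 2 by (intro func.equality) (auto simp: mkC_def tgC_def fun_eq_iff r_in)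
 moreover have "diff (mkC X r (tgC X r M)) n = diff M n" for n
  using FC_homD(3)[OF d(2)] by (auto simp: mkC_def tgC_def fun_eq_iff)
 ultimately show ?thesis by (intro cochain.equality) (auto simp: fun_eq_iff)
qed

lemma tgm_mkm:
 assumes M: "is_diag X r M" and N: "is_diag X r N" and f: "is_dmor X r M f N"
 shows "tgm X (mkC X r M) (mkC X r N) (mkm X f) = f"
proof -
 note F = cmorD[OF is_dmorD(1)[OF f]]
 have "tgm X (mkC X r M) (mkC X r N) (mkm X f) x n = f x n" for x n
  using ar_eq[of "f x n"] F(1-3)[of x n] is_dmorD(3)[OF f, of x] by (cases "x \<in> X") (auto simp: tgm_def mkm_def mkC_def)
 then show ?thesis by (simp add: fun_eq_iff)
qed

lemma mkm_tgm:
 assumes f: "f \<in> Hom CF M N" shows "mkm X (tgm X M N f) = f"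
 using FC_homD(3)[OF CF_hom(1)[OF f]] by (auto simp: mkm_def tgm_def fun_eq_iff)

lemma mkm_comp:
 assumes f: "is_dmor X r M f N" and g: "is_dmor X r N g L"
 shows "mkm X (%x n. g x n ** f x n) = (%n. mkm X g n \<bullet> mkm X f n)"
 using cmorD[OF is_dmorD(1)[OF f]] cmorD[OF is_dmorD(1)[OF g]]
 by (auto simp: mkm_def FC_sel restrict_def fun_eq_iff un_simps)

lemma tgm_comp:
 assumes o: "M \<in> Obj CF" "N \<in> Obj CF" "L \<in> Obj CF" and f: "f \<in> Hom CF M N" and g: "g \<in> Hom CF N L"
 shows "tgm X M L (%n. g n \<bullet> f n) = (%x n. tgm X N L g x n ** tgm X M N f x n)"
 using FC_objD(1)[OF complexD(1)[OF o(1)]] FC_objD(1)[OF complexD(1)[OF o(2)]] FC_objD(1)[OF complexD(1)[OF o(3)]]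
  FC_homD(1)[OF CF_hom(1)[OF f]] FC_homD(1)[OF CF_hom(1)[OF g]]
 by (auto simp: tgm_def FC_sel fun_eq_iff cmp_Some)

definition tgF where "tgF = \<lparr>on_obj = tgC X r, on_arr = tgm X\<rparr>"
definition mkF where "mkF = \<lparr>on_obj = mkC X r, on_arr = (%_ _. mkm X)\<rparr>"

lemma tgF_sel [simp]: "on_obj tgF M = tgC X r M" "on_arr tgF M N f = tgm X M N f"
 "on_obj mkF D = mkC X r D" "on_arr mkF D E g = mkm X g" by (simp_all add: tgF_def mkF_def)

lemma CF_sel: "Comp CF g f = (%n. g n \<bullet> f n)" "Ident CF M = (%n. Ident FC (deg M n))"
 by (simp_all add: complex_category_def)

lemma tgF_functor: "is_functor CF (DG X r) tgF"
proof -
 have "tgm X M M (%n. Ident FC (deg M n)) = (%x n. if x \<in> X then idn (dm (fst (tgC X r M) x n)) else None)" if M: "M \<in> Obj CF" for M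
  using FC_objD(1)[OF complexD(1)[OF M]] by (auto simp: tgm_def tgC_def FC_sel fun_eq_iff idn_def)
 then show ?thesis unfolding is_functor_def
  by (simp add: CF_sel tgC_diag tgm_dmor tgm_comp)
qed

lemma mkF_functor: "is_functor (DG X r) CF mkF"
proof -
 have "mkm X (%x n. if x \<in> X then idn (dm (fst M x n)) else None) = (%n. Ident FC (deg (mkC X r M) n))" if M: "is_diag X r M" for M
  using cpxD(1)[OF is_diagD(1)[OF M]] by (auto simp: mkm_def mkC_def FC_sel restrict_def fun_eq_iff un_simps)
 then show ?thesis unfolding is_functor_def
  by (auto simp: CF_sel mkC_Obj mkm_Hom mkm_comp)
qed

lemma quasi_iso_tg:
 assumes M: "M \<in> Obj CF" and N: "N \<in> Obj CF" and f: "f \<in> Hom CF M N"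
 shows "f \<in> quasi_iso FC M N \<longleftrightarrow> (\<forall>x\<in>X. qi (fst (tgC X r M) x) (tgm X M N f x) (fst (tgC X r N) x))"
 unfolding quasi_iso_pointwise[OF M N f]
 using quasi_iso_iff_qi[OF ev_Obj[OF M] ev_Obj[OF N] ev_Hom[OF f]] by (simp add: tgC_fst tgm_stm)

lemma quasi_iso_mk:
 assumes M: "is_diag X r M" and N: "is_diag X r N" and f: "is_dmor X r M f N"
 shows "mkm X f \<in> quasi_iso FC (mkC X r M) (mkC X r N) \<longleftrightarrow> (\<forall>x\<in>X. qi (fst M x) (f x) (fst N x))"
 using quasi_iso_tg[OF mkC_Obj[OF M] mkC_Obj[OF N] mkm_Hom[OF M N f]] by (simp add: tg_mk tgm_mkm M N f)

lemma shift_tg: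
 assumes M: "M \<in> Obj CF" shows "tgC X r (shift_complex FC M) = on_obj dshift (tgC X r M)"
proof -
 interpret FC: preadditive_category FC by (rule FC_preadditive)
 note d = complexD[OF M]
 have "Neg FC (deg M (n+1)) (deg M (n+1+1)) (diff M (n+1)) x = Neg A (on_obj (deg M (n+1)) x) (on_obj (deg M (n+1+1)) x) (diff M (n+1) x)"
  if "x \<in> X" for x n using FC_Neg[OF d(1) d(1) d(2)[of "n+1"]] that by simp
 then show ?thesis
  using FC_objD(1)[OF d(1)] FC_homD(1)[OF d(2)[of "_+1"]]
  by (auto simp: tgC_def fun_eq_iff shk_def ng_Some)
qed

lemma is_diag_shift: "is_diag X r M ==> is_diag X r (on_obj dshift M)"
 using shift_tg[OF mkC_Obj] tgC_diag preadditive_category.shift_Obj[OF FC_preadditive mkC_Obj] by (metis tg_mk)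

lemma shift_mk: "is_diag X r M ==> shift_complex FC (mkC X r M) = mkC X r (on_obj dshift M)"
 using shift_tg[OF mkC_Obj] mk_tg[OF preadditive_category.shift_Obj[OF FC_preadditive mkC_Obj]] by (metis tg_mk)

lemma mapping_cone_tg:
 assumes M: "M \<in> Obj CF" and N: "N \<in> Obj CF" and Z: "Z \<in> Obj CF" and f: "f \<in> Hom CF M N"
  and mc: "is_mapping_cone FC M N f Z i p"
 shows "i \<in> Hom CF N Z" "p \<in> Hom CF Z (shift_complex FC M)"
  "dmc X r (tgC X r M) (tgC X r N) (tgm X M N f) (tgC X r Z) (tgm X N Z i) (tgm X Z (shift_complex FC M) p)"
proof -
 interpret FC: preadditive_category FC by (rule FC_preadditive)
 note dM = complexD[OF M] and dN = complexD[OF N] and dZ = complexD[OF Z]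
 obtain j q where b: "!!n. is_biproduct FC (deg M (n+1)) (deg N n) (deg Z n) (j n) (i n) (p n) (q n)"
  and e: "!!n. diff Z n = j (n+1) \<bullet> Neg FC (deg M (n+1)) (deg M (n+1+1)) (diff M (n+1)) \<bullet> p n
    \<boxplus>\<^bsub>FC\<^esub> i (n+1) \<bullet> f (n+1) \<bullet> p n \<boxplus>\<^bsub>FC\<^esub> i (n+1) \<bullet> diff N n \<bullet> q n"
  using mc unfolding is_mapping_cone_def by blast
 have h: "j n \<in> Hom FC (deg M (n+1)) (deg Z n)" "i n \<in> Hom FC (deg N n) (deg Z n)" "p n \<in> Hom FC (deg Z n) (deg M (n+1))"
  "q n \<in> Hom FC (deg Z n) (deg N n)" for n using b[of n] by (auto simp: is_biproduct_def)
 note O = FC_objD(1)[OF dM(1)] FC_objD(1)[OF dN(1)] FC_objD(1)[OF dZ(1)]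
 note H = FC_homD(1)[OF h(1)] FC_homD(1)[OF h(2)] FC_homD(1)[OF h(3)] FC_homD(1)[OF h(4)]
   FC_homD(1)[OF dM(2)] FC_homD(1)[OF dN(2)] FC_homD(1)[OF dZ(2)] FC_homD(1)[OF CF_hom(1)[OF f]]
 define tj where "tj x n = Some (on_obj (deg M (n+1)) x, j n x, on_obj (deg Z n) x)" for x n
 define tq where "tq x n = Some (on_obj (deg Z n) x, q n x, on_obj (deg N n) x)" for x n
 let ?M = "tgC X r M" and ?N = "tgC X r N" and ?Z = "tgC X r Z" and ?f = "tgm X M N f" and ?i = "tgm X N Z i"
  and ?p = "tgm X Z (shift_complex FC M) p"
 have pv: "?p x n = Some (on_obj (deg Z n) x, p n x, on_obj (deg M (n+1)) x)" if "x \<in> X" for x n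
  using that by (simp add: tgm_def)
 have t: "tmc (fst ?M x) (fst ?N x) (?f x) (fst ?Z x) (?i x) (?p x) (tj x) (tq x)" if x: "x \<in> X" for x
 proof (rule tmcI)
  fix n
  have bx: "is_biproduct A (on_obj (deg M (n+1)) x) (on_obj (deg N n) x) (on_obj (deg Z n) x) (j n x) (i n x) (p n x) (q n x)"
   using b[of n] x FC_homD(1)[OF h(1) x] FC_homD(1)[OF h(2) x] FC_homD(1)[OF h(3) x] FC_homD(1)[OF h(4) x] O[OF x]
   unfolding is_biproduct_def FC_sel by (auto dest!: fun_cong[where x = x])
  show "tbip (dm (fst ?M x (n+1))) (dm (fst ?N x n)) (tj x n) (?i x n) (?p x n) (tq x n)"
   using bx is_biproduct_tbip[OF O(1)[OF x] O(2)[OF x]] x by (simp add: tj_def tq_def tgm_def tgC_def)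
  show "cd (tj x n) = dm (fst ?Z x n)" using x by (simp add: tj_def tgC_def)
  have sh: "\<ominus> fst ?M x (n+1) = Some (on_obj (deg M (n+1)) x, Neg A (on_obj (deg M (n+1)) x) (on_obj (deg M (n+1+1)) x) (diff M (n+1) x), on_obj (deg M (n+1+1)) x)"
   using x ng_Some[OF O(1)[OF x] O(1)[OF x] H(5)[OF x, of "n+1"]] by (simp add: tgC_def)
  have nh: "Neg A (on_obj (deg M (n+1)) x) (on_obj (deg M (n+1+1)) x) (diff M (n+1) x) \<in> Hom A (on_obj (deg M (n+1)) x) (on_obj (deg M (n+1+1)) x)"
   using neg_hom[OF O(1)[OF x] O(1)[OF x] H(5)[OF x]] .
  have ex: "diff Z n x = j (n+1) x \<cdot> Neg A (on_obj (deg M (n+1)) x) (on_obj (deg M (n+1+1)) x) (diff M (n+1) x) \<cdot> p n x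
    \<boxplus> i (n+1) x \<cdot> f (n+1) x \<cdot> p n x \<boxplus> i (n+1) x \<cdot> diff N n x \<cdot> q n x"
   using fun_cong[OF e[of n], of x] x FC_Neg[OF dM(1) dM(1) dM(2)[of "n+1"]] by (simp add: FC_sel)
  have tv: "tj x m = Some (on_obj (deg M (m+1)) x, j m x, on_obj (deg Z m) x)" "?i x m = Some (on_obj (deg N m) x, i m x, on_obj (deg Z m) x)"
   "?f x m = Some (on_obj (deg M m) x, f m x, on_obj (deg N m) x)" "tq x m = Some (on_obj (deg Z m) x, q m x, on_obj (deg N m) x)"
   "fst ?N x m = Some (on_obj (deg N m) x, diff N m x, on_obj (deg N (m+1)) x)" "fst ?Z x m = Some (on_obj (deg Z m) x, diff Z m x, on_obj (deg Z (m+1)) x)" for m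
   using x by (simp_all add: tj_def tq_def tgm_def tgC_def)
  note c = comp_in_Hom[OF O(3)[OF x] _ _ H(3)[OF x]] comp_in_Hom[OF O(3)[OF x] _ _ H(4)[OF x]]
  have s1: "tj x (n+1) ** \<ominus> fst ?M x (n+1) ** ?p x n = Some (on_obj (deg Z n) x, j (n+1) x \<cdot> Neg A (on_obj (deg M (n+1)) x) (on_obj (deg M (n+1+1)) x) (diff M (n+1) x) \<cdot> p n x, on_obj (deg Z (n+1)) x)"
   unfolding tv sh pv[OF x] cmp_Some[OF O(3)[OF x] O(1)[OF x] O(1)[OF x] H(3)[OF x] nh]
   by (rule cmp_Some[OF O(3)[OF x] O(1)[OF x] O(3)[OF x] comp_in_Hom[OF O(3)[OF x] O(1)[OF x] O(1)[OF x] H(3)[OF x] nh] H(1)[OF x]])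
  have s2: "?i x (n+1) ** ?f x (n+1) ** ?p x n = Some (on_obj (deg Z n) x, i (n+1) x \<cdot> f (n+1) x \<cdot> p n x, on_obj (deg Z (n+1)) x)"
   unfolding tv pv[OF x] cmp_Some[OF O(3)[OF x] O(1)[OF x] O(2)[OF x] H(3)[OF x] H(8)[OF x]]
   by (rule cmp_Some[OF O(3)[OF x] O(2)[OF x] O(3)[OF x] comp_in_Hom[OF O(3)[OF x] O(1)[OF x] O(2)[OF x] H(3)[OF x] H(8)[OF x]] H(2)[OF x]])
  have s3: "?i x (n+1) ** fst ?N x n ** tq x n = Some (on_obj (deg Z n) x, i (n+1) x \<cdot> diff N n x \<cdot> q n x, on_obj (deg Z (n+1)) x)"
   unfolding tv cmp_Some[OF O(3)[OF x] O(2)[OF x] O(2)[OF x] H(4)[OF x] H(6)[OF x]]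
   by (rule cmp_Some[OF O(3)[OF x] O(2)[OF x] O(3)[OF x] comp_in_Hom[OF O(3)[OF x] O(2)[OF x] O(2)[OF x] H(4)[OF x] H(6)[OF x]] H(2)[OF x]])
  have h1: "j (n+1) x \<cdot> Neg A (on_obj (deg M (n+1)) x) (on_obj (deg M (n+1+1)) x) (diff M (n+1) x) \<cdot> p n x \<in> Hom A (on_obj (deg Z n) x) (on_obj (deg Z (n+1)) x)"
   by (rule comp_in_Hom[OF O(3)[OF x] O(1)[OF x] O(3)[OF x] comp_in_Hom[OF O(3)[OF x] O(1)[OF x] O(1)[OF x] H(3)[OF x] nh] H(1)[OF x]])
  have h2: "i (n+1) x \<cdot> f (n+1) x \<cdot> p n x \<in> Hom A (on_obj (deg Z n) x) (on_obj (deg Z (n+1)) x)"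
   by (rule comp_in_Hom[OF O(3)[OF x] O(2)[OF x] O(3)[OF x] comp_in_Hom[OF O(3)[OF x] O(1)[OF x] O(2)[OF x] H(3)[OF x] H(8)[OF x]] H(2)[OF x]])
  have h3: "i (n+1) x \<cdot> diff N n x \<cdot> q n x \<in> Hom A (on_obj (deg Z n) x) (on_obj (deg Z (n+1)) x)"
   by (rule comp_in_Hom[OF O(3)[OF x] O(2)[OF x] O(3)[OF x] comp_in_Hom[OF O(3)[OF x] O(2)[OF x] O(2)[OF x] H(4)[OF x] H(6)[OF x]] H(2)[OF x]])
  show "fst ?Z x n = tj x (n+1) ** \<ominus> fst ?M x (n+1) ** ?p x n \<oplus> ?i x (n+1) ** ?f x (n+1) ** ?p x n \<oplus> ?i x (n+1) ** fst ?N x n ** tq x n"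
   unfolding s1 s2 s3 pls_assoc[symmetric] pls_Some[OF O(3)[OF x] O(3)[OF x] h1 h2]
    pls_Some[OF O(3)[OF x] O(3)[OF x] plus_hom[OF O(3)[OF x] O(3)[OF x] h1 h2] h3]
   unfolding tv ex ..
 qed
 have tc: "is_diag X r ?M" "is_diag X r ?N" "is_diag X r ?Z" using tgC_diag M N Z by auto
 have fm: "is_dmor X r ?M ?f ?N" using tgm_dmor[OF M N f] .
 have nat: "snd ?Z x y n ** tj x n = tj y n ** snd ?M x y (n+1)" "tq y n ** snd ?Z x y n = snd ?N x y n ** tq x n"
  "snd ?Z x y n ** ?i x n = ?i y n ** snd ?N x y n" "snd ?M x y (n+1) ** ?p x n = ?p y n ** snd ?Z x y n"
  if xy: "(x, y) \<in> r" for x y n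
 proof -
  note X = r_in[OF xy]
  note arr = FC_objD(2)[OF dM(1) xy] FC_objD(2)[OF dN(1) xy] FC_objD(2)[OF dZ(1) xy]
  show "snd ?Z x y n ** tj x n = tj y n ** snd ?M x y (n+1)"
   using xy by (simp add: tj_def tgC_def cmp_Some O X arr H FC_homD(2)[OF h(1) xy])
  show "tq y n ** snd ?Z x y n = snd ?N x y n ** tq x n"
   using xy by (simp add: tq_def tgC_def cmp_Some O X arr H FC_homD(2)[OF h(4) xy])
  show "snd ?Z x y n ** ?i x n = ?i y n ** snd ?N x y n"
   using xy by (simp add: tgm_def tgC_def cmp_Some O X arr H FC_homD(2)[OF h(2) xy])
  show "snd ?M x y (n+1) ** ?p x n = ?p y n ** snd ?Z x y n"
   using xy by (simp add: tgm_def tgC_def cmp_Some O X arr H FC_homD(2)[OF h(3) xy])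
 qed
 show "dmc X r ?M ?N ?f ?Z ?i ?p" unfolding dmc_def using t nat by blast
 have "is_dmor X r ?N ?i ?Z"
  unfolding is_dmor_def using nat(3) tmc_cmor(1)[OF is_diagD(1)[OF tc(1)] is_diagD(1)[OF tc(2)] is_dmorD(1)[OF fm] t]
  by (auto simp: tgm_def fun_eq_iff)
 then have "mkm X ?i \<in> Hom CF (mkC X r ?N) (mkC X r ?Z)" by (rule mkm_Hom[OF tc(2,3)])
 moreover have "mkm X ?i = i" using FC_homD(3)[OF h(2)] by (auto simp: mkm_def tgm_def fun_eq_iff)
 ultimately show "i \<in> Hom CF N Z" using mk_tg M N Z by simp
 have sM: "shift_complex FC M \<in> Obj CF" using FC.shift_Obj[OF M] .
 have "is_dmor X r ?Z ?p (on_obj dshift ?M)"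
  unfolding is_dmor_def using nat(4) tmc_cmor(2)[OF is_diagD(1)[OF tc(1)] is_diagD(1)[OF tc(2)] is_dmorD(1)[OF fm] t]
  by (auto simp: tgm_def fun_eq_iff)
 then have "is_dmor X r ?Z ?p (tgC X r (shift_complex FC M))" unfolding shift_tg[OF M] .
 then have "mkm X ?p \<in> Hom CF (mkC X r ?Z) (mkC X r (tgC X r (shift_complex FC M)))" by (rule mkm_Hom[OF tc(3) tgC_diag[OF sM]])
 moreover have "mkm X ?p = p" using FC_homD(3)[OF h(3)] by (auto simp: mkm_def tgm_def fun_eq_iff)
 ultimately show "p \<in> Hom CF Z (shift_complex FC M)" using mk_tg Z sM by simp
qed

lemma mapping_cone_mk:
 assumes M: "is_diag X r M" and N: "is_diag X r N" and Z: "is_diag X r Z" and f: "is_dmor X r M f N"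
  and i: "is_dmor X r N i Z" and p: "is_dmor X r Z p (on_obj dshift M)" and mc: "dmc X r M N f Z i p"
 shows "is_mapping_cone FC (mkC X r M) (mkC X r N) (mkm X f) (mkC X r Z) (mkm X i) (mkm X p)"
proof -
 obtain j q where t: "!!x. x \<in> X ==> tmc (fst M x) (fst N x) (f x) (fst Z x) (i x) (p x) (j x) (q x)"
  and nj: "!!x y n. (x, y) \<in> r ==> snd Z x y n ** j x n = j y n ** snd M x y (n+1)"
  and nq: "!!x y n. (x, y) \<in> r ==> q y n ** snd Z x y n = snd N x y n ** q x n"
  using mc unfolding dmc_def by blast
 note T = tmcD(1-17)[OF t] and C = cpxD[OF is_diagD(1)[OF M]] cpxD[OF is_diagD(1)[OF N]] cpxD[OF is_diagD(1)[OF Z]]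
  and F = cmorD(1-3)[OF is_dmorD(1)[OF f]]
  and R = cmorD(1-3)[OF is_diagD(2)[OF M]] cmorD(1-3)[OF is_diagD(2)[OF N]] cmorD(1-3)[OF is_diagD(2)[OF Z]]
 let ?j = "mkm X j" and ?q = "mkm X q"
 have hM: "mkC X r M \<in> Obj CF" "mkC X r N \<in> Obj CF" "mkC X r Z \<in> Obj CF" using mkC_Obj M N Z by auto
 have hi: "mkm X i n \<in> Hom FC (deg (mkC X r N) n) (deg (mkC X r Z) n)" for n using CF_hom(1)[OF mkm_Hom[OF N Z i]] .
 have hp: "mkm X p n \<in> Hom FC (deg (mkC X r Z) n) (deg (mkC X r M) (n+1))" for n
 proof -
  interpret FC: preadditive_category FC by (rule FC_preadditive)
  show ?thesis using CF_hom(1)[OF mkm_Hom[OF Z is_diag_shift[OF M] p], of n] unfolding shift_mk[OF M, symmetric] by simp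
 qed
 have hj: "?j n \<in> Hom FC (deg (mkC X r M) (n+1)) (deg (mkC X r Z) n)" for n
  unfolding FC_Hom
 proof (intro conjI ballI allI impI, goal_cases)
  case (2 w)
  then obtain x y where w: "w = (x, y)" "(x, y) \<in> r" by (cases w) auto
  have "un (snd Z x y n ** j x n) = un (j y n ** snd M x y (n+1))" using nj[OF w(2)] by simp
  then show ?case using w r_in[OF w(2)] by (simp add: un_simps C R T mkC_def mkm_def)
 qed (simp_all add: mkC_def mkm_def un_hom T)
 have hq: "?q n \<in> Hom FC (deg (mkC X r Z) n) (deg (mkC X r N) n)" for n
  unfolding FC_Hom
 proof (intro conjI ballI allI impI, goal_cases)
  case (2 w)
  then obtain x y where w: "w = (x, y)" "(x, y) \<in> r" by (cases w) auto
  have "un (q y n ** snd Z x y n) = un (snd N x y n ** q x n)" using nq[OF w(2)] by simp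
  then show ?case using w r_in[OF w(2)] by (simp add: un_simps C R T mkC_def mkm_def)
 qed (simp_all add: mkC_def mkm_def un_hom T)
 show ?thesis
  unfolding is_mapping_cone_def
 proof (rule exI[of _ ?j], rule exI[of _ ?q], intro allI conjI)
  fix n
  have U: "un (p x n) \<cdot> un (j x n) = Ident A (dm (fst M x (n+1)))" "un (q x n) \<cdot> un (i x n) = Ident A (dm (fst N x n))"
   "un (p x n) \<cdot> un (i x n) = Zero A (dm (fst N x n)) (dm (fst M x (n+1)))"
   "un (q x n) \<cdot> un (j x n) = Zero A (dm (fst M x (n+1))) (dm (fst N x n))"
   "un (j x n) \<cdot> un (p x n) \<boxplus> un (i x n) \<cdot> un (q x n) = Ident A (dm (fst Z x n))" if x: "x \<in> X" for x
   using arg_cong[OF T(13)[OF x, of n], of un] arg_cong[OF T(14)[OF x, of n], of un] arg_cong[OF T(15)[OF x, of n], of un]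
    arg_cong[OF T(16)[OF x, of n], of un] arg_cong[OF T(17)[OF x, of n], of un] x
   by (simp_all add: un_simps T(1-12) C)
  show "is_biproduct FC (deg (mkC X r M) (n+1)) (deg (mkC X r N) n) (deg (mkC X r Z) n) (?j n) (mkm X i n) (mkm X p n) (?q n)"
   unfolding is_biproduct_def using hi hp hj hq complexD(1)[OF hM(3)]
   by (auto simp: FC_sel restrict_def fun_eq_iff mkm_def mkC_def U)
  have ng: "Neg FC (deg (mkC X r M) (n+1)) (deg (mkC X r M) (n+1+1)) (diff (mkC X r M) (n+1)) x = un (\<ominus> fst M x (n+1))" if "x \<in> X" for x
   using FC_Neg[OF complexD(1)[OF hM(1)] complexD(1)[OF hM(1)] complexD(2)[OF hM(1)], of "n+1"] that
   by (simp add: mkC_def un_simps C)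
  have E: "un (fst Z x n) = un (j x (n+1)) \<cdot> un (\<ominus> fst M x (n+1)) \<cdot> un (p x n) \<boxplus> un (i x (n+1)) \<cdot> un (f x (n+1)) \<cdot> un (p x n) \<boxplus> un (i x (n+1)) \<cdot> un (fst N x n) \<cdot> un (q x n)"
   if x: "x \<in> X" for x
  proof -
   note [simp] = T(1-12)[OF x] C(1,2,5,6,9,10)[OF x] F[OF x]
   have "fst Z x n = (j x (n+1) ** \<ominus> fst M x (n+1) ** p x n \<oplus> i x (n+1) ** f x (n+1) ** p x n) \<oplus> i x (n+1) ** fst N x n ** q x n"
    unfolding pls_assoc by (rule tmcD(18)[OF t[OF x]])
   then have "un (fst Z x n) = un ((j x (n+1) ** \<ominus> fst M x (n+1) ** p x n \<oplus> i x (n+1) ** f x (n+1) ** p x n) \<oplus> i x (n+1) ** fst N x n ** q x n)"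
    by (rule arg_cong)
   also have "\<dots> = (un (j x (n+1) ** \<ominus> fst M x (n+1) ** p x n) \<boxplus> un (i x (n+1) ** f x (n+1) ** p x n)) \<boxplus> un (i x (n+1) ** fst N x n ** q x n)"
    by (subst un_simps(2); (subst un_simps(2))?) (simp_all del: pls_assoc cmp_ng ng_cmp)
   also have "un (j x (n+1) ** \<ominus> fst M x (n+1) ** p x n) = un (j x (n+1)) \<cdot> un (\<ominus> fst M x (n+1)) \<cdot> un (p x n)"
    by (subst un_simps(1); (subst un_simps(1))?) (simp_all del: cmp_ng ng_cmp)
   also have "un (i x (n+1) ** f x (n+1) ** p x n) = un (i x (n+1)) \<cdot> un (f x (n+1)) \<cdot> un (p x n)"
    by (subst un_simps(1); (subst un_simps(1))?) simp_all
   also have "un (i x (n+1) ** fst N x n ** q x n) = un (i x (n+1)) \<cdot> un (fst N x n) \<cdot> un (q x n)"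
    by (subst un_simps(1); (subst un_simps(1))?) simp_all
   finally show ?thesis .
  qed
  show "diff (mkC X r Z) n = ?j (n+1) \<bullet> Neg FC (deg (mkC X r M) (n+1)) (deg (mkC X r M) (n+1+1)) (diff (mkC X r M) (n+1)) \<bullet> mkm X p n
    \<boxplus>\<^bsub>FC\<^esub> mkm X i (n+1) \<bullet> mkm X f (n+1) \<bullet> mkm X p n \<boxplus>\<^bsub>FC\<^esub> mkm X i (n+1) \<bullet> diff (mkC X r N) n \<bullet> ?q n"
  proof
   fix x
   show "diff (mkC X r Z) n x = (?j (n+1) \<bullet> Neg FC (deg (mkC X r M) (n+1)) (deg (mkC X r M) (n+1+1)) (diff (mkC X r M) (n+1)) \<bullet> mkm X p n
    \<boxplus>\<^bsub>FC\<^esub> mkm X i (n+1) \<bullet> mkm X f (n+1) \<bullet> mkm X p n \<boxplus>\<^bsub>FC\<^esub> mkm X i (n+1) \<bullet> diff (mkC X r N) n \<bullet> ?q n) x"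
    unfolding FC_sel using E[of x] ng[of x] by (cases "x \<in> X") (auto simp: mkm_def mkC_def)
  qed
 qed
qed

end

text \<open>The criterion \<open>derived_equivalentI\<close> in tagged form: everything is conjugated with the
isomorphism between complexes of diagrams and tagged diagrams, and quasi-isomorphisms are tested at the
points.\<close>
lemma (in abelian_category) diag_equivalence:
 fixes X :: "'x set" and Y :: "'y set"
 assumes X: "preordered_set X r" and Y: "preordered_set Y s"
  and F: "is_functor (DG X r) (DG Y s) F" and G: "is_functor (DG Y s) (DG X r) G"
  and Fq: "!!M N f. is_diag X r M ==> is_diag X r N ==> is_dmor X r M f N ==> \<forall>x\<in>X. qi (fst M x) (f x) (fst N x) ==>
    \<forall>y\<in>Y. qi (fst (on_obj F M) y) (on_arr F M N f y) (fst (on_obj F N) y)"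
  and Gq: "!!M N f. is_diag Y s M ==> is_diag Y s N ==> is_dmor Y s M f N ==> \<forall>y\<in>Y. qi (fst M y) (f y) (fst N y) ==>
    \<forall>x\<in>X. qi (fst (on_obj G M) x) (on_arr G M N f x) (fst (on_obj G N) x)"
  and \<eta>: "nat_trans (DG X r) (DG X r) id_functor (comp_functor G F) \<eta>"
   "!!M. is_diag X r M ==> \<forall>x\<in>X. qi (fst M x) (\<eta> M x) (fst (on_obj G (on_obj F M)) x)"
  and \<epsilon>: "nat_trans (DG Y s) (DG Y s) (comp_functor F G) id_functor \<epsilon>"
   "!!M. is_diag Y s M ==> \<forall>y\<in>Y. qi (fst (on_obj F (on_obj G M)) y) (\<epsilon> M y) (fst M y)"
  and \<theta>: "nat_trans (DG X r) (DG Y s) (comp_functor F dshift) (comp_functor dshift F) \<theta>"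
   "!!M. is_diag X r M ==> \<forall>y\<in>Y. qi (fst (on_obj F (on_obj dshift M)) y) (\<theta> M y) (fst (on_obj dshift (on_obj F M)) y)"
  and cone: "!!M N f Z i p. is_diag X r M ==> is_diag X r N ==> is_diag X r Z ==> is_dmor X r M f N ==> is_dmor X r N i Z ==>
    is_dmor X r Z p (on_obj dshift M) ==> dmc X r M N f Z i p ==>
    dmc Y s (on_obj F M) (on_obj F N) (on_arr F M N f) (on_obj F Z) (on_arr F N Z i) (%y n. \<theta> M y n ** on_arr F Z (on_obj dshift M) p y n)"
 shows "triangulated_equivalent (derived_category (functor_category (poset_category X r) A))
  (derived_category (functor_category (poset_category Y s) A))"
proof -
 interpret PX: preordered_set X r by fact
 interpret PY: preordered_set Y s by fact
 interpret I: abelian_diagrams A X r by unfold_locales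
 interpret J: abelian_diagrams A Y s by unfold_locales
 interpret IF: preadditive_category I.FC by (rule I.FC_preadditive)
 interpret JF: preadditive_category J.FC by (rule J.FC_preadditive)
 let ?F = "comp_functor J.mkF (comp_functor F I.tgF)" and ?G = "comp_functor I.mkF (comp_functor G J.tgF)"
 have Fo: "is_diag Y s (on_obj F M)" if "is_diag X r M" for M using functor_obj[OF F] that by simp
 have Fm: "is_dmor Y s (on_obj F M) (on_arr F M N f) (on_obj F N)" if "is_dmor X r M f N" "is_diag X r M" "is_diag X r N" for M f N
  using functor_arr[OF F, of f M N] that by simp
 have Go: "is_diag X r (on_obj G M)" if "is_diag Y s M" for M using functor_obj[OF G] that by simp
 have Gm: "is_dmor X r (on_obj G M) (on_arr G M N f) (on_obj G N)" if "is_dmor Y s M f N" "is_diag Y s M" "is_diag Y s N" for M f N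
  using functor_arr[OF G, of f M N] that by simp
 have Cm: "on_arr F M L (%x n. g x n ** f x n) = (%y n. on_arr F N L g y n ** on_arr F M N f y n)"
  if "is_dmor X r M f N" "is_dmor X r N g L" "is_diag X r M" "is_diag X r N" "is_diag X r L" for M N L f g
  using functor_comp[OF F, of f M N g L] that by simp
 note tI = I.tgC_diag I.tgm_dmor and tJ = J.tgC_diag J.tgm_dmor
 have main: "triangulated_equivalent (derived_category I.FC) (derived_category J.FC)"
 proof (rule derived_equivalentI[OF I.FC_preadditive J.FC_preadditive, where F = ?F and G = ?G
   and \<eta> = "%M. mkm X (\<eta> (tgC X r M))" and \<epsilon> = "%M. mkm Y (\<epsilon> (tgC Y s M))" and \<theta> = "%M. mkm Y (\<theta> (tgC X r M))"])
  show "is_functor I.CF J.CF ?F" by (rule is_functor_comp[OF is_functor_comp[OF I.tgF_functor F] J.mkF_functor])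
  show "is_functor J.CF I.CF ?G" by (rule is_functor_comp[OF is_functor_comp[OF J.tgF_functor G] I.mkF_functor])
 next
  fix M N f assume MN: "M \<in> Obj I.CF" "N \<in> Obj I.CF" and f: "f \<in> quasi_iso I.FC M N"
  then have fh: "f \<in> Hom I.CF M N" by (simp add: quasi_iso_def)
  show "on_arr ?F M N f \<in> quasi_iso J.FC (on_obj ?F M) (on_obj ?F N)"
   using f Fq[OF tI(1)[OF MN(1)] tI(1)[OF MN(2)] tI(2)[OF MN fh]]
   by (simp add: J.quasi_iso_mk Fo Fm tI MN fh I.quasi_iso_tg)
 next
  fix M N f assume MN: "M \<in> Obj J.CF" "N \<in> Obj J.CF" and f: "f \<in> quasi_iso J.FC M N"
  then have fh: "f \<in> Hom J.CF M N" by (simp add: quasi_iso_def)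
  show "on_arr ?G M N f \<in> quasi_iso I.FC (on_obj ?G M) (on_obj ?G N)"
   using f Gq[OF tJ(1)[OF MN(1)] tJ(1)[OF MN(2)] tJ(2)[OF MN fh]]
   by (simp add: I.quasi_iso_mk Go Gm tJ MN fh J.quasi_iso_tg)
 next
  have h: "is_dmor X r M (\<eta> M) (on_obj G (on_obj F M))" if "is_diag X r M" for M using nat_transD(1)[OF \<eta>(1)] that by simp
  have q: "mkm X (\<eta> (tgC X r M)) \<in> quasi_iso I.FC M (on_obj ?G (on_obj ?F M))" if M: "M \<in> Obj I.CF" for M
   using I.quasi_iso_mk[OF tI(1)[OF M] Go[OF Fo[OF tI(1)[OF M]]] h[OF tI(1)[OF M]]] \<eta>(2)[OF tI(1)[OF M]]
   by (simp add: I.mk_tg M J.tg_mk Fo tI)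
  then show "!!M. M \<in> Obj I.CF ==> mkm X (\<eta> (tgC X r M)) \<in> quasi_iso I.FC M (on_obj ?G (on_obj ?F M))" .
  show "nat_trans I.CF I.CF id_functor (comp_functor ?G ?F) (%M. mkm X (\<eta> (tgC X r M)))"
   unfolding nat_trans_def
  proof (intro conjI ballI)
   show "mkm X (\<eta> (tgC X r M)) \<in> Hom I.CF (on_obj id_functor M) (on_obj (comp_functor ?G ?F) M)" if "M \<in> Obj I.CF" for M
    using q[OF that] by (simp add: quasi_iso_def)
   fix M N f assume MN: "M \<in> Obj I.CF" "N \<in> Obj I.CF" and f: "f \<in> Hom I.CF M N"
   note d = tI(1)[OF MN(1)] tI(1)[OF MN(2)] tI(2)[OF MN f]
   have "Comp I.CF (mkm X (\<eta> (tgC X r N))) f = Comp I.CF (mkm X (\<eta> (tgC X r N))) (mkm X (tgm X M N f))"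
    by (simp add: I.mkm_tgm f)
   also have "\<dots> = mkm X (%x n. \<eta> (tgC X r N) x n ** tgm X M N f x n)"
    unfolding I.CF_sel by (rule I.mkm_comp[OF d(3) h[OF d(2)], symmetric])
   also have "(%x n. \<eta> (tgC X r N) x n ** tgm X M N f x n) =
     (%x n. on_arr G (on_obj F (tgC X r M)) (on_obj F (tgC X r N)) (on_arr F (tgC X r M) (tgC X r N) (tgm X M N f)) x n ** \<eta> (tgC X r M) x n)"
    using nat_transD(2)[OF \<eta>(1), of "tgC X r M" "tgC X r N" "tgm X M N f"] d by simp
   also have "mkm X \<dots> = Comp I.CF (mkm X (on_arr G (on_obj F (tgC X r M)) (on_obj F (tgC X r N)) (on_arr F (tgC X r M) (tgC X r N) (tgm X M N f)))) (mkm X (\<eta> (tgC X r M)))"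
    unfolding I.CF_sel by (rule I.mkm_comp[OF h[OF d(1)] Gm[OF Fm[OF d(3,1,2)] Fo[OF d(1)] Fo[OF d(2)]]])
   finally show "Comp I.CF (mkm X (\<eta> (tgC X r N))) (on_arr id_functor M N f) = Comp I.CF (on_arr (comp_functor ?G ?F) M N f) (mkm X (\<eta> (tgC X r M)))"
    by (simp add: J.tg_mk J.tgm_mkm Fo Fm d)
  qed
 next
  have h: "is_dmor Y s (on_obj F (on_obj G M)) (\<epsilon> M) M" if "is_diag Y s M" for M using nat_transD(1)[OF \<epsilon>(1)] that by simp
  have q: "mkm Y (\<epsilon> (tgC Y s M)) \<in> quasi_iso J.FC (on_obj ?F (on_obj ?G M)) M" if M: "M \<in> Obj J.CF" for M
   using J.quasi_iso_mk[OF Fo[OF Go[OF tJ(1)[OF M]]] tJ(1)[OF M] h[OF tJ(1)[OF M]]] \<epsilon>(2)[OF tJ(1)[OF M]]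
   by (simp add: J.mk_tg M I.tg_mk Go tJ)
  then show "!!M. M \<in> Obj J.CF ==> mkm Y (\<epsilon> (tgC Y s M)) \<in> quasi_iso J.FC (on_obj ?F (on_obj ?G M)) M" .
  show "nat_trans J.CF J.CF (comp_functor ?F ?G) id_functor (%M. mkm Y (\<epsilon> (tgC Y s M)))"
   unfolding nat_trans_def
  proof (intro conjI ballI)
   show "mkm Y (\<epsilon> (tgC Y s M)) \<in> Hom J.CF (on_obj (comp_functor ?F ?G) M) (on_obj id_functor M)" if "M \<in> Obj J.CF" for M
    using q[OF that] by (simp add: quasi_iso_def)
   fix M N f assume MN: "M \<in> Obj J.CF" "N \<in> Obj J.CF" and f: "f \<in> Hom J.CF M N"
   note d = tJ(1)[OF MN(1)] tJ(1)[OF MN(2)] tJ(2)[OF MN f]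
   let ?FG = "on_arr F (on_obj G (tgC Y s M)) (on_obj G (tgC Y s N)) (on_arr G (tgC Y s M) (tgC Y s N) (tgm Y M N f))"
   have "Comp J.CF f (mkm Y (\<epsilon> (tgC Y s M))) = Comp J.CF (mkm Y (tgm Y M N f)) (mkm Y (\<epsilon> (tgC Y s M)))"
    by (simp add: J.mkm_tgm f)
   also have "\<dots> = mkm Y (%x n. tgm Y M N f x n ** \<epsilon> (tgC Y s M) x n)"
    unfolding J.CF_sel by (rule J.mkm_comp[OF h[OF d(1)] d(3), symmetric])
   also have "(%x n. tgm Y M N f x n ** \<epsilon> (tgC Y s M) x n) = (%x n. \<epsilon> (tgC Y s N) x n ** ?FG x n)"
    using nat_transD(2)[OF \<epsilon>(1), of "tgC Y s M" "tgC Y s N" "tgm Y M N f"] d by simp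
   also have "mkm Y \<dots> = Comp J.CF (mkm Y (\<epsilon> (tgC Y s N))) (mkm Y ?FG)"
    unfolding J.CF_sel by (rule J.mkm_comp[OF Fm[OF Gm[OF d(3,1,2)] Go[OF d(1)] Go[OF d(2)]] h[OF d(2)]])
   finally show "Comp J.CF (mkm Y (\<epsilon> (tgC Y s N))) (on_arr (comp_functor ?F ?G) M N f) = Comp J.CF (on_arr id_functor M N f) (mkm Y (\<epsilon> (tgC Y s M)))"
    by (simp add: I.tg_mk I.tgm_mkm Go Gm d)
  qed
 next
  have h: "is_dmor Y s (on_obj F (on_obj dshift M)) (\<theta> M) (on_obj dshift (on_obj F M))" if "is_diag X r M" for M
   using nat_transD(1)[OF \<theta>(1)] that by simp
  have q: "mkm Y (\<theta> (tgC X r M)) \<in> quasi_iso J.FC (on_obj ?F (shift_complex I.FC M)) (shift_complex J.FC (on_obj ?F M))" if M: "M \<in> Obj I.CF" for M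
   using J.quasi_iso_mk[OF Fo[OF I.is_diag_shift[OF tI(1)[OF M]]] J.is_diag_shift[OF Fo[OF tI(1)[OF M]]] h[OF tI(1)[OF M]]] \<theta>(2)[OF tI(1)[OF M]]
   by (simp add: I.shift_tg M J.shift_mk Fo tI del: dshift_sel)
  then show "!!M. M \<in> Obj I.CF ==> mkm Y (\<theta> (tgC X r M)) \<in> quasi_iso J.FC (on_obj ?F (shift_complex I.FC M)) (shift_complex J.FC (on_obj ?F M))" .
  show "nat_trans I.CF J.CF (comp_functor ?F IF.shift_functor) (comp_functor JF.shift_functor ?F) (%M. mkm Y (\<theta> (tgC X r M)))"
   unfolding nat_trans_def
  proof (intro conjI ballI)
   show "mkm Y (\<theta> (tgC X r M)) \<in> Hom J.CF (on_obj (comp_functor ?F IF.shift_functor) M) (on_obj (comp_functor JF.shift_functor ?F) M)" if "M \<in> Obj I.CF" for M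
    using q[OF that] by (simp add: quasi_iso_def IF.shift_functor_def JF.shift_functor_def)
   fix M N f assume MN: "M \<in> Obj I.CF" "N \<in> Obj I.CF" and f: "f \<in> Hom I.CF M N"
   note d = tI(1)[OF MN(1)] tI(1)[OF MN(2)] tI(2)[OF MN f]
   have sf: "tgm X (shift_complex I.FC M) (shift_complex I.FC N) (shift_map f) = on_arr dshift (tgC X r M) (tgC X r N) (tgm X M N f)"
    by (auto simp: tgm_def fun_eq_iff)
   have sf': "mkm Y (on_arr dshift U V g) = shift_map (mkm Y g)" for U V g by (simp add: mkm_def fun_eq_iff)
   have dsf: "is_dmor X r (on_obj dshift (tgC X r M)) (on_arr dshift (tgC X r M) (tgC X r N) (tgm X M N f)) (on_obj dshift (tgC X r N))"
    using tI(2)[OF IF.shift_Obj[OF MN(1)] IF.shift_Obj[OF MN(2)] IF.shift_Hom[OF MN f]] sf I.shift_tg MN by metis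
   have dsF: "is_dmor Y s (on_obj dshift (on_obj F (tgC X r M))) (on_arr dshift (on_obj F (tgC X r M)) (on_obj F (tgC X r N)) (on_arr F (tgC X r M) (tgC X r N) (tgm X M N f))) (on_obj dshift (on_obj F (tgC X r N)))"
   proof -
    let ?M = "mkC Y s (on_obj F (tgC X r M))" and ?N = "mkC Y s (on_obj F (tgC X r N))" and ?f = "mkm Y (on_arr F (tgC X r M) (tgC X r N) (tgm X M N f))"
    have o: "?M \<in> Obj J.CF" "?N \<in> Obj J.CF" "?f \<in> Hom J.CF ?M ?N" using J.mkC_Obj J.mkm_Hom Fo Fm d by blast+
    have "tgm Y (shift_complex J.FC ?M) (shift_complex J.FC ?N) (shift_map ?f) = on_arr dshift (on_obj F (tgC X r M)) (on_obj F (tgC X r N)) (tgm Y ?M ?N ?f)"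
     by (auto simp: tgm_def fun_eq_iff)
    then show ?thesis
     using tJ(2)[OF JF.shift_Obj[OF o(1)] JF.shift_Obj[OF o(2)] JF.shift_Hom[OF o]]
     by (simp add: J.shift_tg o J.tg_mk J.tgm_mkm Fo Fm d del: dshift_sel)
   qed
   let ?F1 = "on_arr F (on_obj dshift (tgC X r M)) (on_obj dshift (tgC X r N)) (on_arr dshift (tgC X r M) (tgC X r N) (tgm X M N f))"
   let ?F2 = "on_arr dshift (on_obj F (tgC X r M)) (on_obj F (tgC X r N)) (on_arr F (tgC X r M) (tgC X r N) (tgm X M N f))"
   have "Comp J.CF (mkm Y (\<theta> (tgC X r N))) (mkm Y ?F1) = mkm Y (%x n. \<theta> (tgC X r N) x n ** ?F1 x n)"
    unfolding J.CF_sel by (rule J.mkm_comp[OF Fm[OF dsf I.is_diag_shift[OF d(1)] I.is_diag_shift[OF d(2)]] h[OF d(2)], symmetric])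
   also have "(%x n. \<theta> (tgC X r N) x n ** ?F1 x n) = (%x n. ?F2 x n ** \<theta> (tgC X r M) x n)"
    using nat_transD(2)[OF \<theta>(1), of "tgC X r M" "tgC X r N" "tgm X M N f"] d by simp
   also have "mkm Y \<dots> = Comp J.CF (mkm Y ?F2) (mkm Y (\<theta> (tgC X r M)))"
    unfolding J.CF_sel by (rule J.mkm_comp[OF h[OF d(1)] dsF])
   finally show "Comp J.CF (mkm Y (\<theta> (tgC X r N))) (on_arr (comp_functor ?F IF.shift_functor) M N f) =
     Comp J.CF (on_arr (comp_functor JF.shift_functor ?F) M N f) (mkm Y (\<theta> (tgC X r M)))"
    by (simp add: IF.shift_functor_def JF.shift_functor_def sf sf' I.shift_tg MN del: dshift_sel)
  qed
 next
  fix M N Z f i p assume o: "M \<in> Obj I.CF" "N \<in> Obj I.CF" "Z \<in> Obj I.CF" and f: "f \<in> Hom I.CF M N"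
   and mc: "is_mapping_cone I.FC M N f Z i p"
  note ip = I.mapping_cone_tg[OF o f mc]
  show "i \<in> Hom I.CF N Z & p \<in> Hom I.CF Z (shift_complex I.FC M)" using ip by simp
  have sM: "shift_complex I.FC M \<in> Obj I.CF" using IF.shift_Obj[OF o(1)] .
  let ?M = "tgC X r M" and ?N = "tgC X r N" and ?Z = "tgC X r Z" and ?f = "tgm X M N f" and ?i = "tgm X N Z i"
   and ?p = "tgm X Z (shift_complex I.FC M) p"
  have d: "is_diag X r ?M" "is_diag X r ?N" "is_diag X r ?Z" using tI o by auto
  have m: "is_dmor X r ?M ?f ?N" "is_dmor X r ?N ?i ?Z" "is_dmor X r ?Z ?p (on_obj dshift ?M)"
   using tI(2)[OF o(1,2) f] tI(2)[OF o(2,3) ip(1)] tI(2)[OF o(3) sM ip(2)] unfolding I.shift_tg[OF o(1)] by auto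
  have h: "is_dmor Y s (on_obj F (on_obj dshift ?M)) (\<theta> ?M) (on_obj dshift (on_obj F ?M))"
   using nat_transD(1)[OF \<theta>(1)] d(1) by simp
  have hp: "is_dmor Y s (on_obj F ?Z) (on_arr F ?Z (on_obj dshift ?M) ?p) (on_obj F (on_obj dshift ?M))"
   by (rule Fm[OF m(3) d(3) I.is_diag_shift[OF d(1)]])
  have cat: "is_dmor Y s U (%y n. b y n ** a y n) W" if a: "is_dmor Y s U a V" and b: "is_dmor Y s V b W" for U V W a b
   unfolding is_dmor_def
  proof (intro conjI ballI allI impI)
   show "cmor (fst U y) (%n. b y n ** a y n) (fst W y)" if "y \<in> Y" for y
    using cmor_comp[OF is_dmorD(1)[OF a that] is_dmorD(1)[OF b that]] .
   show "snd W x y n ** b x n ** a x n = (b y n ** a y n) ** snd U x y n" if "(x, y) \<in> s" for x y n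
    using cmp_left[OF is_dmorD(2)[OF b that, of n], of "a x n"] is_dmorD(2)[OF a that, of n] by simp
   show "(%n. b y n ** a y n) = (%_. None)" if "y \<notin> Y" for y using is_dmorD(3)[OF a that] by simp
  qed
  have "is_mapping_cone J.FC (mkC Y s (on_obj F ?M)) (mkC Y s (on_obj F ?N)) (mkm Y (on_arr F ?M ?N ?f)) (mkC Y s (on_obj F ?Z))
    (mkm Y (on_arr F ?N ?Z ?i)) (mkm Y (%y n. \<theta> ?M y n ** on_arr F ?Z (on_obj dshift ?M) ?p y n))"
   by (rule J.mapping_cone_mk[OF Fo[OF d(1)] Fo[OF d(2)] Fo[OF d(3)] Fm[OF m(1) d(1,2)] Fm[OF m(2) d(2,3)] cat[OF hp h]
    cone[OF d m ip(3)]])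
  also have "mkm Y (%y n. \<theta> ?M y n ** on_arr F ?Z (on_obj dshift ?M) ?p y n) =
    Comp J.CF (mkm Y (\<theta> ?M)) (mkm Y (on_arr F ?Z (on_obj dshift ?M) ?p))"
   unfolding J.CF_sel by (rule J.mkm_comp[OF hp h])
  finally show "is_mapping_cone J.FC (on_obj ?F M) (on_obj ?F N) (on_arr ?F M N f) (on_obj ?F Z) (on_arr ?F N Z i)
     (Comp J.CF (mkm Y (\<theta> ?M)) (on_arr ?F Z (shift_complex I.FC M) p))"
   by (simp add: I.shift_tg o del: dshift_sel)
 qed
 then show ?thesis by (simp add: I.FC_def J.FC_def)
qed

section \<open>Flipping a source to a sink\<close>

text \<open>\<open>P'\<close> arises from \<open>P\<close> by turning the source \<open>v\<close> into a sink;
\<open>ns\<close> lists the neighbours of \<open>v\<close>. The last two assumptions are the trace left by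
the absence of cycles: different neighbours have no common upper bounds, nor common lower bounds other
than \<open>v\<close>.\<close>
locale flip = abelian_category A
 for A :: "('o, 'm, 'z) preadditive_scheme" (structure) +
 fixes V :: "'v set" and P P' :: "'v rel" and v :: 'v and ns :: "'v list" and W :: "'w set" and R :: "'w rel"
 assumes vV: "v \<in> V" and ns: "distinct ns" "set ns \<subseteq> V" "v \<notin> set ns"
  and pP: "preordered_set V P" and pP': "preordered_set V P'" and pR: "preordered_set W R"
  and same: "a ~= v ==> b ~= v ==> (a, b) \<in> P' \<longleftrightarrow> (a, b) \<in> P"
  and src: "(a, v) \<in> P ==> a = v" and out: "b ~= v ==> (v, b) \<in> P \<longleftrightarrow> (\<exists>s\<in>set ns. (s, b) \<in> P)"
  and snk: "(v, b) \<in> P' ==> b = v" and inn: "a ~= v ==> (a, v) \<in> P' \<longleftrightarrow> (\<exists>s\<in>set ns. (a, s) \<in> P)"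
  and disj_up: "s \<in> set ns ==> t \<in> set ns ==> (s, b) \<in> P ==> (t, b) \<in> P ==> s = t"
  and disj_dn: "s \<in> set ns ==> t \<in> set ns ==> a ~= v ==> (a, s) \<in> P ==> (a, t) \<in> P ==> s = t"
begin

abbreviation "X \<equiv> V \<times> W"
abbreviation "r \<equiv> prod_order P R"
abbreviation "r' \<equiv> prod_order P' R"

sublocale P: preordered_set V P by (rule pP)
sublocale P': preordered_set V P' by (rule pP')
sublocale R: preordered_set W R by (rule pR)

lemma preordered_prod: "preordered_set V Q ==> preordered_set X (prod_order Q R)"
 using R.r_in R.r_refl R.r_trans unfolding preordered_set_def prod_order_def by fast

sublocale r: preordered_set X r by (rule preordered_prod[OF pP])
sublocale r': preordered_set X r' by (rule preordered_prod[OF pP'])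

lemma in_prod [simp]: "((a, w), (b, w')) \<in> prod_order Q R \<longleftrightarrow> (a, b) \<in> Q & (w, w') \<in> R"
 by (simp add: prod_order_def)

lemma nsD: "s \<in> set ns ==> s \<in> V" "s \<in> set ns ==> s ~= v" "s \<in> set ns ==> (s, s) \<in> P" "s \<in> set ns ==> (s, s) \<in> P'"
  "s \<in> set ns ==> (v, s) \<in> P" "s \<in> set ns ==> (s, v) \<in> P'"
proof -
 show V: "s \<in> V" and nv: "s ~= v" and s: "(s, s) \<in> P" "(s, s) \<in> P'" if "s \<in> set ns" for s
  using that ns P.r_refl P'.r_refl by auto
 show "(v, s) \<in> P" "(s, v) \<in> P'" if "s \<in> set ns" for s using out[OF nv[OF that]] inn[OF nv[OF that]] s that by blast+
qed

lemma vs_P: "(v, v) \<in> P" "(v, v) \<in> P'" using vV P.r_refl P'.r_refl by auto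

text \<open>Elements below \<open>v\<close> in \<open>P'\<close> that are comparable lie below the same neighbour.\<close>
lemma up_iff: "(a, b) \<in> P' ==> (b, v) \<in> P' ==> b ~= v ==> s \<in> set ns ==> (a, s) \<in> P \<longleftrightarrow> (b, s) \<in> P"
proof -
 assume a: "(a, b) \<in> P'" "(b, v) \<in> P'" "b ~= v" "s \<in> set ns"
 then have av: "a ~= v" using snk by blast
 then have ab: "(a, b) \<in> P" using a same by blast
 obtain t where t: "t \<in> set ns" "(b, t) \<in> P" using inn a by blast
 show ?thesis using av P.r_trans[OF ab] t disj_dn[OF a(4) t(1), of a] by blast
qed

lemma dn_iff: "(b, c) \<in> P ==> (v, b) \<in> P ==> b ~= v ==> s \<in> set ns ==> (s, b) \<in> P' \<longleftrightarrow> (s, c) \<in> P'"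
proof -
 assume a: "(b, c) \<in> P" "(v, b) \<in> P" "b ~= v" "s \<in> set ns"
 then have cv: "c ~= v" using src by blast
 obtain t where t: "t \<in> set ns" "(t, b) \<in> P" using out a by blast
 have "(s, b) \<in> P \<longleftrightarrow> (s, c) \<in> P" using P.r_trans[OF _ a(1)] t disj_up[OF a(4) t(1), of c] by blast
 then show ?thesis using same nsD(2)[OF a(4)] cv a(3) by blast
qed

definition dg :: "('v \<times> 'w) rel => ('v \<times> 'w => 'o) => ('v \<times> 'w => 'v \<times> 'w => ('o, 'm) tarr) => bool" where
 "dg q c t \<longleftrightarrow> (\<forall>x\<in>X. c x \<in> Obj A & t x x = idn (c x)) & (\<forall>x y. (x, y) \<in> q --> ar (t x y) & dm (t x y) = c x & cd (t x y) = c y) &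
  (\<forall>x y z. (x, y) \<in> q & (y, z) \<in> q --> t y z ** t x y = t x z)"

lemma dgD: assumes "dg q c t"
 shows "x \<in> X ==> c x \<in> Obj A" "x \<in> X ==> t x x = idn (c x)" "(x, y) \<in> q ==> ar (t x y)" "(x, y) \<in> q ==> dm (t x y) = c x"
  "(x, y) \<in> q ==> cd (t x y) = c y" "(x, y) \<in> q ==> (y, z) \<in> q ==> t y z ** t x y = t x z"
 using assms unfolding dg_def by blast+

text \<open>The map \<open>c(a,w) \<rightarrow> \<Oplus>\<^sub>s c(s,w')\<close> whose component at \<open>s\<close>
is the transition map when \<open>a \<le> s\<close> and zero otherwise. At \<open>a = v\<close> all
components are transition maps; at \<open>a ~= v\<close> at most one is nonzero.\<close>
definition iota :: "('v \<times> 'w => 'o) => ('v \<times> 'w => 'v \<times> 'w => ('o, 'm) tarr) => 'v => 'w => 'w => ('o, 'm) tarr" where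
 "iota c t a w w' = tup (c (a, w)) ns (%s. if (a, s) \<in> P then t (a, w) (s, w') else zr (c (a, w)) (c (s, w')))"

text \<open>Dually, the map \<open>\<Oplus>\<^sub>s c(s,w) \<rightarrow> c(b,w')\<close>.\<close>
definition kappa :: "('v \<times> 'w => 'o) => ('v \<times> 'w => 'v \<times> 'w => ('o, 'm) tarr) => 'v => 'w => 'w => ('o, 'm) tarr" where
 "kappa c t b w w' = cot (c (b, w')) ns (%s. if (s, b) \<in> P' then t (s, w) (b, w') else zr (c (s, w)) (c (b, w')))"

text \<open>\<open>q\<close> stands for \<open>r\<close> or \<open>r'\<close>, so that a diagram over either order can be used; the last hypothesis says that
the comparisons needed are present in \<open>q\<close>.\<close>
lemma iota_ar:
 assumes "dg q c t" "a \<in> V" "(w, w') \<in> R" "!!s. s \<in> set ns ==> (a, s) \<in> P ==> ((a, w), (s, w')) \<in> q"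
 shows "ar (iota c t a w w')" "dm (iota c t a w w') = c (a, w)" "cd (iota c t a w w') = so ns (%s. c (s, w'))"
proof -
 let ?u = "%s. if (a, s) \<in> P then t (a, w) (s, w') else zr (c (a, w)) (c (s, w'))"
 have X: "c (a, w) \<in> Obj A" "!!s. s \<in> set ns ==> c (s, w') \<in> Obj A" using dgD(1)[OF assms(1)] assms(2,3) R.r_in nsD by auto
 have u: "!!s. s \<in> set ns ==> ar (?u s) & dm (?u s) = c (a, w)" "!!s. s \<in> set ns ==> cd (?u s) = c (s, w')"
  using X dgD(3,4,5)[OF assms(1) assms(4)] by auto
 show "ar (iota c t a w w')" "dm (iota c t a w w') = c (a, w)" "cd (iota c t a w w') = so ns (%s. c (s, w'))"
  using tup_ar[of "c (a, w)" ns ?u, OF X(1) u(1)] so_cong[of ns "%s. cd (?u s)" "%s. c (s, w')", OF u(2)] unfolding iota_def by auto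
qed

lemma kappa_ar:
 assumes "dg q c t" "b \<in> V" "(w, w') \<in> R" "!!s. s \<in> set ns ==> (s, b) \<in> P' ==> ((s, w), (b, w')) \<in> q"
 shows "ar (kappa c t b w w')" "cd (kappa c t b w w') = c (b, w')" "dm (kappa c t b w w') = so ns (%s. c (s, w))"
proof -
 let ?u = "%s. if (s, b) \<in> P' then t (s, w) (b, w') else zr (c (s, w)) (c (b, w'))"
 have X: "c (b, w') \<in> Obj A" "!!s. s \<in> set ns ==> c (s, w) \<in> Obj A" using dgD(1)[OF assms(1)] assms(2,3) R.r_in nsD by auto
 have u: "!!s. s \<in> set ns ==> ar (?u s) & cd (?u s) = c (b, w')" "!!s. s \<in> set ns ==> dm (?u s) = c (s, w)"
  using X dgD(3,4,5)[OF assms(1) assms(4)] by auto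
 show "ar (kappa c t b w w')" "cd (kappa c t b w w') = c (b, w')" "dm (kappa c t b w w') = so ns (%s. c (s, w))"
  using cot_ar[of "c (b, w')" ns ?u, OF X(1) u(1)] so_cong[of ns "%s. dm (?u s)" "%s. c (s, w)", OF u(2)] unfolding kappa_def by auto
qed

lemma iota_nat:
 assumes "dg q c t" "dg q c' t'" "a \<in> V" "(w, w') \<in> R" "!!s. s \<in> set ns ==> (a, s) \<in> P ==> ((a, w), (s, w')) \<in> q"
  and g: "!!x. x \<in> X ==> ar (g x) & dm (g x) = c x & cd (g x) = c' x"
  and nat: "!!x y. (x, y) \<in> q ==> g y ** t x y = t' x y ** g x"
 shows "smap ns (%s. g (s, w')) ** iota c t a w w' = iota c' t' a w w' ** g (a, w)"
proof -
 have W: "w \<in> W" "w' \<in> W" using assms(4) R.r_in by auto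
 have o: "c (a, w) \<in> Obj A" "c' (a, w) \<in> Obj A" "!!s. s \<in> set ns ==> c (s, w') \<in> Obj A" "!!s. s \<in> set ns ==> c' (s, w') \<in> Obj A"
  using dgD(1)[OF assms(1)] dgD(1)[OF assms(2)] assms(3) W nsD by auto
 have gg: "ar (g (a, w))" "dm (g (a, w)) = c (a, w)" "cd (g (a, w)) = c' (a, w)"
  "!!s. s \<in> set ns ==> ar (g (s, w')) & dm (g (s, w')) = c (s, w') & cd (g (s, w')) = c' (s, w')"
  using g assms(3) W nsD by auto
 note T = dgD(3,4,5)[OF assms(1) assms(5)] dgD(3,4,5)[OF assms(2) assms(5)]
 have "smap ns (%s. g (s, w')) ** iota c t a w w' =
  tup (c (a, w)) ns (%s. g (s, w') ** (if (a, s) \<in> P then t (a, w) (s, w') else zr (c (a, w)) (c (s, w'))))"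
  unfolding iota_def by (rule smap_tup) (use o gg T in auto)
 also have "\<dots> = tup (c (a, w)) ns (%s. (if (a, s) \<in> P then t' (a, w) (s, w') else zr (c' (a, w)) (c' (s, w'))) ** g (a, w))"
  by (rule tup_cong) (use o gg T nat[OF assms(5)] in auto)
 also have "\<dots> = iota c' t' a w w' ** g (a, w)"
  unfolding iota_def by (subst tup_cmp) (use o gg T in auto)
 finally show ?thesis .
qed

lemma kappa_nat:
 assumes "dg q c t" "dg q c' t'" "b \<in> V" "(w, w') \<in> R" "!!s. s \<in> set ns ==> (s, b) \<in> P' ==> ((s, w), (b, w')) \<in> q"
  and g: "!!x. x \<in> X ==> ar (g x) & dm (g x) = c x & cd (g x) = c' x"
  and nat: "!!x y. (x, y) \<in> q ==> g y ** t x y = t' x y ** g x"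
 shows "g (b, w') ** kappa c t b w w' = kappa c' t' b w w' ** smap ns (%s. g (s, w))"
proof -
 have W: "w \<in> W" "w' \<in> W" using assms(4) R.r_in by auto
 have o: "c (b, w') \<in> Obj A" "c' (b, w') \<in> Obj A" "!!s. s \<in> set ns ==> c (s, w) \<in> Obj A" "!!s. s \<in> set ns ==> c' (s, w) \<in> Obj A"
  using dgD(1)[OF assms(1)] dgD(1)[OF assms(2)] assms(3) W nsD by auto
 have gg: "ar (g (b, w'))" "dm (g (b, w')) = c (b, w')" "cd (g (b, w')) = c' (b, w')"
  "!!s. s \<in> set ns ==> ar (g (s, w)) & dm (g (s, w)) = c (s, w) & cd (g (s, w)) = c' (s, w)"
  using g assms(3) W nsD by auto
 note T = dgD(3,4,5)[OF assms(1) assms(5)] dgD(3,4,5)[OF assms(2) assms(5)]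
 have "kappa c' t' b w w' ** smap ns (%s. g (s, w)) =
  cot (c' (b, w')) ns (%s. (if (s, b) \<in> P' then t' (s, w) (b, w') else zr (c' (s, w)) (c' (b, w'))) ** g (s, w))"
  unfolding kappa_def by (rule cot_smap) (use o gg T in auto)
 also have "\<dots> = cot (c' (b, w')) ns (%s. g (b, w') ** (if (s, b) \<in> P' then t (s, w) (b, w') else zr (c (s, w)) (c (b, w'))))"
  by (rule cot_cong) (use o gg T nat[OF assms(5)] in auto)
 also have "\<dots> = g (b, w') ** kappa c t b w w'"
  unfolding kappa_def by (subst cmp_cot) (use o gg T in auto)
 finally show ?thesis ..
qed

lemma iota_pre:
 assumes "dg q c t" "(w, w') \<in> R" "(w', w'') \<in> R" "((a, w), (b, w')) \<in> q" "b \<in> V"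
  and q: "!!s. s \<in> set ns ==> (b, s) \<in> P ==> ((b, w'), (s, w'')) \<in> q" and "a \<in> V"
  and iff: "!!s. s \<in> set ns ==> (a, s) \<in> P \<longleftrightarrow> (b, s) \<in> P"
 shows "iota c t b w' w'' ** t (a, w) (b, w') = iota c t a w w''"
proof -
 have W: "w \<in> W" "w' \<in> W" "w'' \<in> W" using assms R.r_in by auto
 have o: "c (a, w) \<in> Obj A" "c (b, w') \<in> Obj A" "!!s. s \<in> set ns ==> c (s, w'') \<in> Obj A"
  using dgD(1)[OF assms(1)] assms W nsD by auto
 note T = dgD(3,4,5)[OF assms(1) assms(4)] dgD(3,4,5)[OF assms(1) q]
 have "iota c t b w' w'' ** t (a, w) (b, w') = tup (c (a, w)) ns
   (%s. (if (b, s) \<in> P then t (b, w') (s, w'') else zr (c (b, w')) (c (s, w''))) ** t (a, w) (b, w'))"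
  unfolding iota_def by (subst tup_cmp) (use o T in auto)
 also have "\<dots> = iota c t a w w''"
  unfolding iota_def by (rule tup_cong) (use o T iff dgD(6)[OF assms(1) assms(4) q] in auto)
 finally show ?thesis .
qed

lemma kappa_post:
 assumes "dg q c t" "(w, w') \<in> R" "(w', w'') \<in> R" "((b, w'), (e, w'')) \<in> q" "b \<in> V"
  and q: "!!s. s \<in> set ns ==> (s, b) \<in> P' ==> ((s, w), (b, w')) \<in> q" and "e \<in> V"
  and iff: "!!s. s \<in> set ns ==> (s, b) \<in> P' \<longleftrightarrow> (s, e) \<in> P'"
 shows "t (b, w') (e, w'') ** kappa c t b w w' = kappa c t e w w''"
proof -
 have W: "w \<in> W" "w' \<in> W" "w'' \<in> W" using assms R.r_in by auto
 have o: "c (e, w'') \<in> Obj A" "c (b, w') \<in> Obj A" "!!s. s \<in> set ns ==> c (s, w) \<in> Obj A"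
  using dgD(1)[OF assms(1)] assms W nsD by auto
 note T = dgD(3,4,5)[OF assms(1) assms(4)] dgD(3,4,5)[OF assms(1) q]
 have "t (b, w') (e, w'') ** kappa c t b w w' = cot (c (e, w'')) ns
   (%s. t (b, w') (e, w'') ** (if (s, b) \<in> P' then t (s, w) (b, w') else zr (c (s, w)) (c (b, w'))))"
  unfolding kappa_def by (subst cmp_cot) (use o T in auto)
 also have "\<dots> = kappa c t e w w''"
  unfolding kappa_def by (rule cot_cong) (use o T iff dgD(6)[OF assms(1) q assms(4)] in auto)
 finally show ?thesis .
qed

lemma iota_post:
 assumes "dg q c t" "(w, w') \<in> R" "(w', w'') \<in> R" "a \<in> V"
  and q: "!!s. s \<in> set ns ==> (a, s) \<in> P ==> ((a, w), (s, w')) \<in> q" and q': "!!s. s \<in> set ns ==> ((s, w'), (s, w'')) \<in> q"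
 shows "smap ns (%s. t (s, w') (s, w'')) ** iota c t a w w' = iota c t a w w''"
proof -
 have W: "w \<in> W" "w' \<in> W" "w'' \<in> W" using assms R.r_in by auto
 have o: "c (a, w) \<in> Obj A" "!!s. s \<in> set ns ==> c (s, w'') \<in> Obj A" "!!s. s \<in> set ns ==> c (s, w') \<in> Obj A"
  using dgD(1)[OF assms(1)] assms W nsD by auto
 note T = dgD(3,4,5)[OF assms(1) q] dgD(3,4,5)[OF assms(1) q']
 have "smap ns (%s. t (s, w') (s, w'')) ** iota c t a w w' = tup (c (a, w)) ns
   (%s. t (s, w') (s, w'') ** (if (a, s) \<in> P then t (a, w) (s, w') else zr (c (a, w)) (c (s, w'))))"
  unfolding iota_def by (rule smap_tup) (use o T in auto)
 also have "\<dots> = iota c t a w w''"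
  unfolding iota_def by (rule tup_cong) (use o T dgD(6)[OF assms(1) q q'] in auto)
 finally show ?thesis .
qed

lemma kappa_pre:
 assumes "dg q c t" "(w, w') \<in> R" "(w', w'') \<in> R" "b \<in> V"
  and q: "!!s. s \<in> set ns ==> (s, b) \<in> P' ==> ((s, w'), (b, w'')) \<in> q" and q': "!!s. s \<in> set ns ==> ((s, w), (s, w')) \<in> q"
 shows "kappa c t b w' w'' ** smap ns (%s. t (s, w) (s, w')) = kappa c t b w w''"
proof -
 have W: "w \<in> W" "w' \<in> W" "w'' \<in> W" using assms R.r_in by auto
 have o: "c (b, w'') \<in> Obj A" "!!s. s \<in> set ns ==> c (s, w) \<in> Obj A" "!!s. s \<in> set ns ==> c (s, w') \<in> Obj A"
  using dgD(1)[OF assms(1)] assms W nsD by auto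
 note T = dgD(3,4,5)[OF assms(1) q] dgD(3,4,5)[OF assms(1) q']
 have "kappa c t b w' w'' ** smap ns (%s. t (s, w) (s, w')) = cot (c (b, w'')) ns
   (%s. (if (s, b) \<in> P' then t (s, w') (b, w'') else zr (c (s, w')) (c (b, w''))) ** t (s, w) (s, w'))"
  unfolding kappa_def by (rule cot_smap) (use o T in auto)
 also have "\<dots> = kappa c t b w w''"
  unfolding kappa_def by (rule cot_cong) (use o T dgD(6)[OF assms(1) q' q] in auto)
 finally show ?thesis .
qed

text \<open>Every \<open>b\<close> above \<open>v\<close> is above a single neighbour \<open>s\<close>, so the sum
over the neighbours has the single term \<open>v \<le> s \<le> b\<close>.\<close>
lemma kappa_iota_v:
 assumes d: "dg r c t" and R: "(w, w') \<in> R" and b: "(v, b) \<in> P" "b ~= v"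
 shows "kappa c t b w w' ** iota c t v w w = t (v, w) (b, w')"
proof -
 have W: "w \<in> W" "w' \<in> W" "(w, w) \<in> R" using R R.r_in R.r_refl by auto
 have bV: "b \<in> V" using b P.r_in by auto
 obtain s0 where s0: "s0 \<in> set ns" "(s0, b) \<in> P" using out b by blast
 have o: "c (b, w') \<in> Obj A" "c (v, w) \<in> Obj A" "!!s. s \<in> set ns ==> c (s, w) \<in> Obj A"
  using dgD(1)[OF d] W nsD bV vV by auto
 have q: "!!s. s \<in> set ns ==> (s, b) \<in> P' \<longleftrightarrow> (s, b) \<in> P" using same nsD b by blast
 have T: "ar (t (v, w) (s, w)) & dm (t (v, w) (s, w)) = c (v, w) & cd (t (v, w) (s, w)) = c (s, w)" if "s \<in> set ns" for s
  using dgD(3,4,5)[OF d, of "(v, w)" "(s, w)"] nsD that W by simp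
 have T': "ar (t (s, w) (b, w')) & dm (t (s, w) (b, w')) = c (s, w) & cd (t (s, w) (b, w')) = c (b, w')" if "(s, b) \<in> P" for s
  using dgD(3,4,5)[OF d, of "(s, w)" "(b, w')"] that R by simp
 have "kappa c t b w w' ** iota c t v w w = (if (s0, b) \<in> P' then t (s0, w) (b, w') else zr (c (s0, w)) (c (b, w'))) ** (if (v, s0) \<in> P then t (v, w) (s0, w) else zr (c (v, w)) (c (s0, w)))"
  unfolding kappa_def iota_def
 proof (rule cot_tup_single[OF o(2,1) ns(1) s0(1)], goal_cases)
  case (1 s)
  then show ?case using T[OF 1] T'[of s] o q[OF 1] nsD(5)[OF 1] disj_up[OF 1 s0(1), of b] s0(2) by (cases "(s, b) \<in> P") auto
 qed
 also have "\<dots> = t (v, w) (b, w')"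
  using dgD(6)[OF d, of "(v, w)" "(s0, w)" "(b, w')"] q s0 nsD(5)[OF s0(1)] W R by simp
 finally show ?thesis .
qed

text \<open>The mirror image: \<open>a\<close> lies below a single neighbour.\<close>
lemma kappa_v_iota:
 assumes d: "dg r' c t" and R: "(w, w') \<in> R" and a: "(a, v) \<in> P'" "a ~= v"
 shows "kappa c t v w' w' ** iota c t a w w' = t (a, w) (v, w')"
proof -
 have W: "w \<in> W" "w' \<in> W" "(w', w') \<in> R" using R R.r_in R.r_refl by auto
 have aV: "a \<in> V" using a P'.r_in by auto
 obtain s0 where s0: "s0 \<in> set ns" "(a, s0) \<in> P" using inn a by blast
 have o: "c (a, w) \<in> Obj A" "c (v, w') \<in> Obj A" "!!s. s \<in> set ns ==> c (s, w') \<in> Obj A"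
  using dgD(1)[OF d] W nsD aV vV by auto
 have q: "!!s. s \<in> set ns ==> (a, s) \<in> P' \<longleftrightarrow> (a, s) \<in> P" using same nsD a by blast
 have T: "ar (t (s, w') (v, w')) & dm (t (s, w') (v, w')) = c (s, w') & cd (t (s, w') (v, w')) = c (v, w')" if "s \<in> set ns" for s
  using dgD(3,4,5)[OF d, of "(s, w')" "(v, w')"] nsD that W by simp
 have T': "ar (t (a, w) (s, w')) & dm (t (a, w) (s, w')) = c (a, w) & cd (t (a, w) (s, w')) = c (s, w')" if "(a, s) \<in> P" "s \<in> set ns" for s
  using dgD(3,4,5)[OF d, of "(a, w)" "(s, w')"] that R q by simp
 have "kappa c t v w' w' ** iota c t a w w' = (if (s0, v) \<in> P' then t (s0, w') (v, w') else zr (c (s0, w')) (c (v, w'))) ** (if (a, s0) \<in> P then t (a, w) (s0, w') else zr (c (a, w)) (c (s0, w')))"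
  unfolding kappa_def iota_def
 proof (rule cot_tup_single[OF o(1,2) ns(1) s0(1)], goal_cases)
  case (1 s)
  then show ?case using T[OF 1] T'[OF _ 1] o nsD(6)[OF 1] disj_dn[OF 1 s0(1) a(2)] s0(2) by (cases "(a, s) \<in> P") auto
 qed
 also have "\<dots> = t (a, w) (v, w')"
  using dgD(6)[OF d, of "(a, w)" "(s0, w')" "(v, w')"] q s0 nsD(6)[OF s0(1)] W R by simp
 finally show ?thesis .
qed

text \<open>Neighbours are pairwise incomparable, so \<open>iota\<close> at a neighbour is the inclusion of a summand.\<close>
lemma iota_delta:
 assumes d: "dg q c t" and w: "w \<in> W" and s: "s \<in> set ns"
 shows "iota c t s w w = tup (c (s, w)) ns (delta (%s. c (s, w)) s)"
 unfolding iota_def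
proof (rule tup_cong)
 fix u assume u: "u \<in> set ns"
 have "(s, u) \<in> P \<longleftrightarrow> s = u" using disj_up[OF s u, of u] nsD(3) s u by blast
 then show "(if (s, u) \<in> P then t (s, w) (u, w) else zr (c (s, w)) (c (u, w))) = delta (%s. c (s, w)) s u"
  using dgD(2)[OF d, of "(s, w)"] nsD(1)[OF s] w by (cases "s = u") (auto simp: delta_def)
qed

lemma kappa_delta:
 assumes d: "dg q c t" and w: "w \<in> W" and s: "s \<in> set ns"
 shows "kappa c t s w w = cot (c (s, w)) ns (%u. delta (%s. c (s, w)) u s)"
 unfolding kappa_def
proof (rule cot_cong)
 fix u assume u: "u \<in> set ns"
 have "(u, s) \<in> P' \<longleftrightarrow> u = s" using disj_up[OF u s, of s] nsD(2,3) same s u by blast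
 then show "(if (u, s) \<in> P' then t (u, w) (s, w) else zr (c (u, w)) (c (s, w))) = delta (%s. c (s, w)) u s"
  using dgD(2)[OF d, of "(s, w)"] nsD(1)[OF s] w by (auto simp: delta_def)
qed

definition cc :: "('v \<times> 'w, 'o, 'm) sdiag => int => 'v \<times> 'w => 'o" where "cc M n x = dm (fst M x n)"
definition tt :: "('v \<times> 'w, 'o, 'm) sdiag => int => 'v \<times> 'w => 'v \<times> 'w => ('o, 'm) tarr" where "tt M n x y = snd M x y n"

lemma dg_diag: "is_diag X q M ==> dg q (cc M n) (tt M n)"
 unfolding dg_def cc_def tt_def
proof (intro conjI ballI allI impI)
 assume M: "is_diag X q M"
 show "dm (fst M x n) \<in> Obj A" if "x \<in> X" for x using ar_ob(1)[OF cpxD(1)[OF is_diagD(1)[OF M that]]] .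
 show "snd M x x n = idn (dm (fst M x n))" if "x \<in> X" for x using is_diagD(3)[OF M that] .
 show "ar (snd M x y n)" "dm (snd M x y n) = dm (fst M x n)" "cd (snd M x y n) = dm (fst M y n)" if "(x, y) \<in> q" for x y
  using cmorD(1-3)[OF is_diagD(2)[OF M that]] by auto
 show "snd M y z n ** snd M x y n = snd M x z n" if "(x, y) \<in> q & (y, z) \<in> q" for x y z
  using is_diagD(4)[OF M, of x y z n] that by simp
qed

text \<open>The functor \<open>\<Oplus>\<^sub>s\<close> over the neighbours at fixed \<open>w\<close>, on complexes
and maps; \<open>St\<close> gives its transition maps in \<open>w\<close>.\<close>
definition Ss :: "('v \<times> 'w => ('o, 'm) gmap) => 'w => ('o, 'm) gmap" where
 "Ss f w n = smap ns (%s. f (s, w) n)"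
definition St :: "('v \<times> 'w, 'o, 'm) sdiag => 'w => 'w => ('o, 'm) gmap" where
 "St M w w' n = smap ns (%s. snd M (s, w) (s, w') n)"
definition phi :: "('v \<times> 'w, 'o, 'm) sdiag => 'w => ('o, 'm) gmap" where
 "phi M w n = iota (cc M n) (tt M n) v w w"
definition psi :: "('v \<times> 'w, 'o, 'm) sdiag => 'w => ('o, 'm) gmap" where
 "psi M w n = kappa (cc M n) (tt M n) v w w"

definition Fo :: "('v \<times> 'w, 'o, 'm) sdiag => ('v \<times> 'w, 'o, 'm) sdiag" where
 "Fo M = (%(a, w). if a \<in> V & w \<in> W then if a = v then cone (fst M (v, w)) (phi M w) (Ss (fst M) w) else fst M (a, w) else (%_. None),
  %(a, w) (b, w'). if (a, b) \<in> P' & (w, w') \<in> R then if b ~= v then snd M (a, w) (b, w')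
    else if a = v then cmap (snd M (v, w) (v, w')) (St M w w')
    else (%n. cinc (fst M (v, w')) (Ss (fst M) w') n ** iota (cc M n) (tt M n) a w w') else (%_. None))"

definition Fm :: "('v \<times> 'w, 'o, 'm) smor => ('v \<times> 'w, 'o, 'm) smor" where
 "Fm f = (%(a, w). if a \<in> V & w \<in> W then if a = v then cmap (f (v, w)) (Ss f w) else f (a, w) else (%_. None))"

definition Go :: "('v \<times> 'w, 'o, 'm) sdiag => ('v \<times> 'w, 'o, 'm) sdiag" where
 "Go M = (%(a, w). if a \<in> V & w \<in> W then if a = v then fib (Ss (fst M) w) (psi M w) (fst M (v, w)) else fst M (a, w) else (%_. None),
  %(a, w) (b, w'). if (a, b) \<in> P & (w, w') \<in> R then if a ~= v then snd M (a, w) (b, w')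
    else if b = v then fmap (St M w w') (snd M (v, w) (v, w'))
    else (%n. kappa (cc M n) (tt M n) b w w' ** fprj (Ss (fst M) w) (fst M (v, w)) n) else (%_. None))"

definition Gm :: "('v \<times> 'w, 'o, 'm) smor => ('v \<times> 'w, 'o, 'm) smor" where
 "Gm f = (%(a, w). if a \<in> V & w \<in> W then if a = v then fmap (Ss f w) (f (v, w)) else f (a, w) else (%_. None))"

text \<open>Both \<open>r\<close> and \<open>r'\<close> restrict to \<open>R\<close> over each neighbour, and the sums
over the neighbours depend on this part of the order only.\<close>
definition vertical :: "('v \<times> 'w) rel => bool" where
 "vertical q \<longleftrightarrow> (\<forall>s\<in>set ns. \<forall>(w, w')\<in>R. ((s, w), (s, w')) \<in> q)"

lemma verticalD: "vertical q ==> s \<in> set ns ==> (w, w') \<in> R ==> ((s, w), (s, w')) \<in> q"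
 unfolding vertical_def by blast

context
 fixes q :: "('v \<times> 'w) rel" and M :: "('v \<times> 'w, 'o, 'm) sdiag"
 assumes q: "vertical q" and M: "is_diag X q M"
begin

lemma Mcpx: "a \<in> V ==> w \<in> W ==> cpx (fst M (a, w))" using is_diagD(1)[OF M] by simp

lemma Ss_cpx: "w \<in> W ==> cpx (Ss (fst M) w)"
 unfolding Ss_def[abs_def] by (rule smap_cpx) (simp add: Mcpx nsD)

lemma dm_Ss: "w \<in> W ==> dm (Ss (fst M) w n) = so ns (%s. cc M n (s, w))"
 unfolding Ss_def cc_def by (rule dm_smap) (simp add: Mcpx nsD)

lemma St_cmor: "(w, w') \<in> R ==> cmor (Ss (fst M) w) (St M w w') (Ss (fst M) w')"
 unfolding Ss_def[abs_def] St_def[abs_def] by (rule smap_cmor) (auto simp: Mcpx nsD R.r_in intro: is_diagD(2)[OF M] verticalD[OF q])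

lemma St_St: "(w, w') \<in> R ==> (w', w'') \<in> R ==> St M w' w'' n ** St M w w' n = St M w w'' n"
 unfolding St_def
 by (subst smap_smap) (auto simp: cmorD[OF is_diagD(2)[OF M verticalD[OF q]]] is_diagD(4)[OF M verticalD[OF q] verticalD[OF q]] intro!: smap_cong)

lemma St_idn: "w \<in> W ==> St M w w n = idn (dm (Ss (fst M) w n))"
proof -
 assume w: "w \<in> W"
 have "St M w w n = smap ns (%s. idn (dm (fst M (s, w) n)))"
  unfolding St_def by (rule smap_cong) (simp add: is_diagD(3)[OF M] nsD w)
 then show ?thesis using w by (simp add: smap_idn dm_Ss cc_def cpxD(1)[OF Mcpx] nsD)
qed

end

lemma q_r: "vertical r" and q_r': "vertical r'" unfolding vertical_def by (auto simp: nsD)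

lemma Ss_cmor:
 assumes q: "vertical q"
  and M: "is_diag X q M" and N: "is_diag X q N" and f: "is_dmor X q M f N" and w: "w \<in> W"
 shows "cmor (Ss (fst M) w) (Ss f w) (Ss (fst N) w)"
  "\<forall>x\<in>X. qi (fst M x) (f x) (fst N x) ==> qi (Ss (fst M) w) (Ss f w) (Ss (fst N) w)"
 unfolding Ss_def[abs_def]
 by (rule smap_cmor, use is_diagD(1)[OF M] is_diagD(1)[OF N] is_dmorD(1)[OF f] nsD w in auto)[1]
  (rule smap_qi, use is_diagD(1)[OF M] is_diagD(1)[OF N] is_dmorD(1)[OF f] nsD w in auto)

lemma Ss_St:
 assumes q: "vertical q"
  and M: "is_diag X q M" and N: "is_diag X q N" and f: "is_dmor X q M f N" and w: "(w, w') \<in> R"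
 shows "St N w w' n ** Ss f w n = Ss f w' n ** St M w w' n"
 unfolding Ss_def St_def using w
 by (subst (1 2) smap_smap)
  (auto simp: cmorD[OF is_diagD(2)[OF M verticalD[OF q]]] cmorD[OF is_diagD(2)[OF N verticalD[OF q]]] cmorD[OF is_dmorD(1)[OF f]] nsD R.r_in
   is_dmorD(2)[OF f verticalD[OF q]] intro!: smap_cong)

lemma Ss_comp:
 assumes "is_diag X q M" "is_diag X q N" "is_diag X q L" and f: "is_dmor X q M f N" and g: "is_dmor X q N g L" and w: "w \<in> W"
 shows "Ss g w n ** Ss f w n = Ss (%x n. g x n ** f x n) w n"
 unfolding Ss_def using w
 by (subst smap_smap) (auto simp: cmorD[OF is_dmorD(1)[OF f]] cmorD[OF is_dmorD(1)[OF g]] nsD)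

section \<open>From source to sink: cones\<close>

context
 fixes M assumes M: "is_diag X r M"
begin

lemmas dgM = dg_diag[OF M]
lemmas Mc = Mcpx[OF q_r M] and Sc = Ss_cpx[OF q_r M]

lemma iotaM:
 assumes "a \<in> V" "(w, w') \<in> R"
 shows "ar (iota (cc M n) (tt M n) a w w')" "dm (iota (cc M n) (tt M n) a w w') = dm (fst M (a, w) n)"
  "cd (iota (cc M n) (tt M n) a w w') = dm (Ss (fst M) w' n)"
 using iota_ar[OF dgM assms, of n] dm_Ss[OF q_r M, of w' n] assms R.r_in by (auto simp: cc_def)

lemma iota_cmor:
 assumes a: "a \<in> V" "(w, w') \<in> R"
 shows "cmor (fst M (a, w)) (%n. iota (cc M n) (tt M n) a w w') (Ss (fst M) w')"
proof (rule cmorI)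
 fix n
 show "Ss (fst M) w' n ** iota (cc M n) (tt M n) a w w' = iota (cc M (n+1)) (tt M (n+1)) a w w' ** fst M (a, w) n"
  unfolding Ss_def
 proof (rule iota_nat[OF dgM dgM a])
  show "((a, w), (s, w')) \<in> r" if "s \<in> set ns" "(a, s) \<in> P" for s using that a by simp
  show "ar (fst M x n) & dm (fst M x n) = cc M n x & cd (fst M x n) = cc M (n+1) x" if "x \<in> X" for x
   using cpxD[OF is_diagD(1)[OF M that]] by (simp add: cc_def)
  show "fst M y n ** tt M n x y = tt M (n+1) x y ** fst M x n" if "(x, y) \<in> r" for x y
   using cmorD(4)[OF is_diagD(2)[OF M that]] by (simp add: tt_def)
 qed
qed (use iotaM[OF a] in auto)

lemma phi_cmor: "w \<in> W ==> cmor (fst M (v, w)) (phi M w) (Ss (fst M) w)"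
 unfolding phi_def[abs_def] using iota_cmor[OF vV R.r_refl] .

lemma phi_square: "(w, w') \<in> R ==> phi M w' n ** snd M (v, w) (v, w') n = St M w w' n ** phi M w n"
proof -
 assume w: "(w, w') \<in> R"
 then have W: "w \<in> W" "w' \<in> W" using R.r_in by auto
 have "phi M w' n ** snd M (v, w) (v, w') n = iota (cc M n) (tt M n) v w w'"
  using iota_pre[OF dgM w R.r_refl[OF W(2)], of v v] w vV vs_P R.r_refl[OF W(2)] unfolding phi_def by (simp add: tt_def)
 also have "\<dots> = St M w w' n ** phi M w n"
  using iota_post[OF dgM R.r_refl[OF W(1)] w vV, of n] w R.r_refl[OF W(1)] nsD unfolding phi_def St_def by (simp add: tt_def)
 finally show ?thesis .
qed

lemmas coneM = Mc[OF vV] Sc phi_cmor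

lemma Fo_sel:
 "a \<in> V ==> w \<in> W ==> a ~= v ==> fst (Fo M) (a, w) = fst M (a, w)"
 "w \<in> W ==> fst (Fo M) (v, w) = cone (fst M (v, w)) (phi M w) (Ss (fst M) w)"
 "(a, b) \<in> P' ==> (w, w') \<in> R ==> b ~= v ==> snd (Fo M) (a, w) (b, w') = snd M (a, w) (b, w')"
 "(w, w') \<in> R ==> snd (Fo M) (v, w) (v, w') = cmap (snd M (v, w) (v, w')) (St M w w')"
 "(a, v) \<in> P' ==> (w, w') \<in> R ==> a ~= v ==> snd (Fo M) (a, w) (v, w') = (%n. cinc (fst M (v, w')) (Ss (fst M) w') n ** iota (cc M n) (tt M n) a w w')"
 using vV vs_P by (simp_all add: Fo_def)

lemma nonv: "(a, b) \<in> P' ==> b ~= v ==> a ~= v" "(a, b) \<in> P' ==> b ~= v ==> (a, b) \<in> P"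
 using snk same by metis+

lemma Tv: "(w, w') \<in> R ==> cmor (fst M (v, w)) (snd M (v, w) (v, w')) (fst M (v, w'))"
 using is_diagD(2)[OF M] vs_P by simp

text \<open>Compatibility of transition maps along \<open>x \<le> y \<le> z\<close> is split according to how many of
the points lie over \<open>v\<close>. As \<open>v\<close> is a sink, points over \<open>v\<close> come
last.\<close>
lemma Fo_diag: "is_diag X r' (Fo M)"
 unfolding is_diag_def
proof (intro conjI ballI allI impI)
 fix x assume "x \<in> X"
 then obtain a w where x: "x = (a, w)" "a \<in> V" "w \<in> W" by auto
 show "cpx (fst (Fo M) x)"
  using x cone_cpx[OF coneM(1) coneM(2) coneM(3)] Mc by (cases "a = v") (auto simp: Fo_sel q_r)
next
 fix x y assume "(x, y) \<in> r'"
 then obtain a w b w' where xy: "x = (a, w)" "y = (b, w')" "(a, b) \<in> P'" "(w, w') \<in> R" by (cases x; cases y) auto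
 then have in': "a \<in> V" "b \<in> V" "w \<in> W" "w' \<in> W" using P'.r_in R.r_in by auto
 show "cmor (fst (Fo M) x) (snd (Fo M) x y) (fst (Fo M) y)"
 proof (cases "b = v")
  case False
  then show ?thesis using xy in' nonv[OF xy(3)] is_diagD(2)[OF M] by (simp add: Fo_sel)
 next
  case True
  show ?thesis
  proof (cases "a = v")
   case a: True
   then show ?thesis using xy True in'
    cmap_cmor(1)[OF coneM(1)[OF in'(3)] Ss_cpx[OF q_r M in'(3)] phi_cmor[OF in'(3)] coneM(1)[OF in'(4)] Ss_cpx[OF q_r M in'(4)] phi_cmor[OF in'(4)]
     Tv[OF xy(4)] St_cmor[OF q_r M xy(4)] phi_square[OF xy(4)]]
    by (simp add: Fo_sel)
  next
   case a: False
   then show ?thesis using xy True in'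
     cmor_comp[OF iota_cmor[OF in'(1) xy(4)] cinc_cmor[OF coneM(1)[OF in'(4)] Ss_cpx[OF q_r M in'(4)] phi_cmor[OF in'(4)]]]
    by (simp add: Fo_sel)
  qed
 qed
next
 fix x n assume "x \<in> X"
 then obtain a w where x: "x = (a, w)" "a \<in> V" "w \<in> W" by auto
 show "snd (Fo M) x x n = idn (dm (fst (Fo M) x n))"
 proof (cases "a = v")
  case True
  then show ?thesis using x R.r_refl[OF x(3)] cpxD(1)[OF Mc] cpxD(1)[OF Ss_cpx[OF q_r M]] vV
   by (simp add: Fo_sel cmap_def dm_cone[OF coneM(1) Ss_cpx[OF q_r M] phi_cmor] St_idn[OF q_r M] is_diagD(3)[OF M] diag2_idn)
 next
  case False
  then show ?thesis using x P'.r_refl[OF x(2)] R.r_refl[OF x(3)] by (simp add: Fo_sel is_diagD(3)[OF M])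
 qed
next
 fix x y z n assume "(x, y) \<in> r' & (y, z) \<in> r'"
 then obtain a w b w' c w'' where xy: "x = (a, w)" "y = (b, w')" "z = (c, w'')" "(a, b) \<in> P'" "(w, w') \<in> R" "(b, c) \<in> P'" "(w', w'') \<in> R"
  by (cases x; cases y; cases z) auto
 have xz: "(a, c) \<in> P'" "(w, w'') \<in> R" using xy P'.r_trans R.r_trans by blast+
 have in': "a \<in> V" "b \<in> V" "c \<in> V" "w \<in> W" "w' \<in> W" "w'' \<in> W" using xy P'.r_in R.r_in by auto
 show "snd (Fo M) x z n = snd (Fo M) y z n ** snd (Fo M) x y n"
 proof (cases "c = v")
  case c: False
  then have b: "b ~= v" using xy nonv by blast
  show ?thesis using xy xz c b nonv is_diagD(4)[OF M, of "(a, w)" "(b, w')" "(c, w'')"] by (simp add: Fo_sel)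
 next
  case c: True
  show ?thesis
  proof (cases "b = v")
   case b: False
   then have a: "a ~= v" using xy nonv by blast
   have "iota (cc M n) (tt M n) b w' w'' ** snd M (a, w) (b, w') n = iota (cc M n) (tt M n) a w w''"
    using iota_pre[OF dgM xy(5,7), of a b n] up_iff[OF xy(4) _ b] xy in' c b nonv by (simp add: tt_def)
   then show ?thesis using xy xz c b a by (simp add: Fo_sel)
  next
   case b: True
   show ?thesis
   proof (cases "a = v")
    case a: True
    have "snd M (v, w') (v, w'') m ** snd M (v, w) (v, w') m = snd M (v, w) (v, w'') m" for m
     using is_diagD(4)[OF M, of "(v, w)" "(v, w')" "(v, w'')"] vs_P xy by simp
    then show ?thesis using xy xz a b c cmorD[OF Tv[OF xy(5)]] cmorD[OF Tv[OF xy(7)]] cmorD[OF St_cmor[OF q_r M xy(5)]] cmorD[OF St_cmor[OF q_r M xy(7)]]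
     by (simp add: Fo_sel cmap_def St_St[OF q_r M])
   next
    case a: False
    have e: "St M w' w'' n ** iota (cc M n) (tt M n) a w w' = iota (cc M n) (tt M n) a w w''"
     using iota_post[OF dgM xy(5,7) in'(1), of n] xy nsD unfolding St_def by (simp add: tt_def)
    note [simp] = cmorD(1-3)[OF Tv[OF xy(7)]] cmorD(1-3)[OF St_cmor[OF q_r M xy(7)]] iotaM[OF in'(1) xy(5)]
    have "cmap (snd M (v, w') (v, w'')) (St M w' w'') n ** cinc (fst M (v, w')) (Ss (fst M) w') n ** iota (cc M n) (tt M n) a w w'
      = cinc (fst M (v, w'')) (Ss (fst M) w'') n ** St M w' w'' n ** iota (cc M n) (tt M n) a w w'"
     by (subst cmp_assoc[symmetric]) (simp add: cmap_def cinc_def)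
    then show ?thesis using xy xz a b c e by (simp add: Fo_sel)
   qed
  qed
 qed
qed (auto simp: Fo_def)

end

context
 fixes M N :: "('v \<times> 'w, 'o, 'm) sdiag" and \<kappa> :: "int => int" and g :: "('v \<times> 'w, 'o, 'm) smor"
 assumes M: "is_diag X r M" and N: "is_diag X r N" and \<kappa>: "!!n. \<kappa> (n+1) = \<kappa> n+1"
  and g: "!!x n. x \<in> X ==> ar (g x n) & dm (g x n) = dm (fst M x (\<kappa> n)) & cd (g x n) = dm (fst N x n)"
  and nat: "!!x y n. (x, y) \<in> r ==> snd N x y n ** g x n = g y n ** snd M x y (\<kappa> n)"
begin

lemma iota_natural:
 assumes "a \<in> V" "(w, w') \<in> R"
 shows "Ss g w' n ** iota (cc M (\<kappa> n)) (tt M (\<kappa> n)) a w w' = iota (cc N n) (tt N n) a w w' ** g (a, w) n"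
 unfolding Ss_def
proof (rule iota_nat[OF dgM[OF M] dgM[OF N] assms])
 show "((a, w), (s, w')) \<in> r" if "(a, s) \<in> P" for s using that assms(2) by simp
qed (use g nat in \<open>simp_all add: cc_def tt_def\<close>)

lemma phi_natural: "w \<in> W ==> phi N w n ** g (v, w) n = Ss g w n ** phi M w (\<kappa> n)"
 unfolding phi_def using iota_natural[OF vV R.r_refl] by simp

lemma Ss_arr: "w \<in> W ==> ar (Ss g w n) & dm (Ss g w n) = dm (Ss (fst M) w (\<kappa> n)) & cd (Ss g w n) = dm (Ss (fst N) w n)"
 using smap_ar[of ns "%s. g (s, w) n"] g nsD dm_Ss[OF q_r M, of w] dm_Ss[OF q_r N, of w] unfolding Ss_def cc_def
 by (simp cong: so_cong)

lemma St_natural: "(w, w') \<in> R ==> St N w w' n ** Ss g w n = Ss g w' n ** St M w w' (\<kappa> n)"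
 unfolding Ss_def St_def
 by (subst (1 2) smap_smap)
  (auto simp: cmorD[OF is_diagD(2)[OF M verticalD[OF q_r]]] cmorD[OF is_diagD(2)[OF N verticalD[OF q_r]]] g nsD R.r_in
   nat[OF verticalD[OF q_r]] intro!: smap_cong)

text \<open>A family \<open>g\<close> that is natural in each degree stays natural after applying \<open>F\<close>,
whatever sign \<open>sg\<close> is put on the first summand of the cone. With \<open>\<kappa> n =
n\<close> this is functoriality; with \<open>\<kappa> n = n + 1\<close> and a minus sign it treats the
splittings of mapping cones, which raise the degree.\<close>
lemma Fo_natural:
 assumes sg: "sg = (%h. h) \<or> sg = (%h. \<ominus> h)" and "(x, y) \<in> r'"
  and g'v: "!!w n. w \<in> W ==> g' (v, w) n = diag2 (sg (g (v, w) (n+1))) (Ss g w n)"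
  and g': "!!a w. (a, w) \<in> X ==> a ~= v ==> g' (a, w) = g (a, w)"
 shows "snd (Fo N) x y n ** g' x n = g' y n ** snd (Fo M) x y (\<kappa> n)"
proof -
 obtain a w b w' where xy: "x = (a, w)" "y = (b, w')" "(a, b) \<in> P'" "(w, w') \<in> R" using assms(2) by (cases x; cases y) auto
 then have in': "a \<in> V" "b \<in> V" "w \<in> W" "w' \<in> W" using P'.r_in R.r_in by auto
 note [simp] = \<kappa>
 have [simp]: "ar (g (v, w) m)" "dm (g (v, w) m) = dm (fst M (v, w) (\<kappa> m))" "cd (g (v, w) m) = dm (fst N (v, w) m)"
   "ar (g (v, w') m)" "dm (g (v, w') m) = dm (fst M (v, w') (\<kappa> m))" "cd (g (v, w') m) = dm (fst N (v, w') m)" for m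
  using g in' vV by auto
 note [simp] = Ss_arr[OF in'(3)] Ss_arr[OF in'(4)]
 show ?thesis
 proof (cases "b = v")
  case False
  then show ?thesis using xy in' nonv[OF M xy(3)] nat by (simp add: Fo_sel M N g')
 next
  case b: True
  show ?thesis
  proof (cases "a = v")
   case a: True
   have "snd N (v, w) (v, w') m ** g (v, w) m = g (v, w') m ** snd M (v, w) (v, w') (\<kappa> m)" for m
    using nat vs_P xy by simp
   from this[of "n+1"] show ?thesis using xy in' a b cmorD(1-3)[OF Tv[OF M xy(4)]] cmorD(1-3)[OF Tv[OF N xy(4)]]
     cmorD(1-3)[OF St_cmor[OF q_r M xy(4)]] cmorD(1-3)[OF St_cmor[OF q_r N xy(4)]] sg
    by (auto simp add: Fo_sel M N g'v cmap_def St_natural)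
  next
   case a: False
   note [simp] = iotaM[OF M in'(1) xy(4)] iotaM[OF N in'(1) xy(4)] cpxD(1)[OF coneM(1)[OF M in'(4)]] cpxD(1)[OF coneM(2)[OF M in'(4)]]
     cpxD(1)[OF coneM(1)[OF N in'(4)]] cpxD(1)[OF coneM(2)[OF N in'(4)]]
   have "g' (v, w') n ** cinc (fst M (v, w')) (Ss (fst M) w') (\<kappa> n) = cinc (fst N (v, w')) (Ss (fst N) w') n ** Ss g w' n"
    using sg in' by (auto simp add: g'v cinc_def)
   from cmp_left[OF this] show ?thesis using xy in' a b by (simp add: Fo_sel M N g' iota_natural)
  qed
 qed
qed

end

lemma Fm_sel: "a \<in> V ==> w \<in> W ==> a ~= v ==> Fm f (a, w) = f (a, w)" "w \<in> W ==> Fm f (v, w) = cmap (f (v, w)) (Ss f w)"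
 using vV by (simp_all add: Fm_def)

lemma Gm_sel: "a \<in> V ==> w \<in> W ==> a ~= v ==> Gm f (a, w) = f (a, w)" "w \<in> W ==> Gm f (v, w) = fmap (Ss f w) (f (v, w))"
 using vV by (simp_all add: Gm_def)

lemma dmor_arr: "is_dmor X q M f N ==> x \<in> X ==> ar (f x n) & dm (f x n) = dm (fst M x n) & cd (f x n) = dm (fst N x n)"
 by (drule (1) is_dmorD(1)) (simp add: cmorD)

lemma phi_dmor:
 assumes "is_diag X r M" "is_diag X r N" "is_dmor X r M f N" "w \<in> W"
 shows "phi N w n ** f (v, w) n = Ss f w n ** phi M w n"
 by (rule phi_natural[where \<kappa> = "%n. n"]) (use assms dmor_arr[OF assms(3)] is_dmorD(2)[OF assms(3)] in simp_all)

lemma Fm_dmor: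
 assumes M: "is_diag X r M" and N: "is_diag X r N" and f: "is_dmor X r M f N"
 shows "is_dmor X r' (Fo M) (Fm f) (Fo N)"
  "\<forall>x\<in>X. qi (fst M x) (f x) (fst N x) ==> \<forall>x\<in>X. qi (fst (Fo M) x) (Fm f x) (fst (Fo N) x)"
proof -
 have fv: "w \<in> W ==> cmor (fst M (v, w)) (f (v, w)) (fst N (v, w))" for w using is_dmorD(1)[OF f] vV by simp
 note cM = coneM[OF M] and cN = coneM[OF N] and fS = Ss_cmor[OF q_r M N f]
 note c = cmap_cmor[OF cM cN fv fS(1) phi_dmor[OF M N f]]
 show "is_dmor X r' (Fo M) (Fm f) (Fo N)"
  unfolding is_dmor_def
 proof (intro conjI ballI allI impI)
  fix x assume "x \<in> X"
  then obtain a w where x: "x = (a, w)" "a \<in> V" "w \<in> W" by auto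
  show "cmor (fst (Fo M) x) (Fm f x) (fst (Fo N) x)"
   using x c(1) is_dmorD(1)[OF f] by (cases "a = v") (auto simp: Fo_sel M N Fm_sel)
 next
  fix x y n assume xy: "(x, y) \<in> r'"
  show "snd (Fo N) x y n ** Fm f x n = Fm f y n ** snd (Fo M) x y n"
   by (rule Fo_natural[where \<kappa> = "%n. n" and sg = "%h. h", OF M N])
    (use xy dmor_arr[OF f] is_dmorD(2)[OF f] in \<open>simp_all add: Fm_sel cmap_def\<close>)
 qed (auto simp: Fm_def)
 show "\<forall>x\<in>X. qi (fst (Fo M) x) (Fm f x) (fst (Fo N) x)" if q: "\<forall>x\<in>X. qi (fst M x) (f x) (fst N x)"
 proof
  fix x assume "x \<in> X"
  then obtain a w where x: "x = (a, w)" "a \<in> V" "w \<in> W" by auto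
  show "qi (fst (Fo M) x) (Fm f x) (fst (Fo N) x)"
   using x c(2) fS(2)[OF x(3) q] q vV by (cases "a = v") (auto simp: Fo_sel M N Fm_sel)
 qed
qed

definition Ff where "Ff = \<lparr>on_obj = Fo, on_arr = (%_ _. Fm)\<rparr>"
definition Gf where "Gf = \<lparr>on_obj = Go, on_arr = (%_ _. Gm)\<rparr>"

lemma FG_sel [simp]: "on_obj Ff = Fo" "on_arr Ff M N = Fm" "on_obj Gf = Go" "on_arr Gf M N = Gm"
 by (simp_all add: Ff_def Gf_def)

lemma Ss_idn: "is_diag X q M ==> w \<in> W ==> (!!s. s \<in> set ns ==> f (s, w) n = idn (dm (fst M (s, w) n))) ==> Ss f w n = idn (so ns (%s. cc M n (s, w)))"
proof -
 assume M: "is_diag X q M" and w: "w \<in> W" and f: "!!s. s \<in> set ns ==> f (s, w) n = idn (dm (fst M (s, w) n))"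
 have "Ss f w n = smap ns (%s. idn (cc M n (s, w)))" unfolding Ss_def cc_def by (rule smap_cong) (rule f)
 then show ?thesis using dgD(1)[OF dg_diag[OF M], of _ n] w nsD by (simp add: smap_idn)
qed

lemma Ff_functor: "is_functor (DG X r) (DG X r') Ff"
 unfolding is_functor_def FG_sel
proof (intro conjI ballI)
 fix M assume "M \<in> Obj (DG X r)"
 then have M: "is_diag X r M" by simp
 show "Fo M \<in> Obj (DG X r')" using Fo_diag[OF M] by simp
 note c = coneM(1)[OF M] Ss_cpx[OF q_r M] phi_cmor[OF M]
 have "Ss (%x n. if x \<in> X then idn (dm (fst M x n)) else None) w n = idn (dm (Ss (fst M) w n))" if "w \<in> W" for w n
  using Ss_idn[OF M that, of "%x n. if x \<in> X then idn (dm (fst M x n)) else None" n] dm_Ss[OF q_r M that] nsD that by simp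
 then show "Fm (Ident (DG X r) M) = Ident (DG X r') (Fo M)"
  using vV cpxD(1)[OF c(1)] cpxD(1)[OF c(2)]
  by (auto simp: Fm_def fun_eq_iff Fo_sel[OF M] dm_cone[OF c] cmap_def diag2_idn)
next
 fix M N f assume "M \<in> Obj (DG X r)" "N \<in> Obj (DG X r)" "f \<in> Hom (DG X r) M N"
 then show "Fm f \<in> Hom (DG X r') (Fo M) (Fo N)" using Fm_dmor(1) by simp
next
 fix M N L f g assume "M \<in> Obj (DG X r)" "N \<in> Obj (DG X r)" "L \<in> Obj (DG X r)" "f \<in> Hom (DG X r) M N" "g \<in> Hom (DG X r) N L"
 then have d: "is_diag X r M" "is_diag X r N" "is_diag X r L" and f: "is_dmor X r M f N" and g: "is_dmor X r N g L" by auto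
 note F = cmorD[OF is_dmorD(1)[OF f]] and G = cmorD[OF is_dmorD(1)[OF g]]
 show "Fm (Comp (DG X r) g f) = Comp (DG X r') (Fm g) (Fm f)"
  using vV cmorD(1-3)[OF Ss_cmor(1)[OF q_r d(1,2) f]] cmorD(1-3)[OF Ss_cmor(1)[OF q_r d(2,3) g]]
  by (auto simp: Fm_def fun_eq_iff cmap_def F G Ss_comp[OF d f g, symmetric])
qed

section \<open>From sink to source: fibres\<close>

context
 fixes M assumes M: "is_diag X r' M"
begin

lemmas dgN = dg_diag[OF M]
lemmas Nc = Mcpx[OF q_r' M]

lemma kappaM:
 assumes "b \<in> V" "(w, w') \<in> R"
 shows "ar (kappa (cc M n) (tt M n) b w w')" "cd (kappa (cc M n) (tt M n) b w w') = dm (fst M (b, w') n)"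
  "dm (kappa (cc M n) (tt M n) b w w') = dm (Ss (fst M) w n)"
 using kappa_ar[OF dgN assms, of n] dm_Ss[OF q_r' M, of w n] assms R.r_in by (auto simp: cc_def)

lemma kappa_cmor:
 assumes b: "b \<in> V" "(w, w') \<in> R"
 shows "cmor (Ss (fst M) w) (%n. kappa (cc M n) (tt M n) b w w') (fst M (b, w'))"
proof (rule cmorI)
 fix n
 show "fst M (b, w') n ** kappa (cc M n) (tt M n) b w w' = kappa (cc M (n+1)) (tt M (n+1)) b w w' ** Ss (fst M) w n"
  unfolding Ss_def
 proof (rule kappa_nat[OF dgN dgN b])
  show "((s, w), (b, w')) \<in> r'" if "s \<in> set ns" "(s, b) \<in> P'" for s using that b by simp
  show "ar (fst M x n) & dm (fst M x n) = cc M n x & cd (fst M x n) = cc M (n+1) x" if "x \<in> X" for x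
   using cpxD[OF is_diagD(1)[OF M that]] by (simp add: cc_def)
  show "fst M y n ** tt M n x y = tt M (n+1) x y ** fst M x n" if "(x, y) \<in> r'" for x y
   using cmorD(4)[OF is_diagD(2)[OF M that]] by (simp add: tt_def)
 qed
qed (use kappaM[OF b] in auto)

lemma psi_cmor: "w \<in> W ==> cmor (Ss (fst M) w) (psi M w) (fst M (v, w))"
 unfolding psi_def[abs_def] using kappa_cmor[OF vV R.r_refl] .

lemma psi_square: "(w, w') \<in> R ==> psi M w' n ** St M w w' n = snd M (v, w) (v, w') n ** psi M w n"
proof -
 assume w: "(w, w') \<in> R"
 then have W: "w \<in> W" "w' \<in> W" using R.r_in by auto
 have "snd M (v, w) (v, w') n ** psi M w n = kappa (cc M n) (tt M n) v w w'"
  using kappa_post[OF dgN R.r_refl[OF W(1)] w, of v v] w vV vs_P R.r_refl[OF W(1)] unfolding psi_def by (simp add: tt_def)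
 also have "\<dots> = psi M w' n ** St M w w' n"
  using kappa_pre[OF dgN w R.r_refl[OF W(2)] vV, of n] w R.r_refl[OF W(2)] nsD unfolding psi_def St_def by (simp add: tt_def)
 finally show ?thesis ..
qed

lemma Go_sel:
 "a \<in> V ==> w \<in> W ==> a ~= v ==> fst (Go M) (a, w) = fst M (a, w)"
 "w \<in> W ==> fst (Go M) (v, w) = fib (Ss (fst M) w) (psi M w) (fst M (v, w))"
 "(a, b) \<in> P ==> (w, w') \<in> R ==> a ~= v ==> snd (Go M) (a, w) (b, w') = snd M (a, w) (b, w')"
 "(w, w') \<in> R ==> snd (Go M) (v, w) (v, w') = fmap (St M w w') (snd M (v, w) (v, w'))"
 "(v, b) \<in> P ==> (w, w') \<in> R ==> b ~= v ==> snd (Go M) (v, w) (b, w') = (%n. kappa (cc M n) (tt M n) b w w' ** fprj (Ss (fst M) w) (fst M (v, w)) n)"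
 using vV vs_P by (simp_all add: Go_def)

lemma nonv': "(a, b) \<in> P ==> a ~= v ==> b ~= v" "(a, b) \<in> P ==> a ~= v ==> (a, b) \<in> P'"
 using src same by metis+

lemma Tv': "(w, w') \<in> R ==> cmor (fst M (v, w)) (snd M (v, w) (v, w')) (fst M (v, w'))"
 using is_diagD(2)[OF M] vs_P by simp

lemmas fibM = Ss_cpx[OF q_r' M] Nc[OF vV] psi_cmor

text \<open>The mirror image of \<open>Fo_diag\<close>: over a source, points over \<open>v\<close> come first.\<close>
lemma Go_diag: "is_diag X r (Go M)"
 unfolding is_diag_def
proof (intro conjI ballI allI impI)
 fix x assume "x \<in> X"
 then obtain a w where x: "x = (a, w)" "a \<in> V" "w \<in> W" by auto
 show "cpx (fst (Go M) x)"
  using x fib_cpx[OF fibM(1) fibM(2) fibM(3)] Nc by (cases "a = v") (auto simp: Go_sel)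
next
 fix x y assume "(x, y) \<in> r"
 then obtain a w b w' where xy: "x = (a, w)" "y = (b, w')" "(a, b) \<in> P" "(w, w') \<in> R" by (cases x; cases y) auto
 then have in': "a \<in> V" "b \<in> V" "w \<in> W" "w' \<in> W" using P.r_in R.r_in by auto
 show "cmor (fst (Go M) x) (snd (Go M) x y) (fst (Go M) y)"
 proof (cases "a = v")
  case False
  then show ?thesis using xy in' nonv'[OF xy(3)] is_diagD(2)[OF M] by (simp add: Go_sel)
 next
  case True
  show ?thesis
  proof (cases "b = v")
   case b: True
   then show ?thesis using xy True in'
    fmap_cmor(1)[OF fibM[OF in'(3)] fibM[OF in'(4)] St_cmor[OF q_r' M xy(4)] Tv'[OF xy(4)] psi_square[OF xy(4)]]
    by (simp add: Go_sel)
  next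
   case b: False
   then show ?thesis using xy True in' cmor_comp[OF fprj_cmor[OF fibM[OF in'(3)]] kappa_cmor[OF in'(2) xy(4)]]
    by (simp add: Go_sel)
  qed
 qed
next
 fix x n assume "x \<in> X"
 then obtain a w where x: "x = (a, w)" "a \<in> V" "w \<in> W" by auto
 show "snd (Go M) x x n = idn (dm (fst (Go M) x n))"
 proof (cases "a = v")
  case True
  then show ?thesis using x R.r_refl[OF x(3)] cpxD(1)[OF Nc] cpxD(1)[OF Ss_cpx[OF q_r' M]] vV
   by (simp add: Go_sel fmap_def dm_fib[OF fibM] St_idn[OF q_r' M] is_diagD(3)[OF M] diag2_idn)
 next
  case False
  then show ?thesis using x P.r_refl[OF x(2)] R.r_refl[OF x(3)] by (simp add: Go_sel is_diagD(3)[OF M])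
 qed
next
 fix x y z n assume "(x, y) \<in> r & (y, z) \<in> r"
 then obtain a w b w' c w'' where xy: "x = (a, w)" "y = (b, w')" "z = (c, w'')" "(a, b) \<in> P" "(w, w') \<in> R" "(b, c) \<in> P" "(w', w'') \<in> R"
  by (cases x; cases y; cases z) auto
 have xz: "(a, c) \<in> P" "(w, w'') \<in> R" using xy P.r_trans R.r_trans by blast+
 have in': "a \<in> V" "b \<in> V" "c \<in> V" "w \<in> W" "w' \<in> W" "w'' \<in> W" using xy P.r_in R.r_in by auto
 show "snd (Go M) x z n = snd (Go M) y z n ** snd (Go M) x y n"
 proof (cases "a = v")
  case a: False
  then have b: "b ~= v" using xy nonv' by blast
  show ?thesis using xy xz a b nonv' is_diagD(4)[OF M, of "(a, w)" "(b, w')" "(c, w'')"] by (simp add: Go_sel)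
 next
  case a: True
  show ?thesis
  proof (cases "b = v")
   case b: False
   then have c: "c ~= v" using xy nonv' by blast
   have "snd M (b, w') (c, w'') n ** kappa (cc M n) (tt M n) b w w' = kappa (cc M n) (tt M n) c w w''"
    using kappa_post[OF dgN xy(5,7), of b c n] dn_iff[OF xy(6) _ b] xy in' c a b nonv' by (simp add: tt_def)
   then have "kappa (cc M n) (tt M n) c w w'' ** h = snd M (b, w') (c, w'') n ** kappa (cc M n) (tt M n) b w w' ** h" for h
    by (metis cmp_assoc)
   then show ?thesis using xy xz a b c by (simp add: Go_sel)
  next
   case b: True
   show ?thesis
   proof (cases "c = v")
    case c: True
    have "snd M (v, w') (v, w'') m ** snd M (v, w) (v, w') m = snd M (v, w) (v, w'') m" for m
     using is_diagD(4)[OF M, of "(v, w)" "(v, w')" "(v, w'')"] vs_P xy by simp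
    then show ?thesis using xy xz a b c cmorD[OF Tv'[OF xy(5)]] cmorD[OF Tv'[OF xy(7)]] cmorD[OF St_cmor[OF q_r' M xy(5)]] cmorD[OF St_cmor[OF q_r' M xy(7)]]
     by (simp add: Go_sel fmap_def St_St[OF q_r' M])
   next
    case c: False
    have e: "kappa (cc M n) (tt M n) c w' w'' ** St M w w' n = kappa (cc M n) (tt M n) c w w''"
     using kappa_pre[OF dgN xy(5,7) in'(3), of n] xy nsD unfolding St_def by (simp add: tt_def)
    note [simp] = cmorD(1-3)[OF Tv'[OF xy(5)]] cmorD(1-3)[OF St_cmor[OF q_r' M xy(5)]] kappaM[OF in'(3) xy(7)]
    have "fprj (Ss (fst M) w') (fst M (v, w')) n ** fmap (St M w w') (snd M (v, w) (v, w')) n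
      = St M w w' n ** fprj (Ss (fst M) w) (fst M (v, w)) n"
     by (simp add: fmap_def fprj_def)
    then show ?thesis using xy xz a b c cmp_left[OF e] by (simp add: Go_sel)
   qed
  qed
 qed
qed (auto simp: Go_def)

end

lemma kappa_natural:
 assumes M: "is_diag X r' M" and N: "is_diag X r' N" and f: "is_dmor X r' M f N" and bw: "b \<in> V" "(w, w') \<in> R"
 shows "f (b, w') n ** kappa (cc M n) (tt M n) b w w' = kappa (cc N n) (tt N n) b w w' ** Ss f w n"
 unfolding Ss_def
proof (rule kappa_nat[OF dgN[OF M] dgN[OF N] bw])
 show "((s, w), (b, w')) \<in> r'" if "(s, b) \<in> P'" for s using that bw by simp
qed (use dmor_arr[OF f] is_dmorD(2)[OF f] in \<open>simp_all add: cc_def tt_def\<close>)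

lemma psi_dmor:
 assumes M: "is_diag X r' M" and N: "is_diag X r' N" and f: "is_dmor X r' M f N" and "w \<in> W"
 shows "psi N w n ** Ss f w n = f (v, w) n ** psi M w n"
 unfolding psi_def using kappa_natural[OF M N f vV R.r_refl[OF assms(4)]] ..

lemma Gm_dmor:
 assumes M: "is_diag X r' M" and N: "is_diag X r' N" and f: "is_dmor X r' M f N"
 shows "is_dmor X r (Go M) (Gm f) (Go N)"
  "\<forall>x\<in>X. qi (fst M x) (f x) (fst N x) ==> \<forall>x\<in>X. qi (fst (Go M) x) (Gm f x) (fst (Go N) x)"
proof -
 have fv: "w \<in> W ==> cmor (fst M (v, w)) (f (v, w)) (fst N (v, w))" for w using is_dmorD(1)[OF f] vV by simp
 note sq = psi_dmor[OF M N f] and nat_kappa = kappa_natural[OF M N f]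
 note fM = fibM[OF M] and fN = fibM[OF N]
 note fS = Ss_cmor[OF q_r' M N f]
 show "is_dmor X r (Go M) (Gm f) (Go N)"
  unfolding is_dmor_def
 proof (intro conjI ballI allI impI)
  fix x assume "x \<in> X"
  then obtain a w where x: "x = (a, w)" "a \<in> V" "w \<in> W" by auto
  show "cmor (fst (Go M) x) (Gm f x) (fst (Go N) x)"
   using x fmap_cmor(1)[OF fM[OF x(3)] fN[OF x(3)] fS(1)[OF x(3)] fv[OF x(3)] sq[OF x(3)]] is_dmorD(1)[OF f]
   by (cases "a = v") (auto simp: Go_sel M N Gm_sel)
 next
  fix x y n assume "(x, y) \<in> r"
  then obtain a w b w' where xy: "x = (a, w)" "y = (b, w')" "(a, b) \<in> P" "(w, w') \<in> R" by (cases x; cases y) auto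
  then have in': "a \<in> V" "b \<in> V" "w \<in> W" "w' \<in> W" using P.r_in R.r_in by auto
  show "snd (Go N) x y n ** Gm f x n = Gm f y n ** snd (Go M) x y n"
  proof (cases "a = v")
   case False
   then show ?thesis using xy in' nonv'[OF M xy(3)] is_dmorD(2)[OF f] by (simp add: Go_sel M N Gm_sel)
  next
   case a: True
   note [simp] = cmorD(1-3)[OF fv[OF in'(3)]] cmorD(1-3)[OF fv[OF in'(4)]] cmorD(1-3)[OF fS(1)[OF in'(3)]] cmorD(1-3)[OF fS(1)[OF in'(4)]]
   show ?thesis
   proof (cases "b = v")
    case b: True
    have "snd N (v, w) (v, w') m ** f (v, w) m = f (v, w') m ** snd M (v, w) (v, w') m" for m
     using is_dmorD(2)[OF f] vs_P xy by simp
    then show ?thesis using xy in' a b cmorD(1-3)[OF Tv'[OF M xy(4)]] cmorD(1-3)[OF Tv'[OF N xy(4)]]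
      cmorD(1-3)[OF St_cmor[OF q_r' M xy(4)]] cmorD(1-3)[OF St_cmor[OF q_r' N xy(4)]]
     by (simp add: Go_sel M N Gm_sel fmap_def Ss_St[OF q_r' M N f])
   next
    case b: False
    have "fprj (Ss (fst N) w) (fst N (v, w)) n ** fmap (Ss f w) (f (v, w)) n
     = Ss f w n ** fprj (Ss (fst M) w) (fst M (v, w)) n"
     by (simp add: fmap_def fprj_def)
    then show ?thesis using xy in' a b cmp_left[OF nat_kappa[OF in'(2) xy(4)]] by (simp add: Go_sel M N Gm_sel)
   qed
  qed
 qed (auto simp: Gm_def)
 show "\<forall>x\<in>X. qi (fst (Go M) x) (Gm f x) (fst (Go N) x)" if q: "\<forall>x\<in>X. qi (fst M x) (f x) (fst N x)"
 proof
  fix x assume "x \<in> X"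
  then obtain a w where x: "x = (a, w)" "a \<in> V" "w \<in> W" by auto
  show "qi (fst (Go M) x) (Gm f x) (fst (Go N) x)"
   using x fmap_cmor(2)[OF fM[OF x(3)] fN[OF x(3)] fS(1)[OF x(3)] fv[OF x(3)] sq[OF x(3)] fS(2)[OF x(3) q]] q vV
   by (cases "a = v") (auto simp: Go_sel M N Gm_sel)
 qed
qed

lemma Gf_functor: "is_functor (DG X r') (DG X r) Gf"
 unfolding is_functor_def FG_sel
proof (intro conjI ballI)
 fix M assume "M \<in> Obj (DG X r')"
 then have M: "is_diag X r' M" by simp
 show "Go M \<in> Obj (DG X r)" using Go_diag[OF M] by simp
 note c = fibM[OF M]
 have "Ss (%x n. if x \<in> X then idn (dm (fst M x n)) else None) w n = idn (dm (Ss (fst M) w n))" if "w \<in> W" for w n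
  using Ss_idn[OF M that, of "%x n. if x \<in> X then idn (dm (fst M x n)) else None" n] dm_Ss[OF q_r' M that] nsD that by simp
 then show "Gm (Ident (DG X r') M) = Ident (DG X r) (Go M)"
  using vV cpxD(1)[OF c(1)] cpxD(1)[OF c(2)]
  by (auto simp: Gm_def fun_eq_iff Go_sel[OF M] dm_fib[OF c] fmap_def diag2_idn)
next
 fix M N f assume "M \<in> Obj (DG X r')" "N \<in> Obj (DG X r')" "f \<in> Hom (DG X r') M N"
 then show "Gm f \<in> Hom (DG X r) (Go M) (Go N)" using Gm_dmor(1) by simp
next
 fix M N L f g assume "M \<in> Obj (DG X r')" "N \<in> Obj (DG X r')" "L \<in> Obj (DG X r')" "f \<in> Hom (DG X r') M N" "g \<in> Hom (DG X r') N L"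
 then have d: "is_diag X r' M" "is_diag X r' N" "is_diag X r' L" and f: "is_dmor X r' M f N" and g: "is_dmor X r' N g L" by auto
 note F = cmorD[OF is_dmorD(1)[OF f]] and G = cmorD[OF is_dmorD(1)[OF g]]
 show "Gm (Comp (DG X r') g f) = Comp (DG X r) (Gm g) (Gm f)"
  using vV cmorD(1-3)[OF Ss_cmor(1)[OF q_r' d(1,2) f]] cmorD(1-3)[OF Ss_cmor(1)[OF q_r' d(2,3) g]]
  by (auto simp: Gm_def fun_eq_iff fmap_def F G Ss_comp[OF d f g, symmetric])
qed

end

context flip
begin

section \<open>Unit, counit and shift\<close>

lemma qi_idn: "cpx d ==> qi d (%n. idn (dm (d n))) d"
 by (rule qi_iso[OF _ _ cmor_idn, of d "%n. idn (dm (d n))"]) (simp_all add: cpxD)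

context
 fixes M assumes M: "is_diag X r M"
begin

lemma Ss_Fo: "w \<in> W ==> Ss (fst (Fo M)) w = Ss (fst M) w"
 unfolding Ss_def fun_eq_iff using Fo_sel(1)[OF M] nsD by (auto intro!: smap_cong)

lemma St_Fo: "(w, w') \<in> R ==> St (Fo M) w w' = St M w w'"
 unfolding St_def fun_eq_iff using Fo_sel(3)[OF M] nsD by (auto intro!: smap_cong)

lemma kappa_Fo:
 assumes b: "b \<in> V" "b ~= v" and w: "(w, w') \<in> R"
 shows "kappa (cc (Fo M) n) (tt (Fo M) n) b w w' = kappa (cc M n) (tt M n) b w w'"
proof -
 have W: "w \<in> W" "w' \<in> W" using w R.r_in by auto
 have e: "cc (Fo M) n (b, w') = cc M n (b, w')" using b W by (simp add: cc_def Fo_sel[OF M])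
 show ?thesis unfolding kappa_def e
  by (rule cot_cong) (use b w W nsD in \<open>simp add: cc_def tt_def Fo_sel[OF M]\<close>)
qed

text \<open>The neighbours map into the cone through its second summand, and together they give the inclusion of this
summand. Hence \<open>G F M\<close> at \<open>(v,w)\<close> is the fibre for which \<open>eta\<close> was
built.\<close>
lemma psi_Fo:
 assumes w: "w \<in> W"
 shows "psi (Fo M) w n = cinc (fst M (v, w)) (Ss (fst M) w) n"
proof -
 let ?c = "%s. cc M n (s, w)" and ?i = "cinc (fst M (v, w)) (Ss (fst M) w) n"
 note c = coneM[OF M w]
 have o: "!!s. s \<in> set ns ==> ?c s \<in> Obj A" using dgD(1)[OF dgM[OF M]] w nsD by auto
 have i: "ar ?i" "dm ?i = so ns ?c" "cd ?i = cc (Fo M) n (v, w)"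
  using cmorD(1-3)[OF cinc_cmor[OF c]] dm_Ss[OF q_r M w] w by (simp_all add: cc_def Fo_sel[OF M])
 have u: "ar (tup (?c s) ns (delta ?c s)) & cd (tup (?c s) ns (delta ?c s)) = so ns ?c" if "s \<in> set ns" for s
  using iotaM[OF M _ R.r_refl[OF w], of s n] dm_Ss[OF q_r M w, of n] iota_delta[OF dgM[OF M] w that, of n] nsD(1)[OF that] by simp
 have "psi (Fo M) w n = cot (cc (Fo M) n (v, w)) ns (%s. ?i ** tup (?c s) ns (delta ?c s))"
  unfolding psi_def kappa_def
  by (rule cot_cong) (use nsD w R.r_refl iota_delta[OF dgM[OF M] w] in \<open>simp add: tt_def Fo_sel[OF M]\<close>)
 also have "\<dots> = ?i ** cot (so ns ?c) ns (%s. tup (?c s) ns (delta ?c s))"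
  unfolding i(3)[symmetric] by (rule cmp_cot[symmetric]) (use i u o in \<open>auto intro!: so_Obj\<close>)
 also have "\<dots> = ?i" using i o cot_tup_delta[OF ns(1), of ?c] by simp
 finally show ?thesis .
qed

end

definition unit :: "('v \<times> 'w, 'o, 'm) sdiag => ('v \<times> 'w, 'o, 'm) smor" where
 "unit M = (%(a, w). if a \<in> V & w \<in> W then if a = v then eta (fst M (v, w)) (phi M w) (Ss (fst M) w)
   else (%n. idn (dm (fst M (a, w) n))) else (%_. None))"

lemma unit_sel: "a \<in> V ==> w \<in> W ==> a ~= v ==> unit M (a, w) = (%n. idn (dm (fst M (a, w) n)))"
  "w \<in> W ==> unit M (v, w) = eta (fst M (v, w)) (phi M w) (Ss (fst M) w)"
 using vV by (simp_all add: unit_def)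

lemma GF_sel:
 assumes M: "is_diag X r M"
 shows "w \<in> W ==> fst (Go (Fo M)) (v, w) = fib (Ss (fst M) w) (cinc (fst M (v, w)) (Ss (fst M) w)) (cone (fst M (v, w)) (phi M w) (Ss (fst M) w))"
  "a \<in> V ==> w \<in> W ==> a ~= v ==> fst (Go (Fo M)) (a, w) = fst M (a, w)"
 using ext[of "psi (Fo M) w", OF psi_Fo[OF M]] by (simp_all add: Go_sel[OF Fo_diag[OF M]] Fo_sel[OF M] Ss_Fo[OF M])

lemma unit_dmor:
 assumes M: "is_diag X r M"
 shows "is_dmor X r M (unit M) (Go (Fo M))" "x \<in> X ==> qi (fst M x) (unit M x) (fst (Go (Fo M)) x)"
proof -
 note FM = Fo_diag[OF M]
 show "is_dmor X r M (unit M) (Go (Fo M))"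
  unfolding is_dmor_def
 proof (intro conjI ballI allI impI)
  fix x assume "x \<in> X"
  then obtain a w where x: "x = (a, w)" "a \<in> V" "w \<in> W" by auto
  show "cmor (fst M x) (unit M x) (fst (Go (Fo M)) x)"
   using x eta_cmor[OF coneM[OF M x(3)]] cmor_idn[OF Mc[OF M x(2,3)]] by (cases "a = v") (simp_all add: unit_sel GF_sel[OF M])
 next
  fix x y n assume "(x, y) \<in> r"
  then obtain a w b w' where xy: "x = (a, w)" "y = (b, w')" "(a, b) \<in> P" "(w, w') \<in> R" by (cases x; cases y) auto
  then have in': "a \<in> V" "b \<in> V" "w \<in> W" "w' \<in> W" using P.r_in R.r_in by auto
  show "snd (Go (Fo M)) x y n ** unit M x n = unit M y n ** snd M x y n"
  proof (cases "a = v")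
   case False
   then show ?thesis using xy in' nonv'[OF FM xy(3)] cmorD(1-3)[OF is_diagD(2)[OF M]]
    by (simp add: Go_sel[OF FM] Fo_sel[OF M] unit_sel)
  next
   case a: True
   show ?thesis
   proof (cases "b = v")
    case b: True
    show ?thesis using eta_natural[OF coneM[OF M in'(3)] coneM[OF M in'(4)] Tv[OF M xy(4)] St_cmor[OF q_r M xy(4)] phi_square[OF M xy(4)]]
      xy in' a b vs_P by (simp add: Go_sel[OF FM] Fo_sel[OF M] unit_sel St_Fo[OF M])
   next
    case b: False
    have "kappa (cc M n) (tt M n) b w w' ** phi M w n = snd M (v, w) (b, w') n"
     using kappa_iota_v[OF dgM[OF M, of n] xy(4), of b] xy a b unfolding phi_def by (simp add: tt_def)
    then show ?thesis
     using xy in' a b fprj_eta[OF coneM[OF M in'(3)]] cmorD(1-3)[OF is_diagD(2)[OF M]]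
     by (simp add: Go_sel[OF FM] unit_sel kappa_Fo[OF M] Ss_Fo[OF M] Fo_sel(2)[OF M])
   qed
  qed
 qed (auto simp: unit_def)
 show "qi (fst M x) (unit M x) (fst (Go (Fo M)) x)" if "x \<in> X"
 proof -
  obtain a w where x: "x = (a, w)" "a \<in> V" "w \<in> W" using \<open>x \<in> X\<close> by auto
  show ?thesis
   using x eta_qi[OF coneM[OF M x(3)]] qi_idn[OF Mc[OF M x(2,3)]] by (cases "a = v") (simp_all add: unit_sel GF_sel[OF M])
 qed
qed

lemma Ss_Fm: "w \<in> W ==> Ss (Fm f) w = Ss f w"
 unfolding Ss_def fun_eq_iff using Fm_sel(1) nsD by (auto intro!: smap_cong)

lemma Ss_Gm: "w \<in> W ==> Ss (Gm f) w = Ss f w"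
 unfolding Ss_def fun_eq_iff using Gm_sel(1) nsD by (auto intro!: smap_cong)

lemma unit_natural:
 assumes M: "is_diag X r M" and N: "is_diag X r N" and f: "is_dmor X r M f N"
 shows "unit N x n ** f x n = Gm (Fm f) x n ** unit M x n"
proof (cases "x \<in> X")
 case True
 then obtain a w where x: "x = (a, w)" "a \<in> V" "w \<in> W" by auto
 have fx: "cmor (fst M x) (f x) (fst N x)" by (rule is_dmorD(1)[OF f True])
 show ?thesis
 proof (cases "a = v")
  case True
  then show ?thesis using x eta_natural[OF coneM[OF M x(3)] coneM[OF N x(3)] _ Ss_cmor(1)[OF q_r M N f x(3)] phi_dmor[OF M N f x(3)]] fx
   by (simp add: unit_sel Gm_sel Fm_sel Ss_Fm)
 next
  case False
  then show ?thesis using x cmorD(1-3)[OF fx] by (simp add: unit_sel Gm_sel Fm_sel)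
 qed
qed (cases x, auto simp: unit_def Gm_def)

context
 fixes M assumes M: "is_diag X r' M"
begin

lemma Ss_Go: "w \<in> W ==> Ss (fst (Go M)) w = Ss (fst M) w"
 unfolding Ss_def fun_eq_iff using Go_sel(1)[OF M] nsD by (auto intro!: smap_cong)

lemma St_Go: "(w, w') \<in> R ==> St (Go M) w w' = St M w w'"
 unfolding St_def fun_eq_iff using Go_sel(3)[OF M] nsD by (auto intro!: smap_cong)

lemma iota_Go:
 assumes a: "a \<in> V" "a ~= v" and w: "(w, w') \<in> R"
 shows "iota (cc (Go M) n) (tt (Go M) n) a w w' = iota (cc M n) (tt M n) a w w'"
proof -
 have W: "w \<in> W" "w' \<in> W" using w R.r_in by auto
 have e: "cc (Go M) n (a, w) = cc M n (a, w)" using a W by (simp add: cc_def Go_sel[OF M])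
 show ?thesis unfolding iota_def e
  by (rule tup_cong) (use a w W nsD in \<open>simp add: cc_def tt_def Go_sel[OF M]\<close>)
qed

text \<open>Dual to \<open>psi_Fo\<close>: together the maps from the fibre to the neighbours form its projection.\<close>
lemma phi_Go:
 assumes w: "w \<in> W"
 shows "phi (Go M) w n = fprj (Ss (fst M) w) (fst M (v, w)) n"
proof -
 let ?c = "%s. cc M n (s, w)" and ?i = "fprj (Ss (fst M) w) (fst M (v, w)) n"
 note c = fibM[OF M w]
 have o: "!!s. s \<in> set ns ==> ?c s \<in> Obj A" using dgD(1)[OF dgN[OF M]] w nsD by auto
 have i: "ar ?i" "cd ?i = so ns ?c" "dm ?i = cc (Go M) n (v, w)"
  using cmorD(1-3)[OF fprj_cmor[OF c]] dm_Ss[OF q_r' M w] w by (simp_all add: cc_def Go_sel[OF M])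
 have u: "ar (cot (?c s) ns (%u. delta ?c u s)) & dm (cot (?c s) ns (%u. delta ?c u s)) = so ns ?c" if "s \<in> set ns" for s
  using kappaM[OF M _ R.r_refl[OF w], of s n] dm_Ss[OF q_r' M w, of n] kappa_delta[OF dgN[OF M] w that, of n] nsD(1)[OF that] by simp
 have "phi (Go M) w n = tup (cc (Go M) n (v, w)) ns (%s. cot (?c s) ns (%u. delta ?c u s) ** ?i)"
  unfolding phi_def iota_def
  by (rule tup_cong) (use nsD w R.r_refl kappa_delta[OF dgN[OF M] w] in \<open>simp add: tt_def Go_sel[OF M]\<close>)
 also have "\<dots> = tup (so ns ?c) ns (%s. cot (?c s) ns (%u. delta ?c u s)) ** ?i"
  unfolding i(3)[symmetric] by (rule tup_cmp[symmetric]) (use i u o in \<open>auto intro!: so_Obj\<close>)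
 also have "\<dots> = ?i" using i o tup_cot_delta[OF ns(1), of ?c] by simp
 finally show ?thesis .
qed

end

definition counit :: "('v \<times> 'w, 'o, 'm) sdiag => ('v \<times> 'w, 'o, 'm) smor" where
 "counit M = (%(a, w). if a \<in> V & w \<in> W then if a = v then eps (Ss (fst M) w) (psi M w) (fst M (v, w))
   else (%n. idn (dm (fst M (a, w) n))) else (%_. None))"

lemma counit_sel: "a \<in> V ==> w \<in> W ==> a ~= v ==> counit M (a, w) = (%n. idn (dm (fst M (a, w) n)))"
  "w \<in> W ==> counit M (v, w) = eps (Ss (fst M) w) (psi M w) (fst M (v, w))"
 using vV by (simp_all add: counit_def)

lemma FG_obj_sel:
 assumes M: "is_diag X r' M"
 shows "w \<in> W ==> fst (Fo (Go M)) (v, w) = cone (fib (Ss (fst M) w) (psi M w) (fst M (v, w))) (fprj (Ss (fst M) w) (fst M (v, w))) (Ss (fst M) w)"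
  "a \<in> V ==> w \<in> W ==> a ~= v ==> fst (Fo (Go M)) (a, w) = fst M (a, w)"
 using ext[of "phi (Go M) w", OF phi_Go[OF M]] by (simp_all add: Fo_sel[OF Go_diag[OF M]] Go_sel[OF M] Ss_Go[OF M])

lemma counit_dmor:
 assumes M: "is_diag X r' M"
 shows "is_dmor X r' (Fo (Go M)) (counit M) M" "x \<in> X ==> qi (fst (Fo (Go M)) x) (counit M x) (fst M x)"
proof -
 note GM = Go_diag[OF M]
 show "is_dmor X r' (Fo (Go M)) (counit M) M"
  unfolding is_dmor_def
 proof (intro conjI ballI allI impI)
  fix x assume "x \<in> X"
  then obtain a w where x: "x = (a, w)" "a \<in> V" "w \<in> W" by auto
  show "cmor (fst (Fo (Go M)) x) (counit M x) (fst M x)"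
   using x eps_cmor[OF fibM[OF M x(3)]] cmor_idn[OF Nc[OF M x(2,3)]] by (cases "a = v") (simp_all add: counit_sel FG_obj_sel[OF M])
 next
  fix x y n assume "(x, y) \<in> r'"
  then obtain a w b w' where xy: "x = (a, w)" "y = (b, w')" "(a, b) \<in> P'" "(w, w') \<in> R" by (cases x; cases y) auto
  then have in': "a \<in> V" "b \<in> V" "w \<in> W" "w' \<in> W" using P'.r_in R.r_in by auto
  show "snd M x y n ** counit M x n = counit M y n ** snd (Fo (Go M)) x y n"
  proof (cases "b = v")
   case False
   then show ?thesis using xy in' nonv[OF GM xy(3)] cmorD(1-3)[OF is_diagD(2)[OF M]]
    by (simp add: Go_sel[OF M] Fo_sel[OF GM] counit_sel)
  next
   case b: True
   show ?thesis
   proof (cases "a = v")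
    case a: True
    show ?thesis using eps_natural[OF fibM[OF M in'(3)] fibM[OF M in'(4)] St_cmor[OF q_r' M xy(4)] Tv'[OF M xy(4)] psi_square[OF M xy(4)]]
      xy in' a b vs_P by (simp add: Go_sel[OF M] Fo_sel[OF GM] counit_sel St_Go[OF M])
   next
    case a: False
    have e: "psi M w' n ** iota (cc M n) (tt M n) a w w' = snd M (a, w) (v, w') n"
     using kappa_v_iota[OF dgN[OF M, of n] xy(4), of a] xy a b unfolding psi_def by (simp add: tt_def)
    show ?thesis
     using xy in' a b cmp_left[OF eps_cinc[OF fibM[OF M in'(4)]]] e cmorD(1-3)[OF is_diagD(2)[OF M]]
     by (simp add: Fo_sel[OF GM] counit_sel iota_Go[OF M] Ss_Go[OF M] Go_sel(2)[OF M])
   qed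
  qed
 qed (auto simp: counit_def)
 show "qi (fst (Fo (Go M)) x) (counit M x) (fst M x)" if "x \<in> X"
 proof -
  obtain a w where x: "x = (a, w)" "a \<in> V" "w \<in> W" using \<open>x \<in> X\<close> by auto
  show ?thesis
   using x eps_qi[OF fibM[OF M x(3)]] qi_idn[OF Nc[OF M x(2,3)]] by (cases "a = v") (simp_all add: counit_sel FG_obj_sel[OF M])
 qed
qed

lemma counit_natural:
 assumes M: "is_diag X r' M" and N: "is_diag X r' N" and f: "is_dmor X r' M f N"
 shows "counit N x n ** Fm (Gm f) x n = f x n ** counit M x n"
proof (cases "x \<in> X")
 case True
 then obtain a w where x: "x = (a, w)" "a \<in> V" "w \<in> W" by auto
 have fx: "cmor (fst M x) (f x) (fst N x)" by (rule is_dmorD(1)[OF f True])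
 show ?thesis
 proof (cases "a = v")
  case True
  then show ?thesis using x eps_natural[OF fibM[OF M x(3)] fibM[OF N x(3)] Ss_cmor(1)[OF q_r' M N f x(3)] _ psi_dmor[OF M N f x(3)]] fx
   by (simp add: counit_sel Gm_sel Fm_sel Ss_Gm)
 next
  case False
  then show ?thesis using x cmorD(1-3)[OF fx] by (simp add: counit_sel Gm_sel Fm_sel)
 qed
qed (cases x, auto simp: counit_def Fm_def)

text \<open>The comparison \<open>F(M[1]) \<rightarrow> (F M)[1]\<close>.\<close>
definition shft :: "('v \<times> 'w, 'o, 'm) sdiag => ('v \<times> 'w, 'o, 'm) smor" where
 "shft M = (%(a, w). if a \<in> V & w \<in> W then if a = v then theta (fst M (v, w)) (Ss (fst M) w)
   else (%n. idn (dm (fst M (a, w) (n+1)))) else (%_. None))"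

lemma shft_sel: "a \<in> V ==> w \<in> W ==> a ~= v ==> shft M (a, w) = (%n. idn (dm (fst M (a, w) (n+1))))"
  "w \<in> W ==> shft M (v, w) = theta (fst M (v, w)) (Ss (fst M) w)"
 using vV by (simp_all add: shft_def)

abbreviation "sh M \<equiv> on_obj dshift M"

context
 fixes M assumes M: "is_diag X r M"
begin

lemma is_diag_sh: "is_diag X r (sh M)"
proof -
 interpret I: abelian_diagrams A X r by unfold_locales
 show ?thesis by (rule I.is_diag_shift[OF M])
qed

lemma Ss_sh: "w \<in> W ==> Ss (fst (sh M)) w = shk 1 (Ss (fst M) w)"
 unfolding Ss_def fun_eq_iff shk_def by (subst smap_ng) (auto simp: shk_def nsD cpxD Mc[OF M])

lemma cc_sh: "cc (sh M) n = cc M (n+1)"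
proof
 fix x
 show "cc (sh M) n x = cc M (n+1) x"
  using is_diagD(1,5)[OF M, of x] by (cases "x \<in> X") (auto simp: cc_def shk_def cpxD(1))
qed

lemma tt_sh: "tt (sh M) n = tt M (n+1)"
 by (simp add: tt_def fun_eq_iff)

lemma phi_sh: "phi (sh M) w = (%n. phi M w (n+1))"
 by (simp add: phi_def cc_sh tt_sh fun_eq_iff del: dshift_sel)

lemma St_sh: "St (sh M) w w' = (%n. St M w w' (n+1))"
 by (simp add: St_def fun_eq_iff)

lemma shft_dmor:
 "is_dmor X r' (Fo (sh M)) (shft M) (sh (Fo M))" "x \<in> X ==> qi (fst (Fo (sh M)) x) (shft M x) (fst (sh (Fo M)) x)"
proof -
 note SM = is_diag_sh
 have v: "cmor (fst (Fo (sh M)) (v, w)) (shft M (v, w)) (fst (sh (Fo M)) (v, w)) &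
   qi (fst (Fo (sh M)) (v, w)) (shft M (v, w)) (fst (sh (Fo M)) (v, w))" if "w \<in> W" for w
  using that theta_cmor[OF coneM[OF M that]] unfolding shft_sel(2)[OF that] Fo_sel(2)[OF SM that] Ss_sh[OF that] phi_sh
  by (simp add: Fo_sel[OF M])
 have nv: "cmor (fst (Fo (sh M)) (a, w)) (shft M (a, w)) (fst (sh (Fo M)) (a, w)) &
   qi (fst (Fo (sh M)) (a, w)) (shft M (a, w)) (fst (sh (Fo M)) (a, w))" if "a \<in> V" "a ~= v" "w \<in> W" for a w
  using that cmor_idn[OF shk_cpx[OF Mc[OF M that(1,3)], of 1]] qi_idn[OF shk_cpx[OF Mc[OF M that(1,3)], of 1]]
  unfolding shft_sel(1)[OF that(1,3,2)] Fo_sel(1)[OF SM that(1,3,2)]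
  by (simp add: Fo_sel[OF M] shk_simps[OF Mc[OF M that(1,3)]])
 show "is_dmor X r' (Fo (sh M)) (shft M) (sh (Fo M))"
  unfolding is_dmor_def
 proof (intro conjI ballI allI impI)
  fix x assume "x \<in> X"
  then obtain a w where x: "x = (a, w)" "a \<in> V" "w \<in> W" by auto
  then show "cmor (fst (Fo (sh M)) x) (shft M x) (fst (sh (Fo M)) x)" using v nv by (cases "a = v") auto
 next
  fix x y n assume "(x, y) \<in> r'"
  then obtain a w b w' where xy: "x = (a, w)" "y = (b, w')" "(a, b) \<in> P'" "(w, w') \<in> R" by (cases x; cases y) auto
  then have in': "a \<in> V" "b \<in> V" "w \<in> W" "w' \<in> W" using P'.r_in R.r_in by auto
  have T: "snd (sh M) p q = (%n. snd M p q (n+1))" for p q by simp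
  have T': "snd (sh (Fo M)) p q n = snd (Fo M) p q (n+1)" for p q by simp
  show "snd (sh (Fo M)) x y n ** shft M x n = shft M y n ** snd (Fo (sh M)) x y n"
  proof (cases "b = v")
   case False
   then show ?thesis using xy in' nonv[OF M xy(3)] cmorD(1-3)[OF is_diagD(2)[OF M]]
    by (simp add: Fo_sel[OF M] Fo_sel[OF SM] shft_sel T T' del: dshift_sel)
  next
   case b: True
   show ?thesis
   proof (cases "a = v")
    case a: True
    show ?thesis using theta_natural[OF coneM(1,2)[OF M in'(3)] coneM(1,2)[OF M in'(4)] Tv[OF M xy(4)] St_cmor[OF q_r M xy(4)]]
      xy in' a b vs_P by (simp add: Fo_sel[OF M] Fo_sel[OF SM] shft_sel T T' St_sh del: dshift_sel)
   next
    case a: False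
    note [simp] = iotaM[OF M in'(1) xy(4)] cpxD(1,2)[OF coneM(1)[OF M in'(4)]] cpxD(1,2)[OF coneM(2)[OF M in'(4)]]
    have "theta (fst M (v, w')) (Ss (fst M) w') n ** cinc (fst (sh M) (v, w')) (Ss (fst (sh M)) w') n
      = cinc (fst M (v, w')) (Ss (fst M) w') (n+1)"
     using in' by (simp add: theta_def cinc_def Ss_sh shk_simps[OF coneM(1)[OF M in'(4)]] shk_simps[OF coneM(2)[OF M in'(4)]] del: dshift_sel)
      (simp add: shk_simps[OF coneM(1)[OF M in'(4)]])
    from cmp_left[OF this, of "iota (cc M (n+1)) (tt M (n+1)) a w w'"] show ?thesis
     using xy in' a b by (simp add: Fo_sel[OF M] Fo_sel[OF SM] shft_sel T' cc_sh tt_sh del: dshift_sel)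
   qed
  qed
 qed (auto simp: shft_def)
 show "qi (fst (Fo (sh M)) x) (shft M x) (fst (sh (Fo M)) x)" if "x \<in> X"
  using that v nv by (cases x; cases "fst x = v") auto
qed

end

lemma shft_natural:
 assumes M: "is_diag X r M" and N: "is_diag X r N" and f: "is_dmor X r M f N"
 shows "shft N x n ** Fm (%x n. f x (n+1)) x n = Fm f x (n+1) ** shft M x n"
proof (cases "x \<in> X")
 case True
 then obtain a w where x: "x = (a, w)" "a \<in> V" "w \<in> W" by auto
 have fx: "cmor (fst M x) (f x) (fst N x)" by (rule is_dmorD(1)[OF f True])
 have S: "Ss (%x n. f x (n+1)) w = (%n. Ss f w (n+1))" by (simp add: Ss_def fun_eq_iff)
 show ?thesis
 proof (cases "a = v")
  case True
  then show ?thesis using x theta_natural[OF coneM(1,2)[OF M x(3)] coneM(1,2)[OF N x(3)] _ Ss_cmor(1)[OF q_r M N f x(3)]] fx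
   by (simp add: shft_sel Fm_sel S)
 next
  case False
  then show ?thesis using x cmorD(1-3)[OF fx] by (simp add: shft_sel Fm_sel)
 qed
qed (cases x, auto simp: shft_def Fm_def)

text \<open>Away from \<open>v\<close> nothing changes; over \<open>v\<close> this is \<open>tmc_cone\<close>, applied
to the given cone and to the sum of the cones at the neighbours.\<close>
lemma Fo_dmc:
 assumes M: "is_diag X r M" and N: "is_diag X r N" and Z: "is_diag X r Z" and f: "is_dmor X r M f N"
  and i: "is_dmor X r N i Z" and p: "is_dmor X r Z p (sh M)" and t: "dmc X r M N f Z i p"
 shows "dmc X r' (Fo M) (Fo N) (Fm f) (Fo Z) (Fm i) (%y n. shft M y n ** Fm p y n)"
proof -
 obtain j q where tm: "!!x. x \<in> X ==> tmc (fst M x) (fst N x) (f x) (fst Z x) (i x) (p x) (j x) (q x)"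
  and nj: "!!x y n. (x, y) \<in> r ==> snd Z x y n ** j x n = j y n ** snd M x y (n+1)"
  and nq: "!!x y n. (x, y) \<in> r ==> snd N x y n ** q x n = q y n ** snd Z x y n"
  using t unfolding dmc_def by (metis (no_types, lifting))
 have gj: "ar (j x n) & dm (j x n) = dm (fst M x (n+1)) & cd (j x n) = dm (fst Z x n)"
  and gq: "ar (q x n) & dm (q x n) = dm (fst Z x n) & cd (q x n) = dm (fst N x n)"
  and gp: "ar (p x n) & dm (p x n) = dm (fst Z x n) & cd (p x n) = dm (fst M x (n+1))" if "x \<in> X" for x n
  using tmcD(1-12)[OF tm[OF that]] by auto
 define j' where "j' = (%(a, w). if a = v then %n. diag2 (\<ominus> j (v, w) (n+1)) (Ss j w n) else j (a, w))"
 define q' where "q' = (%(a, w). if a = v then %n. diag2 (q (v, w) (n+1)) (Ss q w n) else q (a, w))"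
 have "tmc (fst (Fo M) x) (fst (Fo N) x) (Fm f x) (fst (Fo Z) x) (Fm i x) (%n. shft M x n ** Fm p x n) (j' x) (q' x)"
  if x: "x \<in> X" for x
 proof -
  obtain a w where xa: "x = (a, w)" "a \<in> V" "w \<in> W" using x by auto
  show ?thesis
  proof (cases "a = v")
   case False
   have "(%n. idn (dm (fst M x (n+1))) ** p x n) = p x" using gp[OF x] by (simp add: fun_eq_iff)
   then show ?thesis using tm[OF x] xa False by (simp add: Fo_sel M N Z Fm_sel shft_sel j'_def q'_def)
  next
   case True
   have vw: "(v, w) \<in> X" using vV xa by simp
   note dm = is_dmorD(1)[OF f]
   have S: "tmc (Ss (fst M) w) (Ss (fst N) w) (Ss f w) (Ss (fst Z) w) (Ss i w) (Ss p w) (Ss j w) (Ss q w)"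
    unfolding Ss_def[abs_def]
    by (rule smap_tmc) (use is_diagD(1)[OF M] is_diagD(1)[OF N] is_diagD(1)[OF Z] is_dmorD(1)[OF f] tm nsD xa in auto)
   have cj: "phi Z w n ** j (v, w) n = Ss j w n ** phi M w (n+1)" for n
    by (rule phi_natural[where \<kappa> = "%n. n+1", OF M Z]) (use gj nj xa in auto)
   have "tmc (cone (fst M (v, w)) (phi M w) (Ss (fst M) w)) (cone (fst N (v, w)) (phi N w) (Ss (fst N) w)) (cmap (f (v, w)) (Ss f w))
     (cone (fst Z (v, w)) (phi Z w) (Ss (fst Z) w)) (cmap (i (v, w)) (Ss i w))
     (%n. theta (fst M (v, w)) (Ss (fst M) w) n ** cmap (p (v, w)) (Ss p w) n)
     (%n. diag2 (\<ominus> j (v, w) (n+1)) (Ss j w n)) (%n. diag2 (q (v, w) (n+1)) (Ss q w n))"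
    by (rule tmc_cone[OF coneM(1)[OF M xa(3)] coneM(1)[OF N xa(3)] is_dmorD(1)[OF f vw] coneM(1)[OF Z xa(3)] tm[OF vw]
      coneM(2)[OF M xa(3)] coneM(2)[OF N xa(3)] Ss_cmor(1)[OF q_r M N f xa(3)] coneM(2)[OF Z xa(3)] S
      coneM(3)[OF M xa(3)] coneM(3)[OF N xa(3)] coneM(3)[OF Z xa(3)] cj phi_dmor[OF N Z i xa(3)]])
   then show ?thesis using xa True by (simp add: Fo_sel M N Z Fm_sel shft_sel j'_def q'_def)
  qed
 qed
 moreover have "snd (Fo Z) x y n ** j' x n = j' y n ** snd (Fo M) x y (n+1)" if "(x, y) \<in> r'" for x y n
  by (rule Fo_natural[where \<kappa> = "%n. n+1" and sg = "%h. \<ominus> h", OF M Z]) (use gj nj that in \<open>auto simp: j'_def\<close>)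
 moreover have "snd (Fo N) x y n ** q' x n = q' y n ** snd (Fo Z) x y n" if "(x, y) \<in> r'" for x y n
  by (rule Fo_natural[where \<kappa> = "%n. n" and sg = "%h. h", OF Z N]) (use gq nq that in \<open>auto simp: q'_def\<close>)
 ultimately show ?thesis unfolding dmc_def by (intro exI[of _ j'] exI[of _ q']) auto
qed

theorem flip_equivalence:
 "triangulated_equivalent (derived_category (functor_category (poset_category X r) A))
  (derived_category (functor_category (poset_category X r') A))"
proof (rule diag_equivalence[where F = Ff and G = Gf and \<eta> = unit and \<epsilon> = counit and \<theta> = shft])
 show "preordered_set X r" "preordered_set X r'" by (rule r.preordered_set_axioms r'.preordered_set_axioms)+
 show "is_functor (DG X r) (DG X r') Ff" "is_functor (DG X r') (DG X r) Gf" by (rule Ff_functor Gf_functor)+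
 show "nat_trans (DG X r) (DG X r) id_functor (comp_functor Gf Ff) unit"
  using unit_dmor(1) unit_natural by (auto simp: nat_trans_def id_functor_def comp_functor_def)
 show "nat_trans (DG X r') (DG X r') (comp_functor Ff Gf) id_functor counit"
  using counit_dmor(1) counit_natural by (auto simp: nat_trans_def id_functor_def comp_functor_def)
 show "nat_trans (DG X r) (DG X r') (comp_functor Ff dshift) (comp_functor dshift Ff) shft"
  using shft_dmor(1) shft_natural by (auto simp: nat_trans_def comp_functor_def simp del: dshift_sel(1))
qed (use Fm_dmor(2) Gm_dmor(2) unit_dmor(2) counit_dmor(2) shft_dmor(2) Fo_dmc in \<open>auto simp: id_functor_def comp_functor_def\<close>)

end

section \<open>Orientations and height functions\<close>

definition adj :: "'v set set => 'v => 'v => bool" where "adj E a b \<longleftrightarrow> {a, b} \<in> E"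

lemma adj_sym: "adj E a b ==> adj E b a" by (simp add: adj_def insert_commute)

lemma tree_adj: "finite_tree V E ==> adj E a b ==> a \<in> V & b \<in> V & a ~= b"
 unfolding finite_tree_def adj_def by (metis doubleton_eq_iff)

lemma rtranclp_simple_path:
 assumes "p\<^sup>*\<^sup>* a b"
 shows "\<exists>vs. vs ~= [] & hd vs = a & last vs = b & distinct vs & successively p vs"
 using assms
proof (induction rule: rtranclp_induct)
 case base
 show ?case by (rule exI[of _ "[a]"]) simp
next
 case (step b c)
 then obtain vs where vs: "vs ~= []" "hd vs = a" "last vs = b" "distinct vs" "successively p vs" by blast
 show ?case
 proof (cases "c \<in> set vs")
  case True
  then obtain xs ys where s: "vs = xs @ c # ys" by (meson split_list)
  have "hd (xs @ [c]) = a" using vs(2) s by (cases xs) auto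
  moreover have "successively p (xs @ [c])" using vs(5) unfolding s by (simp add: successively_append_iff)
  moreover have "distinct (xs @ [c])" using vs(4) s by auto
  ultimately show ?thesis by (intro exI[of _ "xs @ [c]"]) auto
 next
  case False
  then show ?thesis using vs step(2) by (intro exI[of _ "vs @ [c]"]) (auto simp: successively_append_iff)
 qed
qed

lemma successively_nth: "successively p vs ==> Suc i < length vs ==> p (vs ! i) (vs ! Suc i)"
proof (induction vs arbitrary: i)
 case (Cons x vs)
 then show ?case by (cases i; cases vs) auto
qed simp

text \<open>A simple path with at least three vertices whose ends are adjacent closes up to a cycle.\<close>
lemma cycle_inI:
 assumes "3 \<le> length vs" "distinct vs" "successively (adj E) vs" "adj E (last vs) (hd vs)"
 shows "cycle_in E vs"
 unfolding cycle_in_def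
proof (intro conjI allI impI)
 fix i assume i: "i < length vs"
 show "{vs ! i, vs ! (Suc i mod length vs)} \<in> E"
 proof (cases "Suc i < length vs")
  case True
  then show ?thesis using assms(3) using successively_nth[of "adj E" vs i] by (simp add: adj_def)
 next
  case False
  then have "Suc i = length vs" "vs ~= []" using i by auto
  then have "Suc i mod length vs = 0" "vs ! i = last vs" by (auto simp: last_conv_nth simp flip: \<open>Suc i = length vs\<close>)
  then show ?thesis using assms(4) \<open>vs ~= []\<close> by (simp add: adj_def hd_conv_nth)
 qed
qed (use assms in auto)

lemma successively_adj_mono: "successively (adj F) vs ==> F \<subseteq> E ==> successively (adj E) vs"
 by (erule successively_mono) (auto simp: adj_def)

text \<open>A path between the ends of an edge that avoids the edge closes up to a cycle.\<close>
lemma acyclic_edge: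
 assumes "\<nexists>vs. cycle_in (insert {a, b} F) vs" "{a, b} \<notin> F" "a ~= b"
 shows "\<not> (adj F)\<^sup>*\<^sup>* a b"
proof
 assume "(adj F)\<^sup>*\<^sup>* a b"
 then obtain vs where vs: "vs ~= []" "hd vs = a" "last vs = b" "distinct vs" "successively (adj F) vs"
  by (elim rtranclp_simple_path[elim_format] exE conjE)
 have "3 \<le> length vs"
 proof -
  obtain ws where ws: "vs = a # ws" using vs(1,2) by (cases vs) auto
  have "ws ~= []" using vs(3) assms(3) ws by auto
  then obtain y zs where y: "ws = y # zs" by (cases ws) auto
  have "adj F a y" using vs(5) ws y by simp
  then have "y ~= b" using assms(2) by (auto simp: adj_def)
  then have "zs ~= []" using vs(3) ws y by auto
  then show ?thesis using ws y by (cases zs) auto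
 qed
 then have "cycle_in (insert {a, b} F) vs"
  using vs(2-4) successively_adj_mono[OF vs(5), of "insert {a, b} F"] adj_sym[of "insert {a, b} F" a b]
  by (intro cycle_inI) (auto simp: adj_def)
 then show False using assms(1) by blast
qed

text \<open>A path between two neighbours of \<open>v\<close> that avoids \<open>v\<close> closes up through
\<open>v\<close>.\<close>
lemma acyclic_vertex:
 assumes "\<nexists>vs. cycle_in E vs" "adj E s v" "adj E t v" "s ~= t" "s ~= v" "t ~= v"
 shows "\<not> (adj {e \<in> E. v \<notin> e})\<^sup>*\<^sup>* s t"
proof
 let ?F = "{e \<in> E. v \<notin> e}"
 assume "(adj ?F)\<^sup>*\<^sup>* s t"
 then obtain vs where vs: "vs ~= []" "hd vs = s" "last vs = t" "distinct vs" "successively (adj ?F) vs"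
  by (elim rtranclp_simple_path[elim_format] exE conjE)
 have nv: "v \<notin> set vs"
 proof
  assume "v \<in> set vs"
  then obtain xs ys where x: "vs = xs @ v # ys" by (meson split_list)
  then have "xs ~= []" using vs(2) assms(5) by auto
  then have "adj ?F (last xs) v" using vs(5) x by (simp add: successively_append_iff)
  then show False by (simp add: adj_def)
 qed
 have "2 \<le> length vs"
 proof -
  obtain ws where ws: "vs = s # ws" using vs(1,2) by (cases vs) auto
  have "ws ~= []" using vs(3) assms(4) ws by auto
  then show ?thesis using ws by (cases ws) auto
 qed
 then have "cycle_in E (vs @ [v])"
  using vs nv assms(2,3) successively_adj_mono[OF vs(5), of E]
  by (intro cycle_inI) (auto simp: successively_append_iff adj_sym)
 then show False using assms(1) by blast
qed

text \<open>Induction on the edges: removing an edge \<open>{a, b}\<close> separates \<open>a\<close> from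
\<open>b\<close>, so the heights on the component of \<open>b\<close> can be adjusted freely.\<close>
lemma potential_exists:
 assumes "finite E" "\<nexists>vs. cycle_in E vs"
  and "!!a b. k a b ==> adj E a b & a ~= b & \<not> k b a"
 shows "\<exists>h :: 'v => int. \<forall>a b. k a b --> h b = h a+1"
 using assms
proof (induction E arbitrary: k rule: finite_induct)
 case empty
 then show ?case by (auto simp: adj_def)
next
 case (insert e F)
 have "\<nexists>vs. cycle_in F vs" using insert.prems(1) unfolding cycle_in_def by blast
 moreover have "k a b & adj F a b ==> adj F a b & a ~= b & \<not> (k b a & adj F b a)" for a b using insert.prems(2) by blast
 ultimately obtain h :: "'v => int" where h: "!!a b. k a b ==> adj F a b ==> h b = h a+1"
  using insert.IH[of "%a b. k a b & adj F a b"] by blast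
 show ?case
 proof (cases "\<exists>a b. k a b & e = {a, b}")
  case False
  then have "k a b ==> adj F a b" for a b using insert.prems(2)[of a b] by (auto simp: adj_def)
  then show ?thesis using h by blast
 next
  case True
  then obtain a b where ab: "k a b" "e = {a, b}" by blast
  have ne: "a ~= b" using insert.prems(2) ab by blast
  have sep: "\<not> (adj F)\<^sup>*\<^sup>* a b" by (rule acyclic_edge) (use insert ab ne in auto)
  (* shift the component of b so that the removed edge gets its prescribed slope *)
  define h' where "h' = (%x. if (adj F)\<^sup>*\<^sup>* x b then h x + (h a+1 - h b) else h x)"
  have comp: "(adj F)\<^sup>*\<^sup>* x b \<longleftrightarrow> (adj F)\<^sup>*\<^sup>* y b" if "adj F x y" for x y
   using that adj_sym[OF that] by (meson converse_rtranclp_into_rtranclp)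
  have "h' y = h' x+1" if "k x y" for x y
  proof (cases "adj F x y")
   case True
   then show ?thesis using h[OF that True] comp[OF True] by (simp add: h'_def)
  next
   case False
   then have "{x, y} = {a, b}" using insert.prems(2)[OF that] ab by (auto simp: adj_def)
   then have "x = a & y = b" using insert.prems(2)[OF that] ab(1) by (auto simp: doubleton_eq_iff)
   then show ?thesis using sep by (simp add: h'_def)
  qed
  then show ?thesis by blast
 qed
qed

definition heights :: "'v set set => ('v => int) => bool" where
 "heights E h \<longleftrightarrow> (\<forall>a b. adj E a b --> h b = h a+1 \<or> h a = h b+1)"

definition step :: "'v set set => ('v => int) => 'v => 'v => bool" where
 "step E h a b \<longleftrightarrow> adj E a b & h b = h a+1"

definition ord :: "'v set => 'v set set => ('v => int) => 'v rel" where
 "ord V E h = {(a, b). a \<in> V & b \<in> V & (step E h)\<^sup>*\<^sup>* a b}"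

lemma preordered_ord: "preordered_set V (ord V E h)"
 unfolding preordered_set_def ord_def by auto

text \<open>A finite order is generated by its covering relation: induction on the size of the interval.\<close>
lemma partial_order_covers:
 assumes fin: "finite V" and P: "partial_order_on V P" and ab: "(a, b) \<in> P"
 shows "(covers P)\<^sup>*\<^sup>* a b"
 using ab
proof (induction "card {z. (a, z) \<in> P & (z, b) \<in> P}" arbitrary: a b rule: less_induct)
 case less
 let ?I = "%a b. {z. (a, z) \<in> P & (z, b) \<in> P}"
 have PV: "P \<subseteq> V \<times> V" and tr: "trans P" and as: "antisym P" and rf: "refl_on V P"
  using P unfolding partial_order_on_def preorder_on_def by auto
 have fI: "finite (?I a b)" using PV by (intro finite_subset[OF _ fin]) auto
 have re: "(a, a) \<in> P" "(b, b) \<in> P" using less.prems PV rf unfolding refl_on_def by auto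
 show ?case
 proof (cases "a = b \<or> covers P a b")
  case False
  then obtain z where z: "(a, z) \<in> P" "(z, b) \<in> P" "z ~= a" "z ~= b" using less.prems unfolding covers_def by blast
  have "?I a z \<subset> ?I a b" "?I z b \<subset> ?I a b"
   using z re transD[OF tr] antisymD[OF as] by blast+
  then have "card (?I a z) < card (?I a b)" "card (?I z b) < card (?I a b)" using fI by (auto intro: psubset_card_mono)
  then show ?thesis using less.hyps[of a z] less.hyps[of z b] z by auto
 qed auto
qed

text \<open>The heights are a potential of the covering relation. The order is recovered from the covers, and the covers from
the direction of the edges.\<close>
lemma orientation_heights:
 assumes T: "finite_tree V E" and P: "P \<in> Or V E"
 shows "\<exists>h. heights E h & P = ord V E h"
proof -
 have fin: "finite V" and edge: "!!e. e \<in> E ==> \<exists>u\<in>V. \<exists>v\<in>V. u ~= v & e = {u, v}" and ac: "\<nexists>vs. cycle_in E vs"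
  using T unfolding finite_tree_def by auto
 have "E \<subseteq> Pow V" using edge by blast
 then have finE: "finite E" using fin by (simp add: finite_subset)
 have po: "partial_order_on V P" and E: "E = {{x, y} | x y. covers P x y}" using P unfolding Or_def by auto
 have PV: "P \<subseteq> V \<times> V" and tr: "trans P" and as: "antisym P" and rf: "refl_on V P"
  using po unfolding partial_order_on_def preorder_on_def by auto
 have c: "adj E a b & a ~= b & \<not> covers P b a" if "covers P a b" for a b
  using that antisymD[OF as, of a b] E by (auto simp: adj_def covers_def)
 obtain h :: "'a => int" where h: "!!a b. covers P a b ==> h b = h a+1"
  using potential_exists[OF finE ac, of "covers P"] c by blast
 have adj: "adj E a b \<longleftrightarrow> covers P a b \<or> covers P b a" for a b
  unfolding adj_def E by (auto simp: doubleton_eq_iff)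
 have hh: "heights E h" unfolding heights_def adj using h by blast
 have st: "step E h = covers P"
 proof (intro ext iffI)
  show "covers P a b" if "step E h a b" for a b using that h[of b a] unfolding step_def adj by auto
  show "step E h a b" if "covers P a b" for a b using that h c unfolding step_def by blast
 qed
 have "(covers P)\<^sup>*\<^sup>* a b ==> a \<in> V ==> (a, b) \<in> P" for a b
 proof (induction rule: rtranclp_induct)
  case base
  then show ?case using rf unfolding refl_on_def by blast
 next
  case (step y z)
  then show ?case using transD[OF tr] unfolding covers_def by blast
 qed
 then have "P = ord V E h" unfolding ord_def st using partial_order_covers[OF fin po] PV by blast
 with hh show ?thesis by blast
qed

section \<open>Raising a local minimum\<close>

text \<open>Directed paths from a point other than \<open>v\<close> avoid \<open>v\<close> before the flip, and
directed paths to a point other than \<open>v\<close> avoid \<open>v\<close> after the flip. Both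
therefore run in the graph without \<open>v\<close>, where the flip changes nothing and where no two
neighbours of \<open>v\<close> are connected.\<close>
lemma (in abelian_category) raise_flip:
 assumes T: "finite_tree V E" and h: "heights E h" and v: "v \<in> V" and min: "!!u. adj E v u ==> h u = h v+1"
  and ns: "set ns = {u. adj E v u}" "distinct ns" and R: "preordered_set W R"
 shows "flip A V (ord V E h) (ord V E (h(v := h v + 2))) v ns W R"
proof -
 let ?h = "h(v := h v + 2)" and ?D0 = "adj {e \<in> E. v \<notin> e}"
 note edge = tree_adj[OF T]
 have ac: "\<nexists>vs. cycle_in E vs" using T by (simp add: finite_tree_def)
 define D0 where "D0 = (%a b. step E h a b & a ~= v & b ~= v)"
 have nsD: "s \<in> V" "s ~= v" "step E h v s" "step E ?h s v" "adj E s v" if "s \<in> set ns" for s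
  using that ns edge[of v s] min[of s] adj_sym[of E v s] by (auto simp: step_def)
 have nsI: "s \<in> set ns" if "step E h v s \<or> step E ?h s v" for s using that ns adj_sym[of E s v] by (auto simp: step_def)
 have noin: "\<not> step E h u v" for u using min[of u] adj_sym[of E u v] by (auto simp: step_def)
 have noout: "\<not> step E ?h v u" for u using min[of u] edge[of v u] by (auto simp: step_def)
 have s0: "step E h a b \<longleftrightarrow> step E ?h a b" if "a ~= v" "b ~= v" for a b using that by (simp add: step_def)
 have fw: "(step E h)\<^sup>*\<^sup>* a b ==> a ~= v ==> D0\<^sup>*\<^sup>* a b & b ~= v" for a b
 proof (induction rule: rtranclp_induct)
  case (step y z)
  moreover have "z ~= v" using step(2) noin by blast
  ultimately have "D0 y z" by (simp add: D0_def)
  then show ?case using step \<open>z ~= v\<close> by (meson rtranclp.rtrancl_into_rtrancl)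
 qed simp
 have bw: "(step E ?h)\<^sup>*\<^sup>* a b ==> b ~= v ==> D0\<^sup>*\<^sup>* a b & a ~= v" for a b
 proof (induction rule: converse_rtranclp_induct)
  case (step y z)
  moreover have "y ~= v" using step(1) noout by blast
  ultimately have "D0 y z" using s0 by (simp add: D0_def)
  then show ?case using step \<open>y ~= v\<close> by (meson converse_rtranclp_into_rtranclp)
 qed simp
 have D0: "D0\<^sup>*\<^sup>* a b ==> (step E h)\<^sup>*\<^sup>* a b" "D0\<^sup>*\<^sup>* a b ==> (step E ?h)\<^sup>*\<^sup>* a b" "D0\<^sup>*\<^sup>* a b ==> ?D0\<^sup>*\<^sup>* a b"
   "D0\<^sup>*\<^sup>* a b ==> ?D0\<^sup>*\<^sup>* b a" for a b
 proof -
  show "D0\<^sup>*\<^sup>* a b ==> (step E h)\<^sup>*\<^sup>* a b" "D0\<^sup>*\<^sup>* a b ==> (step E ?h)\<^sup>*\<^sup>* a b"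
   by (erule rtranclp_mono[THEN predicate2D, rotated], use s0 in \<open>auto simp: D0_def\<close>)+
  show 1: "D0\<^sup>*\<^sup>* a b ==> ?D0\<^sup>*\<^sup>* a b" for a b
   by (erule rtranclp_mono[THEN predicate2D, rotated]) (auto simp: D0_def step_def adj_def)
  have "symp ?D0" by (rule sympI) (rule adj_sym)
  from sympD[OF symp_rtranclp[OF this]] show "D0\<^sup>*\<^sup>* a b ==> ?D0\<^sup>*\<^sup>* b a" using 1[of a b] by blast
 qed
 have same: "(step E ?h)\<^sup>*\<^sup>* a b \<longleftrightarrow> (step E h)\<^sup>*\<^sup>* a b" if "a ~= v" "b ~= v" for a b
  using fw[OF _ that(1), of b] bw[OF _ that(2), of a] D0(1,2)[of a b] by blast
 show ?thesis
 proof (rule flip.intro[OF abelian_category_axioms flip_axioms.intro])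
  show "v \<in> V" "distinct ns" "set ns \<subseteq> V" "v \<notin> set ns" using v ns nsD by auto
  show "preordered_set V (ord V E h)" "preordered_set V (ord V E ?h)" "preordered_set W R" by (rule preordered_ord R)+
  show "(a, b) \<in> ord V E ?h \<longleftrightarrow> (a, b) \<in> ord V E h" if "a ~= v" "b ~= v" for a b
   unfolding ord_def using same[OF that] by simp
  show "a = v" if "(a, v) \<in> ord V E h" for a
   using that noin unfolding ord_def by (auto elim: rtranclp.cases)
  show "b = v" if "(v, b) \<in> ord V E ?h" for b
   using that noout unfolding ord_def by (auto elim: converse_rtranclpE)
  show "(v, b) \<in> ord V E h \<longleftrightarrow> (\<exists>s\<in>set ns. (s, b) \<in> ord V E h)" if bv: "b ~= v" for b
  proof
   assume "(v, b) \<in> ord V E h"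
   then have b: "b \<in> V" "(step E h)\<^sup>*\<^sup>* v b" by (auto simp: ord_def)
   from b(2) obtain s where "step E h v s" "(step E h)\<^sup>*\<^sup>* s b" using bv by (auto elim: converse_rtranclpE)
   then show "\<exists>s\<in>set ns. (s, b) \<in> ord V E h" using nsI nsD(1) b(1) by (auto simp: ord_def)
  next
   assume "\<exists>s\<in>set ns. (s, b) \<in> ord V E h"
   then show "(v, b) \<in> ord V E h" using v nsD(3) by (auto simp: ord_def intro: converse_rtranclp_into_rtranclp)
  qed
  show "(a, v) \<in> ord V E ?h \<longleftrightarrow> (\<exists>s\<in>set ns. (a, s) \<in> ord V E h)" if av: "a ~= v" for a
  proof
   assume "(a, v) \<in> ord V E ?h"
   then have a: "a \<in> V" "(step E ?h)\<^sup>*\<^sup>* a v" by (auto simp: ord_def)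
   from a(2) obtain s where s: "step E ?h s v" "(step E ?h)\<^sup>*\<^sup>* a s" using av by (auto elim: rtranclp.cases)
   have "s \<in> set ns" using nsI s by blast
   then show "\<exists>s\<in>set ns. (a, s) \<in> ord V E h" using same[OF av] nsD(1,2) s a(1) by (auto simp: ord_def)
  next
   assume "\<exists>s\<in>set ns. (a, s) \<in> ord V E h"
   then obtain s where s: "s \<in> set ns" "a \<in> V" "(step E h)\<^sup>*\<^sup>* a s" by (auto simp: ord_def)
   then have "(step E ?h)\<^sup>*\<^sup>* a s" using same[OF av nsD(2)] by blast
   then show "(a, v) \<in> ord V E ?h" using v nsD(4) s by (auto simp: ord_def intro: rtranclp.rtrancl_into_rtrancl)
  qed
  show "s = t" if "s \<in> set ns" "t \<in> set ns" "(s, b) \<in> ord V E h" "(t, b) \<in> ord V E h" for s t b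
  proof (rule ccontr)
   assume "s ~= t"
   have "?D0\<^sup>*\<^sup>* s b" "?D0\<^sup>*\<^sup>* b t" using fw[of s b] fw[of t b] that nsD(2) D0(3,4) unfolding ord_def by blast+
   then have "?D0\<^sup>*\<^sup>* s t" by (rule rtranclp_trans)
   then show False using acyclic_vertex[OF ac nsD(5) nsD(5) \<open>s ~= t\<close> nsD(2) nsD(2)] that by blast
  qed
  show "s = t" if "s \<in> set ns" "t \<in> set ns" "a ~= v" "(a, s) \<in> ord V E h" "(a, t) \<in> ord V E h" for s t a
  proof (rule ccontr)
   assume "s ~= t"
   have "?D0\<^sup>*\<^sup>* s a" "?D0\<^sup>*\<^sup>* a t" using fw[of a s] fw[of a t] that nsD(2) D0(3,4) unfolding ord_def by blast+
   then have "?D0\<^sup>*\<^sup>* s t" by (rule rtranclp_trans)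
   then show False using acyclic_vertex[OF ac nsD(5) nsD(5) \<open>s ~= t\<close> nsD(2) nsD(2)] that by blast
  qed
 qed
qed

text \<open>Among the vertices where \<open>h < h'\<close> take one with \<open>h v\<close> least. A neighbour
\<open>u\<close> with \<open>h u = h v - 1\<close> would satisfy \<open>h' u = h u \<le> h' v - 3\<close>,
which is impossible for adjacent vertices.\<close>
lemma raise_minimum:
 assumes T: "finite_tree V E" and h: "heights E h" and h': "heights E h'" and le: "!!v. v \<in> V ==> h v \<le> h' v & even (h' v - h v)"
  and ne: "\<exists>v\<in>V. h v ~= h' v"
 shows "\<exists>v\<in>V. h v + 2 \<le> h' v & (\<forall>u. adj E v u --> h u = h v+1)"
proof -
 have fin: "finite V" using T by (simp add: finite_tree_def)
 note edge = tree_adj[OF T]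
 have two: "h v + 2 \<le> h' v" if v: "v \<in> V" "h v < h' v" for v
 proof -
  obtain k where "h' v - h v = 2 * k" using conjunct2[OF le[OF v(1)]] by (rule evenE)
  moreover from this have "0 < k" using v(2) by linarith
  ultimately show ?thesis by linarith
 qed
 let ?S = "{v \<in> V. h v < h' v}"
 have S: "finite ?S" "?S ~= {}" using fin ne le by (auto simp: order_less_le)
 obtain v where v: "v \<in> ?S" "!!u. u \<in> ?S ==> h v \<le> h u"
  using ex_min_if_finite[of "h ` ?S"] S by (auto simp: not_less) (metis not_le)
 have "h u = h v+1" if u: "adj E v u" for u
 proof (rule ccontr)
  assume "h u ~= h v+1"
  then have "h v = h u+1" using h u unfolding heights_def by blast
  moreover from this have "h u = h' u" using v(2)[of u] edge[OF u] le[of u] by force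
  moreover have "h' u = h' v+1 \<or> h' v = h' u+1" using h' u unfolding heights_def by blast
  ultimately show False using two[of v] v(1) by auto
 qed
 then show ?thesis using v(1) two by auto
qed

text \<open>Induction on the total height difference. The functions are assumed to be different so that at least one
flip takes place and reflexivity of triangulated equivalence does not come up.\<close>
lemma (in abelian_category) heights_equivalence:
 fixes V :: "'v set" and W :: "'w set"
 assumes T: "finite_tree V E" and R: "preordered_set W R"
  and "heights E h" "heights E h'" "!!v. v \<in> V ==> h v \<le> h' v & even (h' v - h v)" "\<exists>v\<in>V. h v ~= h' v"
 shows "triangulated_equivalent (derived_category (functor_category (poset_category (V \<times> W) (prod_order (ord V E h) R)) A))
  (derived_category (functor_category (poset_category (V \<times> W) (prod_order (ord V E h') R)) A))"
 using assms(3-)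
proof (induction "nat (\<Sum>v\<in>V. h' v - h v)" arbitrary: h rule: less_induct)
 case less
 have fin: "finite V" using T by (simp add: finite_tree_def)
 note edge' = tree_adj[OF T]
 obtain v where v: "v \<in> V" "h v + 2 \<le> h' v" and min: "!!u. adj E v u ==> h u = h v+1"
  using raise_minimum[OF T less.prems] by blast
 have "finite {u. adj E v u}" using edge' by (intro finite_subset[OF _ fin]) auto
 then obtain ns where ns: "set ns = {u. adj E v u}" "distinct ns" using finite_distinct_list by blast
 let ?h = "h(v := h v + 2)"
 let ?D = "%h. functor_category (poset_category (V \<times> W) (prod_order (ord V E h) R)) A"
 interpret flip A V "ord V E h" "ord V E ?h" v ns W R
  by (rule raise_flip[OF T less.prems(1) v(1) min ns R])
 have one: "triangulated_equivalent (derived_category (?D h)) (derived_category (?D ?h))"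
  by (rule flip_equivalence)
 have pre: "preadditive_category (?D k)" for k
 proof -
  interpret diagrams A "V \<times> W" "prod_order (ord V E k) R"
   by (intro diagrams.intro preadditive_category_axioms preordered_prod preordered_ord)
  show ?thesis using FC_preadditive by (simp add: FC_def)
 qed
 show ?case
 proof (cases "\<exists>u\<in>V. ?h u ~= h' u")
  case False
  have "step E ?h = step E h'"
  proof (intro ext)
   fix a b show "step E ?h a b = step E h' a b"
  proof (cases "adj E a b")
   case True
   then have "?h a = h' a" "?h b = h' b" using False edge'[OF True] by blast+
   then show ?thesis by (simp only: step_def)
  qed (simp add: step_def)
  qed
  then have "ord V E ?h = ord V E h'" by (simp add: ord_def)
  with one show ?thesis by simp
 next
  case True
  have adjv: "h u = h v+1" if "adj E v u \<or> adj E u v" for u using that min adj_sym[of E u v] by blast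
  have hts: "heights E ?h"
   unfolding heights_def
  proof (intro allI impI)
   fix a b assume ab: "adj E a b"
   then show "?h b = ?h a+1 \<or> ?h a = ?h b+1"
    using less.prems(1) adjv[of a] adjv[of b] edge'[OF ab] unfolding heights_def by auto
  qed
  have le: "?h u \<le> h' u & even (h' u - ?h u)" if "u \<in> V" for u
   using less.prems(3)[OF that] v(2) by auto
  have "(\<Sum>u\<in>V. h' u - ?h u) < (\<Sum>u\<in>V. h' u - h u)"
   by (rule sum_strict_mono_ex1[OF fin]) (use v(1) in auto)
  moreover have "0 \<le> (\<Sum>u\<in>V. h' u - ?h u)" using le by (intro sum_nonneg) auto
  ultimately have "nat (\<Sum>u\<in>V. h' u - ?h u) < nat (\<Sum>u\<in>V. h' u - h u)" by simp
  from less.hyps[OF this hts less.prems(2) le True]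
  show ?thesis by (rule derived_equivalent_trans[OF pre pre pre one])
 qed
qed

lemma heights_shift: "heights E h ==> heights E (%v. h v + c)" "ord V E (%v. h v + c) = ord V E h"
proof -
 show "heights E h ==> heights E (%v. h v + c)" unfolding heights_def by auto
 have "step E (%v. h v + c) = step E h" by (auto simp: step_def fun_eq_iff)
 then show "ord V E (%v. h v + c) = ord V E h" by (simp add: ord_def)
qed

text \<open>Along each edge both heights change parity, so on a connected graph their difference has constant parity;
the bound makes the shift large enough.\<close>
lemma common_parity:
 assumes T: "finite_tree V E" and h: "heights E h" and k: "heights E k"
 shows "\<exists>c. \<forall>v\<in>V. h v < k v + c & even (k v + c - h v)"
proof -
 obtain a where a: "a \<in> V" and fin: "finite V" and con: "!!u. u \<in> V ==> (a, u) \<in> {(a, b). {a, b} \<in> E}\<^sup>*"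
  using T unfolding finite_tree_def by blast
 let ?d = "%v. h v - k v - (h a - k a)"
 have ev: "even (?d u)" if "u \<in> V" for u
  using con[OF that]
 proof (induction rule: rtrancl_induct)
  case (step y z)
  then have "adj E y z" by (simp add: adj_def)
  then have "h z = h y+1 \<or> h y = h z+1" "k z = k y+1 \<or> k y = k z+1" using h k unfolding heights_def by blast+
  then show ?case using step(3) by auto
 qed simp
 define S where "S = (\<Sum>v\<in>V. \<bar>?d v\<bar>)"
 have S: "\<bar>?d u\<bar> \<le> S" if "u \<in> V" for u
  unfolding S_def by (rule member_le_sum) (use that fin in auto)
 show ?thesis
 (* the first summand matches the parities; the second is even and exceeds every difference *)
 proof (intro exI[of _ "h a - k a + 2 * (S+1)"] ballI conjI)
  fix v assume v: "v \<in> V"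
  show "h v < k v + (h a - k a + 2 * (S+1))" proof -
   have "?d v \<le> S" "0 \<le> S" using S[OF v] abs_ge_self[of "?d v"] abs_ge_zero[of "?d v"] by (meson order_trans)+
   then show ?thesis by simp
  qed
  have "k v + (h a - k a + 2 * (S+1)) - h v = 2 * (S+1) - ?d v" by simp
  also have "even \<dots>" using ev[OF v] by simp
  finally show "even (k v + (h a - k a + 2 * (S+1)) - h v)" .
 qed
qed

theorem corollary5p4:
 fixes V :: "'v set" and E :: "'v set set" and P Q :: "'v rel"
  and W :: "'r set" and R :: "'r rel"
 assumes "finite_tree V E"
  and "P \<in> Or V E" and "Q \<in> Or V E"
  and "finite W" and "partial_order_on W R"
 shows "universally_derived_equivalent TYPE('o) TYPE('m)
  (V \<times> W) (prod_order P R) (V \<times> W) (prod_order Q R)"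
 unfolding universally_derived_equivalent_def
proof (intro allI impI)
 fix A :: "('o, 'm) preadditive" assume A: "abelian_category A"
 obtain h k where h: "heights E h" "P = ord V E h" and k: "heights E k" "Q = ord V E k"
  using orientation_heights[OF assms(1)] assms(2,3) by metis
 (* adding c to the heights k does not change the orientation Q *)
 obtain c where c: "!!v. v \<in> V ==> h v < k v + c & even (k v + c - h v)" using common_parity[OF assms(1) h(1) k(1)] by blast
 have R: "preordered_set W R"
  using assms(5) unfolding preordered_set_def partial_order_on_def preorder_on_def refl_on_def trans_def by blast
 have "\<exists>v\<in>V. h v ~= k v + c" using c assms(1) unfolding finite_tree_def by fastforce
 then show "triangulated_equivalent (derived_category (functor_category (poset_category (V \<times> W) (prod_order P R)) A))
   (derived_category (functor_category (poset_category (V \<times> W) (prod_order Q R)) A))"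
  using abelian_category.heights_equivalence[OF A assms(1) R h(1) heights_shift(1)[OF k(1), of c]] c
  unfolding h(2) k(2) heights_shift(2) by force
qed

end
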